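(* Let $\Omega$ be an exterior domain as in the context, and assume that $\Omega$ is invariant under the central symmetry $\boldsymbol x\mapsto-\boldsymbol x$. There exists a constant $C>0$ depending only on $\Omega$ such that the following holds. Let $\bar{\boldsymbol u}\in\dot H^1_\sigma(\Omega)$ be a centrally symmetric steady solution (for some boundary value $\boldsymbol u^*$) satisfying $$\sup_{\boldsymbol x\in\Omega}\big(|\boldsymbol x|\,|\bar{\boldsymbol u}(\boldsymbol x)|\big)\le\frac{\delta}{C}$$ for some $\delta>0$. If $\delta<1$, then $\bar{\boldsymbol u}$ is asymptotically stable with respect to any centrally symmetric $L^2$-perturbation; that is, for every centrally symmetric $\boldsymbol v_0\in L^2_\sigma(\Omega)$ and every weak solution $\boldsymbol v$ on $(0,\infty)$ of the perturbed system with initial datum $\boldsymbol v_0$ satisfying $$\|\boldsymbol v(t)\|_2^2+(1-\delta)\int_s^t\|\nabla\boldsymbol v(\tau)\|_2^2\,\mathrm d\tau\le\|\boldsymbol v(s)\|_2^2\qquad\text{for all }t\ge s\ge0,$$ one has $\lim_{t\to\infty}\|\boldsymbol v(t)\|_2=0$.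
   Context: Domain: $\Omega=\mathbb{R}^2\setminus\bar B$, where $B$ is a bounded simply connected Lipschitz domain with $\boldsymbol 0\in B$. A vector field $\boldsymbol w$ on $\Omega$ is centrally symmetric if $\boldsymbol w(\boldsymbol x)=-\boldsymbol w(-\boldsymbol x)$. Spaces: $C^\infty_{0,\sigma}(\Omega)$ is the space of smooth divergence-free vector fields with compact support in $\Omega$; $L^2_\sigma(\Omega)$, $\dot H^1_{0,\sigma}(\Omega)$ are its completions in the natural norms of $L^2(\Omega)$, $\dot H^1(\Omega)$. $\dot H^1_\sigma(\Omega)$ is the space of weakly divergence-free vector fields in $\dot H^1(\Omega)$. $(\cdot,\cdot)$ is the $L^2(\Omega)$ pairing and $\|\cdot\|_2$ the $L^2(\Omega)$ norm. Steady solution: $\bar{\boldsymbol u}$ (with some pressure $\bar p$) solves $\Delta\bar{\boldsymbol u}-\nabla\bar p=\bar{\boldsymbol u}\cdot\nabla\bar{\boldsymbol u}$, $\nabla\cdot\bar{\boldsymbol u}=0$ in $\Omega$, $\bar{\boldsymbol u}|_{\partial\Omega}=\boldsymbol u^*$. Perturbed system: $\partial_t\boldsymbol v+\bar{\boldsymbol u}\cdot\nabla\boldsymbol v+\boldsymbol v\cdot\nabla\bar{\boldsymbol u}+\boldsymbol v\cdot\nabla\boldsymbol v=\Delta\boldsymbol v-\nabla q$, $\nabla\cdot\boldsymbol v=0$ in $\Omega$, $\boldsymbol v|_{t=0}=\boldsymbol v_0$, $\boldsymbol v|_{\partial\Omega}=\boldsymbol 0$. Weak solution on $(0,\infty)$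 with initial datum $\boldsymbol v_0$: a vector field $\boldsymbol v\in L^\infty(0,\infty;L^2_\sigma(\Omega))\cap L^2(0,\infty;\dot H^1_{0,\sigma}(\Omega))$ with $\boldsymbol v(0)=\boldsymbol v_0$ such that $$(\boldsymbol v(t),\boldsymbol\varphi(t))+\int_s^t\big[(\nabla\boldsymbol v,\nabla\boldsymbol\varphi)+(\bar{\boldsymbol u}\cdot\nabla\boldsymbol v,\boldsymbol\varphi)+(\boldsymbol v\cdot\nabla\bar{\boldsymbol u},\boldsymbol\varphi)+(\boldsymbol v\cdot\nabla\boldsymbol v,\boldsymbol\varphi)\big]\mathrm d\tau=(\boldsymbol v(s),\boldsymbol\varphi(s))+\int_s^t(\boldsymbol v,\dot{\boldsymbol\varphi})\,\mathrm d\tau$$ for all $t\ge s\ge0$ and all $\boldsymbol\varphi\in C^1([0,\infty);C^\infty_{0,\sigma}(\Omega))$. *)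

theory Defs
  imports "HOL-Analysis.Analysis"
begin

section \<open>Domains in the plane\<close>

text \<open>
  The unit vectors \<open>e\<close>, \<open>n\<close> are local orthonormal coordinates near the boundary point \<open>p\<close>;
  \<open>p \<in> frontier B\<close> forces \<open>g 0 = 0\<close>.
\<close>

definition lipschitz_boundary :: "(real^2) set \<Rightarrow> bool" where
  "lipschitz_boundary B \<longleftrightarrow>
     (\<forall>p \<in> frontier B. \<exists>e n r L g.
        norm e = 1 \<and> norm n = 1 \<and> e \<bullet> n = 0 \<and> r > 0 \<and> L-lipschitz_on (UNIV :: real set) g \<and>
        B \<inter> ball p r = {x \<in> ball p r. (x - p) \<bullet> n > (g ((x - p) \<bullet> e) :: real)})"

definition lipschitz_domain :: "(real^2) set \<Rightarrow> bool" where
  "lipschitz_domain B \<longleftrightarrow> open B \<and> connected B \<and> B \<noteq> {} \<and> lipschitz_boundary B"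

text \<open>Fields are classes modulo null sets, hence the almost-everywhere formulation.\<close>

definition centrally_symmetric :: "(real^2) set \<Rightarrow> (real^2 \<Rightarrow> real^2) \<Rightarrow> bool" where
  "centrally_symmetric \<Omega> w \<longleftrightarrow> (AE x in lebesgue_on \<Omega>. w x = - w (- x))"

section \<open>Test functions\<close>

fun iter_deriv :: "'a list \<Rightarrow> ('a::real_normed_vector \<Rightarrow> 'b::real_normed_vector) \<Rightarrow> 'a \<Rightarrow> 'b" where
  "iter_deriv [] f = f"
| "iter_deriv (v # vs) f = iter_deriv vs (\<lambda>x. frechet_derivative f (at x) v)"

definition smooth :: "('a::real_normed_vector \<Rightarrow> 'b::real_normed_vector) \<Rightarrow> bool" where
  "smooth f \<longleftrightarrow> (\<forall>vs x. iter_deriv vs f differentiable (at x))"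

definition supp :: "('a::topological_space \<Rightarrow> 'b::zero) \<Rightarrow> 'a set" where
  "supp f = closure {x. f x \<noteq> 0}"

text \<open>Functions compactly supported in \<open>\<Omega>\<close> are identified with their extension by zero.\<close>

definition test_functions ::
  "(real^2) set \<Rightarrow> (real^2 \<Rightarrow> 'b::real_normed_vector) set" where
  "test_functions \<Omega> = {f. smooth f \<and> compact (supp f) \<and> supp f \<subseteq> \<Omega>}"

definition grad :: "(real^2 \<Rightarrow> real) \<Rightarrow> real^2 \<Rightarrow> real^2" where
  "grad f x = (\<chi> j. frechet_derivative f (at x) (axis j 1))"

definition divergence :: "(real^2 \<Rightarrow> real^2) \<Rightarrow> real^2 \<Rightarrow> real" where
  "divergence f x = trace (jacobian f (at x))"

definition C0_sigma :: "(real^2) set \<Rightarrow> (real^2 \<Rightarrow> real^2) set" where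
  "C0_sigma \<Omega> = {f \<in> test_functions \<Omega>. \<forall>x. divergence f x = 0}"

text \<open>
  Convergence in the usual (inductive limit) topology of test functions, and continuously
  differentiable curves with values in \<open>C0_sigma \<Omega>\<close>; \<open>\<phi>'\<close> is the time derivative of \<open>\<phi>\<close>.
  On \<open>[0, \<infinity>)\<close> a curve that is continuous for this topology has locally its support
  in one fixed compact set, so the eventual common support is no restriction.
\<close>

definition test_tendsto ::
  "(real^2) set \<Rightarrow> ('i \<Rightarrow> real^2 \<Rightarrow> real^2) \<Rightarrow> (real^2 \<Rightarrow> real^2) \<Rightarrow> 'i filter \<Rightarrow> bool" where
  "test_tendsto \<Omega> f l F \<longleftrightarrow>
     (\<exists>K. compact K \<and> K \<subseteq> \<Omega> \<and> (\<forall>\<^sub>F i in F. supp (f i) \<subseteq> K)) \<and>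
     (\<forall>vs. uniform_limit UNIV (\<lambda>i. iter_deriv vs (f i)) (iter_deriv vs l) F)"

definition C1_test_curve ::
  "(real^2) set \<Rightarrow> (real \<Rightarrow> real^2 \<Rightarrow> real^2) \<Rightarrow> (real \<Rightarrow> real^2 \<Rightarrow> real^2) \<Rightarrow> bool" where
  "C1_test_curve \<Omega> \<phi> \<phi>' \<longleftrightarrow>
     (\<forall>t\<ge>0. \<phi> t \<in> C0_sigma \<Omega> \<and> \<phi>' t \<in> C0_sigma \<Omega> \<and>
        test_tendsto \<Omega> (\<lambda>s x. (\<phi> s x - \<phi> t x) /\<^sub>R (s - t)) (\<phi>' t) (at t within {0..}) \<and>
        test_tendsto \<Omega> \<phi>' (\<phi>' t) (at t within {0..}))"

section \<open>Lebesgue and homogeneous Sobolev spaces\<close>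

definition L2 :: "(real^2) set \<Rightarrow> (real^2 \<Rightarrow> 'b::euclidean_space) set" where
  "L2 S = {w \<in> borel_measurable (lebesgue_on S). integrable (lebesgue_on S) (\<lambda>x. (norm (w x))\<^sup>2)}"

definition L2_inner ::
  "(real^2) set \<Rightarrow> (real^2 \<Rightarrow> 'b::euclidean_space) \<Rightarrow> (real^2 \<Rightarrow> 'b) \<Rightarrow> real" where
  "L2_inner S v w = (LINT x|lebesgue_on S. v x \<bullet> w x)"

definition L2_norm :: "(real^2) set \<Rightarrow> (real^2 \<Rightarrow> 'b::euclidean_space) \<Rightarrow> real" where
  "L2_norm S w = sqrt (LINT x|lebesgue_on S. (norm (w x))\<^sup>2)"

definition L1_loc :: "(real^2) set \<Rightarrow> (real^2 \<Rightarrow> 'b::euclidean_space) set" where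
  "L1_loc \<Omega> = {w. \<forall>K. compact K \<and> K \<subseteq> \<Omega> \<longrightarrow> w absolutely_integrable_on K}"

text \<open>The entry \<open>G x $ i $ j\<close> is the weak derivative of the component \<open>w $ i\<close> in direction \<open>j\<close>.\<close>

definition has_weak_gradient ::
  "(real^2) set \<Rightarrow> (real^2 \<Rightarrow> real^2) \<Rightarrow> (real^2 \<Rightarrow> real^2^2) \<Rightarrow> bool" where
  "has_weak_gradient \<Omega> w G \<longleftrightarrow> w \<in> L1_loc \<Omega> \<and> G \<in> L1_loc \<Omega> \<and>
     (\<forall>\<psi> \<in> test_functions \<Omega>. \<forall>i j.
        (LINT x|lebesgue_on \<Omega>. w x $ i * grad \<psi> x $ j) =
        - (LINT x|lebesgue_on \<Omega>. G x $ i $ j * \<psi> x))"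

text \<open>Weak gradients are unique almost everywhere; \<open>wgrad\<close> picks a representative.\<close>

definition wgrad :: "(real^2) set \<Rightarrow> (real^2 \<Rightarrow> real^2) \<Rightarrow> real^2 \<Rightarrow> real^2^2" where
  "wgrad \<Omega> w = (SOME G. has_weak_gradient \<Omega> w G)"

definition weakly_div_free :: "(real^2) set \<Rightarrow> (real^2 \<Rightarrow> real^2) \<Rightarrow> bool" where
  "weakly_div_free \<Omega> w \<longleftrightarrow> w \<in> L1_loc \<Omega> \<and>
     (\<forall>\<psi> \<in> test_functions \<Omega>. (LINT x|lebesgue_on \<Omega>. w x \<bullet> grad \<psi> x) = 0)"

definition H1_dot :: "(real^2) set \<Rightarrow> (real^2 \<Rightarrow> real^2) set" where
  "H1_dot \<Omega> = {w. \<exists>G \<in> L2 \<Omega>. has_weak_gradient \<Omega> w G}"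

definition H1_dot_norm :: "(real^2) set \<Rightarrow> (real^2 \<Rightarrow> real^2) \<Rightarrow> real" where
  "H1_dot_norm \<Omega> w = L2_norm \<Omega> (wgrad \<Omega> w)"

definition H1_dot_sigma :: "(real^2) set \<Rightarrow> (real^2 \<Rightarrow> real^2) set" where
  "H1_dot_sigma \<Omega> = {w \<in> H1_dot \<Omega>. weakly_div_free \<Omega> w}"

definition L2_sigma :: "(real^2) set \<Rightarrow> (real^2 \<Rightarrow> real^2) set" where
  "L2_sigma \<Omega> = {w \<in> L2 \<Omega>. \<exists>\<phi>. (\<forall>n. \<phi> n \<in> C0_sigma \<Omega>) \<and>
     (\<lambda>n. L2_norm \<Omega> (\<lambda>x. \<phi> n x - w x)) \<longlonglongrightarrow> 0}"

text \<open>
  The completion of \<open>C0_sigma \<Omega>\<close> in the norm \<open>H1_dot_norm \<Omega>\<close>, realised as a space of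
  fields. By the Poincare inequality for fields vanishing on the boundary of an exterior
  domain, a Cauchy sequence for the gradient norm converges in \<open>L2 (\<Omega> \<inter> ball 0 R)\<close> for
  every \<open>R\<close>; its abstract limit is identified with that limit. The local convergence
  is what excludes adding constants to the elements.
\<close>

definition H1_dot_0_sigma :: "(real^2) set \<Rightarrow> (real^2 \<Rightarrow> real^2) set" where
  "H1_dot_0_sigma \<Omega> = {w \<in> H1_dot \<Omega>. (\<forall>R>0. w \<in> L2 (\<Omega> \<inter> ball 0 R)) \<and>
     (\<exists>\<phi>. (\<forall>n. \<phi> n \<in> C0_sigma \<Omega>) \<and>
        (\<lambda>n. H1_dot_norm \<Omega> (\<lambda>x. \<phi> n x - w x)) \<longlonglongrightarrow> 0 \<and>
        (\<forall>R>0. (\<lambda>n. L2_norm (\<Omega> \<inter> ball 0 R) (\<lambda>x. \<phi> n x - w x)) \<longlonglongrightarrow> 0))}"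

section \<open>Bochner spaces on the time interval from 0 to infinity\<close>

text \<open>
  Here \<open>X\<close> is a space of fields and \<open>N\<close> its norm. Strong measurability is almost everywhere
  approximation by \<open>X\<close>-valued simple functions.
\<close>

definition strongly_measurable ::
  "(real^2 \<Rightarrow> real^2) set \<Rightarrow> ((real^2 \<Rightarrow> real^2) \<Rightarrow> real) \<Rightarrow> (real \<Rightarrow> real^2 \<Rightarrow> real^2) \<Rightarrow> bool" where
  "strongly_measurable X N v \<longleftrightarrow>
     (AE t in lebesgue_on {0<..}. v t \<in> X) \<and>
     (\<exists>s. (\<forall>n. simple_function (lebesgue_on {0<..}) (s n) \<and> (\<forall>t>0. s n t \<in> X)) \<and>
        (AE t in lebesgue_on {0<..}. (\<lambda>n. N (\<lambda>x. s n t x - v t x)) \<longlonglongrightarrow> 0))"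

definition Bochner_Linf ::
  "(real^2 \<Rightarrow> real^2) set \<Rightarrow> ((real^2 \<Rightarrow> real^2) \<Rightarrow> real) \<Rightarrow> (real \<Rightarrow> real^2 \<Rightarrow> real^2) set" where
  "Bochner_Linf X N = {v. strongly_measurable X N v \<and>
     (\<exists>M. AE t in lebesgue_on {0<..}. N (v t) \<le> M)}"

definition Bochner_L2 ::
  "(real^2 \<Rightarrow> real^2) set \<Rightarrow> ((real^2 \<Rightarrow> real^2) \<Rightarrow> real) \<Rightarrow> (real \<Rightarrow> real^2 \<Rightarrow> real^2) set" where
  "Bochner_L2 X N = {v. strongly_measurable X N v \<and>
     integrable (lebesgue_on {0<..}) (\<lambda>t. (N (v t))\<^sup>2)}"

section \<open>Steady solutions\<close>

text \<open>Sets of vanishing one-dimensional Hausdorff measure.\<close>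

definition hausdorff1_null :: "(real^2) set \<Rightarrow> bool" where
  "hausdorff1_null S \<longleftrightarrow>
     (\<forall>\<epsilon>>0. \<exists>A :: nat \<Rightarrow> (real^2) set. (\<forall>n. bounded (A n)) \<and> S \<subseteq> (\<Union>n. A n) \<and>
        summable (\<lambda>n. diameter (A n)) \<and> (\<Sum>n. diameter (A n)) < \<epsilon>)"

text \<open>
  \<open>ustar\<close> is the trace of \<open>u\<close> on the boundary of \<open>\<Omega>\<close>: at almost every boundary point
  (for arc length) \<open>ustar\<close> is the limit of \<open>u\<close> in the mean. On a Lipschitz boundary
  the trace of a Sobolev function has this property.
\<close>

definition has_trace :: "(real^2) set \<Rightarrow> (real^2 \<Rightarrow> real^2) \<Rightarrow> (real^2 \<Rightarrow> real^2) \<Rightarrow> bool" where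
  "has_trace \<Omega> u ustar \<longleftrightarrow> hausdorff1_null {x \<in> frontier \<Omega>.
     \<not> ((\<lambda>r. (LINT y|lebesgue_on (\<Omega> \<inter> ball x r). norm (u y - ustar x))
             / measure lebesgue (\<Omega> \<inter> ball x r)) \<longlongrightarrow> 0) (at_right 0)}"

text \<open>\<open>convect \<Omega> u w\<close> is the field \<open>u \<bullet> \<nabla>w\<close>, with components \<open>\<Sum>j. u\<^sub>j \<partial>\<^sub>j w\<^sub>i\<close>.\<close>

definition convect ::
  "(real^2) set \<Rightarrow> (real^2 \<Rightarrow> real^2) \<Rightarrow> (real^2 \<Rightarrow> real^2) \<Rightarrow> real^2 \<Rightarrow> real^2" where
  "convect \<Omega> u w x = wgrad \<Omega> w x *v u x"

definition steady_solution ::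
  "(real^2) set \<Rightarrow> (real^2 \<Rightarrow> real^2) \<Rightarrow> (real^2 \<Rightarrow> real) \<Rightarrow> (real^2 \<Rightarrow> real^2) \<Rightarrow> bool" where
  "steady_solution \<Omega> u p ustar \<longleftrightarrow>
     p \<in> L1_loc \<Omega> \<and>
     (\<forall>\<psi> \<in> test_functions \<Omega>.
        - L2_inner \<Omega> (wgrad \<Omega> u) (\<lambda>x. jacobian \<psi> (at x)) + L2_inner \<Omega> p (divergence \<psi>)
        = L2_inner \<Omega> (convect \<Omega> u u) \<psi>) \<and>
     weakly_div_free \<Omega> u \<and>
     has_trace \<Omega> u ustar"

section \<open>Weak solutions of the perturbed system\<close>

text \<open>
  The identities below are required for all times, so \<open>v\<close> is a curve whose value
  at every \<open>t \<ge> 0\<close> is a field in \<open>L2_sigma \<Omega>\<close>; the initial condition is equality in \<open>L2\<close>.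
\<close>

definition weak_solution ::
  "(real^2) set \<Rightarrow> (real^2 \<Rightarrow> real^2) \<Rightarrow> (real^2 \<Rightarrow> real^2) \<Rightarrow> (real \<Rightarrow> real^2 \<Rightarrow> real^2) \<Rightarrow> bool" where
  "weak_solution \<Omega> u v0 v \<longleftrightarrow>
     (\<forall>t\<ge>0. v t \<in> L2_sigma \<Omega>) \<and>
     v \<in> Bochner_Linf (L2_sigma \<Omega>) (L2_norm \<Omega>) \<and>
     v \<in> Bochner_L2 (H1_dot_0_sigma \<Omega>) (H1_dot_norm \<Omega>) \<and>
     (AE x in lebesgue_on \<Omega>. v 0 x = v0 x) \<and>
     (\<forall>\<phi> \<phi>' s t. C1_test_curve \<Omega> \<phi> \<phi>' \<and> 0 \<le> s \<and> s \<le> t \<longrightarrow>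
        L2_inner \<Omega> (v t) (\<phi> t) +
        (LINT \<tau>|lebesgue_on {s..t}.
            L2_inner \<Omega> (wgrad \<Omega> (v \<tau>)) (\<lambda>x. jacobian (\<phi> \<tau>) (at x)) +
            L2_inner \<Omega> (convect \<Omega> u (v \<tau>)) (\<phi> \<tau>) +
            L2_inner \<Omega> (convect \<Omega> (v \<tau>) u) (\<phi> \<tau>) +
            L2_inner \<Omega> (convect \<Omega> (v \<tau>) (v \<tau>)) (\<phi> \<tau>))
        = L2_inner \<Omega> (v s) (\<phi> s) +
          (LINT \<tau>|lebesgue_on {s..t}. L2_inner \<Omega> (v \<tau>) (\<phi>' \<tau>)))"

end

theory Submission imports Defs begin

text \<open>
  Write \<open>N t\<close> for the norm of \<open>\<nabla>v t\<close> in \<open>L2\<close>; its square is integrable on the half line. The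
  perturbation decays because its right-hand side is controlled by \<open>N\<close> alone.

  The terms that are quadratic in \<open>v\<close> are harmless in the plane by Ladyzhenskaya's inequality. The
  terms linear in \<open>v\<close> are controlled by the norm of \<open>\<bar>v\<bar> / \<bar>x\<bar>\<close>, as \<open>\<bar>u\<bar> \<le> 1 / \<bar>x\<bar>\<close>. Hardy's inequality
  fails for this norm in the plane, but it holds for centrally symmetric fields: such a field satisfies
  \<open>2 v x = v x - v (- x)\<close>, the difference is an integral along a half circle, and rotations preserve
  the measure. So \<open>v\<close> must be known to be symmetric at all times. The field
  \<open>- v (- x)\<close> solves the same problem, and weak solutions in the plane are unique: the even part \<open>z\<close>
  of \<open>v\<close> satisfies a linear equation with coefficients controlled by \<open>N\<close>, and Gronwall's inequality
  gives \<open>z = 0\<close> (lemma \<open>v_symmetric\<close>).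

  With the right-hand side controlled, there are two consequences. Testing with a fixed field and
  averaging over a unit of time, one finds that \<open>v t\<close> tends to zero weakly (\<open>weak_decay\<close>). And along
  \<open>\<tau> \<mapsto> (v \<tau>, v (2 t - \<tau>))\<close> with \<open>S \<le> \<tau> \<le> t\<close> the increase is at most a constant times the
  integral of \<open>N\<^sup>2\<close> over \<open>{S..2 t - S}\<close>, which is small if \<open>S\<close> is large. At \<open>\<tau> = t\<close> this correlation
  is the square of the norm of \<open>v t\<close>, and at \<open>\<tau> = S\<close> it is \<open>(v S, v (2 t - S))\<close>, which tends to zero as
  \<open>t\<close> grows (\<open>reflected_correlation\<close>, \<open>norm_tends_to_zero\<close>). The constant \<open>C = 1\<close> works.

  Two technical points carry much of the length. The weak formulation has to be tested with \<open>v\<close>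
  itself, so \<open>v t\<close> and its gradient are approximated simultaneously by
  solenoidal test fields (\<open>solenoidal_H1_0_wgrad\<close>), by cutting off a stream function. And
  time derivatives of \<open>v\<close> exist only in a weak sense, so differential inequalities are replaced by bounds
  on increments over short steps, which are averaged (\<open>increment_bound_from_steps\<close>).
\<close>

section \<open>Smooth functions\<close>

text \<open>Unlike \<open>smooth\<close>, which speaks of iterated directional derivatives of \<open>f\<close> itself, this form
  admits an induction over the order for sums, products and affine substitutions.\<close>

primrec diff_upto :: "nat \<Rightarrow> ('a::real_normed_vector \<Rightarrow> 'b::real_normed_vector) \<Rightarrow> bool" where
  "diff_upto 0 f \<longleftrightarrow> (\<forall>x. f differentiable (at x))"
| "diff_upto (Suc k) f \<longleftrightarrow> (\<forall>x. f differentiable (at x)) \<and>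
     (\<forall>v. diff_upto k (\<lambda>x. frechet_derivative f (at x) v))"

lemma smooth_iff_diff_upto: "smooth f \<longleftrightarrow> (\<forall>k. diff_upto k f)"
proof
  have "diff_upto k f" if "\<forall>vs x. iter_deriv vs f differentiable (at x)" for k
    using that
  proof (induction k arbitrary: f)
    case 0
    then show ?case by (metis iter_deriv.simps(1) diff_upto.simps(1))
  next
    case (Suc k)
    have "f differentiable (at x)" for x using Suc.prems by (metis iter_deriv.simps(1))
    moreover have "\<forall>vs x. iter_deriv vs (\<lambda>x. frechet_derivative f (at x) v) differentiable (at x)" for v
      using Suc.prems by (metis iter_deriv.simps(2))
    ultimately show ?case using Suc.IH by simp
  qed
  then show "smooth f \<Longrightarrow> \<forall>k. diff_upto k f" unfolding smooth_def by blast
next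
  assume *: "\<forall>k. diff_upto k f"
  have "iter_deriv vs f differentiable (at x)" if "diff_upto (length vs) f" for vs x
    using that
  proof (induction vs arbitrary: f)
    case Nil then show ?case by simp
  next
    case (Cons v vs) then show ?case by simp
  qed
  then show "smooth f" using * unfolding smooth_def by blast
qed

lemma diff_upto_differentiable: "diff_upto k f \<Longrightarrow> f differentiable (at x)"
  by (cases k) auto

lemma diff_upto_SucI:
  assumes "\<And>x. (f has_derivative f' x) (at x)" "\<And>v. diff_upto k (\<lambda>x. f' x v)"
  shows "diff_upto (Suc k) f"
proof -
  have "frechet_derivative f (at x) = f' x" for x
    using assms(1) frechet_derivative_at by metis
  then show ?thesis using assms by (auto simp: differentiable_def)
qed

lemma diff_upto_SucD: "diff_upto (Suc k) f \<Longrightarrow> diff_upto k f"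
proof (induction k arbitrary: f)
  case 0 then show ?case by simp
next
  case (Suc k)
  then show ?case by (metis diff_upto.simps(2))
qed

lemma diff_upto_deriv: "diff_upto (Suc k) f \<Longrightarrow> diff_upto k (\<lambda>x. frechet_derivative f (at x) v)"
  by simp

lemma diff_upto_has_derivative:
  "diff_upto k f \<Longrightarrow> (f has_derivative frechet_derivative f (at x)) (at x)"
  using diff_upto_differentiable frechet_derivative_works by blast

lemma diff_upto_const: "diff_upto k (\<lambda>x. c)"
  by (induction k arbitrary: c) (auto simp: frechet_derivative_const)

lemma diff_upto_add: "diff_upto k f \<Longrightarrow> diff_upto k g \<Longrightarrow> diff_upto k (\<lambda>x. f x + g x)"
proof (induction k arbitrary: f g)
  case 0 then show ?case by (simp add: differentiable_add)
next
  case (Suc k)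
  show ?case
    by (rule diff_upto_SucI[OF has_derivative_add[OF diff_upto_has_derivative[OF Suc.prems(1)]
          diff_upto_has_derivative[OF Suc.prems(2)]]])
      (use Suc in auto)
qed

lemma diff_upto_linear:
  assumes "bounded_linear L" shows "diff_upto k f \<Longrightarrow> diff_upto k (\<lambda>x. L (f x))"
proof (induction k arbitrary: f)
  case 0 then show ?case
    using bounded_linear.has_derivative[OF assms] by (auto simp: differentiable_def) blast
next
  case (Suc k)
  show ?case
    by (rule diff_upto_SucI[OF bounded_linear.has_derivative[OF assms diff_upto_has_derivative[OF Suc.prems(1)]]])
      (use Suc in auto)
qed

lemma diff_upto_bilinear:
  assumes "bounded_bilinear p"
  shows "diff_upto k f \<Longrightarrow> diff_upto k g \<Longrightarrow> diff_upto k (\<lambda>x. p (f x) (g x))"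
proof (induction k arbitrary: f g)
  case 0 then show ?case
    using bounded_bilinear.FDERIV[OF assms] by (auto simp: differentiable_def) blast
next
  case (Suc k)
  show ?case
  proof (rule diff_upto_SucI[OF bounded_bilinear.FDERIV[OF assms diff_upto_has_derivative[OF Suc.prems(1)]
          diff_upto_has_derivative[OF Suc.prems(2)]]])
    fix v
    show "diff_upto k (\<lambda>x. p (f x) (frechet_derivative g (at x) v) + p (frechet_derivative f (at x) v) (g x))"
      by (intro diff_upto_add Suc.IH diff_upto_SucD[OF Suc.prems(1)] diff_upto_SucD[OF Suc.prems(2)]
         diff_upto_deriv Suc.prems)
  qed
qed

lemma diff_upto_affine:
  assumes l: "\<And>x. (l has_derivative l') (at x)"
  shows "diff_upto k f \<Longrightarrow> diff_upto k (\<lambda>x. f (l x))"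
proof (induction k arbitrary: f)
  case 0 
  then have "(f has_derivative frechet_derivative f (at y)) (at y)" for y
    by (rule diff_upto_has_derivative)
  from has_derivative_compose[OF l this] show ?case by (auto simp: differentiable_def)
next
  case (Suc k)
  show ?case
  proof (rule diff_upto_SucI[OF has_derivative_compose[OF l diff_upto_has_derivative[OF Suc.prems(1)]]])
    show "diff_upto k (\<lambda>x. frechet_derivative f (at (l x)) (l' v))" for v
      using Suc.IH[OF diff_upto_deriv[OF Suc.prems]] .
  qed
qed

lemma diff_upto_inverse:
  fixes f :: "'a::real_normed_vector \<Rightarrow> real"
  assumes nz: "\<And>x. f x \<noteq> 0"
  shows "diff_upto k f \<Longrightarrow> diff_upto k (\<lambda>x. inverse (f x))"
proof (induction k)
  case 0 then show ?case using nz by (simp add: differentiable_inverse)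
next
  case (Suc k)
  have D: "((\<lambda>x. inverse (f x)) has_derivative
      (\<lambda>h. - (inverse (f x) * frechet_derivative f (at x) h * inverse (f x)))) (at x)" for x
    by (rule Deriv.has_derivative_inverse[OF nz diff_upto_has_derivative[OF Suc.prems(1)]])
  have I: "diff_upto k (\<lambda>x. inverse (f x))" using Suc diff_upto_SucD by blast
  show ?case
  proof (rule diff_upto_SucI[OF D])
    fix v
    show "diff_upto k (\<lambda>x. - (inverse (f x) * frechet_derivative f (at x) v * inverse (f x)))"
      by (intro diff_upto_linear[OF bounded_linear_minus[OF bounded_linear_ident]]
          diff_upto_bilinear[OF bounded_bilinear_mult] I diff_upto_deriv Suc.prems)
  qed
qed

lemma smooth_differentiable: "smooth f \<Longrightarrow> f differentiable (at x)"
  and smooth_has_derivative: "smooth f \<Longrightarrow> (f has_derivative frechet_derivative f (at x)) (at x)"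
  using diff_upto_differentiable diff_upto_has_derivative smooth_iff_diff_upto by blast+

lemma smooth_deriv: "smooth f \<Longrightarrow> smooth (\<lambda>x. frechet_derivative f (at x) v)"
  unfolding smooth_iff_diff_upto using diff_upto_deriv by blast

lemma smoothI_deriv:
  assumes "\<And>x. (f has_derivative f' x) (at x)" "\<And>v. smooth (\<lambda>x. f' x v)"
  shows "smooth f"
  unfolding smooth_iff_diff_upto
  by (metis assms diff_upto_SucD diff_upto_SucI smooth_iff_diff_upto)

lemma smooth_const: "smooth (\<lambda>x. c)"
  and smooth_add: "smooth f \<Longrightarrow> smooth g \<Longrightarrow> smooth (\<lambda>x. f x + g x)"
  and smooth_linear: "bounded_linear L \<Longrightarrow> smooth f \<Longrightarrow> smooth (\<lambda>x. L (f x))"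
  and smooth_bilinear: "bounded_bilinear p \<Longrightarrow> smooth f \<Longrightarrow> smooth h \<Longrightarrow> smooth (\<lambda>x. p (f x) (h x))"
  by (auto simp: smooth_iff_diff_upto diff_upto_const diff_upto_add diff_upto_linear diff_upto_bilinear)

lemma smooth_affine:
  "(\<And>x. (l has_derivative l') (at x)) \<Longrightarrow> smooth f \<Longrightarrow> smooth (\<lambda>x. f (l x))"
  unfolding smooth_iff_diff_upto using diff_upto_affine by blast

lemma smooth_inverse:
  fixes f :: "'a::real_normed_vector \<Rightarrow> real"
  shows "(\<And>x. f x \<noteq> 0) \<Longrightarrow> smooth f \<Longrightarrow> smooth (\<lambda>x. inverse (f x))"
  unfolding smooth_iff_diff_upto using diff_upto_inverse by blast

lemma smooth_mult:
  fixes f g :: "'a::real_normed_vector \<Rightarrow> real"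
  shows "smooth f \<Longrightarrow> smooth g \<Longrightarrow> smooth (\<lambda>x. f x * g x)"
  by (rule smooth_bilinear[OF bounded_bilinear_mult])

lemma smooth_uminus: "smooth f \<Longrightarrow> smooth (\<lambda>x. - f x)"
  by (rule smooth_linear[OF bounded_linear_minus[OF bounded_linear_ident]])

lemma smooth_diff: "smooth f \<Longrightarrow> smooth g \<Longrightarrow> smooth (\<lambda>x. f x - g x)"
  using smooth_add[OF _ smooth_uminus] by force

lemma smooth_vec_nth: "smooth f \<Longrightarrow> smooth (\<lambda>x. f x $ i)"
  by (rule smooth_linear[OF bounded_linear_vec_nth])

lemma smooth_continuous_on: "smooth f \<Longrightarrow> continuous_on S f"
  by (simp add: continuous_at_imp_continuous_on differentiable_imp_continuous_within smooth_differentiable)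

lemma smooth_sum: "finite I \<Longrightarrow> (\<And>i. i \<in> I \<Longrightarrow> smooth (f i)) \<Longrightarrow> smooth (\<lambda>x. \<Sum>i\<in>I. f i x)"
  by (induction I rule: finite_induct) (auto intro: smooth_const smooth_add)

lemma smooth_vec2:
  fixes f :: "'a::real_normed_vector \<Rightarrow> real^2"
  assumes "\<And>i. smooth (\<lambda>x. f x $ i)" shows "smooth f"
proof -
  have "f = (\<lambda>x. \<Sum>i\<in>UNIV. (f x $ i) *\<^sub>R axis i 1)"
    by (auto simp: vec_eq_iff axis_def sum.If_cases if_distrib[of "(*) _"] cong: if_cong)
  moreover have "smooth (\<lambda>x. \<Sum>i\<in>UNIV. (f x $ i) *\<^sub>R (axis i 1 :: real^2))"
    by (intro smooth_sum smooth_linear[OF bounded_linear_scaleR_left] assms) auto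
  ultimately show ?thesis by simp
qed

text \<open>The functions \<open>p (1 / t) exp (- 1 / t)\<close>, extended by zero, form a class that is closed under
  differentiation; this is what makes them smooth at the origin.\<close>

definition flat_exp :: "real poly \<Rightarrow> real \<Rightarrow> real" where
  "flat_exp p t = (if t > 0 then poly p (1 / t) * exp (- (1 / t)) else 0)"

lemma flat_exp_tendsto_0: fixes p :: "real poly" shows "((\<lambda>t. poly p (1 / t) * exp (- (1 / t))) \<longlongrightarrow> 0) (at_right 0)"
proof -
  have monomial: "((\<lambda>x::real. x ^ n * exp (- x)) \<longlongrightarrow> 0) at_top" for n :: nat
    using tendsto_power_div_exp_0[of n] by (simp add: exp_minus field_simps)
  have "((\<lambda>x::real. \<Sum>i\<le>degree p. coeff p i * (x ^ i * exp (- x))) \<longlongrightarrow> (\<Sum>i\<le>degree p. coeff p i * 0)) at_top"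
    by (intro tendsto_sum tendsto_mult tendsto_const)
      (rule monomial)
  then have "((\<lambda>x::real. poly p x * exp (- x)) \<longlongrightarrow> 0) at_top"
    by (simp add: poly_altdef sum_distrib_right mult.assoc)
  from filterlim_compose[OF this filterlim_inverse_at_top_right]
  show ?thesis by (simp add: inverse_eq_divide)
qed

lemma flat_exp_has_derivative:
  "(flat_exp p has_real_derivative flat_exp ([:0,0,1:] * (p - pderiv p)) t) (at t)"
proof -
  consider "t > 0" | "t < 0" | "t = 0" by linarith
  then show ?thesis
  proof cases
    case 1
    have "((\<lambda>t. poly p (1/t) * exp (- (1/t))) has_real_derivative
       flat_exp ([:0,0,1:] * (p - pderiv p)) t) (at t)"
      using 1 by (auto intro!: derivative_eq_intros DERIV_chain'[OF _ poly_DERIV]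
           simp: flat_exp_def field_simps power2_eq_square)
    then show ?thesis
      by (rule DERIV_cong_ev[THEN iffD1, rotated -1])
        (use 1 in \<open>auto simp: flat_exp_def eventually_nhds intro!: exI[of _ "{0<..}"]\<close>)
  next
    case 2
    have "((\<lambda>t::real. 0::real) has_real_derivative
       flat_exp ([:0,0,1:] * (p - pderiv p)) t) (at t)"
      using 2 by (simp add: flat_exp_def)
    then show ?thesis
      by (rule DERIV_cong_ev[THEN iffD1, rotated -1])
        (use 2 in \<open>auto simp: flat_exp_def eventually_nhds intro!: exI[of _ "{..<0}"]\<close>)
  next
    case 3
    have "((\<lambda>t. flat_exp p t / t) \<longlongrightarrow> 0) (at 0)"
    proof (rule filterlim_split_at)
      have "((\<lambda>t. 0::real) \<longlongrightarrow> 0) (at_left 0)" by simp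
      then show "((\<lambda>t. flat_exp p t / t) \<longlongrightarrow> 0) (at_left (0::real))"
        by (rule tendsto_cong[THEN iffD1, rotated])
          (auto simp: flat_exp_def eventually_at_filter)
      have "((\<lambda>t. poly ([:0,1:] * p) (1 / t) * exp (- (1 / t))) \<longlongrightarrow> 0) (at_right 0)"
        by (rule flat_exp_tendsto_0)
      then show "((\<lambda>t. flat_exp p t / t) \<longlongrightarrow> 0) (at_right (0::real))"
        by (rule tendsto_cong[THEN iffD1, rotated])
          (auto simp: flat_exp_def eventually_at_filter)
    qed
    then show ?thesis using 3 by (simp add: DERIV_def flat_exp_def)
  qed
qed

lemma smooth_flat_exp: "smooth (flat_exp p)"
proof -
  have "diff_upto k (flat_exp p)" for k
  proof (induction k arbitrary: p)
    case 0 then show ?case using flat_exp_has_derivative real_differentiable_def 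
      by (fastforce simp: differentiable_def has_field_derivative_def)
  next
    case (Suc k)
    show ?case
    proof (rule diff_upto_SucI)
      show "(flat_exp p has_derivative (\<lambda>h. flat_exp ([:0,0,1:] * (p - pderiv p)) x * h)) (at x)" for x
        using flat_exp_has_derivative by (simp add: has_field_derivative_def)
      show "diff_upto k (\<lambda>x. flat_exp ([:0,0,1:] * (p - pderiv p)) x * v)" for v
        by (rule diff_upto_linear[OF bounded_linear_mult_left Suc.IH])
    qed
  qed
  then show ?thesis by (simp add: smooth_iff_diff_upto)
qed

abbreviation "bump1 \<equiv> flat_exp 1"

lemma bump1: "bump1 t = (if t > 0 then exp (- (1 / t)) else 0)"
  by (simp add: flat_exp_def)

definition smooth_step :: "real \<Rightarrow> real" where
  "smooth_step t = bump1 t * inverse (bump1 t + bump1 (1 - t))"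

lemma bump1_pos: "bump1 t + bump1 (1 - t) > 0"
  by (auto simp: bump1 add_pos_nonneg add_nonneg_pos add_pos_pos)

lemma smooth_smooth_step: "smooth smooth_step"
proof -
  have "smooth (\<lambda>t. bump1 (1 - t))"
    by (rule smooth_affine[where l="\<lambda>t. 1 - t", OF _ smooth_flat_exp]) (auto intro!: derivative_eq_intros)
  then show ?thesis unfolding smooth_step_def[abs_def]
    using bump1_pos by (intro smooth_mult smooth_flat_exp smooth_inverse smooth_add) (metis less_irrefl)
qed

lemma smooth_step_range: "0 \<le> smooth_step t" "smooth_step t \<le> 1"
  using bump1_pos[of t] by (auto simp: smooth_step_def bump1 field_simps)

lemma smooth_step_1: "t \<ge> 1 \<Longrightarrow> smooth_step t = 1"
  and smooth_step_0: "t \<le> 0 \<Longrightarrow> smooth_step t = 0"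
  using bump1_pos[of t] by (auto simp: smooth_step_def bump1 field_simps)

section \<open>Supports and Jacobians\<close>

lemma supp_outside: "x \<notin> supp f \<Longrightarrow> f x = 0"
  unfolding supp_def using closure_subset[of "{x. f x \<noteq> 0}"] by auto

lemma supp_subset: "closed K \<Longrightarrow> (\<And>x. x \<notin> K \<Longrightarrow> f x = 0) \<Longrightarrow> supp f \<subseteq> K"
  unfolding supp_def by (rule closure_minimal) auto

lemma closed_supp: "closed (supp f)" by (simp add: supp_def)

lemma frechet_derivative_outside_supp:
  assumes "x \<notin> supp f" shows "frechet_derivative f (at x) = (\<lambda>h. 0)"
proof -
  have "((\<lambda>y. 0) has_derivative (\<lambda>h. 0)) (at x)" by simp
  then have "(f has_derivative (\<lambda>h. 0)) (at x)"
    by (rule has_derivative_transform_within_open[OF _ open_Compl[OF closed_supp[of f]]])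
      (use assms supp_outside in force)+
  then show ?thesis using frechet_derivative_at by metis
qed

lemma test_functionsI:
  assumes "smooth f" "compact K" "K \<subseteq> \<Omega>" "\<And>x. x \<notin> K \<Longrightarrow> f x = 0"
  shows "f \<in> test_functions \<Omega>"
proof -
  have "supp f \<subseteq> K" by (rule supp_subset) (use assms compact_imp_closed in auto)
  then show ?thesis unfolding test_functions_def
    using assms compact_Int_closed[OF assms(2) closed_supp[of f]] by (auto simp: Int_absorb1)
qed

lemma test_functionsD:
  assumes "f \<in> test_functions \<Omega>"
  shows "smooth f" "compact (supp f)" "supp f \<subseteq> \<Omega>" "\<And>x. x \<notin> \<Omega> \<Longrightarrow> f x = 0"
  using assms supp_outside[of _ f] unfolding test_functions_def by auto

lemma test_functions_deriv:
  "f \<in> test_functions \<Omega> \<Longrightarrow> (\<lambda>x. frechet_derivative f (at x) v) \<in> test_functions \<Omega>"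
  by (rule test_functionsI[where K="supp f"])
    (auto simp: test_functionsD smooth_deriv frechet_derivative_outside_supp)

lemma jacobian_nth:
  "jacobian f (at x) $ i $ j = frechet_derivative f (at x) (axis j 1) $ i"
  by (simp add: jacobian_def matrix_def)

lemma frechet_derivative_vec_nth:
  fixes f :: "'a::real_normed_vector \<Rightarrow> real^'n"
  assumes "f differentiable (at x)"
  shows "frechet_derivative (\<lambda>x. f x $ i) (at x) = (\<lambda>v. frechet_derivative f (at x) v $ i)"
  using bounded_linear.has_derivative[OF bounded_linear_vec_nth
     assms[unfolded frechet_derivative_works], of i] frechet_derivative_at by metis

lemma grad_component:
  fixes f :: "real^2 \<Rightarrow> real^2"
  assumes "f differentiable (at x)"
  shows "grad (\<lambda>x. f x $ i) x $ j = jacobian f (at x) $ i $ j"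
  using frechet_derivative_vec_nth[OF assms] by (simp add: grad_def jacobian_nth)

lemma jacobian_works:
  fixes f :: "real^'n \<Rightarrow> real^'m"
  assumes "f differentiable (at x)"
  shows "frechet_derivative f (at x) v = jacobian f (at x) *v v"
proof -
  have "linear (frechet_derivative f (at x))"
    using assms frechet_derivative_works has_derivative_linear by blast
  then show ?thesis by (simp add: jacobian_def matrix_works)
qed

lemma continuous_on_jacobian:
  fixes f :: "real^'n \<Rightarrow> real^'m"
  assumes "smooth f" shows "continuous_on S (\<lambda>x. jacobian f (at x))"
  unfolding jacobian_def matrix_def
  by (intro continuous_on_vec_lambda continuous_on_component smooth_continuous_on smooth_deriv assms)

section \<open>Integrals of compactly supported functions\<close>

lemma integrable_lborel_compact_support:
  fixes f :: "'a::euclidean_space \<Rightarrow> 'b::euclidean_space"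
  assumes "continuous_on UNIV f" "compact K" "\<And>x. x \<notin> K \<Longrightarrow> f x = 0"
  shows "integrable lborel f"
proof -
  have "integrable lborel (\<lambda>x. indicator K x *\<^sub>R f x)"
    by (rule borel_integrable_compact[OF assms(2)]) (use assms continuous_on_subset in blast)
  moreover have "(\<lambda>x. indicator K x *\<^sub>R f x) = f" using assms(3) by (auto simp: indicator_def)
  ultimately show ?thesis by simp
qed

lemma integrable_lebesgue_on_iff_supported:
  fixes f :: "'a::euclidean_space \<Rightarrow> 'b::euclidean_space"
  assumes "S \<in> sets lebesgue" "\<And>x. x \<notin> S \<Longrightarrow> f x = 0"
  shows "integrable (lebesgue_on S) f \<longleftrightarrow> integrable lebesgue f"
    and "integral\<^sup>L (lebesgue_on S) f = integral\<^sup>L lebesgue f"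
proof -
  have "(\<lambda>x. indicator S x *\<^sub>R f x) = f" using assms(2) by (auto simp: indicator_def)
  then show "integrable (lebesgue_on S) f \<longleftrightarrow> integrable lebesgue f"
    and "integral\<^sup>L (lebesgue_on S) f = integral\<^sup>L lebesgue f"
    using assms(1) by (auto simp: integrable_restrict_space integral_restrict_space)
qed

lemma integral_lborel_translate:
  fixes f :: "'a::euclidean_space \<Rightarrow> 'b::euclidean_space"
  assumes "f \<in> borel_measurable borel"
  shows "integral\<^sup>L lborel (\<lambda>x. f (a + x)) = integral\<^sup>L lborel f"
proof -
  have "integral\<^sup>L lborel f = integral\<^sup>L (distr lborel borel ((+) a)) f"
    by (simp add: lborel_distr_plus)
  also have "\<dots> = integral\<^sup>L lborel (\<lambda>x. f (a + x))"
    by (rule integral_distr) (use assms in auto)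
  finally show ?thesis by simp
qed

lemma bounded_range_compact_support:
  fixes f :: "'a::euclidean_space \<Rightarrow> 'b::real_normed_vector"
  assumes "continuous_on UNIV f" "compact K" "\<And>x. x \<notin> K \<Longrightarrow> f x = 0"
  obtains M where "M > 0" "\<And>x. norm (f x) \<le> M"
proof -
  have "compact (f ` K)" by (rule compact_continuous_image[OF continuous_on_subset[OF assms(1)]]) (use assms(2) in auto)
  then obtain M where "M > 0" "\<forall>y\<in>f ` K. norm y \<le> M" using compact_imp_bounded bounded_pos by metis
  then show ?thesis using that[of M] assms(3) by (metis imageI norm_zero less_imp_le)
qed

text \<open>The difference quotients of a compactly supported function have integral zero by translation
  invariance, and they converge boundedly to the derivative.\<close>

lemma integral_deriv_compact_support:
  fixes f :: "real^2 \<Rightarrow> real"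
  assumes sm: "smooth f" and K: "compact K" "\<And>x. x \<notin> K \<Longrightarrow> f x = 0"
  shows "integral\<^sup>L lborel (\<lambda>x. frechet_derivative f (at x) v) = 0"
proof -
  define D where "D = (\<lambda>x. frechet_derivative f (at x) v)"
  have supp: "supp f \<subseteq> K" by (rule supp_subset) (use K compact_imp_closed in auto)
  have D0: "D x = 0" if "x \<notin> K" for x
    using frechet_derivative_outside_supp[of x f] subsetD[OF supp, of x] that by (metis D_def)
  have Dc: "continuous_on UNIV D" unfolding D_def by (intro smooth_continuous_on smooth_deriv sm)
  obtain M where M: "M > 0" "\<And>x. norm (D x) \<le> M"
    using bounded_range_compact_support[OF Dc K(1) D0] by blast
  obtain R where R: "R > 0" "\<And>x. x \<in> K \<Longrightarrow> norm x \<le> R" using compact_imp_bounded[OF K(1)] bounded_pos by metis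
  define s where "s = (\<lambda>(n::nat) x. real (Suc n) * (f ((1 / real (Suc n)) *\<^sub>R v + x) - f x))"
  have fc: "continuous_on UNIV f" by (rule smooth_continuous_on[OF sm])
  have bc: "f \<in> borel_measurable borel" using fc by (rule borel_measurable_continuous_onI)
  have fi: "integrable lborel f" by (rule integrable_lborel_compact_support[OF fc K])
  have tr: "integrable lborel (\<lambda>x. f (a + x))" for a
    using integrable_distr[of "(+) a" lborel borel f] fi lborel_distr_plus[of a] by simp
  have s0: "integral\<^sup>L lborel (s n) = 0" for n
    unfolding s_def using fi tr bc by (simp add: integral_lborel_translate)
  have quot: "norm (f (t *\<^sub>R v + x) - f x) \<le> M * t" if "t > 0" for t x
  proof -
    have "((\<lambda>r. f (r *\<^sub>R v + x)) has_real_derivative D (r *\<^sub>R v + x)) (at r)" for r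
    proof -
      have "((\<lambda>r. f (r *\<^sub>R v + x)) has_derivative (\<lambda>h. frechet_derivative f (at (r *\<^sub>R v + x)) (h *\<^sub>R v))) (at r)"
        by (rule has_derivative_compose[OF _ smooth_has_derivative[OF sm]]) (auto intro!: derivative_eq_intros)
      moreover have "frechet_derivative f (at (r *\<^sub>R v + x)) (h *\<^sub>R v) = D (r *\<^sub>R v + x) * h" for h
        unfolding D_def using linear_cmul[OF has_derivative_linear[OF smooth_has_derivative[OF sm]]]
        by (metis mult.commute real_scaleR_def)
      ultimately show ?thesis by (simp add: has_field_derivative_def)
    qed
    from MVT2[OF that this] obtain z where "f (t *\<^sub>R v + x) - f (0 *\<^sub>R v + x) = (t - 0) * D (z *\<^sub>R v + x)"
      by blast
    then show ?thesis using M(2)[of "z *\<^sub>R v + x"] that by (simp add: abs_mult mult.commute)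
  qed
  have "(\<lambda>n. integral\<^sup>L lborel (s n)) \<longlonglongrightarrow> integral\<^sup>L lborel D"
  proof (rule integral_dominated_convergence[where w="\<lambda>x. indicator (cball 0 (R + norm v)) x *\<^sub>R M"])
    show "integrable lborel (\<lambda>x. indicator (cball 0 (R + norm v)) x *\<^sub>R M)"
      by (rule borel_integrable_compact) auto
    show "AE x in lborel. (\<lambda>n. s n x) \<longlonglongrightarrow> D x"
    proof (rule AE_I2)
      fix x
      have "((\<lambda>r. f (r *\<^sub>R v + x)) has_derivative (\<lambda>h. frechet_derivative f (at (0 *\<^sub>R v + x)) (h *\<^sub>R v))) (at 0)"
        by (rule has_derivative_compose[OF _ smooth_has_derivative[OF sm]]) (auto intro!: derivative_eq_intros)
      moreover have "frechet_derivative f (at x) (h *\<^sub>R v) = D x * h" for h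
        unfolding D_def using linear_cmul[OF has_derivative_linear[OF smooth_has_derivative[OF sm]]]
        by (metis mult.commute real_scaleR_def)
      ultimately have "((\<lambda>r. f (r *\<^sub>R v + x)) has_real_derivative D x) (at 0)"
        by (simp add: has_field_derivative_def)
      then have "((\<lambda>h. (f (h *\<^sub>R v + x) - f x) / h) \<longlongrightarrow> D x) (at 0)" by (simp add: DERIV_def)
      moreover have "filterlim (\<lambda>n. 1 / real (Suc n)) (at 0) sequentially"
        by (rule filterlim_atI) (use LIMSEQ_Suc[OF lim_1_over_n] in auto)
      ultimately have "(\<lambda>n. (f ((1 / real (Suc n)) *\<^sub>R v + x) - f x) / (1 / real (Suc n))) \<longlonglongrightarrow> D x"
        by (rule filterlim_compose)
      then show "(\<lambda>n. s n x) \<longlonglongrightarrow> D x" by (simp add: s_def field_simps)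
    qed
    show "AE x in lborel. norm (s n x) \<le> indicator (cball 0 (R + norm v)) x *\<^sub>R M" for n
    proof (rule AE_I2)
      fix x
      show "norm (s n x) \<le> indicator (cball 0 (R + norm v)) x *\<^sub>R M"
      proof (cases "x \<in> cball 0 (R + norm v)")
        case True
        have "norm (s n x) = real (Suc n) * norm (f ((1 / real (Suc n)) *\<^sub>R v + x) - f x)"
          by (simp add: s_def abs_mult)
        also have "\<dots> \<le> real (Suc n) * (M * (1 / real (Suc n)))"
          by (rule mult_left_mono[OF quot]) auto
        finally show ?thesis using True by simp
      next
        case False
        then have "R + norm v < norm x" by simp
        moreover have "norm ((1 / real (Suc n)) *\<^sub>R v) \<le> norm v"
          by (simp add: divide_le_eq mult_le_cancel_left1)
        moreover have "norm x \<le> norm ((1 / real (Suc n)) *\<^sub>R v + x) + norm ((1 / real (Suc n)) *\<^sub>R v)"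
          by (metis add_diff_cancel_left' norm_triangle_sub add.commute norm_minus_commute)
        ultimately have "norm ((1 / real (Suc n)) *\<^sub>R v + x) > R" "norm x > R" using norm_ge_zero[of v] by linarith+
        then have "f ((1 / real (Suc n)) *\<^sub>R v + x) = 0" "f x = 0"
          using K(2) R(2) by (metis not_less)+
        then show ?thesis using False by (simp add: s_def)
      qed
    qed
    show "D \<in> borel_measurable lborel" using Dc by (simp add: borel_measurable_continuous_onI)
    show "s n \<in> borel_measurable lborel" for n unfolding s_def using bc by measurable
  qed
  then show ?thesis using s0 by (simp add: D_def LIMSEQ_const_iff)
qed

section \<open>Weak gradients\<close>

lemma AE_lebesgue_on_iff:
  "S \<in> sets lebesgue \<Longrightarrow> (AE x in lebesgue_on S. P x) \<longleftrightarrow> (AE x in lebesgue. x \<in> S \<longrightarrow> P x)"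
  by (rule AE_restrict_space_iff) auto

lemma lebesgue_measurable_continuous:
  "continuous_on UNIV f \<Longrightarrow> f \<in> borel_measurable (lebesgue :: 'a::euclidean_space measure)"
  by (intro measurable_completion) (simp add: borel_measurable_continuous_onI)

lemma AE_notin_negligible: "negligible N \<Longrightarrow> AE x in lebesgue. x \<notin> N"
  using AE_not_in[of N lebesgue] by (simp add: negligible_iff_null_sets)

text \<open>An open set is a countable union of compact boxes.\<close>

lemma L1_loc_measurable:
  assumes "open \<Omega>" "w \<in> L1_loc \<Omega>" shows "w \<in> borel_measurable (lebesgue_on \<Omega>)"
proof -
  obtain \<D> where D: "countable \<D>" "\<D> \<subseteq> Pow \<Omega>" "\<And>X. X \<in> \<D> \<Longrightarrow> \<exists>a b. X = cbox a b" "\<Union>\<D> = \<Omega>"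
    by (rule open_countable_Union_open_cbox[OF assms(1)]) blast
  show ?thesis
  proof (rule measurable_piecewise_restrict[OF D(1)])
    fix X assume X: "X \<in> \<D>"
    then obtain a b where ab: "X = cbox a b" using D(3) by blast
    have sub: "X \<subseteq> \<Omega>" using X D(2) by auto
    show "X \<inter> space (lebesgue_on \<Omega>) \<in> sets (lebesgue_on \<Omega>)"
      using sub assms(1) ab by (auto simp: sets_restrict_space space_restrict_space image_iff intro!: bexI[of _ X])
    have "set_integrable lebesgue X w" using assms(2) sub ab by (auto simp: L1_loc_def)
    then have "w \<in> borel_measurable (lebesgue_on X)"
      using ab integrable_restrict_space[of X lebesgue w] by (auto simp: set_integrable_def)
    moreover have "restrict_space (lebesgue_on \<Omega>) X = lebesgue_on (\<Omega> \<inter> X)"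
      by (rule restrict_restrict_space) (use assms(1) ab in auto)
    ultimately show "w \<in> borel_measurable (restrict_space (lebesgue_on \<Omega>) X)"
      using sub by (simp add: Int_absorb1)
  qed (use D in \<open>auto simp: space_restrict_space\<close>)
qed

lemma L1_loc_diff: "f \<in> L1_loc \<Omega> \<Longrightarrow> g \<in> L1_loc \<Omega> \<Longrightarrow> (\<lambda>x. f x - g x) \<in> L1_loc \<Omega>"
  by (auto simp: L1_loc_def intro!: set_integral_diff)

lemma L1_loc_linear: "bounded_linear h \<Longrightarrow> f \<in> L1_loc \<Omega> \<Longrightarrow> (\<lambda>x. h (f x)) \<in> L1_loc \<Omega>"
  using absolutely_integrable_linear[of _ _ h] by (auto simp: L1_loc_def o_def)

lemma L1_loc_continuous:
  assumes "continuous_on UNIV f" shows "f \<in> L1_loc \<Omega>"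
proof -
  have "f absolutely_integrable_on K" if "compact K" for K
  proof -
    have "integrable lborel (\<lambda>x. indicator K x *\<^sub>R f x)"
      by (rule borel_integrable_compact[OF that]) (use assms continuous_on_subset in blast)
    then show ?thesis unfolding set_integrable_def
      by (subst integrable_completion) auto
  qed
  then show ?thesis by (auto simp: L1_loc_def)
qed

lemma integrable_L1_loc_test:
  fixes p :: "'a::euclidean_space \<Rightarrow> 'b::euclidean_space \<Rightarrow> 'c::euclidean_space"
  assumes p: "bounded_bilinear p" and w: "w \<in> L1_loc \<Omega>" and h: "continuous_on UNIV h"
    and K: "compact K" "K \<subseteq> \<Omega>" "\<And>x. x \<notin> K \<Longrightarrow> h x = 0" and \<Omega>: "open \<Omega>"
  shows "integrable (lebesgue_on \<Omega>) (\<lambda>x. p (w x) (h x))"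
proof -
  interpret bounded_bilinear p by fact
  obtain B where B: "\<And>a b. norm (p a b) \<le> norm a * norm b * B" "B \<ge> 0" using nonneg_bounded by blast
  obtain M where M: "M > 0" "\<And>x. norm (h x) \<le> M" using bounded_range_compact_support[OF h K(1,3)] by blast
  have i: "integrable lebesgue (\<lambda>x. indicator K x *\<^sub>R w x)"
    using w K by (auto simp: L1_loc_def set_integrable_def)
  have "integrable lebesgue (\<lambda>x. p (indicator K x *\<^sub>R w x) (h x))"
  proof (rule Bochner_Integration.integrable_bound)
    show "integrable lebesgue (\<lambda>x. M * B * norm (indicator K x *\<^sub>R w x))"
      by (intro integrable_mult_right integrable_norm i)
    have c: "continuous_on UNIV (\<lambda>z. p (fst z) (snd z))"
      by (intro continuous_on continuous_intros)
    show "(\<lambda>x. p (indicator K x *\<^sub>R w x) (h x)) \<in> borel_measurable lebesgue"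
      by (rule borel_measurable_continuous_Pair[OF _ _ c])
       (use i lebesgue_measurable_continuous[OF h] in auto)
    have bd: "norm (p a (h x)) \<le> M * B * norm a" for a x
      using B(1)[of a "h x"] M(2)[of x] B(2) 
      by (smt (verit, ccfv_SIG) mult.assoc mult.commute mult_left_mono mult_nonneg_nonneg norm_ge_zero)
    have "norm (M * B * norm y) = M * B * norm y" for y :: 'a using M B by (simp add: abs_mult)
    then show "AE x in lebesgue. norm (p (indicator K x *\<^sub>R w x) (h x)) \<le> norm (M * B * norm (indicator K x *\<^sub>R w x))"
      using bd by (intro AE_I2) (simp only:)
  qed
  moreover have "(\<lambda>x. p (indicator K x *\<^sub>R w x) (h x)) = (\<lambda>x. p (w x) (h x))"
  proof
    fix x show "p (indicator K x *\<^sub>R w x) (h x) = p (w x) (h x)"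
      using K(3)[of x] zero_right by (cases "x \<in> K") auto
  qed
  ultimately have "integrable lebesgue (\<lambda>x. p (w x) (h x))" by simp
  moreover have "p (w x) (h x) = 0" if "x \<notin> \<Omega>" for x using that K(2,3) zero_right by (metis subsetD)
  ultimately show ?thesis
    using integrable_lebesgue_on_iff_supported(1)[of \<Omega> "\<lambda>x. p (w x) (h x)"] \<Omega> by auto
qed

lemma smooth_prod:
  fixes f :: "'i \<Rightarrow> 'a::real_normed_vector \<Rightarrow> real"
  shows "finite I \<Longrightarrow> (\<And>i. i \<in> I \<Longrightarrow> smooth (f i)) \<Longrightarrow> smooth (\<lambda>x. \<Prod>i\<in>I. f i x)"
  by (induction I rule: finite_induct) (auto intro: smooth_const smooth_mult)

lemma smooth_affine_coord:
  fixes h :: "real \<Rightarrow> real" assumes "smooth h"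
  shows "smooth (\<lambda>x::real^2. h (c * (x $ i - d)))" "smooth (\<lambda>x::real^2. h (c * (d - x $ i)))"
proof -
  show "smooth (\<lambda>x::real^2. h (c * (x $ i - d)))"
    by (rule smooth_affine[where l="\<lambda>x. c * (x $ i - d)" and l'="\<lambda>v. c * v $ i", OF _ assms])
      (auto intro!: derivative_eq_intros bounded_linear.has_derivative[OF bounded_linear_vec_nth])
  show "smooth (\<lambda>x::real^2. h (c * (d - x $ i)))"
    by (rule smooth_affine[where l="\<lambda>x. c * (d - x $ i)" and l'="\<lambda>v. - (c * v $ i)", OF _ assms])
      (auto intro!: derivative_eq_intros bounded_linear.has_derivative[OF bounded_linear_vec_nth])
qed

text \<open>The test functions \<open>\<psi> n\<close> are products of powers of the flat exponential with exponent tending to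
  zero, so they converge boundedly to the indicator of the open box.\<close>

lemma integral_cbox_zero_if_test_zero:
  fixes g :: "real^2 \<Rightarrow> real"
  assumes "open \<Omega>" and g: "g \<in> L1_loc \<Omega>"
    and z: "\<And>\<psi>. \<psi> \<in> test_functions \<Omega> \<Longrightarrow> (LINT x|lebesgue_on \<Omega>. g x * \<psi> x) = 0"
    and sub: "cbox a b \<subseteq> \<Omega>"
  shows "integral (cbox a b) g = 0"
proof -
  define \<psi> where "\<psi> = (\<lambda>(n::nat) x. \<Prod>i\<in>UNIV. bump1 (real (Suc n) * (x $ i - a $ i)) 
      * bump1 (real (Suc n) * (b $ i - x $ i)))"
  have b01: "0 \<le> bump1 t" "bump1 t \<le> 1" for t by (auto simp: bump1)
  have r: "0 \<le> \<psi> n x" "\<psi> n x \<le> 1" for n x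
    unfolding \<psi>_def by (auto intro!: prod_nonneg prod_le_1 mult_le_one b01 mult_nonneg_nonneg)
  have pos: "bump1 (real (Suc n) * s) = (if s > 0 then exp (- (1 / (real (Suc n) * s))) else 0)" for n s
    by (simp only: bump1 zero_less_mult_iff) auto
  have out: "\<psi> n x = 0" if "x \<notin> box a b" for n x
  proof -
    have "\<exists>i. \<not> (a $ i < x $ i \<and> x $ i < b $ i)" using that by (simp add: mem_box_cart)
    then obtain i where "\<not> (a $ i < x $ i \<and> x $ i < b $ i)" by blast
    then have "bump1 (real (Suc n) * (x $ i - a $ i)) 
      * bump1 (real (Suc n) * (b $ i - x $ i)) = 0" unfolding pos by auto
    then show ?thesis unfolding \<psi>_def by (auto intro!: prod_zero)
  qed
  have lim: "(\<lambda>n. \<psi> n x) \<longlonglongrightarrow> indicator (box a b) x" for x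
  proof (cases "x \<in> box a b")
    case False then show ?thesis using out by simp
  next
    case True
    have e: "(\<lambda>n. exp (- (1 / (real (Suc n) * d)))) \<longlonglongrightarrow> 1" for d
    proof -
      have "(\<lambda>n. exp (- (1 / real (Suc n) * (1 / d)))) \<longlonglongrightarrow> exp (- (0 * (1 / d)))"
        by (intro tendsto_intros LIMSEQ_Suc[OF lim_1_over_n])
      then show ?thesis by simp
    qed
    have "(\<lambda>n. \<psi> n x) \<longlonglongrightarrow> (\<Prod>i\<in>(UNIV::2 set). 1 * 1)"
      unfolding \<psi>_def
    proof (intro tendsto_prod tendsto_mult)
      fix i :: 2
      have "a $ i < x $ i" "x $ i < b $ i" using True by (auto simp: mem_box_cart)
      then show "(\<lambda>n. bump1 (real (Suc n) * (x $ i - a $ i))) \<longlonglongrightarrow> 1"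
        "(\<lambda>n. bump1 (real (Suc n) * (b $ i - x $ i))) \<longlonglongrightarrow> 1"
        unfolding pos using e by auto
    qed
    then show ?thesis using True by simp
  qed
  have sm: "smooth (\<psi> n)" for n
    unfolding \<psi>_def by (intro smooth_prod smooth_mult smooth_affine_coord smooth_flat_exp) auto
  have T: "\<psi> n \<in> test_functions \<Omega>" for n
    by (rule test_functionsI[OF sm compact_cbox sub]) (use out box_subset_cbox in blast)
  have ga: "integrable lebesgue (\<lambda>x. indicator (cbox a b) x *\<^sub>R g x)"
    using g sub by (auto simp: L1_loc_def set_integrable_def)
  have "(\<lambda>n. integral\<^sup>L lebesgue (\<lambda>x. g x * \<psi> n x)) \<longlonglongrightarrow> integral\<^sup>L lebesgue (\<lambda>x. indicator (box a b) x *\<^sub>R g x)"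
  proof (rule integral_dominated_convergence[where w="\<lambda>x. norm (indicator (cbox a b) x *\<^sub>R g x)"])
    show "integrable lebesgue (\<lambda>x. norm (indicator (cbox a b) x *\<^sub>R g x))" using ga by (rule integrable_norm)
    have eq: "indicator (box a b) x *\<^sub>R g x = indicator (box a b) x * (indicator (cbox a b) x *\<^sub>R g x)" for x
      using box_subset_cbox[of a b] by (auto simp: indicator_def)
    show "(\<lambda>x. indicator (box a b) x *\<^sub>R g x) \<in> borel_measurable lebesgue"
      unfolding eq using ga by (intro borel_measurable_times borel_measurable_indicator) auto
    have eq2: "g x * \<psi> n x = (indicator (cbox a b) x *\<^sub>R g x) * \<psi> n x" for x n
      using out[of x n] box_subset_cbox[of a b] by (cases "x \<in> cbox a b") (auto simp: indicator_def)
    show "(\<lambda>x. g x * \<psi> n x) \<in> borel_measurable lebesgue" for n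
      unfolding eq2 using ga lebesgue_measurable_continuous[OF smooth_continuous_on[OF sm[of n]]]
      by (intro borel_measurable_times) auto
    show "AE x in lebesgue. (\<lambda>n. g x * \<psi> n x) \<longlonglongrightarrow> indicator (box a b) x *\<^sub>R g x"
      using tendsto_mult[OF tendsto_const lim] by (auto simp: mult.commute)
    show "AE x in lebesgue. norm (g x * \<psi> n x) \<le> norm (indicator (cbox a b) x *\<^sub>R g x)" for n
      unfolding eq2 using r by (auto simp: abs_mult intro!: mult_left_le)
  qed
  moreover have "integral\<^sup>L lebesgue (\<lambda>x. g x * \<psi> n x) = 0" for n
    using z[OF T[of n]] integrable_lebesgue_on_iff_supported(2)[of \<Omega> "\<lambda>x. g x * \<psi> n x"] assms(1) 
      test_functionsD(4)[OF T[of n]] by auto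
  ultimately have 0: "integral\<^sup>L lebesgue (\<lambda>x. indicator (box a b) x *\<^sub>R g x) = 0"
    by (simp add: LIMSEQ_const_iff)
  have "integral\<^sup>L lebesgue (\<lambda>x. indicator (box a b) x *\<^sub>R g x) = integral\<^sup>L lebesgue (\<lambda>x. indicator (cbox a b) x *\<^sub>R g x)"
  proof -
    have "AE x in lebesgue. x \<notin> cbox a b - box a b"
      by (rule AE_notin_negligible[OF negligible_frontier_interval])
    then have ae: "AE x in lebesgue. indicator (box a b) x *\<^sub>R g x = indicator (cbox a b) x *\<^sub>R g x"
      by (rule AE_mp) (use box_subset_cbox[of a b] in \<open>auto simp: indicator_def\<close>)
    have eq: "indicator (box a b) x *\<^sub>R g x = indicator (box a b) x * (indicator (cbox a b) x *\<^sub>R g x)" for x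
      using box_subset_cbox[of a b] by (auto simp: indicator_def)
    have "(\<lambda>x. indicator (box a b) x *\<^sub>R g x) \<in> borel_measurable lebesgue"
      unfolding eq using ga by (intro borel_measurable_times borel_measurable_indicator) auto
    then show ?thesis using ae ga by (intro integral_cong_AE) auto
  qed
  then have "set_lebesgue_integral lebesgue (cbox a b) g = 0" using 0 by (simp add: set_lebesgue_integral_def)
  moreover have "set_integrable lebesgue (cbox a b) g" using ga by (simp add: set_integrable_def)
  ultimately show ?thesis using set_lebesgue_integral_eq_integral(2) by metis
qed

text \<open>The integral of \<open>g\<close> over every box in \<open>\<Omega>\<close> vanishes, and countably many boxes cover \<open>\<Omega>\<close>.\<close>

lemma fundamental_lemma_variations:
  fixes g :: "real^2 \<Rightarrow> real"
  assumes op: "open \<Omega>" and g: "g \<in> L1_loc \<Omega>"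
    and z: "\<And>\<psi>. \<psi> \<in> test_functions \<Omega> \<Longrightarrow> (LINT x|lebesgue_on \<Omega>. g x * \<psi> x) = 0"
  shows "AE x in lebesgue_on \<Omega>. g x = 0"
proof -
  obtain \<D> where D: "countable \<D>" "\<D> \<subseteq> Pow \<Omega>" "\<And>X. X \<in> \<D> \<Longrightarrow> \<exists>a b. X = cbox a b" "\<Union>\<D> = \<Omega>"
    by (rule open_countable_Union_open_cbox[OF assms(1)]) blast
  have "AE x in lebesgue. x \<in> X \<longrightarrow> g x = 0" if XD: "X \<in> \<D>" for X
  proof -
    obtain c d where X: "X = cbox c d" using D(3)[OF XD] by blast
    have sub: "cbox c d \<subseteq> \<Omega>" using XD D(2) X by auto
    define f where "f = (\<lambda>x. if x \<in> cbox c d then g x else 0)"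
    have int: "cbox c d \<inter> cbox a b = cbox (\<Sum>i\<in>Basis. max (c \<bullet> i) (a \<bullet> i) *\<^sub>R i) (\<Sum>i\<in>Basis. min (d \<bullet> i) (b \<bullet> i) *\<^sub>R i)" for a b
      by (rule Int_interval)
    have sub': "cbox c d \<inter> cbox a b \<subseteq> \<Omega>" for a b using sub by auto
    have "g absolutely_integrable_on (cbox c d \<inter> cbox a b)" for a b
      using g sub' by (auto simp: L1_loc_def compact_Int)
    then have fi: "f integrable_on cbox a b" for a b
      unfolding f_def integrable_restrict_Int by (rule set_lebesgue_integral_eq_integral(1))
    have f0: "integral (cbox a b) f = 0" for a b
      unfolding f_def integral_restrict_Int int
      by (rule integral_cbox_zero_if_test_zero[OF op g z]) (use sub'[of a b] int in auto)
    obtain N where N: "negligible N" "\<And>x e. \<lbrakk>x \<notin> N; 0 < e\<rbrakk> \<Longrightarrow> \<exists>d>0. \<forall>h. 0 < h \<and> h < d \<longrightarrow>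
        norm (integral (cbox x (x + h *\<^sub>R One)) f /\<^sub>R h ^ DIM(real^2) - f x) < e"
      using integrable_ccontinuous_explicit[OF fi] by blast
    have "f x = 0" if xN: "x \<notin> N" for x
    proof (rule ccontr)
      assume "f x \<noteq> 0"
      then have "\<exists>d>0. \<forall>h. 0 < h \<and> h < d \<longrightarrow> norm (integral (cbox x (x + h *\<^sub>R One)) f /\<^sub>R h ^ DIM(real^2) - f x) < norm (f x)"
        using N(2)[OF xN, of "norm (f x)"] by simp
      then obtain d where d: "d > 0" "\<forall>h. 0 < h \<and> h < d \<longrightarrow> norm (integral (cbox x (x + h *\<^sub>R One)) f /\<^sub>R h ^ DIM(real^2) - f x) < norm (f x)"
        by blast
      from d(2)[rule_format, of "d / 2"] d(1) show False by (simp only: f0) simp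
    qed
    moreover have "AE x in lebesgue. x \<notin> N" by (rule AE_notin_negligible[OF N(1)])
    ultimately have "AE x in lebesgue. f x = 0" by auto
    then show ?thesis unfolding X f_def by eventually_elim (auto split: if_splits)
  qed
  then have "AE x in lebesgue. \<forall>X\<in>\<D>. x \<in> X \<longrightarrow> g x = 0"
    using D(1) by (subst AE_ball_countable) auto
  then have "AE x in lebesgue. x \<in> \<Omega> \<longrightarrow> g x = 0"
    by eventually_elim (use D(4) in auto)
  then show ?thesis using op by (simp add: AE_lebesgue_on_iff)
qed

lemma test_functions_grad: "\<psi> \<in> test_functions \<Omega> \<Longrightarrow> (\<lambda>x. grad \<psi> x $ j) \<in> test_functions \<Omega>"
  using test_functions_deriv[of \<psi> \<Omega> "axis j 1"] by (simp add: grad_def)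

lemma integrable_L1_loc_test_fn:
  fixes p :: "'a::euclidean_space \<Rightarrow> 'b::euclidean_space \<Rightarrow> 'c::euclidean_space"
  assumes "bounded_bilinear p" "open \<Omega>" "\<psi> \<in> test_functions \<Omega>" "w \<in> L1_loc \<Omega>"
  shows "integrable (lebesgue_on \<Omega>) (\<lambda>x. p (w x) (\<psi> x))"
  by (rule integrable_L1_loc_test[OF assms(1,4) smooth_continuous_on[OF test_functionsD(1)[OF assms(3)]]
     test_functionsD(2,3)[OF assms(3)] _ assms(2)]) (rule supp_outside)

lemma weak_gradient_unique:
  assumes op: "open \<Omega>" and G: "has_weak_gradient \<Omega> w G" "has_weak_gradient \<Omega> w G'"
  shows "AE x in lebesgue_on \<Omega>. G x = G' x"
proof -
  have L: "(\<lambda>x. G x $ i $ j) \<in> L1_loc \<Omega>" "(\<lambda>x. G' x $ i $ j) \<in> L1_loc \<Omega>" for i j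
    using G by (auto simp: has_weak_gradient_def intro!: L1_loc_linear[OF bounded_linear_vec_nth])
  have "AE x in lebesgue_on \<Omega>. G x $ i $ j - G' x $ i $ j = 0" for i j
  proof (rule fundamental_lemma_variations[OF op L1_loc_diff[OF L]])
    fix \<psi> :: "real^2 \<Rightarrow> real" assume \<psi>: "\<psi> \<in> test_functions \<Omega>"
    note i = integrable_L1_loc_test_fn[OF bounded_bilinear_mult op \<psi>]
    show "(LINT x|lebesgue_on \<Omega>. (G x $ i $ j - G' x $ i $ j) * \<psi> x) = 0"
      using G \<psi> i[OF L(1)] i[OF L(2)] by (simp add: has_weak_gradient_def left_diff_distrib)
  qed
  then have "AE x in lebesgue_on \<Omega>. \<forall>i j. G x $ i $ j - G' x $ i $ j = 0"
    by (simp add: AE_all_countable)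
  then show ?thesis by eventually_elim (simp add: vec_eq_iff)
qed

lemma weak_gradient_diff:
  assumes op: "open \<Omega>" and G: "has_weak_gradient \<Omega> a G" "has_weak_gradient \<Omega> b H"
  shows "has_weak_gradient \<Omega> (\<lambda>x. a x - b x) (\<lambda>x. G x - H x)"
proof -
  have L: "(\<lambda>x. G x $ i $ j) \<in> L1_loc \<Omega>" "(\<lambda>x. H x $ i $ j) \<in> L1_loc \<Omega>" 
     "(\<lambda>x. a x $ i) \<in> L1_loc \<Omega>" "(\<lambda>x. b x $ i) \<in> L1_loc \<Omega>" for i j
    using G by (auto simp: has_weak_gradient_def intro!: L1_loc_linear[OF bounded_linear_vec_nth])
  have "(LINT x|lebesgue_on \<Omega>. (a x - b x) $ i * grad \<psi> x $ j) = - (LINT x|lebesgue_on \<Omega>. (G x - H x) $ i $ j * \<psi> x)"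
    if \<psi>: "\<psi> \<in> test_functions \<Omega>" for \<psi> i j
  proof -
    note i = integrable_L1_loc_test_fn[OF bounded_bilinear_mult op \<psi>]
    note i' = integrable_L1_loc_test_fn[OF bounded_bilinear_mult op test_functions_grad[OF \<psi>]]
    show ?thesis
      using G \<psi> i[OF L(1)] i[OF L(2)] i'[OF L(3)] i'[OF L(4)] by (simp add: has_weak_gradient_def left_diff_distrib)
  qed
  then show ?thesis using G by (auto simp: has_weak_gradient_def intro: L1_loc_diff)
qed

lemma grad_mult:
  assumes "f differentiable (at x)" "g differentiable (at x)"
  shows "grad (\<lambda>x. f x * g x) x $ j = f x * grad g x $ j + grad f x $ j * g x"
proof -
  have "((\<lambda>x. f x * g x) has_derivative (\<lambda>h. f x * frechet_derivative g (at x) h + frechet_derivative f (at x) h * g x)) (at x)"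
    by (rule has_derivative_mult) (use assms frechet_derivative_works in auto)
  then show ?thesis unfolding grad_def vec_lambda_beta using frechet_derivative_at by (metis (mono_tags))
qed

lemma weak_gradient_jacobian:
  assumes op: "open \<Omega>" and \<phi>: "smooth \<phi>"
  shows "has_weak_gradient \<Omega> \<phi> (\<lambda>x. jacobian \<phi> (at x))"
proof -
  have c: "continuous_on UNIV \<phi>" "continuous_on UNIV (\<lambda>x. jacobian \<phi> (at x))"
    using \<phi> smooth_continuous_on continuous_on_jacobian by auto
  have L: "\<phi> \<in> L1_loc \<Omega>" "(\<lambda>x. jacobian \<phi> (at x)) \<in> L1_loc \<Omega>"
    using c by (auto intro: L1_loc_continuous)
  have "(LINT x|lebesgue_on \<Omega>. \<phi> x $ i * grad \<psi> x $ j) = - (LINT x|lebesgue_on \<Omega>. jacobian \<phi> (at x) $ i $ j * \<psi> x)"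
    if \<psi>: "\<psi> \<in> test_functions \<Omega>" for \<psi> i j
  proof -
    note i = integrable_L1_loc_test_fn[OF bounded_bilinear_mult op \<psi>]
    note i' = integrable_L1_loc_test_fn[OF bounded_bilinear_mult op test_functions_grad[OF \<psi>]]
    have L': "(\<lambda>x. jacobian \<phi> (at x) $ i $ j) \<in> L1_loc \<Omega>" "(\<lambda>x. \<phi> x $ i) \<in> L1_loc \<Omega>"
      using L by (auto intro!: L1_loc_linear[OF bounded_linear_vec_nth])
    define f where "f = (\<lambda>x. \<phi> x $ i * \<psi> x)"
    have sf: "smooth f" unfolding f_def
      by (intro smooth_mult smooth_vec_nth \<phi> test_functionsD(1)[OF \<psi>])
    have f0: "f x = 0" if "x \<notin> supp \<psi>" for x using supp_outside[OF that] by (simp add: f_def)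
    have D: "frechet_derivative f (at x) (axis j 1) = \<phi> x $ i * grad \<psi> x $ j + jacobian \<phi> (at x) $ i $ j * \<psi> x" for x
      using grad_mult[of "\<lambda>x. \<phi> x $ i" x \<psi> j] grad_component[of \<phi> x i j] \<phi> \<psi>
      by (simp add: f_def grad_def smooth_vec_nth smooth_differentiable test_functionsD)
    have "(LINT x|lebesgue_on \<Omega>. \<phi> x $ i * grad \<psi> x $ j + jacobian \<phi> (at x) $ i $ j * \<psi> x) = 
       integral\<^sup>L lebesgue (\<lambda>x. frechet_derivative f (at x) (axis j 1))"
      unfolding D
      by (rule integrable_lebesgue_on_iff_supported(2))
        (use op test_functionsD(4)[OF \<psi>] test_functionsD(4)[OF test_functions_grad[OF \<psi>]] in auto)
    also have "\<dots> = integral\<^sup>L lborel (\<lambda>x. frechet_derivative f (at x) (axis j 1))"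
      by (rule integral_completion) 
        (simp add: borel_measurable_continuous_onI smooth_continuous_on smooth_deriv sf)
    also have "\<dots> = 0" by (rule integral_deriv_compact_support[OF sf test_functionsD(2)[OF \<psi>] f0])
    finally show ?thesis using i[OF L'(1)] i'[OF L'(2)] by simp
  qed
  then show ?thesis using L by (auto simp: has_weak_gradient_def)
qed

lemma H1_dot_wgrad:
  assumes op: "open \<Omega>" and w: "w \<in> H1_dot \<Omega>"
  shows "has_weak_gradient \<Omega> w (wgrad \<Omega> w)" "wgrad \<Omega> w \<in> L2 \<Omega>"
proof -
  obtain G where G: "G \<in> L2 \<Omega>" "has_weak_gradient \<Omega> w G" using w by (auto simp: H1_dot_def)
  show W: "has_weak_gradient \<Omega> w (wgrad \<Omega> w)" unfolding wgrad_def using G(2) by (rule someI[of "has_weak_gradient \<Omega> w"])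
  have ae: "AE x in lebesgue_on \<Omega>. G x = wgrad \<Omega> w x" by (rule weak_gradient_unique[OF op G(2) W])
  have m: "wgrad \<Omega> w \<in> borel_measurable (lebesgue_on \<Omega>)"
    by (rule L1_loc_measurable[OF op]) (use W in \<open>simp add: has_weak_gradient_def\<close>)
  moreover have "integrable (lebesgue_on \<Omega>) (\<lambda>x. (norm (wgrad \<Omega> w x))\<^sup>2)"
    by (rule integrable_cong_AE_imp[of _ "\<lambda>x. (norm (G x))\<^sup>2"])
      (use G m ae in \<open>auto simp: L2_def elim: eventually_mono\<close>)
  ultimately show "wgrad \<Omega> w \<in> L2 \<Omega>" by (simp add: L2_def)
qed

section \<open>Square integrable fields\<close>

lemma L2_D:
  assumes "w \<in> L2 S"
  shows "w \<in> borel_measurable (lebesgue_on S)" "integrable (lebesgue_on S) (\<lambda>x. (norm (w x))\<^sup>2)"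
  using assms by (auto simp: L2_def)

lemma L2_bound:
  assumes "g \<in> borel_measurable (lebesgue_on S)" "f \<in> L2 S" "AE x in lebesgue_on S. norm (g x) \<le> c * norm (f x)"
    and "c \<ge> 0"
  shows "g \<in> L2 S" "L2_norm S g \<le> c * L2_norm S f"
proof -
  have i: "integrable (lebesgue_on S) (\<lambda>x. c\<^sup>2 * (norm (f x))\<^sup>2)" using L2_D(2)[OF assms(2)] by simp
  have ae: "AE x in lebesgue_on S. (norm (g x))\<^sup>2 \<le> c\<^sup>2 * (norm (f x))\<^sup>2"
    using assms(3) by eventually_elim (metis norm_ge_zero power_mono power_mult_distrib)
  have ig: "integrable (lebesgue_on S) (\<lambda>x. (norm (g x))\<^sup>2)"
    by (rule Bochner_Integration.integrable_bound[OF i]) (use ae assms(1) in auto)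
  then show "g \<in> L2 S" using assms(1) by (simp add: L2_def)
  have "(LINT x|lebesgue_on S. (norm (g x))\<^sup>2) \<le> (LINT x|lebesgue_on S. c\<^sup>2 * (norm (f x))\<^sup>2)"
    by (rule integral_mono_AE[OF ig i ae])
  then have "L2_norm S g \<le> sqrt (c\<^sup>2 * (LINT x|lebesgue_on S. (norm (f x))\<^sup>2))"
    by (simp add: L2_norm_def)
  then show "L2_norm S g \<le> c * L2_norm S f" using assms(4) by (simp add: L2_norm_def real_sqrt_mult)
qed

lemma L2_norm_nonneg [simp]: "0 \<le> L2_norm S w"
  by (simp add: L2_norm_def)

lemma L2_norm_power2: "(L2_norm S w)\<^sup>2 = (LINT x|lebesgue_on S. (norm (w x))\<^sup>2)"
  by (simp add: L2_norm_def)

lemma L2_norm_power2_inner: "(L2_norm S w)\<^sup>2 = L2_inner S w w"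
  by (simp add: L2_norm_power2 L2_inner_def power2_norm_eq_inner)

lemma L2_add: assumes "f \<in> L2 S" "g \<in> L2 S" shows "(\<lambda>x. f x + g x) \<in> L2 S"
proof -
  have m: "(\<lambda>x. f x + g x) \<in> borel_measurable (lebesgue_on S)" using L2_D[OF assms(1)] L2_D[OF assms(2)] by auto
  have "integrable (lebesgue_on S) (\<lambda>x. (norm (f x + g x))\<^sup>2)"
  proof (rule Bochner_Integration.integrable_bound)
    show "integrable (lebesgue_on S) (\<lambda>x. 2 * (norm (f x))\<^sup>2 + 2 * (norm (g x))\<^sup>2)"
      using L2_D[OF assms(1)] L2_D[OF assms(2)] by auto
    have "(norm (a + b))\<^sup>2 \<le> 2 * (norm a)\<^sup>2 + 2 * (norm b)\<^sup>2" for a b :: 'a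
    proof -
      have "(norm (a + b))\<^sup>2 \<le> (norm a + norm b)\<^sup>2" by (simp add: norm_triangle_ineq power_mono)
      also have "\<dots> \<le> 2 * (norm a)\<^sup>2 + 2 * (norm b)\<^sup>2"
        using sum_squares_bound[of "norm a" "norm b"] by (simp add: power2_sum)
      finally show ?thesis .
    qed
    then show "AE x in lebesgue_on S. norm ((norm (f x + g x))\<^sup>2) \<le> norm (2 * (norm (f x))\<^sup>2 + 2 * (norm (g x))\<^sup>2)"
      by (intro AE_I2) (simp add: order_trans[OF _ abs_ge_self])
  qed (use m in auto)
  then show ?thesis using m by (simp add: L2_def)
qed

lemma L2_scaleR: assumes "f \<in> L2 S" shows "(\<lambda>x. c *\<^sub>R f x) \<in> L2 S"
  using L2_D[OF assms] by (auto simp: L2_def power_mult_distrib)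

lemma L2_uminus: "f \<in> L2 S \<Longrightarrow> (\<lambda>x. - f x) \<in> L2 S"
  using L2_scaleR[of f S "-1"] by simp

lemma L2_diff: "f \<in> L2 S \<Longrightarrow> g \<in> L2 S \<Longrightarrow> (\<lambda>x. f x - g x) \<in> L2 S"
  using L2_add[OF _ L2_uminus, of f S g] by simp

lemma L2_inner_integrable:
  assumes "f \<in> L2 S" "g \<in> L2 S" shows "integrable (lebesgue_on S) (\<lambda>x. f x \<bullet> g x)"
proof (rule Bochner_Integration.integrable_bound)
  show "integrable (lebesgue_on S) (\<lambda>x. (norm (f x))\<^sup>2 + (norm (g x))\<^sup>2)" using L2_D[OF assms(1)] L2_D[OF assms(2)] by auto
  show "(\<lambda>x. f x \<bullet> g x) \<in> borel_measurable (lebesgue_on S)" using L2_D[OF assms(1)] L2_D[OF assms(2)] by auto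
  have "\<bar>a \<bullet> b\<bar> \<le> (norm a)\<^sup>2 + (norm b)\<^sup>2" for a b :: 'a
    using Cauchy_Schwarz_ineq2[of a b] sum_squares_bound[of "norm a" "norm b"]
      mult_nonneg_nonneg[of "norm a" "norm b"] by (simp; linarith)
  then show "AE x in lebesgue_on S. norm (f x \<bullet> g x) \<le> norm ((norm (f x))\<^sup>2 + (norm (g x))\<^sup>2)"
    by (intro AE_I2) simp
qed

lemma L2_inner_commute: "L2_inner S f g = L2_inner S g f"
  by (simp add: L2_inner_def inner_commute)

lemma L2_inner_add_left: "f \<in> L2 S \<Longrightarrow> g \<in> L2 S \<Longrightarrow> h \<in> L2 S \<Longrightarrow> L2_inner S (\<lambda>x. f x + g x) h = L2_inner S f h + L2_inner S g h"
  and L2_inner_diff_left: "f \<in> L2 S \<Longrightarrow> g \<in> L2 S \<Longrightarrow> h \<in> L2 S \<Longrightarrow> L2_inner S (\<lambda>x. f x - g x) h = L2_inner S f h - L2_inner S g h"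
  and L2_inner_add_right: "f \<in> L2 S \<Longrightarrow> g \<in> L2 S \<Longrightarrow> h \<in> L2 S \<Longrightarrow> L2_inner S h (\<lambda>x. f x + g x) = L2_inner S h f + L2_inner S h g"
  and L2_inner_diff_right: "f \<in> L2 S \<Longrightarrow> g \<in> L2 S \<Longrightarrow> h \<in> L2 S \<Longrightarrow> L2_inner S h (\<lambda>x. f x - g x) = L2_inner S h f - L2_inner S h g"
  by (simp_all add: L2_inner_def inner_add_left inner_diff_left inner_add_right inner_diff_right L2_inner_integrable)

lemma L2_inner_scaleR: "L2_inner S (\<lambda>x. c *\<^sub>R f x) h = c * L2_inner S f h"
  "L2_inner S f (\<lambda>x. c *\<^sub>R h x) = c * L2_inner S f h"
  by (simp_all add: L2_inner_def)

lemma L2_norm_diff_power2: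
  assumes "f \<in> L2 S" "g \<in> L2 S"
  shows "(L2_norm S (\<lambda>x. f x - g x))\<^sup>2 = (L2_norm S f)\<^sup>2 + (L2_norm S g)\<^sup>2 - 2 * L2_inner S f g"
  using assms by (simp add: L2_norm_power2_inner L2_inner_diff_left L2_inner_diff_right L2_diff L2_inner_commute[of S g f])

lemma L2_norm_add_power2:
  assumes "f \<in> L2 S" "g \<in> L2 S"
  shows "(L2_norm S (\<lambda>x. f x + g x))\<^sup>2 = (L2_norm S f)\<^sup>2 + (L2_norm S g)\<^sup>2 + 2 * L2_inner S f g"
  using assms by (simp add: L2_norm_power2_inner L2_inner_add_left L2_inner_add_right L2_add L2_inner_commute[of S g f])

lemma L2_norm_scaleR: "L2_norm S (\<lambda>x. c *\<^sub>R f x) = \<bar>c\<bar> * L2_norm S f"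
  by (simp add: L2_norm_def power_mult_distrib real_sqrt_mult)

lemma L2_Cauchy_Schwarz:
  assumes f: "f \<in> L2 S" and g: "g \<in> L2 S"
  shows "\<bar>L2_inner S f g\<bar> \<le> L2_norm S f * L2_norm S g"
proof -
  have q: "0 \<le> (L2_norm S f)\<^sup>2 + (t * L2_norm S g)\<^sup>2 - 2 * (t * L2_inner S f g)" for t
  proof -
    have "0 \<le> (L2_norm S (\<lambda>x. f x - t *\<^sub>R g x))\<^sup>2" by simp
    also have "\<dots> = (L2_norm S f)\<^sup>2 + (t * L2_norm S g)\<^sup>2 - 2 * (t * L2_inner S f g)"
      by (simp add: L2_norm_diff_power2[OF f L2_scaleR[OF g]] L2_norm_scaleR L2_inner_scaleR power_mult_distrib)
    finally show ?thesis .
  qed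
  show ?thesis
  proof (cases "L2_norm S g = 0")
    case True
    have "L2_inner S f g = 0"
    proof (rule ccontr)
      assume n: "L2_inner S f g \<noteq> 0"
      then show False using q[of "((L2_norm S f)\<^sup>2 + 1) / (2 * L2_inner S f g)"] True by simp
    qed
    then show ?thesis using True by simp
  next
    case False
    then have p: "L2_norm S g > 0" using L2_norm_nonneg[of S g] by linarith
    have "(L2_inner S f g)\<^sup>2 \<le> (L2_norm S f)\<^sup>2 * (L2_norm S g)\<^sup>2"
      using q[of "L2_inner S f g / (L2_norm S g)\<^sup>2"] p
      by (simp add: power_mult_distrib power_divide field_simps power2_eq_square)
    then have "\<bar>L2_inner S f g\<bar>\<^sup>2 \<le> (L2_norm S f * L2_norm S g)\<^sup>2" by (simp add: power_mult_distrib)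
    then show ?thesis by (rule power2_le_imp_le) simp
  qed
qed

lemma L2_norm_triangle:
  assumes "f \<in> L2 S" "g \<in> L2 S"
  shows "L2_norm S (\<lambda>x. f x + g x) \<le> L2_norm S f + L2_norm S g"
proof (rule power2_le_imp_le)
  show "(L2_norm S (\<lambda>x. f x + g x))\<^sup>2 \<le> (L2_norm S f + L2_norm S g)\<^sup>2"
    using L2_norm_add_power2[OF assms] L2_Cauchy_Schwarz[OF assms] by (simp add: power2_sum)
qed simp

lemma L2_norm_uminus: "L2_norm S (\<lambda>x. - f x) = L2_norm S f"
  by (simp add: L2_norm_def)

lemma L2_norm_minus_commute: "L2_norm S (\<lambda>x. f x - g x) = L2_norm S (\<lambda>x. g x - f x)"
  by (simp add: L2_norm_def norm_minus_commute)

lemma L2_norm_triangle_diff: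
  assumes "f \<in> L2 S" "g \<in> L2 S"
  shows "L2_norm S (\<lambda>x. f x - g x) \<le> L2_norm S f + L2_norm S g"
  using L2_norm_triangle[OF assms(1) L2_uminus[OF assms(2)]] by (simp add: L2_norm_uminus)

lemma L2_norm_triangle3:
  assumes "f \<in> L2 S" "g \<in> L2 S" "h \<in> L2 S"
  shows "L2_norm S (\<lambda>x. f x - h x) \<le> L2_norm S (\<lambda>x. f x - g x) + L2_norm S (\<lambda>x. g x - h x)"
  using L2_norm_triangle[OF L2_diff[OF assms(1,2)] L2_diff[OF assms(2,3)]] by simp

lemma L2_norm_sub_le:
  assumes "f \<in> L2 S" "g \<in> L2 S"
  shows "\<bar>L2_norm S f - L2_norm S g\<bar> \<le> L2_norm S (\<lambda>x. f x - g x)"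
proof -
  have "L2_norm S f \<le> L2_norm S (\<lambda>x. f x - g x) + L2_norm S g"
    using L2_norm_triangle[OF L2_diff[OF assms] assms(2)] by simp
  moreover have "L2_norm S g \<le> L2_norm S (\<lambda>x. f x - g x) + L2_norm S f"
    using L2_norm_triangle[OF L2_diff[OF assms(2,1)] assms(1)] by (simp add: L2_norm_minus_commute[of S g f])
  ultimately show ?thesis by linarith
qed

lemma L2_norm_cong_AE:
  assumes "f \<in> borel_measurable (lebesgue_on S)" "g \<in> borel_measurable (lebesgue_on S)"
    "AE x in lebesgue_on S. f x = g x"
  shows "L2_norm S f = L2_norm S g"
proof -
  have "(LINT x|lebesgue_on S. (norm (f x))\<^sup>2) = (LINT x|lebesgue_on S. (norm (g x))\<^sup>2)"
    by (rule integral_cong_AE) (use assms in \<open>auto elim: eventually_mono\<close>)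
  then show ?thesis by (simp add: L2_norm_def)
qed

lemma L2_tendsto_norm:
  assumes "\<And>n. f n \<in> L2 S" "g \<in> L2 S" "(\<lambda>n. L2_norm S (\<lambda>x. f n x - g x)) \<longlonglongrightarrow> 0"
  shows "(\<lambda>n. L2_norm S (f n)) \<longlonglongrightarrow> L2_norm S g"
proof -
  have "(\<lambda>n. L2_norm S (f n) - L2_norm S g) \<longlonglongrightarrow> 0"
    by (rule Lim_null_comparison[OF _ assms(3)]) (auto intro!: eventuallyI L2_norm_sub_le assms)
  then show ?thesis by (simp add: LIM_zero_iff)
qed

lemma L2_tendsto_inner:
  assumes "\<And>n. f n \<in> L2 S" "g \<in> L2 S" "h \<in> L2 S" "(\<lambda>n. L2_norm S (\<lambda>x. f n x - g x)) \<longlonglongrightarrow> 0"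
  shows "(\<lambda>n. L2_inner S h (f n)) \<longlonglongrightarrow> L2_inner S h g"
proof -
  have "(\<lambda>n. L2_inner S h (f n) - L2_inner S h g) \<longlonglongrightarrow> 0"
  proof (rule Lim_null_comparison)
    show "\<forall>\<^sub>F n in sequentially. norm (L2_inner S h (f n) - L2_inner S h g) \<le> L2_norm S h * L2_norm S (\<lambda>x. f n x - g x)"
      using L2_Cauchy_Schwarz[OF assms(3) L2_diff[OF assms(1) assms(2)]] 
      by (auto simp: L2_inner_diff_right assms)
    show "(\<lambda>n. L2_norm S h * L2_norm S (\<lambda>x. f n x - g x)) \<longlonglongrightarrow> 0"
      using tendsto_mult_left[OF assms(4)] by simp
  qed
  then show ?thesis by (simp add: LIM_zero_iff)
qed

lemma L2_AE_subsequence: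
  fixes f :: "nat \<Rightarrow> real^2 \<Rightarrow> 'b::euclidean_space"
  assumes "\<And>n. f n \<in> L2 S" "g \<in> L2 S" "(\<lambda>n. L2_norm S (\<lambda>x. f n x - g x)) \<longlonglongrightarrow> 0"
  obtains r where "strict_mono r" "AE x in lebesgue_on S. (\<lambda>n. f (r n) x) \<longlonglongrightarrow> g x"
proof -
  define u where "u = (\<lambda>n x. (norm (f n x - g x))\<^sup>2)"
  have "(\<lambda>n. (L2_norm S (\<lambda>x. f n x - g x))\<^sup>2) \<longlonglongrightarrow> 0\<^sup>2" by (intro tendsto_intros assms)
  then have "(\<lambda>n. \<integral>x. norm (u n x) \<partial>lebesgue_on S) \<longlonglongrightarrow> 0" by (simp add: L2_norm_power2 u_def)
  moreover have "integrable (lebesgue_on S) (u n)" for n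
    unfolding u_def using L2_D(2)[OF L2_diff[OF assms(1,2)]] .
  ultimately obtain r where r: "strict_mono r" "AE x in lebesgue_on S. (\<lambda>n. u (r n) x) \<longlonglongrightarrow> 0"
    using tendsto_L1_AE_subseq[of "lebesgue_on S" u] by blast
  have "AE x in lebesgue_on S. (\<lambda>n. f (r n) x) \<longlonglongrightarrow> g x"
    using r(2)
  proof eventually_elim
    case (elim x)
    then have "(\<lambda>n. sqrt (u (r n) x)) \<longlonglongrightarrow> sqrt 0" by (rule tendsto_real_sqrt)
    then have "(\<lambda>n. norm (f (r n) x - g x)) \<longlonglongrightarrow> 0" by (simp add: u_def)
    then show ?case by (rule LIM_zero_cancel[OF tendsto_norm_zero_cancel])
  qed
  then show ?thesis using r(1) that by blast
qed

lemma L2_subset_norm: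
  assumes "w \<in> L2 S" "T \<subseteq> S" "T \<in> sets lebesgue" "S \<in> sets lebesgue"
  shows "w \<in> L2 T" "L2_norm T w \<le> L2_norm S w"
proof -
  have m: "w \<in> borel_measurable (lebesgue_on T)"
    using measurable_restrict_mono[OF L2_D(1)[OF assms(1)] assms(2)] .
  have i: "integrable lebesgue (\<lambda>x. indicator S x *\<^sub>R (norm (w x))\<^sup>2)"
    using L2_D(2)[OF assms(1)] assms(4) by (simp add: integrable_restrict_space)
  have i': "integrable lebesgue (\<lambda>x. indicator T x *\<^sub>R (norm (w x))\<^sup>2)"
  proof (rule Bochner_Integration.integrable_bound[OF i])
    have "(\<lambda>x. indicator T x *\<^sub>R (norm (w x))\<^sup>2) = (\<lambda>x. indicator T x *\<^sub>R (indicator S x *\<^sub>R (norm (w x))\<^sup>2))"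
      by (rule ext) (use assms(2) in \<open>auto simp: indicator_def\<close>)
    moreover have "(\<lambda>x. indicator T x *\<^sub>R (indicator S x *\<^sub>R (norm (w x))\<^sup>2)) \<in> borel_measurable lebesgue"
      by (rule borel_measurable_scaleR[OF borel_measurable_indicator[OF assms(3)] borel_measurable_integrable[OF i]])
    ultimately show "(\<lambda>x. indicator T x *\<^sub>R (norm (w x))\<^sup>2) \<in> borel_measurable lebesgue" by simp
  qed (use assms(2) in \<open>auto simp: indicator_def\<close>)
  then have "integrable (lebesgue_on T) (\<lambda>x. (norm (w x))\<^sup>2)"
    using assms(3) by (simp add: integrable_restrict_space)
  then show "w \<in> L2 T" using m by (simp add: L2_def)
  have "(LINT x|lebesgue_on T. (norm (w x))\<^sup>2) \<le> (LINT x|lebesgue_on S. (norm (w x))\<^sup>2)"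
    using assms(3,4) i i' by (simp only: integral_restrict_space[of _ lebesgue] sets.Int_space_eq2)
      (rule integral_mono, use assms(2) in \<open>auto simp: indicator_def\<close>)
  then show "L2_norm T w \<le> L2_norm S w" by (simp add: L2_norm_def)
qed

lemma L2_continuous_compact_support:
  assumes "continuous_on UNIV f" "compact K" "\<And>x. x \<notin> K \<Longrightarrow> f x = 0"
    and S: "S \<in> sets lebesgue"
  shows "f \<in> L2 S"
proof -
  have m: "f \<in> borel_measurable (lebesgue_on S)"
    using lebesgue_measurable_continuous[OF assms(1)] by (rule measurable_restrict_space1)
  have "integrable lborel (\<lambda>x. (norm (f x))\<^sup>2)"
    by (rule integrable_lborel_compact_support[where K=K]) (use assms in \<open>auto intro!: continuous_intros\<close>)
  then have "integrable lebesgue (\<lambda>x. (norm (f x))\<^sup>2)"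
    by (subst integrable_completion) auto
  then have "integrable (lebesgue_on S) (\<lambda>x. (norm (f x))\<^sup>2)"
    using S integrable_mult_indicator[OF S, of "\<lambda>x. (norm (f x))\<^sup>2"] by (simp add: integrable_restrict_space)
  then show ?thesis using m by (simp add: L2_def)
qed

section \<open>Reflection through the origin\<close>

lemma lebesgue_distr_uminus: "distr lebesgue lebesgue uminus = (lebesgue :: 'a::euclidean_space measure)"
proof -
  have "(lebesgue :: 'a measure) = density (distr lebesgue lebesgue (\<lambda>x. 0 + (\<Sum>j\<in>Basis. (-1 * (x \<bullet> j)) *\<^sub>R j))) (\<lambda>_. (\<Prod>j\<in>(Basis::'a set). \<bar>-1::real\<bar>))"
    by (rule lebesgue_affine_euclidean[of "\<lambda>_. -1" 0]) auto
  moreover have "(\<lambda>x::'a. 0 + (\<Sum>j\<in>Basis. (-1 * (x \<bullet> j)) *\<^sub>R j)) = uminus"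
    by (auto simp: sum_negf euclidean_representation)
  ultimately show ?thesis by (simp add: density_1)
qed

lemma measurable_uminus_lebesgue: "uminus \<in> measurable lebesgue (lebesgue :: 'a::euclidean_space measure)"
proof -
  have "(*\<^sub>R) (-1) = (uminus :: 'a \<Rightarrow> 'a)" by auto
  then show ?thesis using lebesgue_measurable_scaling[of "-1", where ?'a='a] by simp
qed

lemma measurable_uminus_lebesgue_on:
  assumes "uminus ` S = S"
  shows "uminus \<in> measurable (lebesgue_on S) (lebesgue_on (S :: 'a::euclidean_space set))"
  by (rule measurable_restrict_space3[OF measurable_uminus_lebesgue]) (use assms in auto)

lemma integral_reflect_lebesgue_on:
  fixes f :: "'a::euclidean_space \<Rightarrow> 'b::euclidean_space"
  assumes S: "S \<in> sets lebesgue" "uminus ` S = S" 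
  shows "integrable (lebesgue_on S) f \<Longrightarrow> integrable (lebesgue_on S) (\<lambda>x. f (- x))"
    and "f \<in> borel_measurable (lebesgue_on S) \<Longrightarrow> (LINT x|lebesgue_on S. f (- x)) = (LINT x|lebesgue_on S. f x)"
proof -
  have ind: "indicator S (- x) = (indicator S x :: real)" for x
    using S(2) by (auto simp: indicator_def image_iff) (metis minus_minus S(2) image_eqI)+
  { assume "integrable (lebesgue_on S) f"
    then have "integrable lebesgue (\<lambda>x. indicator S x *\<^sub>R f x)" using S by (simp add: integrable_restrict_space)
    then have "integrable (distr lebesgue lebesgue uminus) (\<lambda>x. indicator S x *\<^sub>R f x)"
      by (simp add: lebesgue_distr_uminus)
    from integrable_distr[OF measurable_uminus_lebesgue this]
    show "integrable (lebesgue_on S) (\<lambda>x. f (- x))" using S(1) by (simp add: integrable_restrict_space ind) }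
  { assume "f \<in> borel_measurable (lebesgue_on S)"
    then have m: "(\<lambda>x. indicator S x *\<^sub>R f x) \<in> borel_measurable lebesgue"
      using S(1) by (simp add: borel_measurable_restrict_space_iff)
    have "integral\<^sup>L lebesgue (\<lambda>x. indicator S x *\<^sub>R f x) = integral\<^sup>L (distr lebesgue lebesgue uminus) (\<lambda>x. indicator S x *\<^sub>R f x)"
      by (simp add: lebesgue_distr_uminus)
    also have "\<dots> = integral\<^sup>L lebesgue (\<lambda>x. indicator S (- x) *\<^sub>R f (- x))"
      by (rule integral_distr[OF measurable_uminus_lebesgue m])
    finally show "(LINT x|lebesgue_on S. f (- x)) = (LINT x|lebesgue_on S. f x)"
      using S(1) by (simp add: integral_restrict_space ind) }
qed

lemma AE_reflect_lebesgue_on: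
  assumes S: "S \<in> sets lebesgue" "uminus ` S = S" and P: "AE x in lebesgue_on S. P x"
  shows "AE x in lebesgue_on (S :: 'a::euclidean_space set). P (- x)"
proof -
  have "AE x in lebesgue. x \<in> S \<longrightarrow> P x" using P S(1) by (simp add: AE_lebesgue_on_iff)
  then have "AE x in distr lebesgue lebesgue uminus. x \<in> S \<longrightarrow> P x" by (subst lebesgue_distr_uminus)
  then have "AE x in lebesgue. - x \<in> S \<longrightarrow> P (- x)" by (rule AE_distrD[OF measurable_uminus_lebesgue])
  moreover have "- x \<in> S \<longleftrightarrow> x \<in> S" for x using S(2) by (metis image_eqI minus_minus)
  ultimately show ?thesis using S(1) by (simp add: AE_lebesgue_on_iff)
qed

lemma L2_reflect:
  assumes S: "S \<in> sets lebesgue" "uminus ` S = S" and f: "f \<in> L2 S"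
  shows "(\<lambda>x. f (- x)) \<in> L2 S" "L2_norm S (\<lambda>x. f (- x)) = L2_norm S f"
proof -
  have "(\<lambda>x. f (- x)) \<in> borel_measurable (lebesgue_on S)"
    by (rule measurable_compose[OF measurable_uminus_lebesgue_on[OF S(2)] L2_D(1)[OF f]])
  then show "(\<lambda>x. f (- x)) \<in> L2 S"
    using integral_reflect_lebesgue_on(1)[OF S L2_D(2)[OF f]] by (simp add: L2_def)
  show "L2_norm S (\<lambda>x. f (- x)) = L2_norm S f"
    using integral_reflect_lebesgue_on(2)[OF S, of "\<lambda>x. (norm (f x))\<^sup>2"] L2_D(2)[OF f] by (simp add: L2_norm_def)
qed

lemma L2_inner_reflect:
  assumes S: "S \<in> sets lebesgue" "uminus ` S = S" and f: "f \<in> L2 S" "g \<in> L2 S"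
  shows "L2_inner S (\<lambda>x. f (- x)) g = L2_inner S f (\<lambda>x. g (- x))"
  using integral_reflect_lebesgue_on(2)[OF S, of "\<lambda>x. f x \<bullet> g (- x)"] 
    L2_inner_integrable[OF f(1) L2_reflect(1)[OF S f(2)]]
  by (simp add: L2_inner_def)

section \<open>Integral inequalities in the plane\<close>

lemma integral_power2_le:
  fixes k :: "real \<Rightarrow> real"
  assumes "s \<le> t" "continuous_on {s..t} k"
  shows "(integral {s..t} k)\<^sup>2 \<le> (t - s) * integral {s..t} (\<lambda>r. (k r)\<^sup>2)"
proof (cases "s = t")
  case False
  then have L: "t - s > 0" using assms by simp
  define m where "m = integral {s..t} k / (t - s)"
  have md: "m * (t - s) = integral {s..t} k" using L by (simp add: m_def)
  have i: "k integrable_on {s..t}" "(\<lambda>r. (k r)\<^sup>2) integrable_on {s..t}"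
    using assms by (auto intro!: integrable_continuous_interval continuous_intros)
  have c: "((\<lambda>r. m\<^sup>2) has_integral m\<^sup>2 * (t - s)) {s..t}"
    using has_integral_const_real[of "m\<^sup>2" s t] assms(1) by (simp add: mult.commute)
  have "((\<lambda>r. (k r)\<^sup>2 - 2 * m * k r + m\<^sup>2) has_integral
      (integral {s..t} (\<lambda>r. (k r)\<^sup>2) - 2 * m * integral {s..t} k + m\<^sup>2 * (t - s))) {s..t}"
    by (intro has_integral_add has_integral_diff has_integral_mult_right integrable_integral i c)
  moreover have "0 \<le> (k r)\<^sup>2 - 2 * m * k r + m\<^sup>2" for r
    using zero_le_power2[of "k r - m"] by (simp add: power2_diff algebra_simps)
  ultimately have "0 \<le> integral {s..t} (\<lambda>r. (k r)\<^sup>2) - 2 * m * integral {s..t} k + m\<^sup>2 * (t - s)"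
    using has_integral_nonneg by blast
  also have "\<dots> = integral {s..t} (\<lambda>r. (k r)\<^sup>2) - m * integral {s..t} k"
    using md by (simp add: power2_eq_square mult.assoc)
  finally have "0 \<le> (t - s) * (integral {s..t} (\<lambda>r. (k r)\<^sup>2) - m * integral {s..t} k)" using L by simp
  moreover have "(t - s) * (m * integral {s..t} k) = (integral {s..t} k)\<^sup>2"
    by (metis md mult.assoc mult.commute power2_eq_square)
  ultimately show ?thesis by (simp add: right_diff_distrib)
qed simp

lemma nn_integral_continuous_Icc:
  fixes k :: "real \<Rightarrow> real"
  assumes "continuous_on {s..t} k" "\<And>r. r \<in> {s..t} \<Longrightarrow> 0 \<le> k r"
  shows "(\<integral>\<^sup>+r. ennreal (k r) * indicator {s..t} r \<partial>lborel) = ennreal (integral {s..t} k)"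
  by (rule nn_integral_has_integral_lebesgue'[OF assms(2) integrable_integral[OF integrable_continuous_interval[OF assms(1)]]])

text \<open>The fundamental theorem of calculus followed by the Cauchy--Schwarz inequality. The right-hand side
  is a nonnegative integral because it will be integrated over families of curves by Tonelli's theorem.\<close>

lemma norm_increment_power2_le:
  fixes h :: "real \<Rightarrow> 'b::euclidean_space"
  assumes st: "s \<le> t" and D: "\<And>r. r \<in> {s..t} \<Longrightarrow> (h has_vector_derivative h' r) (at r)"
    and c: "continuous_on {s..t} h'"
  shows "ennreal ((norm (h t - h s))\<^sup>2) \<le> ennreal (t - s) * (\<integral>\<^sup>+r. ennreal ((norm (h' r))\<^sup>2) * indicator {s..t} r \<partial>lborel)"
proof -
  have cn: "continuous_on {s..t} (\<lambda>r. norm (h' r))" using c by (intro continuous_intros)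
  have "(h' has_integral (h t - h s)) {s..t}"
    by (rule fundamental_theorem_of_calculus[OF st]) (use D has_vector_derivative_at_within in blast)
  then have "norm (h t - h s) \<le> integral {s..t} (\<lambda>r. norm (h' r))"
    using integral_norm_bound_integral[of h' "{s..t}" "\<lambda>r. norm (h' r)"] integrable_continuous_interval[OF cn]
    by (auto simp: has_integral_integrable_integral)
  then have "(norm (h t - h s))\<^sup>2 \<le> (integral {s..t} (\<lambda>r. norm (h' r)))\<^sup>2" by (simp add: power_mono)
  also have "\<dots> \<le> (t - s) * integral {s..t} (\<lambda>r. (norm (h' r))\<^sup>2)" by (rule integral_power2_le[OF st cn])
  finally have "ennreal ((norm (h t - h s))\<^sup>2) \<le> ennreal ((t - s) * integral {s..t} (\<lambda>r. (norm (h' r))\<^sup>2))"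
    by (rule ennreal_leI)
  also have "\<dots> = ennreal (t - s) * ennreal (integral {s..t} (\<lambda>r. (norm (h' r))\<^sup>2))"
    using st by (intro ennreal_mult' ) simp
  also have "ennreal (integral {s..t} (\<lambda>r. (norm (h' r))\<^sup>2)) = (\<integral>\<^sup>+r. ennreal ((norm (h' r))\<^sup>2) * indicator {s..t} r \<partial>lborel)"
    by (rule nn_integral_continuous_Icc[symmetric]) (use cn in \<open>auto intro!: continuous_intros\<close>)
  finally show ?thesis .
qed

abbreviation vec2 :: "real \<Rightarrow> real \<Rightarrow> real^2" where "vec2 a b \<equiv> vector [a, b]"

lemma vec2_eq: "vec2 a b = a *\<^sub>R axis 1 1 + b *\<^sub>R axis 2 1"
  by (simp add: vec_eq_iff forall_2 axis_def)

lemma vec2_surj: "vec2 (x $ 1) (x $ 2) = x"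
  by (simp add: vec_eq_iff forall_2)

lemma measurable_vec2: "(\<lambda>(a, b). vec2 a b) \<in> borel_measurable (lborel \<Otimes>\<^sub>M lborel)"
  unfolding vec2_eq by measurable

lemma Basis_real2: "(Basis :: (real^2) set) = {axis 1 1, axis 2 1}"
  by (auto simp: Basis_vec_def UNIV_2)

lemma lborel_real2: "(lborel :: (real^2) measure) = distr (lborel \<Otimes>\<^sub>M lborel) borel (\<lambda>(a, b). vec2 a b)"
proof (rule lborel_eqI)
  fix l u :: "real^2" assume le: "\<And>b. b \<in> Basis \<Longrightarrow> l \<bullet> b \<le> u \<bullet> b"
  have le': "l $ 1 \<le> u $ 1" "l $ 2 \<le> u $ 2" using le[of "axis 1 1"] le[of "axis 2 1"] 
    by (auto simp: Basis_real2 inner_axis)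
  have pre: "(\<lambda>(a, b). vec2 a b) -` box l u \<inter> space (lborel \<Otimes>\<^sub>M lborel) = {l $ 1<..<u $ 1} \<times> {l $ 2<..<u $ 2}"
    by (auto simp: mem_box_cart forall_2 space_pair_measure)
  have "emeasure (distr (lborel \<Otimes>\<^sub>M lborel) borel (\<lambda>(a, b). vec2 a b)) (box l u)
      = emeasure (lborel \<Otimes>\<^sub>M lborel) ({l $ 1<..<u $ 1} \<times> {l $ 2<..<u $ 2})"
    using measurable_vec2 by (subst emeasure_distr) (auto simp: pre)
  also have "\<dots> = emeasure lborel {l $ 1<..<u $ 1} * emeasure lborel {l $ 2<..<u $ 2}"
    by (rule lborel.emeasure_pair_measure_Times) auto
  also have "\<dots> = (\<Prod>b\<in>Basis. (u - l) \<bullet> b)"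
    using le' axis_eq_axis[of 1 "1::real" "2::2" 1]
    by (simp add: Basis_real2 inner_axis ennreal_mult')
  finally show "emeasure (distr (lborel \<Otimes>\<^sub>M lborel) borel (\<lambda>(a, b). vec2 a b)) (box l u) = (\<Prod>b\<in>Basis. (u - l) \<bullet> b)" .
qed simp

lemma nn_integral_real2:
  fixes f :: "real^2 \<Rightarrow> ennreal" assumes [measurable]: "f \<in> borel_measurable borel"
  shows "integral\<^sup>N lborel f = (\<integral>\<^sup>+a. \<integral>\<^sup>+b. f (vec2 a b) \<partial>lborel \<partial>lborel)"
    and "integral\<^sup>N lborel f = (\<integral>\<^sup>+b. \<integral>\<^sup>+a. f (vec2 a b) \<partial>lborel \<partial>lborel)"
proof -
  have m: "(\<lambda>z. f (vec2 (fst z) (snd z))) \<in> borel_measurable (lborel \<Otimes>\<^sub>M lborel)"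
    using measurable_compose[OF measurable_vec2 assms] by (simp add: case_prod_beta)
  have "integral\<^sup>N lborel f = (\<integral>\<^sup>+z. f (vec2 (fst z) (snd z)) \<partial>(lborel \<Otimes>\<^sub>M lborel))"
    by (subst lborel_real2, subst nn_integral_distr[OF measurable_vec2]) (auto simp: case_prod_beta)
  also have "\<dots> = (\<integral>\<^sup>+a. \<integral>\<^sup>+b. f (vec2 a b) \<partial>lborel \<partial>lborel)"
    using lborel.nn_integral_fst[OF m] by simp
  finally show 1: "integral\<^sup>N lborel f = (\<integral>\<^sup>+a. \<integral>\<^sup>+b. f (vec2 a b) \<partial>lborel \<partial>lborel)" .
  then show "integral\<^sup>N lborel f = (\<integral>\<^sup>+b. \<integral>\<^sup>+a. f (vec2 a b) \<partial>lborel \<partial>lborel)"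
    using lborel_pair.Fubini'[of "\<lambda>a b. f (vec2 a b)"] m by (simp add: case_prod_beta)
qed

lemma has_vector_derivative_vec2:
  fixes f :: "real^2 \<Rightarrow> 'b::real_normed_vector"
  assumes "\<And>x. f differentiable (at x)"
  shows "((\<lambda>s. f (vec2 s b)) has_vector_derivative frechet_derivative f (at (vec2 a b)) (axis 1 1)) (at a)"
    and "((\<lambda>s. f (vec2 a s)) has_vector_derivative frechet_derivative f (at (vec2 a b)) (axis 2 1)) (at b)"
proof -
  have D: "(f has_derivative frechet_derivative f (at x)) (at x)" for x
    using assms frechet_derivative_works by blast
  have lin: "frechet_derivative f (at x) (h *\<^sub>R v) = h *\<^sub>R frechet_derivative f (at x) v" for x h v
    using linear_cmul[OF has_derivative_linear[OF D]] .
  have "((\<lambda>s. f (vec2 s b)) has_derivative (\<lambda>h. frechet_derivative f (at (vec2 a b)) (h *\<^sub>R axis 1 1))) (at a)"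
    by (rule has_derivative_compose[OF _ D]) (auto simp: vec2_eq intro!: derivative_eq_intros)
  then show "((\<lambda>s. f (vec2 s b)) has_vector_derivative frechet_derivative f (at (vec2 a b)) (axis 1 1)) (at a)"
    by (simp add: has_vector_derivative_def lin)
  have "((\<lambda>s. f (vec2 a s)) has_derivative (\<lambda>h. frechet_derivative f (at (vec2 a b)) (h *\<^sub>R axis 2 1))) (at b)"
    by (rule has_derivative_compose[OF _ D]) (auto simp: vec2_eq intro!: derivative_eq_intros)
  then show "((\<lambda>s. f (vec2 a s)) has_vector_derivative frechet_derivative f (at (vec2 a b)) (axis 2 1)) (at b)"
    by (simp add: has_vector_derivative_def lin)
qed

lemma continuous_on_vec2: "continuous_on UNIV (\<lambda>s. vec2 s b)" "continuous_on UNIV (\<lambda>s. vec2 a s)"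
  unfolding vec2_eq by (intro continuous_intros)+

lemma abs_le_nn_integral_deriv:
  fixes h :: "real \<Rightarrow> real"
  assumes D: "\<And>r. (h has_vector_derivative h' r) (at r)" and c: "continuous_on UNIV h'"
    and z: "h R = 0" "R \<le> a"
  shows "ennreal \<bar>h a\<bar> \<le> (\<integral>\<^sup>+r. ennreal \<bar>h' r\<bar> \<partial>lborel)"
proof -
  have c': "continuous_on {R..a} (\<lambda>r. \<bar>h' r\<bar>)" using c by (intro continuous_intros continuous_on_subset[OF c]) auto
  have "(h' has_integral (h a - h R)) {R..a}"
    by (rule fundamental_theorem_of_calculus[OF z(2)]) (use D has_vector_derivative_at_within in blast)
  then have "\<bar>h a\<bar> \<le> integral {R..a} (\<lambda>r. \<bar>h' r\<bar>)"
    using integral_norm_bound_integral[of h' "{R..a}" "\<lambda>r. \<bar>h' r\<bar>"] integrable_continuous_interval[OF c'] z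
    by (auto simp: has_integral_integrable_integral)
  then have "ennreal \<bar>h a\<bar> \<le> ennreal (integral {R..a} (\<lambda>r. \<bar>h' r\<bar>))" by (rule ennreal_leI)
  also have "\<dots> = (\<integral>\<^sup>+r. ennreal \<bar>h' r\<bar> * indicator {R..a} r \<partial>lborel)"
    by (rule nn_integral_continuous_Icc[OF c', symmetric]) simp
  also have "\<dots> \<le> (\<integral>\<^sup>+r. ennreal \<bar>h' r\<bar> \<partial>lborel)"
    by (intro nn_integral_mono) (auto simp: indicator_def)
  finally show ?thesis .
qed

lemma norm_matrix_mult_le: "norm (A *v w) \<le> norm A * norm w" for A :: "real^2^2"
proof -
  have "norm (A *v w) = L2_set (\<lambda>i. (A $ i) \<bullet> w) UNIV"
    by (simp add: norm_vec_def matrix_vector_mult_def inner_vec_def) (simp add: L2_set_def)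
  also have "\<dots> \<le> L2_set (\<lambda>i. norm (A $ i) * norm w) UNIV"
    unfolding L2_set_def
    by (intro real_sqrt_le_mono sum_mono) (metis Cauchy_Schwarz_ineq2 abs_ge_zero power2_abs power_mono)
  also have "\<dots> = norm A * norm w"
    by (simp add: norm_vec_def[of A] L2_set_left_distrib)
  finally show ?thesis .
qed

lemma norm_frechet_axis_le:
  fixes f :: "real^2 \<Rightarrow> real^2"
  assumes "f differentiable (at x)"
  shows "norm (frechet_derivative f (at x) v) \<le> norm (jacobian f (at x)) * norm v"
    and "norm (frechet_derivative f (at x) (axis j 1)) \<le> norm (jacobian f (at x))"
proof -
  show 1: "norm (frechet_derivative f (at x) v) \<le> norm (jacobian f (at x)) * norm v" for v
    using jacobian_works[OF assms] norm_matrix_mult_le[of "jacobian f (at x)" v] by simp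
  show "norm (frechet_derivative f (at x) (axis j 1)) \<le> norm (jacobian f (at x))"
    using 1[of "axis j 1"] by simp
qed

lemma jacobian_outside_supp: "x \<notin> supp f \<Longrightarrow> jacobian f (at x) = 0"
  by (simp add: jacobian_nth vec_eq_iff frechet_derivative_outside_supp)

text \<open>On a line, \<open>\<bar>\<phi>\<bar>\<^sup>2\<close> is at most the integral of \<open>2 \<bar>\<phi>\<bar> \<bar>\<nabla>\<phi>\<bar>\<close>. Multiplying the bounds obtained on the
  horizontal and on the vertical line through a point gives a product of a function of one coordinate and
  a function of the other, whose integral factorises.\<close>

lemma Ladyzhenskaya_smooth:
  fixes \<phi> :: "real^2 \<Rightarrow> real^2"
  assumes sm: "smooth \<phi>" and K: "compact K" "\<And>x. x \<notin> K \<Longrightarrow> \<phi> x = 0"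
  shows "(\<integral>\<^sup>+x. ennreal ((norm (\<phi> x))^4) \<partial>lborel)
     \<le> ennreal (4 * (L2_norm UNIV \<phi>)\<^sup>2 * (L2_norm UNIV (\<lambda>x. jacobian \<phi> (at x)))\<^sup>2)"
proof -
  define J where "J = (\<lambda>x. jacobian \<phi> (at x))"
  define g where "g = (\<lambda>x. 2 * (norm (\<phi> x) * norm (J x)))"
  have cp: "continuous_on UNIV \<phi>" "continuous_on UNIV J"
    using sm by (auto simp: J_def smooth_continuous_on continuous_on_jacobian)
  have cg: "continuous_on UNIV g" unfolding g_def by (intro continuous_intros cp)
  have g0: "g x \<ge> 0" for x by (simp add: g_def)
  have mg[measurable]: "(\<lambda>x. ennreal (g x)) \<in> borel_measurable borel"
    using borel_measurable_continuous_onI[OF cg] by measurable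
  have mp[measurable]: "\<phi> \<in> borel_measurable borel" using cp(1) by (rule borel_measurable_continuous_onI)
  define f where "f = (\<lambda>x. \<phi> x \<bullet> \<phi> x)"
  have Df: "(f has_derivative (\<lambda>v. 2 * (\<phi> x \<bullet> frechet_derivative \<phi> (at x) v))) (at x)" for x
    unfolding f_def by (auto intro!: derivative_eq_intros smooth_has_derivative[OF sm] simp: inner_commute)
  then have fd: "f differentiable (at x)" for x by (auto simp: differentiable_def)
  have fe: "frechet_derivative f (at x) = (\<lambda>v. 2 * (\<phi> x \<bullet> frechet_derivative \<phi> (at x) v))" for x
    using frechet_derivative_at[OF Df] by simp
  have fg: "\<bar>frechet_derivative f (at x) (axis j 1)\<bar> \<le> g x" for x j
  proof -
    have "\<bar>\<phi> x \<bullet> frechet_derivative \<phi> (at x) (axis j 1)\<bar> \<le> norm (\<phi> x) * norm (J x)"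
      using Cauchy_Schwarz_ineq2[of "\<phi> x" "frechet_derivative \<phi> (at x) (axis j 1)"]
        mult_left_mono[OF norm_frechet_axis_le(2)[OF smooth_differentiable[OF sm]] norm_ge_zero[of "\<phi> x"], of x j]
      unfolding J_def by linarith
    then show ?thesis by (simp add: fe g_def abs_mult)
  qed
  have cfe: "continuous_on UNIV (\<lambda>x. frechet_derivative f (at x) (axis j 1))" for j
    unfolding fe by (intro continuous_intros cp smooth_continuous_on smooth_deriv sm)
  obtain R where R: "\<And>x. x \<in> K \<Longrightarrow> norm x \<le> R" using compact_imp_bounded[OF K(1)] bounded_pos by metis
  have out: "f (vec2 a b) = 0" if "\<bar>a\<bar> > R \<or> \<bar>b\<bar> > R" for a b
  proof -
    have "norm (vec2 a b) > R" using that component_le_norm_cart[of "vec2 a b" 1] component_le_norm_cart[of "vec2 a b" 2] by auto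
    then show ?thesis using R K(2)[of "vec2 a b"] by (auto simp: f_def not_le[symmetric])
  qed
  have A: "ennreal (f (vec2 a b)) \<le> (\<integral>\<^sup>+s. ennreal (g (vec2 s b)) \<partial>lborel)" for a b
  proof -
    have "ennreal \<bar>f (vec2 a b)\<bar> \<le> (\<integral>\<^sup>+s. ennreal \<bar>frechet_derivative f (at (vec2 s b)) (axis 1 1)\<bar> \<partial>lborel)"
      by (rule abs_le_nn_integral_deriv[where R="min a (- \<bar>R\<bar> - 1)", OF has_vector_derivative_vec2(1)[OF fd]])
        (auto intro!: continuous_on_compose2[OF cfe continuous_on_vec2(1)] out)
    also have "\<dots> \<le> (\<integral>\<^sup>+s. ennreal (g (vec2 s b)) \<partial>lborel)"
      by (intro nn_integral_mono ennreal_leI fg)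
    finally show ?thesis by (simp add: f_def)
  qed
  have B: "ennreal (f (vec2 a b)) \<le> (\<integral>\<^sup>+s. ennreal (g (vec2 a s)) \<partial>lborel)" for a b
  proof -
    have "ennreal \<bar>f (vec2 a b)\<bar> \<le> (\<integral>\<^sup>+s. ennreal \<bar>frechet_derivative f (at (vec2 a s)) (axis 2 1)\<bar> \<partial>lborel)"
      by (rule abs_le_nn_integral_deriv[where R="min b (- \<bar>R\<bar> - 1)", OF has_vector_derivative_vec2(2)[OF fd]])
        (auto intro!: continuous_on_compose2[OF cfe continuous_on_vec2(2)] out)
    also have "\<dots> \<le> (\<integral>\<^sup>+s. ennreal (g (vec2 a s)) \<partial>lborel)"
      by (intro nn_integral_mono ennreal_leI fg)
    finally show ?thesis by (simp add: f_def)
  qed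
  define I where "I = integral\<^sup>N lborel (\<lambda>x. ennreal (g x))"
  have "(\<lambda>(a, s). ennreal (g (vec2 a s))) \<in> borel_measurable (lborel \<Otimes>\<^sub>M lborel)"
    using measurable_compose[OF measurable_vec2 mg] by (simp add: case_prod_beta)
  then have mb: "(\<lambda>a. \<integral>\<^sup>+s. ennreal (g (vec2 a s)) \<partial>lborel) \<in> borel_measurable lborel"
    by (rule lborel.borel_measurable_nn_integral)
  have "(\<lambda>(b, s). vec2 s b) \<in> borel_measurable (lborel \<Otimes>\<^sub>M lborel)" unfolding vec2_eq by measurable
  from measurable_compose[OF this mg]
  have "(\<lambda>(b, s). ennreal (g (vec2 s b))) \<in> borel_measurable (lborel \<Otimes>\<^sub>M lborel)"
    by (simp add: case_prod_beta)
  then have ma: "(\<lambda>b. \<integral>\<^sup>+s. ennreal (g (vec2 s b)) \<partial>lborel) \<in> borel_measurable lborel"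
    by (rule lborel.borel_measurable_nn_integral)
  have mf: "f \<in> borel_measurable borel" unfolding f_def by measurable
  have n4: "ennreal ((norm (\<phi> x))^4) = ennreal (f x) * ennreal (f x)" for x
    by (simp add: f_def flip: ennreal_mult) (simp add: dot_square_norm power4_eq_xxxx power2_eq_square mult.assoc)
  have "(\<integral>\<^sup>+x. ennreal ((norm (\<phi> x))^4) \<partial>lborel) = (\<integral>\<^sup>+a. \<integral>\<^sup>+b. ennreal (f (vec2 a b)) * ennreal (f (vec2 a b)) \<partial>lborel \<partial>lborel)"
    using mf unfolding n4 by (intro nn_integral_real2(1)) simp
  also have "\<dots> \<le> (\<integral>\<^sup>+a. \<integral>\<^sup>+b. (\<integral>\<^sup>+s. ennreal (g (vec2 a s)) \<partial>lborel) * (\<integral>\<^sup>+s. ennreal (g (vec2 s b)) \<partial>lborel) \<partial>lborel \<partial>lborel)"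
    by (intro nn_integral_mono mult_mono A B) auto
  also have "\<dots> = (\<integral>\<^sup>+a. (\<integral>\<^sup>+s. ennreal (g (vec2 a s)) \<partial>lborel) * I \<partial>lborel)"
    unfolding I_def nn_integral_real2(2)[OF mg] using ma by (intro nn_integral_cong nn_integral_cmult) 
  also have "\<dots> = I * I"
    using mb by (subst nn_integral_multc) (auto simp: I_def nn_integral_real2(1)[OF mg])
  finally have I1: "(\<integral>\<^sup>+x. ennreal ((norm (\<phi> x))^4) \<partial>lborel) \<le> I * I" .
  have I2: "I \<le> ennreal (2 * L2_norm UNIV \<phi> * L2_norm UNIV J)"
  proof -
    have supp: "supp \<phi> \<subseteq> K" by (rule supp_subset) (use K compact_imp_closed in auto)
    have J0: "J x = 0" if "x \<notin> K" for x
      using jacobian_outside_supp[of x \<phi>] subsetD[OF supp, of x] that by (auto simp: J_def)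
    have l: "(\<lambda>x. norm (\<phi> x)) \<in> L2 UNIV" "(\<lambda>x. norm (J x)) \<in> L2 UNIV"
      using L2_continuous_compact_support[of "\<lambda>x. norm (\<phi> x)" K UNIV] L2_continuous_compact_support[of "\<lambda>x. norm (J x)" K UNIV]
        cp K J0 by (auto intro: continuous_intros)
    have ig: "integrable lborel g"
      by (rule integrable_lborel_compact_support[OF cg K(1)]) (simp add: g_def K(2))
    have "integral\<^sup>L lborel g = integral\<^sup>L lebesgue g"
      using ig by (intro integral_completion[symmetric]) auto
    also have "\<dots> = 2 * L2_inner UNIV (\<lambda>x. norm (\<phi> x)) (\<lambda>x. norm (J x))"
      by (simp add: L2_inner_def g_def lebesgue_on_UNIV_eq)
    also have "\<dots> \<le> 2 * (L2_norm UNIV (\<lambda>x. norm (\<phi> x)) * L2_norm UNIV (\<lambda>x. norm (J x)))"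
      using L2_Cauchy_Schwarz[OF l] by simp
    also have "\<dots> = 2 * L2_norm UNIV \<phi> * L2_norm UNIV J" by (simp add: L2_norm_def)
    finally have le: "ennreal (integral\<^sup>L lborel g) \<le> ennreal (2 * L2_norm UNIV \<phi> * L2_norm UNIV J)"
      by (rule ennreal_leI)
    have Ig: "I = ennreal (integral\<^sup>L lborel g)"
      unfolding I_def by (rule nn_integral_eq_integral[OF ig]) (simp add: g0)
    show ?thesis unfolding Ig by (rule le)
  qed
  note I1
  also have "I * I \<le> ennreal (2 * L2_norm UNIV \<phi> * L2_norm UNIV J) * ennreal (2 * L2_norm UNIV \<phi> * L2_norm UNIV J)"
    by (rule mult_mono[OF I2 I2]) auto
  also have "\<dots> = ennreal (4 * (L2_norm UNIV \<phi>)\<^sup>2 * (L2_norm UNIV J)\<^sup>2)"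
    by (simp add: ennreal_mult[symmetric] power2_eq_square ac_simps)
  finally show ?thesis by (simp add: J_def)
qed

section \<open>Hardy's inequality through rotations\<close>

definition rot :: "real \<Rightarrow> real^2 \<Rightarrow> real^2" where
  "rot \<theta> x = cos \<theta> *\<^sub>R x + sin \<theta> *\<^sub>R vec2 (- (x $ 2)) (x $ 1)"

lemma norm_rot: "norm (rot \<theta> x) = norm x"
proof -
  have "rot \<theta> x \<bullet> rot \<theta> x = ((cos \<theta>)\<^sup>2 + (sin \<theta>)\<^sup>2) * (x \<bullet> x)"
    by (simp add: rot_def inner_vec_def sum_2 power2_eq_square algebra_simps del: sin_cos_squared_add sin_cos_squared_add2 sin_cos_squared_add3)
  then show ?thesis by (simp add: norm_eq_sqrt_inner)
qed

lemma linear_rot: "linear (rot \<theta>)"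
  by (rule linearI) (auto simp: rot_def vec_eq_iff forall_2 algebra_simps)

lemma orthogonal_rot: "orthogonal_transformation (rot \<theta>)"
  by (simp add: orthogonal_transformation linear_rot norm_rot)

lemma rot_has_vector_derivative:
  "((\<lambda>r. rot r x) has_vector_derivative rot (r + pi / 2) x) (at r)"
  unfolding rot_def by (auto intro!: derivative_eq_intros simp: cos_add sin_add)

lemma continuous_on_rot: "continuous_on UNIV (\<lambda>z. rot (snd z) (fst z))"
  unfolding rot_def vec2_eq by (intro continuous_intros)

lemma lborel_distr_orthogonal:
  fixes T :: "real^2 \<Rightarrow> real^2"
  assumes T: "orthogonal_transformation T"
  shows "distr lborel borel T = lborel"
proof (rule sym, rule lborel_eqI)
  have lin: "linear T" using T by (rule orthogonal_transformation_linear)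
  have bij: "bij T" using T by (rule orthogonal_transformation_bij)
  have cT: "continuous_on UNIV T" using lin by (simp add: linear_continuous_on linear_conv_bounded_linear)
  have mT: "T \<in> measurable lborel borel" using borel_measurable_continuous_onI[OF cT] by simp
  fix l u :: "real^2" assume le: "\<And>b. b \<in> Basis \<Longrightarrow> l \<bullet> b \<le> u \<bullet> b"
  define S where "S = T -` box l u"
  have eq: "T ` S = box l u" unfolding S_def using bij by (simp add: bij_is_surj surj_image_vimage_eq)
  have oi: "orthogonal_transformation (inv T)" using T by (rule orthogonal_transformation_inv)
  have S': "S = inv T ` box l u" unfolding S_def using bij_vimage_eq_inv_image[OF bij] .
  have lm: "S \<in> lmeasurable" unfolding S' by (rule measurable_orthogonal_image[OF oi]) simp
  have "open S" unfolding S_def by (rule open_vimage[OF open_box cT])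
  then have Sb: "S \<in> sets borel" by simp
  have "emeasure (distr lborel borel T) (box l u) = emeasure lborel S"
    using mT by (subst emeasure_distr) (auto simp: S_def)
  also have "\<dots> = emeasure lebesgue S" using Sb by simp
  also have "\<dots> = ennreal (measure lebesgue S)" using lm by (rule emeasure_eq_measure2)
  also have "measure lebesgue S = measure lebesgue (box l u)"
    unfolding S' by (rule measure_orthogonal_image[OF oi]) simp
  also have "ennreal (measure lebesgue (box l u)) = emeasure lebesgue (box l u)"
    by (rule emeasure_eq_measure2[symmetric]) simp
  also have "\<dots> = (\<Prod>b\<in>Basis. (u - l) \<bullet> b)" using le by (simp add: emeasure_lborel_box)
  finally show "emeasure (distr lborel borel T) (box l u) = (\<Prod>b\<in>Basis. (u - l) \<bullet> b)" .
qed simp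

lemma nn_integral_rot:
  assumes "f \<in> borel_measurable borel"
  shows "(\<integral>\<^sup>+x. f (rot \<theta> x) \<partial>lborel) = (\<integral>\<^sup>+x. f x \<partial>(lborel :: (real^2) measure))"
proof -
  have "rot \<theta> \<in> measurable lborel borel"
    using borel_measurable_continuous_onI[of "rot \<theta>"] linear_rot[of \<theta>]
    by (simp add: linear_continuous_on linear_conv_bounded_linear)
  from nn_integral_distr[OF this, of f] assms show ?thesis
    by (simp add: lborel_distr_orthogonal[OF orthogonal_rot])
qed

lemma L2_norm_power2_nn:
  assumes "f \<in> L2 UNIV" "f \<in> borel_measurable borel"
  shows "(\<integral>\<^sup>+x. ennreal ((norm (f x))\<^sup>2) \<partial>lborel) = ennreal ((L2_norm UNIV f)\<^sup>2)"
proof -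
  have i: "integrable lborel (\<lambda>x. (norm (f x))\<^sup>2)"
    using L2_D(2)[OF assms(1)] assms(2) by (simp add: lebesgue_on_UNIV_eq integrable_completion)
  then show ?thesis
    using assms(2) by (subst nn_integral_eq_integral) (auto simp: L2_norm_power2 lebesgue_on_UNIV_eq integral_completion)
qed

text \<open>The difference between the values at \<open>x\<close> and \<open>- x\<close> is the integral of the derivative along a
  half circle, and rotations preserve Lebesgue measure.\<close>

lemma Hardy_antipodal:
  fixes \<phi> :: "real^2 \<Rightarrow> real^2"
  assumes sm: "smooth \<phi>" and K: "compact K" "\<And>x. x \<notin> K \<Longrightarrow> \<phi> x = 0"
  shows "(\<integral>\<^sup>+x. ennreal ((norm (\<phi> x - \<phi> (- x)) / norm x)\<^sup>2) \<partial>lborel)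
     \<le> ennreal (pi\<^sup>2 * (L2_norm UNIV (\<lambda>x. jacobian \<phi> (at x)))\<^sup>2)"
proof -
  define J where "J = (\<lambda>x. jacobian \<phi> (at x))"
  have cJ: "continuous_on UNIV J" unfolding J_def by (rule continuous_on_jacobian[OF sm])
  have supp: "supp \<phi> \<subseteq> K" by (rule supp_subset) (use K compact_imp_closed in auto)
  have J0: "J x = 0" if "x \<notin> K" for x using jacobian_outside_supp[of x \<phi>] subsetD[OF supp, of x] that by (auto simp: J_def)
  have pt: "ennreal ((norm (\<phi> x - \<phi> (- x)) / norm x)\<^sup>2) \<le> ennreal pi * (\<integral>\<^sup>+r. ennreal ((norm (J (rot r x)))\<^sup>2) * indicator {0..pi} r \<partial>lborel)" for x
  proof (cases "x = 0")
    case False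
    define h where "h = (\<lambda>r. inverse (norm x) *\<^sub>R \<phi> (rot r x))"
    define h' where "h' = (\<lambda>r. inverse (norm x) *\<^sub>R frechet_derivative \<phi> (at (rot r x)) (rot (r + pi / 2) x))"
    have lin: "frechet_derivative \<phi> (at y) (c *\<^sub>R v) = c *\<^sub>R frechet_derivative \<phi> (at y) v" for y c v
      using linear_cmul[OF has_derivative_linear[OF smooth_has_derivative[OF sm]]] .
    have D: "(h has_vector_derivative h' r) (at r)" for r
    proof -
      have "((\<lambda>r. \<phi> (rot r x)) has_derivative (\<lambda>t. frechet_derivative \<phi> (at (rot r x)) (t *\<^sub>R rot (r + pi / 2) x))) (at r)"
        by (rule has_derivative_compose[OF rot_has_vector_derivative[unfolded has_vector_derivative_def] smooth_has_derivative[OF sm]])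
      then have "((\<lambda>r. \<phi> (rot r x)) has_vector_derivative frechet_derivative \<phi> (at (rot r x)) (rot (r + pi / 2) x)) (at r)"
        by (simp add: has_vector_derivative_def lin)
      then show ?thesis unfolding h_def h'_def
        by (rule bounded_linear.has_vector_derivative[OF bounded_linear_scaleR_right])
    qed
    have cr: "continuous_on UNIV (\<lambda>r. rot r x)" unfolding rot_def by (intro continuous_intros)
    have h'eq: "h' r = inverse (norm x) *\<^sub>R (J (rot r x) *v rot (r + pi / 2) x)" for r
      unfolding h'_def J_def using jacobian_works[OF smooth_differentiable[OF sm]] by simp
    have "continuous_on UNIV h'"
      unfolding h'eq rot_def matrix_vector_mult_def
      by (intro continuous_intros continuous_on_vec_lambda continuous_on_component continuous_on_compose2[OF cJ]) auto
    then have "ennreal ((norm (h pi - h 0))\<^sup>2) \<le> ennreal (pi - 0) * (\<integral>\<^sup>+r. ennreal ((norm (h' r))\<^sup>2) * indicator {0..pi} r \<partial>lborel)"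
      by (intro norm_increment_power2_le D) (auto intro: continuous_on_subset)
    also have "\<dots> \<le> ennreal pi * (\<integral>\<^sup>+r. ennreal ((norm (J (rot r x)))\<^sup>2) * indicator {0..pi} r \<partial>lborel)"
    proof -
      have "norm (h' r) \<le> norm (J (rot r x))" for r
      proof -
        have "norm (frechet_derivative \<phi> (at (rot r x)) (rot (r + pi / 2) x)) \<le> norm (J (rot r x)) * norm x"
          using norm_frechet_axis_le(1)[OF smooth_differentiable[OF sm], of "rot r x" "rot (r + pi / 2) x"]
          by (simp add: J_def norm_rot)
        then show ?thesis using False by (simp add: h'_def field_simps)
      qed
      then have "(norm (h' r))\<^sup>2 \<le> (norm (J (rot r x)))\<^sup>2" for r by (simp add: power_mono)
      then show ?thesis by (intro mult_mono nn_integral_mono mult_right_mono ennreal_leI) auto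
    qed
    also have "norm (h pi - h 0) = norm (\<phi> x - \<phi> (- x)) / norm x"
    proof -
      have "h pi - h 0 = inverse (norm x) *\<^sub>R (\<phi> (- x) - \<phi> x)"
        by (simp add: h_def rot_def scaleR_diff_right)
      then have "norm (h pi - h 0) = inverse (norm x) * norm (\<phi> (- x) - \<phi> x)" by simp
      then show ?thesis by (simp add: divide_inverse mult.commute norm_minus_commute[of "\<phi> (- x)"])
    qed
    finally show ?thesis .
  qed simp
  have cGt: "continuous_on UNIV (\<lambda>z. (norm (J (rot (snd z) (fst z))))\<^sup>2)"
    by (intro continuous_intros continuous_on_compose2[OF cJ continuous_on_rot]) auto
  have m0: "(\<lambda>z. (norm (J (rot (snd z) (fst z))))\<^sup>2) \<in> borel_measurable (lborel \<Otimes>\<^sub>M lborel)"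
    using borel_measurable_continuous_onI[OF cGt] by (simp add: lborel_prod)
  have mG: "(\<lambda>(x, r). ennreal ((norm (J (rot r x)))\<^sup>2) * indicator {0..pi} r) \<in> borel_measurable (lborel \<Otimes>\<^sub>M lborel)"
    unfolding case_prod_beta using m0 by measurable
  have mJ: "(\<lambda>x. ennreal ((norm (J x))\<^sup>2)) \<in> borel_measurable borel"
    using borel_measurable_continuous_onI[OF cJ] by measurable
  have "(\<integral>\<^sup>+x. ennreal ((norm (\<phi> x - \<phi> (- x)) / norm x)\<^sup>2) \<partial>lborel)
      \<le> (\<integral>\<^sup>+x. ennreal pi * (\<integral>\<^sup>+r. ennreal ((norm (J (rot r x)))\<^sup>2) * indicator {0..pi} r \<partial>lborel) \<partial>lborel)"
    by (intro nn_integral_mono pt)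
  also have "\<dots> = ennreal pi * (\<integral>\<^sup>+x. (\<integral>\<^sup>+r. ennreal ((norm (J (rot r x)))\<^sup>2) * indicator {0..pi} r \<partial>lborel) \<partial>lborel)"
    by (rule nn_integral_cmult) (rule lborel.borel_measurable_nn_integral[OF mG])
  also have "(\<integral>\<^sup>+x. (\<integral>\<^sup>+r. ennreal ((norm (J (rot r x)))\<^sup>2) * indicator {0..pi} r \<partial>lborel) \<partial>lborel)
      = (\<integral>\<^sup>+r. (\<integral>\<^sup>+x. ennreal ((norm (J (rot r x)))\<^sup>2) * indicator {0..pi} r \<partial>lborel) \<partial>lborel)"
    by (rule lborel_pair.Fubini'[OF mG, symmetric])
  also have "\<dots> = (\<integral>\<^sup>+r. (\<integral>\<^sup>+x. ennreal ((norm (J x))\<^sup>2) \<partial>lborel) * indicator {0..pi} r \<partial>lborel)"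
  proof (rule nn_integral_cong)
    fix r
    have "(\<lambda>x. ennreal ((norm (J (rot r x)))\<^sup>2)) \<in> borel_measurable lborel"
      using measurable_compose[OF _ mJ, of "rot r" lborel] borel_measurable_continuous_onI[of "rot r"] linear_rot[of r]
      by (simp add: linear_continuous_on linear_conv_bounded_linear)
    then show "(\<integral>\<^sup>+x. ennreal ((norm (J (rot r x)))\<^sup>2) * indicator {0..pi} r \<partial>lborel) = (\<integral>\<^sup>+x. ennreal ((norm (J x))\<^sup>2) \<partial>lborel) * indicator {0..pi} r"
      by (simp add: nn_integral_multc nn_integral_rot[OF mJ])
  qed
  also have "\<dots> = (\<integral>\<^sup>+x. ennreal ((norm (J x))\<^sup>2) \<partial>lborel) * ennreal pi"
    by (subst nn_integral_cmult) auto
  also have "(\<integral>\<^sup>+x. ennreal ((norm (J x))\<^sup>2) \<partial>lborel) = ennreal ((L2_norm UNIV J)\<^sup>2)"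
    by (rule L2_norm_power2_nn[OF L2_continuous_compact_support[OF cJ K(1) J0] borel_measurable_continuous_onI[OF cJ]]) auto
  also have "ennreal pi * (ennreal ((L2_norm UNIV J)\<^sup>2) * ennreal pi) = ennreal (pi\<^sup>2 * (L2_norm UNIV J)\<^sup>2)"
  proof -
    have "ennreal pi * (ennreal X * ennreal pi) = ennreal (pi\<^sup>2 * X)" if "X \<ge> 0" for X
      unfolding power2_eq_square using that by (simp add: ennreal_mult' mult.commute mult.left_commute)
    then show ?thesis by simp
  qed
  finally show ?thesis unfolding J_def .
qed

section \<open>Stream functions\<close>

lemma jacobian_divergence2:
  fixes \<phi> :: "real^2 \<Rightarrow> real^2"
  shows "divergence \<phi> x = jacobian \<phi> (at x) $ 1 $ 1 + jacobian \<phi> (at x) $ 2 $ 2"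
  by (simp add: divergence_def trace_def sum_2)

text \<open>Poincare's lemma on the plane, with the primitive obtained by integrating along the segments from
  the origin.\<close>

lemma stream_function_exists:
  fixes \<phi> :: "real^2 \<Rightarrow> real^2"
  assumes sm: "smooth \<phi>" and div: "\<And>x. divergence \<phi> x = 0"
  obtains F :: "real^2 \<Rightarrow> real" where "\<And>x. (F has_derivative (\<lambda>h. \<phi> x $ 1 * h $ 2 - \<phi> x $ 2 * h $ 1)) (at x)"
proof -
  define J where "J = (\<lambda>x. jacobian \<phi> (at x))"
  have cJ: "continuous_on UNIV J" unfolding J_def by (rule continuous_on_jacobian[OF sm])
  have cp: "continuous_on UNIV \<phi>" by (rule smooth_continuous_on[OF sm])
  have D: "((\<lambda>y. \<phi> y $ i) has_derivative (\<lambda>h. J x $ i $ 1 * h $ 1 + J x $ i $ 2 * h $ 2)) (at x)" for x i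
  proof -
    have "((\<lambda>y. \<phi> y $ i) has_derivative (\<lambda>h. frechet_derivative \<phi> (at x) h $ i)) (at x)"
      by (rule bounded_linear.has_derivative[OF bounded_linear_vec_nth smooth_has_derivative[OF sm]])
    moreover have "frechet_derivative \<phi> (at x) h $ i = J x $ i $ 1 * h $ 1 + J x $ i $ 2 * h $ 2" for h
      using jacobian_works[OF smooth_differentiable[OF sm]] by (simp add: J_def matrix_vector_mult_def sum_2)
    ultimately show ?thesis by simp
  qed
  define f where "f = (\<lambda>(x::real^2) (t::real). \<phi> (t *\<^sub>R x) $ 1 * x $ 2 - \<phi> (t *\<^sub>R x) $ 2 * x $ 1)"
  define L where "L = (\<lambda>(x::real^2) (t::real) (h::real^2). 
      (t * (J (t *\<^sub>R x) $ 1 $ 1 * h $ 1 + J (t *\<^sub>R x) $ 1 $ 2 * h $ 2)) * x $ 2 + \<phi> (t *\<^sub>R x) $ 1 * h $ 2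
    - ((t * (J (t *\<^sub>R x) $ 2 $ 1 * h $ 1 + J (t *\<^sub>R x) $ 2 $ 2 * h $ 2)) * x $ 1 + \<phi> (t *\<^sub>R x) $ 2 * h $ 1))"
  have Df: "((\<lambda>x. f x t) has_derivative L x t) (at x)" for x t
  proof -
    have "((\<lambda>x. \<phi> (t *\<^sub>R x) $ i) has_derivative (\<lambda>h. J (t *\<^sub>R x) $ i $ 1 * (t *\<^sub>R h) $ 1 + J (t *\<^sub>R x) $ i $ 2 * (t *\<^sub>R h) $ 2)) (at x)" for i
      by (rule has_derivative_compose[OF _ D]) (auto intro!: derivative_eq_intros)
    note this[derivative_intros]
    show ?thesis unfolding f_def L_def
      by (auto intro!: derivative_eq_intros bounded_linear.has_derivative[OF bounded_linear_vec_nth] simp: algebra_simps)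
  qed
  then have bl: "bounded_linear (L x t)" for x t using has_derivative_bounded_linear by blast
  define fx where "fx = (\<lambda>x t. Blinfun (L x t))"
  have fxL: "blinfun_apply (fx x t) = L x t" for x t unfolding fx_def by (rule bounded_linear_Blinfun_apply[OF bl])
  define F where "F = (\<lambda>x. integral (cbox 0 1) (f x))"
  have cc: "continuous_on UNIV (\<lambda>t. f x t)" for x
    unfolding f_def by (intro continuous_intros continuous_on_component continuous_on_compose2[OF cp]) auto
  have cfx: "continuous_on (UNIV \<times> cbox 0 1) (\<lambda>(x, t). fx x t)"
  proof (rule continuous_on_blinfun_componentwise)
    fix i :: "real^2" assume "i \<in> Basis"
    show "continuous_on (UNIV \<times> cbox 0 1) (\<lambda>x. blinfun_apply (case x of (x, t) \<Rightarrow> fx x t) i)"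
      unfolding case_prod_beta fxL L_def
      by (intro continuous_intros continuous_on_component continuous_on_compose2[OF cp] continuous_on_compose2[OF cJ]) auto
  qed
  have "(F has_derivative (\<lambda>h. \<phi> x $ 1 * h $ 2 - \<phi> x $ 2 * h $ 1)) (at x)" for x
  proof -
    have 1: "(F has_derivative integral (cbox 0 1) (fx x)) (at x within UNIV)"
      unfolding F_def
    proof (rule leibniz_rule[OF _ _ cfx])
      show "((\<lambda>x. f x t) has_derivative blinfun_apply (fx x t)) (at x within UNIV)" for x t
        using Df fxL by simp
      show "f x integrable_on cbox 0 1" for x
        using cc continuous_on_subset by (intro integrable_continuous) blast
    qed auto
    have "blinfun_apply (integral (cbox 0 1) (fx x)) h = \<phi> x $ 1 * h $ 2 - \<phi> x $ 2 * h $ 1" for h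
    proof -
      have "continuous_on (cbox 0 1) (\<lambda>t. case (x, t) of (x, t) \<Rightarrow> fx x t)"
        by (rule continuous_on_compose2[OF cfx]) (auto intro!: continuous_intros)
      then have ci: "continuous_on (cbox 0 1) (fx x)" by simp
      have "((\<lambda>t. blinfun_apply (fx x t) h) has_integral blinfun_apply (integral (cbox 0 1) (fx x)) h) (cbox 0 1)"
        using has_integral_linear[OF integrable_integral[OF integrable_continuous[OF ci]] blinfun.bounded_linear_left[of h]]
        by (simp add: o_def)
      moreover have "((\<lambda>t. L x t h) has_integral (1 * (\<phi> (1 *\<^sub>R x) $ 1 * h $ 2 - \<phi> (1 *\<^sub>R x) $ 2 * h $ 1) - 
           0 * (\<phi> (0 *\<^sub>R x) $ 1 * h $ 2 - \<phi> (0 *\<^sub>R x) $ 2 * h $ 1))) {0..1}"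
      proof (rule fundamental_theorem_of_calculus)
        fix t :: real
        have "((\<lambda>t. \<phi> (t *\<^sub>R x) $ i) has_derivative (\<lambda>s. J (t *\<^sub>R x) $ i $ 1 * (s *\<^sub>R x) $ 1 + J (t *\<^sub>R x) $ i $ 2 * (s *\<^sub>R x) $ 2)) (at t)" for i
          by (rule has_derivative_compose[OF _ D]) (auto intro!: derivative_eq_intros)
        then have d: "((\<lambda>t. \<phi> (t *\<^sub>R x) $ i) has_real_derivative (J (t *\<^sub>R x) $ i $ 1 * x $ 1 + J (t *\<^sub>R x) $ i $ 2 * x $ 2)) (at t)" for i
          unfolding has_field_derivative_def by (rule has_derivative_eq_rhs) (auto simp: algebra_simps)
        have tr: "J (t *\<^sub>R x) $ 2 $ 2 = - J (t *\<^sub>R x) $ 1 $ 1"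
          using div[of "t *\<^sub>R x"] unfolding jacobian_divergence2 J_def by linarith
        have "((\<lambda>t. t * (\<phi> (t *\<^sub>R x) $ 1 * h $ 2 - \<phi> (t *\<^sub>R x) $ 2 * h $ 1)) has_real_derivative L x t h) (at t)"
          by (auto intro!: derivative_eq_intros d simp: L_def tr algebra_simps)
        then show "((\<lambda>t. t * (\<phi> (t *\<^sub>R x) $ 1 * h $ 2 - \<phi> (t *\<^sub>R x) $ 2 * h $ 1)) has_vector_derivative L x t h) (at t within {0..1})"
          using has_real_derivative_iff_has_vector_derivative has_vector_derivative_at_within by blast
      qed simp
      ultimately show ?thesis by (simp add: fxL) (metis has_integral_unique)
    qed
    then show ?thesis using 1 by (metis (no_types, lifting) ext)
  qed
  then show ?thesis using that by blast
qed

section \<open>Poincare's inequality on a square\<close>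

lemma norm_increment_power2_le_interval:
  fixes h :: "real \<Rightarrow> 'b::euclidean_space"
  assumes D: "\<And>r. (h has_vector_derivative h' r) (at r)" and c: "continuous_on UNIV h'"
    and st: "s \<in> {l..u}" "t \<in> {l..u}" and L: "\<bar>t - s\<bar> \<le> L"
  shows "ennreal ((norm (h t - h s))\<^sup>2) \<le> ennreal L * (\<integral>\<^sup>+r. ennreal ((norm (h' r))\<^sup>2) * indicator {l..u} r \<partial>lborel)"
proof -
  have *: "ennreal ((norm (h t - h s))\<^sup>2) \<le> ennreal L * (\<integral>\<^sup>+r. ennreal ((norm (h' r))\<^sup>2) * indicator {l..u} r \<partial>lborel)"
    if "s \<le> t" "s \<in> {l..u}" "t \<in> {l..u}" "t - s \<le> L" for s t
  proof -
    have "ennreal ((norm (h t - h s))\<^sup>2) \<le> ennreal (t - s) * (\<integral>\<^sup>+r. ennreal ((norm (h' r))\<^sup>2) * indicator {s..t} r \<partial>lborel)"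
      by (rule norm_increment_power2_le[OF that(1) D continuous_on_subset[OF c]]) auto
    also have "\<dots> \<le> ennreal L * (\<integral>\<^sup>+r. ennreal ((norm (h' r))\<^sup>2) * indicator {l..u} r \<partial>lborel)"
      using that by (intro mult_mono nn_integral_mono ennreal_leI) (auto simp: indicator_def)
    finally show ?thesis .
  qed
  show ?thesis
  proof (cases "s \<le> t")
    case True then show ?thesis using *[of s t] st L by simp
  next
    case False then show ?thesis using *[of t s] st L by (simp add: norm_minus_commute)
  qed
qed

definition square :: "real \<Rightarrow> (real^2) set" where
  "square R = cbox (vec2 (-R) (-R)) (vec2 R R)"

lemma square_iff: "x \<in> square R \<longleftrightarrow> \<bar>x $ 1\<bar> \<le> R \<and> \<bar>x $ 2\<bar> \<le> R"
  by (auto simp: square_def mem_box_cart forall_2)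

text \<open>Every point of the square is reached from \<open>(a0, 0)\<close> by a vertical and then a horizontal segment. The
  vertical line \<open>a = a0\<close> is chosen so that its share of the integral of \<open>\<bar>\<phi>\<bar>\<^sup>2\<close> does not exceed twice the average.\<close>

lemma Poincare_square:
  fixes F :: "real^2 \<Rightarrow> real" and \<phi> :: "real^2 \<Rightarrow> real^2"
  assumes D: "\<And>x. (F has_derivative (\<lambda>h. \<phi> x $ 1 * h $ 2 - \<phi> x $ 2 * h $ 1)) (at x)"
    and c\<phi>: "continuous_on UNIV \<phi>" and R: "R > 0"
  shows "\<exists>c. (\<integral>\<^sup>+x. ennreal ((F x - c)\<^sup>2) * indicator (square R) x \<partial>lborel)
     \<le> ennreal (16 * R\<^sup>2) * (\<integral>\<^sup>+x. ennreal ((norm (\<phi> x))\<^sup>2) * indicator (square R) x \<partial>lborel)"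
proof -
  define i :: "real \<Rightarrow> ennreal" where "i = indicator {-R..R}"
  define N where "N = (\<lambda>x. ennreal ((norm (\<phi> x))\<^sup>2))"
  have ind: "indicator (square R) (vec2 a b) = i a * i b" for a b
    by (auto simp: i_def indicator_def square_iff abs_le_iff)
  have m\<phi>[measurable]: "\<phi> \<in> borel_measurable borel" by (rule borel_measurable_continuous_onI[OF c\<phi>])
  have mN[measurable]: "N \<in> borel_measurable borel" unfolding N_def by measurable
  have mi[measurable]: "i \<in> borel_measurable borel" unfolding i_def by measurable
  have cF: "continuous_on UNIV F" by (intro continuous_at_imp_continuous_on ballI has_derivative_continuous[OF D])
  have mF[measurable]: "F \<in> borel_measurable borel" by (rule borel_measurable_continuous_onI[OF cF])
  have sq[measurable]: "square R \<in> sets borel" by (simp add: square_def)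
  have ii: "(\<integral>\<^sup>+a. i a \<partial>lborel) = ennreal (2 * R)" using R by (simp add: i_def)
  have m1: "(\<lambda>(a, b). N (vec2 a b) * i b) \<in> borel_measurable (lborel \<Otimes>\<^sub>M lborel)"
    unfolding vec2_eq by measurable
  have m2: "(\<lambda>(b, a). N (vec2 a b) * i a) \<in> borel_measurable (lborel \<Otimes>\<^sub>M lborel)"
    unfolding vec2_eq by measurable
  define d where "d = (\<lambda>a. \<integral>\<^sup>+b. N (vec2 a b) * i b \<partial>lborel)"
  define e where "e = (\<lambda>b. \<integral>\<^sup>+a. N (vec2 a b) * i a \<partial>lborel)"
  have md[measurable]: "d \<in> borel_measurable borel" using lborel.borel_measurable_nn_integral[OF m1] by (simp add: d_def)
  have me[measurable]: "e \<in> borel_measurable borel" using lborel.borel_measurable_nn_integral[OF m2] by (simp add: e_def)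
  define I where "I = (\<integral>\<^sup>+x. N x * indicator (square R) x \<partial>lborel)"
  have mIi: "(\<lambda>x. N x * indicator (square R) x) \<in> borel_measurable borel" by measurable
  have vm: "(\<lambda>b. vec2 a b) \<in> borel_measurable borel" "(\<lambda>a. vec2 a b) \<in> borel_measurable borel" for a b
    unfolding vec2_eq by measurable
  have mNv: "(\<lambda>b. N (vec2 a b)) \<in> borel_measurable borel" "(\<lambda>a. N (vec2 a b)) \<in> borel_measurable borel" for a b
    using measurable_compose[OF vm(1) mN] measurable_compose[OF vm(2) mN] by auto
  have Id: "I = (\<integral>\<^sup>+a. d a * i a \<partial>lborel)"
    unfolding I_def nn_integral_real2(1)[OF mIi] ind d_def
    using mNv by (intro nn_integral_cong) (simp add: nn_integral_multc[symmetric] mult.assoc mult.commute[of "i _" "i _"])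
  have Ie: "I = (\<integral>\<^sup>+b. e b * i b \<partial>lborel)"
    unfolding I_def nn_integral_real2(2)[OF mIi] ind e_def
    using mNv by (intro nn_integral_cong) (simp add: nn_integral_multc[symmetric] mult.assoc)
  have "integrable lborel (\<lambda>x. indicator (square R) x *\<^sub>R (norm (\<phi> x))\<^sup>2)"
    by (rule borel_integrable_compact) (auto simp: square_def intro!: continuous_intros continuous_on_subset[OF c\<phi>])
  then have "(\<integral>\<^sup>+x. ennreal (norm (indicator (square R) x *\<^sub>R (norm (\<phi> x))\<^sup>2)) \<partial>lborel) < \<infinity>"
    by (simp add: integrable_iff_bounded)
  moreover have "ennreal (norm (indicator (square R) x *\<^sub>R (norm (\<phi> x))\<^sup>2)) = N x * indicator (square R) x" for x
    by (auto simp: N_def indicator_def)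
  ultimately have Ifin: "I < \<infinity>" by (simp add: I_def)
  have "\<exists>a0\<in>{-R..R}. d a0 * ennreal R \<le> I"
  proof (rule ccontr)
    assume "\<not> ?thesis"
    then have gt: "I < d a * ennreal R" if "a \<in> {-R..R}" for a using that by (auto simp: not_le)
    have "I * ennreal (2 * R) = (\<integral>\<^sup>+a. I * i a \<partial>lborel)" by (simp add: nn_integral_cmult ii)
    also have "\<dots> \<le> (\<integral>\<^sup>+a. (d a * i a) * ennreal R \<partial>lborel)"
      using gt by (intro nn_integral_mono) (auto simp: i_def indicator_def less_imp_le)
    also have "\<dots> = I * ennreal R" unfolding Id by (rule nn_integral_multc) measurable
    finally have le: "I * ennreal (2 * R) \<le> I * ennreal R" .
    have I0: "I = 0"
    proof -
      obtain r where r: "r \<ge> 0" "I = ennreal r" using Ifin by (cases I) auto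
      then have "r * (2 * R) \<le> r * R" using le R by (simp add: ennreal_mult[symmetric])
      then show ?thesis using r R by (simp add: mult_le_0_iff)
    qed
    then have "(\<integral>\<^sup>+a. d a * i a \<partial>lborel) = 0" using Id by simp
    then have "AE a in lborel. d a * i a = 0" by (subst (asm) nn_integral_0_iff_AE) auto
    then have "AE a in lborel. a \<notin> {-R..R}"
    proof eventually_elim
      case (elim a)
      show ?case
      proof
        assume a: "a \<in> {-R..R}"
        then have "d a = 0" using elim by (simp add: i_def)
        then show False using gt[OF a] by simp
      qed
    qed
    then have "emeasure lborel {-R..R} = 0" by (subst (asm) AE_iff_measurable[of "{-R..R}"]) auto
    then show False using R by simp
  qed
  then obtain a0 where a0: "a0 \<in> {-R..R}" "d a0 * ennreal R \<le> I" by blast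
  define c where "c = F (vec2 a0 0)"
  have dF: "F differentiable (at x)" for x unfolding differentiable_def by (rule exI, rule D)
  have fd: "frechet_derivative F (at x) = (\<lambda>h. \<phi> x $ 1 * h $ 2 - \<phi> x $ 2 * h $ 1)" for x
    using frechet_derivative_at[OF D] by simp
  have 1: "ennreal ((F (vec2 a b) - F (vec2 a0 b))\<^sup>2) \<le> ennreal (2 * R) * e b" if "a \<in> {-R..R}" for a b
  proof -
    have cc: "continuous_on UNIV (\<lambda>s. frechet_derivative F (at (vec2 s b)) (axis 1 1))"
      unfolding fd by (intro continuous_intros continuous_on_component continuous_on_compose2[OF c\<phi> continuous_on_vec2(1)]) auto
    have "ennreal ((norm (F (vec2 a b) - F (vec2 a0 b)))\<^sup>2) \<le> ennreal (2 * R) *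
        (\<integral>\<^sup>+s. ennreal ((norm (frechet_derivative F (at (vec2 s b)) (axis 1 1)))\<^sup>2) * indicator {-R..R} s \<partial>lborel)"
      by (rule norm_increment_power2_le_interval[OF has_vector_derivative_vec2(1)[OF dF] cc]) (use that a0 in auto)
    also have "\<dots> \<le> ennreal (2 * R) * e b"
      unfolding e_def N_def i_def
      by (intro mult_mono nn_integral_mono ennreal_leI power_mono)
        (use R in \<open>auto simp: fd axis_def component_le_norm_cart\<close>)
    finally show ?thesis by simp
  qed
  have 2: "ennreal ((F (vec2 a0 b) - c)\<^sup>2) \<le> ennreal R * d a0" if "b \<in> {-R..R}" for b
  proof -
    have cc: "continuous_on UNIV (\<lambda>s. frechet_derivative F (at (vec2 a0 s)) (axis 2 1))"
      unfolding fd by (intro continuous_intros continuous_on_component continuous_on_compose2[OF c\<phi> continuous_on_vec2(2)]) auto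
    have "ennreal ((norm (F (vec2 a0 b) - F (vec2 a0 0)))\<^sup>2) \<le> ennreal R *
        (\<integral>\<^sup>+s. ennreal ((norm (frechet_derivative F (at (vec2 a0 s)) (axis 2 1)))\<^sup>2) * indicator {-R..R} s \<partial>lborel)"
      by (rule norm_increment_power2_le_interval[OF has_vector_derivative_vec2(2)[OF dF] cc]) (use that R in auto)
    also have "\<dots> \<le> ennreal R * d a0"
      unfolding d_def N_def i_def
      by (intro mult_mono nn_integral_mono ennreal_leI power_mono)
        (use R in \<open>auto simp: fd axis_def component_le_norm_cart\<close>)
    finally show ?thesis by (simp add: c_def)
  qed
  have pt: "ennreal ((F (vec2 a b) - c)\<^sup>2) * (i a * i b) \<le> (ennreal (4 * R) * i a) * (e b * i b) + (2 * I) * i a * i b" for a b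
  proof (cases "a \<in> {-R..R} \<and> b \<in> {-R..R}")
    case True
    have sq: "(x + y)\<^sup>2 \<le> 2 * x\<^sup>2 + 2 * y\<^sup>2" for x y :: real
      using zero_le_power2[of "x - y"] by (simp add: power2_sum power2_diff)
    have "(F (vec2 a b) - c)\<^sup>2 \<le> 2 * (F (vec2 a b) - F (vec2 a0 b))\<^sup>2 + 2 * (F (vec2 a0 b) - c)\<^sup>2"
      using sq[of "F (vec2 a b) - F (vec2 a0 b)" "F (vec2 a0 b) - c"] by simp
    then have "ennreal ((F (vec2 a b) - c)\<^sup>2) \<le> ennreal (2 * (F (vec2 a b) - F (vec2 a0 b))\<^sup>2 + 2 * (F (vec2 a0 b) - c)\<^sup>2)"
      by (rule ennreal_leI)
    also have "\<dots> = 2 * ennreal ((F (vec2 a b) - F (vec2 a0 b))\<^sup>2) + 2 * ennreal ((F (vec2 a0 b) - c)\<^sup>2)"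
      by (simp add: ennreal_mult')
    also have "\<dots> \<le> 2 * (ennreal (2 * R) * e b) + 2 * (ennreal R * d a0)"
      using True by (intro add_mono mult_left_mono 1 2) auto
    also have "\<dots> \<le> 2 * (ennreal (2 * R) * e b) + 2 * I"
      using a0(2) by (intro add_mono mult_left_mono) (auto simp: mult.commute)
    also have "2 * (ennreal (2 * R) * e b) = ennreal (4 * R) * e b"
    proof -
      have "2 * ennreal (2 * R) = ennreal (4 * R)" using R by (simp add: ennreal_mult'[symmetric, of 2, simplified])
      then show ?thesis by (simp add: mult.assoc[symmetric])
    qed
    finally show ?thesis using True by (simp add: i_def)
  qed (auto simp: i_def)
  have "(\<integral>\<^sup>+x. ennreal ((F x - c)\<^sup>2) * indicator (square R) x \<partial>lborel)
      = (\<integral>\<^sup>+a. \<integral>\<^sup>+b. ennreal ((F (vec2 a b) - c)\<^sup>2) * (i a * i b) \<partial>lborel \<partial>lborel)"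
    by (subst nn_integral_real2(1)) (auto simp: ind)
  also have "\<dots> \<le> (\<integral>\<^sup>+a. \<integral>\<^sup>+b. (ennreal (4 * R) * i a) * (e b * i b) + (2 * I) * i a * i b \<partial>lborel \<partial>lborel)"
    by (intro nn_integral_mono pt)
  also have "\<dots> = (\<integral>\<^sup>+a. ennreal (4 * R) * i a * I + (2 * I) * i a * ennreal (2 * R) \<partial>lborel)"
    by (intro nn_integral_cong) (simp add: nn_integral_add nn_integral_cmult Ie[symmetric] ii)
  also have "\<dots> = ennreal (4 * R) * ennreal (2 * R) * I + (2 * I) * ennreal (2 * R) * ennreal (2 * R)"
    by (simp add: nn_integral_add nn_integral_cmult nn_integral_multc ii)
  also have "\<dots> = ennreal (16 * R\<^sup>2) * I"
  proof -
    obtain r where r: "r \<ge> 0" "I = ennreal r" using Ifin by (cases I) auto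
    have two: "(2::ennreal) = ennreal 2" by simp
    have "ennreal (4 * R) * ennreal (2 * R) * ennreal r + (ennreal 2 * ennreal r) * ennreal (2 * R) * ennreal (2 * R)
      = ennreal (4 * R * (2 * R) * r + 2 * r * (2 * R) * (2 * R))"
      using R r(1)
      by (simp only: ennreal_mult[symmetric] ennreal_plus[symmetric] mult_nonneg_nonneg zero_le_numeral less_imp_le)
    also have "4 * R * (2 * R) * r + 2 * r * (2 * R) * (2 * R) = 16 * R\<^sup>2 * r" by (simp add: power2_eq_square)
    also have "ennreal (16 * R\<^sup>2 * r) = ennreal (16 * R\<^sup>2) * ennreal r" by (rule ennreal_mult) (use r in auto)
    finally show ?thesis unfolding r(2) two .
  qed
  finally show ?thesis unfolding I_def N_def by blast
qed

section \<open>Solenoidal cutoff\<close>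

definition plateau :: "real \<Rightarrow> real" where
  "plateau t = smooth_step (2 + t) * smooth_step (2 - t)"

lemma smooth_plateau: "smooth plateau"
proof -
  have "smooth (\<lambda>t::real. smooth_step (2 + t))"
    by (rule smooth_affine[where l="\<lambda>t. 2 + t", OF _ smooth_smooth_step]) (auto intro!: derivative_eq_intros)
  moreover have "smooth (\<lambda>t::real. smooth_step (2 - t))"
    by (rule smooth_affine[where l="\<lambda>t. 2 - t", OF _ smooth_smooth_step]) (auto intro!: derivative_eq_intros)
  ultimately show ?thesis unfolding plateau_def[abs_def] by (rule smooth_mult)
qed

lemma plateau_1: "\<bar>t\<bar> \<le> 1 \<Longrightarrow> plateau t = 1"
  by (simp add: plateau_def smooth_step_1)

lemma plateau_0: "\<bar>t\<bar> \<ge> 2 \<Longrightarrow> plateau t = 0"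
  using smooth_step_0[of "2 + t"] smooth_step_0[of "2 - t"] by (cases "t \<ge> 0") (auto simp: plateau_def)

lemma plateau_range: "0 \<le> plateau t" "plateau t \<le> 1"
  using smooth_step_range by (auto simp: plateau_def mult_le_one)

abbreviation deriv1 :: "(real \<Rightarrow> real) \<Rightarrow> real \<Rightarrow> real" where
  "deriv1 f \<equiv> \<lambda>t. frechet_derivative f (at t) 1"

lemma smooth_deriv1: "smooth f \<Longrightarrow> smooth (deriv1 f)" by (rule smooth_deriv)

lemma smooth_DERIV:
  fixes f :: "real \<Rightarrow> real"
  assumes "smooth f" shows "(f has_real_derivative deriv1 f t) (at t)"
proof -
  have D: "(f has_derivative frechet_derivative f (at t)) (at t)" by (rule smooth_has_derivative[OF assms])
  have "frechet_derivative f (at t) h = deriv1 f t * h" for h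
    using linear_cmul[OF has_derivative_linear[OF D], of h 1] by (simp add: mult.commute)
  then have "frechet_derivative f (at t) = (\<lambda>h. deriv1 f t * h)" by blast
  with D show ?thesis unfolding has_field_derivative_def by metis
qed

lemma deriv1_0:
  assumes "\<And>t. \<bar>t\<bar> \<ge> 2 \<Longrightarrow> f t = (0::real)" shows "\<bar>t\<bar> > 2 \<Longrightarrow> deriv1 f t = 0"
proof -
  assume t: "\<bar>t\<bar> > 2"
  have "supp f \<subseteq> {-2..2}" by (rule supp_subset) (use assms in \<open>auto simp: abs_le_iff not_le\<close>)
  moreover have "t \<notin> {-2..2}" using t by auto
  ultimately have "t \<notin> supp f" by blast
  from frechet_derivative_outside_supp[OF this] show ?thesis by simp
qed

lemma deriv1_plateau_0: "\<bar>t\<bar> > 2 \<Longrightarrow> deriv1 plateau t = 0"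
  by (rule deriv1_0[OF plateau_0])

lemma deriv1_plateau_0': "\<bar>t\<bar> \<ge> 2 \<Longrightarrow> deriv1 plateau t = 0"
proof -
  assume t: "\<bar>t\<bar> \<ge> 2"
  have c: "isCont (deriv1 plateau) t"
    using smooth_continuous_on[OF smooth_deriv1[OF smooth_plateau], of UNIV] by (simp add: continuous_on_eq_continuous_at)
  define s where "s = (\<lambda>n. t + sgn t / real (Suc n))"
  have "(\<lambda>n. t + sgn t * (1 / real (Suc n))) \<longlonglongrightarrow> t + sgn t * 0"
    by (intro tendsto_intros LIMSEQ_Suc[OF lim_1_over_n])
  then have "s \<longlonglongrightarrow> t" by (simp add: s_def)
  then have "(\<lambda>n. deriv1 plateau (s n)) \<longlonglongrightarrow> deriv1 plateau t" by (rule isCont_tendsto_compose[OF c])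
  moreover have "deriv1 plateau (s n) = 0" for n
  proof (rule deriv1_plateau_0)
    define d where "d = 1 / real (Suc n)"
    have "d > 0" by (simp add: d_def)
    moreover have "s n = t + sgn t * d" by (simp add: s_def d_def)
    ultimately show "2 < \<bar>s n\<bar>" using t by (cases "t > 0") (auto simp: sgn_if abs_if)
  qed
  ultimately show ?thesis by (simp add: LIMSEQ_const_iff)
qed

lemma deriv2_plateau_0: "\<bar>t\<bar> > 2 \<Longrightarrow> deriv1 (deriv1 plateau) t = 0"
  by (rule deriv1_0[OF deriv1_plateau_0'])

lemma plateau_bound:
  obtains M where "M \<ge> 1" "\<And>t. \<bar>plateau t\<bar> \<le> M" "\<And>t. \<bar>deriv1 plateau t\<bar> \<le> M" "\<And>t. \<bar>deriv1 (deriv1 plateau) t\<bar> \<le> M"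
proof -
  have "\<exists>M>0. \<forall>t. \<bar>f t\<bar> \<le> M" if sf: "smooth f" and z: "\<And>t. \<bar>t\<bar> > 2 \<Longrightarrow> f t = 0" for f :: "real \<Rightarrow> real"
  proof -
    have "f t = 0" if "t \<notin> {-2..2}" for t using that z[of t] by (auto simp: not_le abs_if)
    then obtain M where "M > 0" "\<And>t. norm (f t) \<le> M"
      using bounded_range_compact_support[OF smooth_continuous_on[OF sf], of "{-2..2}"] by auto
    then show ?thesis by auto
  qed
  from this[OF smooth_plateau plateau_0] this[OF smooth_deriv1[OF smooth_plateau] deriv1_plateau_0]
    this[OF smooth_deriv1[OF smooth_deriv1[OF smooth_plateau]] deriv2_plateau_0]
  obtain M1 M2 M3 where "\<And>t. \<bar>plateau t\<bar> \<le> M1" "\<And>t. \<bar>deriv1 plateau t\<bar> \<le> M2" "\<And>t. \<bar>deriv1 (deriv1 plateau) t\<bar> \<le> M3"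
    by (metis less_imp_le)
  then show ?thesis
    by (intro that[of "max 1 (max M1 (max M2 M3))"]) (auto intro: order_trans simp: le_max_iff_disj)
qed

lemma norm_mat2_le:
  fixes A :: "real^2^2"
  shows "norm A \<le> \<bar>A $ 1 $ 1\<bar> + \<bar>A $ 1 $ 2\<bar> + (\<bar>A $ 2 $ 1\<bar> + \<bar>A $ 2 $ 2\<bar>)"
proof -
  have "norm A \<le> norm (A $ 1) + norm (A $ 2)"
    unfolding norm_vec_def[of A] using L2_set_le_sum[of UNIV "\<lambda>i. norm (A $ i)"] by (simp add: sum_2)
  moreover have "norm (A $ i) \<le> \<bar>A $ i $ 1\<bar> + \<bar>A $ i $ 2\<bar>" for i
    using norm_le_l1_cart[of "A $ i"] by (simp add: sum_2)
  ultimately show ?thesis using add_mono by (meson order_trans)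
qed

lemma norm_vec2_le: "norm (vec2 a b) \<le> \<bar>a\<bar> + \<bar>b\<bar>"
  using norm_le_l1_cart[of "vec2 a b"] by (simp add: sum_2)

text \<open>The field \<open>\<phi>\<close> is the rotated gradient of a stream function \<open>F\<close>; cutting off \<open>F - c\<close> keeps the
  divergence zero, and Poincare's inequality on the square controls the commutator by \<open>\<phi>\<close>.\<close>

lemma solenoidal_cutoff:
  obtains A where "A > 0"
    "\<And>(\<phi> :: real^2 \<Rightarrow> real^2) K R. smooth \<phi> \<Longrightarrow> (\<And>x. divergence \<phi> x = 0) \<Longrightarrow> compact K \<Longrightarrow>
       (\<And>x. x \<notin> K \<Longrightarrow> \<phi> x = 0) \<Longrightarrow> R > 0 \<Longrightarrow>
     \<exists>Y. smooth Y \<and> (\<forall>x. divergence Y x = 0) \<and> (\<forall>x\<in>ball 0 R. Y x = \<phi> x) \<and> (\<forall>x. x \<notin> square (2 * R) \<longrightarrow> Y x = 0) \<and>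
        L2_norm UNIV Y \<le> A * L2_norm (square (2 * R)) \<phi> \<and>
        L2_norm UNIV (\<lambda>x. jacobian Y (at x) - jacobian \<phi> (at x))
          \<le> A / R * L2_norm (square (2 * R)) \<phi> + L2_norm (- ball 0 R) (\<lambda>x. jacobian \<phi> (at x))"
proof -
  obtain M where M: "M \<ge> 1" "\<And>t. \<bar>plateau t\<bar> \<le> M" "\<And>t. \<bar>deriv1 plateau t\<bar> \<le> M" "\<And>t. \<bar>deriv1 (deriv1 plateau) t\<bar> \<le> M"
    by (rule plateau_bound) blast
  show ?thesis
  proof (rule that[of "40 * M\<^sup>2 + 1"])
    show "40 * M\<^sup>2 + 1 > 0" by (simp add: add_nonneg_pos)
    fix \<phi> :: "real^2 \<Rightarrow> real^2" and K R
    assume sm: "smooth \<phi>" and div: "\<And>x. divergence \<phi> x = 0" and K: "compact K" "\<And>x. x \<notin> K \<Longrightarrow> \<phi> x = 0" and R: "(R::real) > 0"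
    obtain F where DF: "\<And>x. (F has_derivative (\<lambda>h. \<phi> x $ 1 * h $ 2 - \<phi> x $ 2 * h $ 1)) (at x)"
      using stream_function_exists[OF sm div] by blast
    have c\<phi>: "continuous_on UNIV \<phi>" by (rule smooth_continuous_on[OF sm])
    \<comment> \<open>subtracting \<open>c\<close> makes \<open>F - c\<close> of size \<open>R \<bar>\<phi>\<bar>\<close>, which balances the derivatives of the cutoff\<close>
    obtain c where c: "(\<integral>\<^sup>+x. ennreal ((F x - c)\<^sup>2) * indicator (square (2 * R)) x \<partial>lborel)
       \<le> ennreal (16 * (2 * R)\<^sup>2) * (\<integral>\<^sup>+x. ennreal ((norm (\<phi> x))\<^sup>2) * indicator (square (2 * R)) x \<partial>lborel)"
      using Poincare_square[OF DF c\<phi>, of "2 * R"] R by auto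
    have smF: "smooth F"
    proof (rule smoothI_deriv[OF DF])
      show "smooth (\<lambda>x. \<phi> x $ 1 * v $ 2 - \<phi> x $ 2 * v $ 1)" for v :: "real^2"
        by (intro smooth_diff smooth_mult smooth_vec_nth sm smooth_const)
    qed
    define r where "r = 1 / R"
    have r: "r > 0" using R by (simp add: r_def)
    define p where "p = (\<lambda>(i::2) (x::real^2). plateau (r * x $ i))"
    define p1 where "p1 = (\<lambda>(i::2) (x::real^2). deriv1 plateau (r * x $ i))"
    define p2 where "p2 = (\<lambda>(i::2) (x::real^2). deriv1 (deriv1 plateau) (r * x $ i))"
    have Dl: "((\<lambda>x::real^2. r * x $ i) has_derivative (\<lambda>h. r * h $ i)) (at x)" for i x
      by (auto intro!: derivative_eq_intros bounded_linear.has_derivative[OF bounded_linear_vec_nth])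
    have Dp: "(p i has_derivative (\<lambda>h. p1 i x * (r * h $ i))) (at x)" for i x
      unfolding p_def p1_def
      by (rule has_derivative_compose[OF Dl smooth_DERIV[OF smooth_plateau, unfolded has_field_derivative_def]])
    have Dp1: "(p1 i has_derivative (\<lambda>h. p2 i x * (r * h $ i))) (at x)" for i x
      unfolding p1_def p2_def
      by (rule has_derivative_compose[OF Dl smooth_DERIV[OF smooth_deriv1[OF smooth_plateau], unfolded has_field_derivative_def]])
    have sp: "smooth (p i)" "smooth (p1 i)" for i
      unfolding p_def p1_def by (rule smooth_affine[OF Dl], intro smooth_plateau smooth_deriv1)+
    have D\<phi>: "((\<lambda>y. \<phi> y $ i) has_derivative (\<lambda>h. frechet_derivative \<phi> (at x) h $ i)) (at x)" for x i
      by (rule bounded_linear.has_derivative[OF bounded_linear_vec_nth smooth_has_derivative[OF sm]])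
    define Q where "Q = square (2 * R)"
    define E where "E = (\<lambda>x. F x - c)"
    have DE: "(E has_derivative (\<lambda>h. \<phi> x $ 1 * h $ 2 - \<phi> x $ 2 * h $ 1)) (at x)" for x
      unfolding E_def using has_derivative_diff[OF DF has_derivative_const[of c]] by simp
    have smE: "smooth E" unfolding E_def by (intro smooth_diff smF smooth_const)
    \<comment> \<open>\<open>Y\<close> is the rotated gradient of the product of \<open>E\<close> with the cutoff \<open>p 1 * p 2\<close>\<close>
    define y1 where "y1 = (\<lambda>x. p 1 x * p 2 x * \<phi> x $ 1 + E x * (r * (p 1 x * p1 2 x)))"
    define y2 where "y2 = (\<lambda>x. p 1 x * p 2 x * \<phi> x $ 2 - E x * (r * (p1 1 x * p 2 x)))"
    define Y where "Y = (\<lambda>x. vec2 (y1 x) (y2 x))"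
    have s1: "smooth y1" "smooth y2"
      unfolding y1_def y2_def by (intro smooth_add smooth_diff smooth_mult sp smooth_const smooth_vec_nth sm smE)+
    have smY: "smooth Y"
    proof (rule smooth_vec2)
      fix i :: 2 show "smooth (\<lambda>x. Y x $ i)" using s1 exhaust_2[of i] by (auto simp: Y_def)
    qed
    have Dy1: "(y1 has_derivative (\<lambda>h. (p 1 x * p 2 x) * frechet_derivative \<phi> (at x) h $ 1
        + (p1 1 x * (r * h $ 1) * p 2 x + p 1 x * (p1 2 x * (r * h $ 2))) * \<phi> x $ 1
        + (\<phi> x $ 1 * h $ 2 - \<phi> x $ 2 * h $ 1) * (r * (p 1 x * p1 2 x))
        + E x * (r * (p1 1 x * (r * h $ 1) * p1 2 x + p 1 x * (p2 2 x * (r * h $ 2)))))) (at x)" for x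
      unfolding y1_def
      by (auto intro!: derivative_eq_intros Dp Dp1 D\<phi> DE simp: algebra_simps)
    have Dy2: "(y2 has_derivative (\<lambda>h. (p 1 x * p 2 x) * frechet_derivative \<phi> (at x) h $ 2
        + (p1 1 x * (r * h $ 1) * p 2 x + p 1 x * (p1 2 x * (r * h $ 2))) * \<phi> x $ 2
        - (\<phi> x $ 1 * h $ 2 - \<phi> x $ 2 * h $ 1) * (r * (p1 1 x * p 2 x))
        - E x * (r * (p2 1 x * (r * h $ 1) * p 2 x + p1 1 x * (p1 2 x * (r * h $ 2)))))) (at x)" for x
      unfolding y2_def
      by (auto intro!: derivative_eq_intros Dp Dp1 D\<phi> DE simp: algebra_simps)
    have fdY: "frechet_derivative Y (at x) h $ 1 = frechet_derivative y1 (at x) h"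
         "frechet_derivative Y (at x) h $ 2 = frechet_derivative y2 (at x) h" for x h
    proof -
      have "(\<lambda>x. Y x $ 1) = y1" "(\<lambda>x. Y x $ 2) = y2" by (auto simp: Y_def)
      then show "frechet_derivative Y (at x) h $ 1 = frechet_derivative y1 (at x) h"
         "frechet_derivative Y (at x) h $ 2 = frechet_derivative y2 (at x) h"
        using frechet_derivative_vec_nth[OF smooth_differentiable[OF smY], of 1 x]
          frechet_derivative_vec_nth[OF smooth_differentiable[OF smY], of 2 x] by metis+
    qed
    note fd1 = frechet_derivative_at[OF Dy1, symmetric] and fd2 = frechet_derivative_at[OF Dy2, symmetric]
    define J where "J = (\<lambda>x. jacobian \<phi> (at x))"
    define JY where "JY = (\<lambda>x. jacobian Y (at x))"
    have ax: "axis (1::2) (1::real) $ 1 = 1" "axis (1::2) (1::real) $ 2 = 0" "axis (2::2) (1::real) $ 1 = 0" "axis (2::2) (1::real) $ 2 = 1"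
      by (auto simp: axis_def)
    have e11: "JY x $ 1 $ 1 = p 1 x * p 2 x * J x $ 1 $ 1 + r * (p1 1 x * p 2 x * \<phi> x $ 1 - p 1 x * p1 2 x * \<phi> x $ 2) + r\<^sup>2 * (E x * (p1 1 x * p1 2 x))" for x
      by (simp add: JY_def J_def jacobian_nth fdY fd1 ax power2_eq_square algebra_simps)
    have e12: "JY x $ 1 $ 2 = p 1 x * p 2 x * J x $ 1 $ 2 + r * (p 1 x * p1 2 x * \<phi> x $ 1 + p 1 x * p1 2 x * \<phi> x $ 1) + r\<^sup>2 * (E x * (p 1 x * p2 2 x))" for x
      by (simp add: JY_def J_def jacobian_nth fdY fd1 ax power2_eq_square algebra_simps)
    have e21: "JY x $ 2 $ 1 = p 1 x * p 2 x * J x $ 2 $ 1 + r * (p1 1 x * p 2 x * \<phi> x $ 2 - - (p1 1 x * p 2 x * \<phi> x $ 2)) + r\<^sup>2 * (E x * - (p2 1 x * p 2 x))" for x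
      by (simp add: JY_def J_def jacobian_nth fdY fd2 ax power2_eq_square algebra_simps)
    have e22: "JY x $ 2 $ 2 = p 1 x * p 2 x * J x $ 2 $ 2 + r * (p 1 x * p1 2 x * \<phi> x $ 2 - p1 1 x * p 2 x * \<phi> x $ 1) + r\<^sup>2 * (E x * - (p1 1 x * p1 2 x))" for x
      by (simp add: JY_def J_def jacobian_nth fdY fd2 ax power2_eq_square algebra_simps)
    have divY: "divergence Y x = 0" for x
    proof -
      have "divergence Y x = p 1 x * p 2 x * (J x $ 1 $ 1 + J x $ 2 $ 2)"
        using e11[of x] e22[of x] by (simp add: jacobian_divergence2 JY_def algebra_simps)
      then show ?thesis using div[of x] by (simp add: jacobian_divergence2 J_def)
    qed
    have outQ: "p 1 x * p 2 x = 0 \<and> p 1 x * p1 2 x = 0 \<and> p1 1 x * p 2 x = 0 \<and> p1 1 x * p1 2 x = 0 \<and> p 1 x * p2 2 x = 0 \<and> p2 1 x * p 2 x = 0" if "x \<notin> Q" for x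
    proof -
      have "\<bar>r * x $ 1\<bar> > 2 \<or> \<bar>r * x $ 2\<bar> > 2"
        using that R by (auto simp: Q_def square_iff r_def not_le field_simps abs_mult)
      then show ?thesis
        using plateau_0 deriv1_plateau_0 deriv2_plateau_0 by (auto simp: p_def p1_def p2_def less_imp_le)
    qed
    have in1: "p 1 x = 1 \<and> p 2 x = 1 \<and> p1 1 x = 0 \<and> p1 2 x = 0" if x: "x \<in> ball 0 R" for x
    proof -
      have lt: "\<bar>r * y $ i\<bar> < 1" if "y \<in> ball 0 R" for y :: "real^2" and i
      proof -
        have "\<bar>y $ i\<bar> < R" using component_le_norm_cart[of y i] that by simp
        then show ?thesis using R by (simp add: r_def abs_mult field_simps)
      qed
      have one: "p i y = 1" if "y \<in> ball 0 R" for y i using lt[OF that, of i] by (simp add: p_def plateau_1)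
      have z: "deriv1 plateau t = 0" if "\<bar>t\<bar> < 1" for t
      proof -
        have "(plateau has_real_derivative 0) (at t)"
          by (rule DERIV_local_max[OF smooth_DERIV[OF smooth_plateau], THEN subst[of _ _ "\<lambda>d. (plateau has_real_derivative d) (at t)"], of 1]; 
             (use plateau_1[of t] plateau_range that smooth_DERIV[OF smooth_plateau] in auto))
        then show ?thesis using DERIV_unique[OF smooth_DERIV[OF smooth_plateau]] by blast
      qed
      show ?thesis using one[OF x] z[OF lt[OF x]] by (auto simp: p1_def)
    qed
    have eqY: "Y x = \<phi> x" if "x \<in> ball 0 R" for x
      using in1[OF that] by (simp add: Y_def y1_def y2_def vec2_surj)
    have outY: "Y x = 0" if "x \<notin> Q" for x
    proof -
      note o = outQ[OF that]
      have "y1 x = 0" unfolding y1_def using o by (simp only: mult_zero_left mult_zero_right add_0_left)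
      moreover have "y2 x = 0" unfolding y2_def using o by (simp only: mult_zero_left mult_zero_right diff_0_right)
      ultimately show ?thesis by (simp add: Y_def vec_eq_iff forall_2)
    qed
    have bp: "\<bar>p i x\<bar> \<le> M" "\<bar>p1 i x\<bar> \<le> M" "\<bar>p2 i x\<bar> \<le> M" for i x
      using M by (auto simp: p_def p1_def p2_def)
    have M2: "\<bar>a * b\<bar> \<le> M\<^sup>2" if "\<bar>a\<bar> \<le> M" "\<bar>b\<bar> \<le> M" for a b
      unfolding abs_mult power2_eq_square using that M(1) by (intro mult_mono) auto
    have ent: "\<bar>r * (a * u + b * v) + r\<^sup>2 * (w * d)\<bar> \<le> M\<^sup>2 * (2 * r * n + r\<^sup>2 * \<bar>w\<bar>)"
      if "\<bar>a\<bar> \<le> M\<^sup>2" "\<bar>b\<bar> \<le> M\<^sup>2" "\<bar>d\<bar> \<le> M\<^sup>2" "\<bar>u\<bar> \<le> n" "\<bar>v\<bar> \<le> n" for a b d u v w n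
    proof -
      have "\<bar>a * u\<bar> \<le> M\<^sup>2 * n" "\<bar>b * v\<bar> \<le> M\<^sup>2 * n" "\<bar>w * d\<bar> \<le> \<bar>w\<bar> * M\<^sup>2"
        unfolding abs_mult using that by (auto intro!: mult_mono)
      then have "\<bar>a * u + b * v\<bar> \<le> 2 * (M\<^sup>2 * n)" "\<bar>w * d\<bar> \<le> \<bar>w\<bar> * M\<^sup>2" by linarith+
      then have "r * \<bar>a * u + b * v\<bar> \<le> r * (2 * (M\<^sup>2 * n))" "r\<^sup>2 * \<bar>w * d\<bar> \<le> r\<^sup>2 * (\<bar>w\<bar> * M\<^sup>2)"
        using r by (auto intro!: mult_left_mono)
      moreover have "\<bar>r * (a * u + b * v)\<bar> = r * \<bar>a * u + b * v\<bar>" "\<bar>r\<^sup>2 * (w * d)\<bar> = r\<^sup>2 * \<bar>w * d\<bar>"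
        using r by (simp_all only: abs_mult abs_of_pos abs_power2)
      moreover have "M\<^sup>2 * (2 * r * n + r\<^sup>2 * \<bar>w\<bar>) = r * (2 * (M\<^sup>2 * n)) + r\<^sup>2 * (\<bar>w\<bar> * M\<^sup>2)" by algebra
      ultimately show ?thesis using abs_triangle_ineq[of "r * (a * u + b * v)" "r\<^sup>2 * (w * d)"] by linarith
    qed
    have comp: "\<bar>\<phi> x $ i\<bar> \<le> norm (\<phi> x)" for x i by (rule component_le_norm_cart)
    have JYbound: "norm (JY x - (p 1 x * p 2 x) *\<^sub>R J x) \<le> 4 * (M\<^sup>2 * (2 * r * norm (\<phi> x) + r\<^sup>2 * \<bar>E x\<bar>))" for x
    proof -
      let ?B = "M\<^sup>2 * (2 * r * norm (\<phi> x) + r\<^sup>2 * \<bar>E x\<bar>)"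
      let ?D = "JY x - (p 1 x * p 2 x) *\<^sub>R J x"
      have "\<bar>?D $ 1 $ 1\<bar> \<le> ?B"
        using ent[of "p1 1 x * p 2 x" "- (p 1 x * p1 2 x)" "p1 1 x * p1 2 x" "\<phi> x $ 1" "norm (\<phi> x)" "\<phi> x $ 2" "E x"] 
          M2 bp comp by (simp add: e11)
      moreover have "\<bar>?D $ 1 $ 2\<bar> \<le> ?B"
        using ent[of "p 1 x * p1 2 x" "p 1 x * p1 2 x" "p 1 x * p2 2 x" "\<phi> x $ 1" "norm (\<phi> x)" "\<phi> x $ 1" "E x"] 
          M2 bp comp by (simp add: e12)
      moreover have "\<bar>?D $ 2 $ 1\<bar> \<le> ?B"
        using ent[of "p1 1 x * p 2 x" "p1 1 x * p 2 x" "- (p2 1 x * p 2 x)" "\<phi> x $ 2" "norm (\<phi> x)" "\<phi> x $ 2" "E x"] 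
          M2 bp comp by (simp add: e21)
      moreover have "\<bar>?D $ 2 $ 2\<bar> \<le> ?B"
        using ent[of "p 1 x * p1 2 x" "- (p1 1 x * p 2 x)" "- (p1 1 x * p1 2 x)" "\<phi> x $ 2" "norm (\<phi> x)" "\<phi> x $ 1" "E x"] 
          M2 bp comp by (simp add: e22)
      ultimately show ?thesis using norm_mat2_le[of ?D] by linarith
    qed
    have JYout: "norm (JY x - (p 1 x * p 2 x) *\<^sub>R J x) = 0" if "x \<notin> Q" for x
    proof -
      have "JY x - (p 1 x * p 2 x) *\<^sub>R J x = 0" using outQ[OF that]
        by (auto simp: vec_eq_iff forall_2 e11 e12 e21 e22)
      then show ?thesis by simp
    qed
    have Q: "compact Q" "Q \<in> sets lebesgue" "Q \<in> sets borel" by (auto simp: Q_def square_def)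
    have cE: "continuous_on UNIV E" by (rule smooth_continuous_on[OF smE])
    have L2Q: "f \<in> L2 Q" "(\<integral>\<^sup>+x. ennreal ((norm (f x))\<^sup>2) * indicator Q x \<partial>lborel) = ennreal ((L2_norm Q f)\<^sup>2)"
      if "continuous_on UNIV f" for f :: "real^2 \<Rightarrow> 'b::euclidean_space"
    proof -
      have i: "integrable lborel (\<lambda>x. indicator Q x *\<^sub>R (norm (f x))\<^sup>2)"
        by (rule borel_integrable_compact[OF Q(1)]) (auto intro!: continuous_intros continuous_on_subset[OF that])
      then have i': "integrable lebesgue (\<lambda>x. indicator Q x *\<^sub>R (norm (f x))\<^sup>2)" by (subst integrable_completion) auto
      have m: "f \<in> borel_measurable (lebesgue_on Q)"
        using lebesgue_measurable_continuous[OF that] by (rule measurable_restrict_space1)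
      then show "f \<in> L2 Q" using i' Q by (simp add: L2_def integrable_restrict_space)
      have "(L2_norm Q f)\<^sup>2 = integral\<^sup>L lebesgue (\<lambda>x. indicator Q x *\<^sub>R (norm (f x))\<^sup>2)"
        using Q by (simp add: L2_norm_power2 integral_restrict_space)
      also have "\<dots> = integral\<^sup>L lborel (\<lambda>x. indicator Q x *\<^sub>R (norm (f x))\<^sup>2)"
        using i by (intro integral_completion) auto
      finally have "ennreal ((L2_norm Q f)\<^sup>2) = (\<integral>\<^sup>+x. ennreal (indicator Q x *\<^sub>R (norm (f x))\<^sup>2) \<partial>lborel)"
        using nn_integral_eq_integral[OF i] by simp
      also have "\<dots> = (\<integral>\<^sup>+x. ennreal ((norm (f x))\<^sup>2) * indicator Q x \<partial>lborel)"
        by (intro nn_integral_cong) (auto simp: indicator_def)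
      finally show "(\<integral>\<^sup>+x. ennreal ((norm (f x))\<^sup>2) * indicator Q x \<partial>lborel) = ennreal ((L2_norm Q f)\<^sup>2)" by simp
    qed
    have El: "L2_norm Q E \<le> 8 * R * L2_norm Q \<phi>"
    proof -
      have "ennreal ((L2_norm Q E)\<^sup>2) \<le> ennreal (16 * (2 * R)\<^sup>2) * ennreal ((L2_norm Q \<phi>)\<^sup>2)"
        using c L2Q(2)[OF cE] L2Q(2)[OF c\<phi>] by (simp add: E_def Q_def)
      also have "\<dots> = ennreal ((8 * R * L2_norm Q \<phi>)\<^sup>2)"
        by (simp add: ennreal_mult'[symmetric] power_mult_distrib)
      finally have "(L2_norm Q E)\<^sup>2 \<le> (8 * R * L2_norm Q \<phi>)\<^sup>2" by (simp add: ennreal_le_iff)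
      then show ?thesis by (rule power2_le_imp_le) (use R in simp)
    qed
    have lift: "L2_norm UNIV g \<le> a * L2_norm Q \<phi> + b * L2_norm Q E"
      if g: "continuous_on UNIV g" "\<And>x. norm (g x) \<le> a * norm (\<phi> x) + b * \<bar>E x\<bar>" "\<And>x. x \<notin> Q \<Longrightarrow> norm (g x) = 0" and ab: "a \<ge> 0" "b \<ge> 0"
      for g :: "real^2 \<Rightarrow> 'b::euclidean_space" and a b
    proof -
      define k where "k = (\<lambda>x. a * norm (\<phi> x) + b * \<bar>E x\<bar>)"
      have ck: "continuous_on UNIV k" unfolding k_def by (intro continuous_intros c\<phi> cE)
      have "L2_norm Q g \<le> 1 * L2_norm Q k"
        by (rule L2_bound(2)[OF L2_D(1)[OF L2Q(1)[OF g(1)]] L2Q(1)[OF ck]])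
          (auto intro!: AE_I2 order_trans[OF g(2)] simp: k_def)
      also have "L2_norm Q k \<le> L2_norm Q (\<lambda>x. a *\<^sub>R norm (\<phi> x)) + L2_norm Q (\<lambda>x. b *\<^sub>R \<bar>E x\<bar>)"
        unfolding k_def using L2_norm_triangle[OF L2Q(1) L2Q(1), of "\<lambda>x. a *\<^sub>R norm (\<phi> x)" "\<lambda>x. b *\<^sub>R \<bar>E x\<bar>"]
        by (simp add: continuous_intros c\<phi> cE)
      also have "\<dots> = a * L2_norm Q \<phi> + b * L2_norm Q E"
        unfolding L2_norm_scaleR using ab by (simp add: L2_norm_def)
      finally have "L2_norm Q g \<le> a * L2_norm Q \<phi> + b * L2_norm Q E" by simp
      moreover have "L2_norm Q g = L2_norm UNIV g"
        unfolding L2_norm_def using integrable_lebesgue_on_iff_supported(2)[OF Q(2), of "\<lambda>x. (norm (g x))\<^sup>2"] g(3)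
        by (simp add: lebesgue_on_UNIV_eq)
      ultimately show ?thesis by simp
    qed
    have M21: "M\<^sup>2 \<ge> 1" using M(1) by (simp add: one_le_power)
    have nY: "L2_norm UNIV Y \<le> (40 * M\<^sup>2 + 1) * L2_norm Q \<phi>"
    proof -
      have "norm (Y x) \<le> 2 * M\<^sup>2 * norm (\<phi> x) + 2 * r * M\<^sup>2 * \<bar>E x\<bar>" for x
      proof -
        have *: "\<bar>a * u\<bar> \<le> M\<^sup>2 * norm (\<phi> x)" if "\<bar>a\<bar> \<le> M\<^sup>2" "\<bar>u\<bar> \<le> norm (\<phi> x)" for a u
          unfolding abs_mult using that by (auto intro!: mult_mono)
        have **: "\<bar>E x * (r * d)\<bar> \<le> r * M\<^sup>2 * \<bar>E x\<bar>" if "\<bar>d\<bar> \<le> M\<^sup>2" for d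
          using mult_left_mono[OF that, of "r * \<bar>E x\<bar>"] r by (simp add: abs_mult mult_ac)
        have "norm (Y x) \<le> \<bar>y1 x\<bar> + \<bar>y2 x\<bar>" unfolding Y_def by (rule norm_vec2_le)
        also have "\<bar>y1 x\<bar> \<le> M\<^sup>2 * norm (\<phi> x) + r * M\<^sup>2 * \<bar>E x\<bar>"
          unfolding y1_def
          using *[OF M2[OF bp(1) bp(1)] comp, of 1 x 2 x 1] **[OF M2[OF bp(1) bp(2)], of 1 x 2 x]
          by linarith
        also have "\<bar>y2 x\<bar> \<le> M\<^sup>2 * norm (\<phi> x) + r * M\<^sup>2 * \<bar>E x\<bar>"
          unfolding y2_def 
          using *[OF M2[OF bp(1) bp(1)] comp, of 1 x 2 x 2] **[OF M2[OF bp(2) bp(1)], of 1 x 2 x]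
          by linarith
        finally show ?thesis by (simp add: algebra_simps)
      qed
      then have "L2_norm UNIV Y \<le> 2 * M\<^sup>2 * L2_norm Q \<phi> + 2 * r * M\<^sup>2 * L2_norm Q E"
        by (intro lift smooth_continuous_on[OF smY]) (use outY r in auto)
      also have "\<dots> \<le> 2 * M\<^sup>2 * L2_norm Q \<phi> + 2 * r * M\<^sup>2 * (8 * R * L2_norm Q \<phi>)"
        using El r by (intro add_left_mono mult_left_mono) auto
      also have "\<dots> = 18 * M\<^sup>2 * L2_norm Q \<phi>" using R by (simp add: r_def field_simps)
      also have "\<dots> \<le> (40 * M\<^sup>2 + 1) * L2_norm Q \<phi>" by (intro mult_right_mono) auto
      finally show ?thesis .
    qed
    have cJ: "continuous_on UNIV J" "continuous_on UNIV JY"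
      unfolding J_def JY_def by (rule continuous_on_jacobian[OF sm] continuous_on_jacobian[OF smY])+
    have cp: "continuous_on UNIV (p i)" for i by (rule smooth_continuous_on[OF sp(1)])
    have nJ: "L2_norm UNIV (\<lambda>x. JY x - J x) \<le> (40 * M\<^sup>2 + 1) / R * L2_norm Q \<phi> + L2_norm (- ball 0 R) J"
    proof -
      have supp: "supp \<phi> \<subseteq> K" by (rule supp_subset) (use K compact_imp_closed in auto)
      have J0: "J x = 0" if "x \<notin> K" for x
        using jacobian_outside_supp[of x \<phi>] subsetD[OF supp, of x] that by (auto simp: J_def)
      define U where "U = (\<lambda>x. JY x - (p 1 x * p 2 x) *\<^sub>R J x)"
      define V where "V = (\<lambda>x. (1 - p 1 x * p 2 x) *\<^sub>R J x)"
      have cU: "continuous_on UNIV U" and cV: "continuous_on UNIV V" unfolding U_def V_def by (intro continuous_intros cJ cp)+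
      have lU: "U \<in> L2 UNIV" by (rule L2_continuous_compact_support[OF cU Q(1)]) (use JYout in \<open>auto simp: U_def\<close>)
      have lV: "V \<in> L2 UNIV" by (rule L2_continuous_compact_support[OF cV K(1)]) (use J0 in \<open>auto simp: V_def\<close>)
      have lJ: "J \<in> L2 UNIV" by (rule L2_continuous_compact_support[OF cJ(1) K(1) J0]) auto
      have "L2_norm UNIV (\<lambda>x. JY x - J x) = L2_norm UNIV (\<lambda>x. U x - V x)"
        by (simp add: U_def V_def algebra_simps)
      also have "\<dots> \<le> L2_norm UNIV U + L2_norm UNIV V" by (rule L2_norm_triangle_diff[OF lU lV])
      also have "L2_norm UNIV V \<le> L2_norm (- ball 0 R) J"
      proof -
        have S: "- ball 0 R \<in> sets (lebesgue :: (real^2) measure)" by auto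
        have V0: "V x = 0" if "x \<notin> - ball 0 R" for x using in1[of x] that by (simp add: V_def)
        have "L2_norm UNIV V = L2_norm (- ball 0 R) V"
          unfolding L2_norm_def using integrable_lebesgue_on_iff_supported(2)[OF S, of "\<lambda>x. (norm (V x))\<^sup>2"] V0
          by (simp add: lebesgue_on_UNIV_eq)
        also have "\<dots> \<le> 1 * L2_norm (- ball 0 R) J"
        proof (rule L2_bound(2))
          show "V \<in> borel_measurable (lebesgue_on (- ball 0 R))" using L2_D(1)[OF L2_subset_norm(1)[OF lV _ S]] by auto
          show "J \<in> L2 (- ball 0 R)" by (rule L2_subset_norm(1)[OF lJ _ S]) auto
          show "AE x in lebesgue_on (- ball 0 R). norm (V x) \<le> 1 * norm (J x)"
          proof (rule AE_I2)
            fix x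
            have "0 \<le> p 1 x * p 2 x" "p 1 x * p 2 x \<le> 1" using plateau_range by (auto simp: p_def mult_le_one)
            then show "norm (V x) \<le> 1 * norm (J x)" by (auto simp: V_def intro!: mult_left_le_one_le)
          qed
        qed simp
        finally show ?thesis by simp
      qed
      also have "L2_norm UNIV U \<le> 8 * r * M\<^sup>2 * L2_norm Q \<phi> + 4 * r\<^sup>2 * M\<^sup>2 * L2_norm Q E"
      proof (rule lift[OF cU])
        show "norm (U x) \<le> 8 * r * M\<^sup>2 * norm (\<phi> x) + 4 * r\<^sup>2 * M\<^sup>2 * \<bar>E x\<bar>" for x
          using JYbound[of x] by (simp add: U_def algebra_simps)
        show "norm (U x) = 0" if "x \<notin> Q" for x using JYout[OF that] by (simp add: U_def)
      qed (use r in auto)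
      also have "\<dots> \<le> 8 * r * M\<^sup>2 * L2_norm Q \<phi> + 4 * r\<^sup>2 * M\<^sup>2 * (8 * R * L2_norm Q \<phi>)"
        using El r by (intro add_left_mono mult_left_mono) auto
      also have "\<dots> = 40 * M\<^sup>2 / R * L2_norm Q \<phi>" using R by (simp add: r_def field_simps power2_eq_square)
      also have "\<dots> \<le> (40 * M\<^sup>2 + 1) / R * L2_norm Q \<phi>"
        using R by (intro mult_right_mono divide_right_mono) auto
      finally show ?thesis by simp
    qed
    show "\<exists>Y. smooth Y \<and> (\<forall>x. divergence Y x = 0) \<and> (\<forall>x\<in>ball 0 R. Y x = \<phi> x) \<and> (\<forall>x. x \<notin> square (2 * R) \<longrightarrow> Y x = 0) \<and>
        L2_norm UNIV Y \<le> (40 * M\<^sup>2 + 1) * L2_norm (square (2 * R)) \<phi> \<and>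
        L2_norm UNIV (\<lambda>x. jacobian Y (at x) - jacobian \<phi> (at x))
          \<le> (40 * M\<^sup>2 + 1) / R * L2_norm (square (2 * R)) \<phi> + L2_norm (- ball 0 R) (\<lambda>x. jacobian \<phi> (at x))"
      using smY divY eqY outY nY nJ unfolding Q_def J_def JY_def by (intro exI[of _ Y]) blast
  qed
qed

section \<open>Approximation by test fields\<close>

lemma C0_sigmaD:
  assumes "\<phi> \<in> C0_sigma \<Omega>"
  shows "\<phi> \<in> test_functions \<Omega>" "smooth \<phi>" "compact (supp \<phi>)" "supp \<phi> \<subseteq> \<Omega>" "\<And>x. divergence \<phi> x = 0"
    "\<And>x. x \<notin> supp \<phi> \<Longrightarrow> \<phi> x = 0" "\<And>x. x \<notin> \<Omega> \<Longrightarrow> \<phi> x = 0"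
  using assms supp_outside[of _ \<phi>] by (auto simp: C0_sigma_def test_functionsD)

lemma C0_sigma_L2:
  assumes "\<phi> \<in> C0_sigma \<Omega>" "S \<in> sets lebesgue"
  shows "\<phi> \<in> L2 S" "(\<lambda>x. jacobian \<phi> (at x)) \<in> L2 S"
proof -
  show "\<phi> \<in> L2 S"
    by (rule L2_continuous_compact_support[OF smooth_continuous_on[OF C0_sigmaD(2)[OF assms(1)]] C0_sigmaD(3)[OF assms(1)] C0_sigmaD(6)[OF assms(1)] assms(2)])
  show "(\<lambda>x. jacobian \<phi> (at x)) \<in> L2 S"
    by (rule L2_continuous_compact_support[OF continuous_on_jacobian[OF C0_sigmaD(2)[OF assms(1)]] C0_sigmaD(3)[OF assms(1)] jacobian_outside_supp assms(2)])
qed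

lemma jacobian_add:
  fixes f g :: "real^'n \<Rightarrow> real^'m"
  assumes "f differentiable (at x)" "g differentiable (at x)"
  shows "jacobian (\<lambda>x. f x + g x) (at x) = jacobian f (at x) + jacobian g (at x)"
proof -
  have "((\<lambda>x. f x + g x) has_derivative (\<lambda>h. frechet_derivative f (at x) h + frechet_derivative g (at x) h)) (at x)"
    by (intro has_derivative_add) (use assms frechet_derivative_works in auto)
  from frechet_derivative_at[OF this]
  have "frechet_derivative (\<lambda>x. f x + g x) (at x) = (\<lambda>h. frechet_derivative f (at x) h + frechet_derivative g (at x) h)" by simp
  then show ?thesis by (simp add: vec_eq_iff jacobian_nth)
qed

lemma jacobian_uminus:
  fixes f :: "real^'n \<Rightarrow> real^'m"
  assumes "f differentiable (at x)"
  shows "jacobian (\<lambda>x. - f x) (at x) = - jacobian f (at x)"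
proof -
  have "((\<lambda>x. - f x) has_derivative (\<lambda>h. - frechet_derivative f (at x) h)) (at x)"
    by (intro has_derivative_minus) (use assms frechet_derivative_works in auto)
  from frechet_derivative_at[OF this]
  have "frechet_derivative (\<lambda>x. - f x) (at x) = (\<lambda>h. - frechet_derivative f (at x) h)" by simp
  then show ?thesis by (simp add: vec_eq_iff jacobian_nth)
qed

lemma jacobian_reflect:
  fixes f :: "real^'n \<Rightarrow> real^'m"
  assumes "f differentiable (at (- x))"
  shows "jacobian (\<lambda>x. f (- x)) (at x) = - jacobian f (at (- x))"
proof -
  have D: "(f has_derivative frechet_derivative f (at (- x))) (at (- x))" using assms frechet_derivative_works by blast
  have "((\<lambda>x. f (- x)) has_derivative (\<lambda>h. frechet_derivative f (at (- x)) (- h))) (at x)"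
    by (rule has_derivative_compose[where f="\<lambda>x. - x" and f'="\<lambda>h. - h" and g=f, OF _ D]) (auto intro!: derivative_eq_intros)
  from frechet_derivative_at[OF this]
  have "frechet_derivative (\<lambda>x. f (- x)) (at x) = (\<lambda>h. - frechet_derivative f (at (- x)) h)"
    using linear_neg[OF has_derivative_linear[OF D]] by (metis)
  then show ?thesis by (simp add: vec_eq_iff jacobian_nth)
qed

lemma C0_sigmaI:
  assumes "smooth \<phi>" "\<And>x. divergence \<phi> x = 0" "compact K" "K \<subseteq> \<Omega>" "\<And>x. x \<notin> K \<Longrightarrow> \<phi> x = 0"
  shows "\<phi> \<in> C0_sigma \<Omega>"
  using test_functionsI[OF assms(1,3,4,5)] assms(2) by (simp add: C0_sigma_def)

lemma C0_sigma_add: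
  assumes "\<phi> \<in> C0_sigma \<Omega>" "\<psi> \<in> C0_sigma \<Omega>" shows "(\<lambda>x. \<phi> x + \<psi> x) \<in> C0_sigma \<Omega>"
proof (rule C0_sigmaI[where K="supp \<phi> \<union> supp \<psi>"])
  note a = C0_sigmaD[OF assms(1)] and b = C0_sigmaD[OF assms(2)]
  show "divergence (\<lambda>x. \<phi> x + \<psi> x) x = 0" for x
    using a(5)[of x] b(5)[of x] jacobian_add[OF smooth_differentiable[OF a(2)] smooth_differentiable[OF b(2)], of x]
    by (simp add: jacobian_divergence2)
  show "smooth (\<lambda>x. \<phi> x + \<psi> x)" "compact (supp \<phi> \<union> supp \<psi>)" "supp \<phi> \<union> supp \<psi> \<subseteq> \<Omega>"
    using a b by (auto intro: smooth_add)
  show "\<phi> x + \<psi> x = 0" if "x \<notin> supp \<phi> \<union> supp \<psi>" for x using a(6) b(6) that by simp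
qed

lemma C0_sigma_uminus:
  assumes "\<phi> \<in> C0_sigma \<Omega>" shows "(\<lambda>x. - \<phi> x) \<in> C0_sigma \<Omega>"
proof (rule C0_sigmaI[where K="supp \<phi>"])
  note a = C0_sigmaD[OF assms]
  show "divergence (\<lambda>x. - \<phi> x) x = 0" for x
    using a(5)[of x] jacobian_uminus[OF smooth_differentiable[OF a(2)], of x]
    by (simp add: jacobian_divergence2)
qed (use C0_sigmaD[OF assms] in \<open>auto intro: smooth_uminus\<close>)

lemma C0_sigma_reflect:
  assumes "\<phi> \<in> C0_sigma \<Omega>" "uminus ` \<Omega> = \<Omega>" shows "(\<lambda>x. \<phi> (- x)) \<in> C0_sigma \<Omega>"
proof (rule C0_sigmaI[where K="uminus ` supp \<phi>"])
  note a = C0_sigmaD[OF assms(1)]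
  show "divergence (\<lambda>x. \<phi> (- x)) x = 0" for x
    using a(5)[of "- x"] jacobian_reflect[OF smooth_differentiable[OF a(2)], of x]
    by (simp add: jacobian_divergence2)
  show "smooth (\<lambda>x. \<phi> (- x))"
    by (rule smooth_affine[OF _ a(2)]) (auto intro!: derivative_eq_intros)
  show "compact (uminus ` supp \<phi>)" using a(3) by (rule compact_negations)
  show "uminus ` supp \<phi> \<subseteq> \<Omega>" using a(4) assms(2) by blast
  show "\<phi> (- x) = 0" if "x \<notin> uminus ` supp \<phi>" for x
  proof (rule a(6))
    show "- x \<notin> supp \<phi>" using that by (metis image_eqI minus_minus)
  qed
qed

lemma L2_norm_subset_supported:
  assumes "S \<in> sets lebesgue" "T \<in> sets lebesgue" "T \<subseteq> S" "\<And>x. x \<in> S - T \<Longrightarrow> f x = 0"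
  shows "L2_norm S f = L2_norm T f"
proof -
  have "(\<lambda>x. indicator S x *\<^sub>R (norm (f x))\<^sup>2) = (\<lambda>x. indicator T x *\<^sub>R (norm (f x))\<^sup>2)"
    using assms(3,4) by (intro ext) (auto simp: indicator_def)
  then show ?thesis using assms(1,2) by (simp add: L2_norm_def integral_restrict_space)
qed

lemma H1_dot_norm_diff:
  assumes op: "open \<Omega>" and G: "has_weak_gradient \<Omega> a G" "has_weak_gradient \<Omega> b H"
  shows "H1_dot_norm \<Omega> (\<lambda>x. a x - b x) = L2_norm \<Omega> (\<lambda>x. G x - H x)"
proof -
  note D = weak_gradient_diff[OF op G]
  have W: "has_weak_gradient \<Omega> (\<lambda>x. a x - b x) (wgrad \<Omega> (\<lambda>x. a x - b x))"
    unfolding wgrad_def using D by (rule someI[of "has_weak_gradient \<Omega> (\<lambda>x. a x - b x)"])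
  have m: "wgrad \<Omega> (\<lambda>x. a x - b x) \<in> borel_measurable (lebesgue_on \<Omega>)" "(\<lambda>x. G x - H x) \<in> borel_measurable (lebesgue_on \<Omega>)"
    using L1_loc_measurable[OF op] W D by (auto simp: has_weak_gradient_def)
  show ?thesis unfolding H1_dot_norm_def
    by (rule L2_norm_cong_AE[OF m weak_gradient_unique[OF op W D]])
qed

lemma L2_norm_tail:
  assumes \<Omega>: "\<Omega> \<in> sets lebesgue" "- \<Omega> \<subseteq> ball 0 R0" and G: "G \<in> L2 \<Omega>"
  shows "(\<lambda>n. L2_norm (- ball 0 (R0 + real n)) G) \<longlonglongrightarrow> 0"
proof -
  have sub: "- ball 0 (R0 + real n) \<subseteq> \<Omega>" for n using \<Omega>(2) by (force simp: subset_eq)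
  have S: "- ball 0 (R0 + real n) \<in> sets (lebesgue :: (real^2) measure)" for n by auto
  have i: "integrable lebesgue (\<lambda>x. indicator \<Omega> x *\<^sub>R (norm (G x))\<^sup>2)"
    using L2_D(2)[OF G] \<Omega>(1) by (simp add: integrable_restrict_space)
  have eq: "indicator (- ball 0 (R0 + real n)) x *\<^sub>R (norm (G x))\<^sup>2
      = indicator (- ball 0 (R0 + real n)) x *\<^sub>R (indicator \<Omega> x *\<^sub>R (norm (G x))\<^sup>2)" for n x
    using sub[of n] by (auto simp: indicator_def)
  have "(\<lambda>n. integral\<^sup>L lebesgue (\<lambda>x. indicator (- ball 0 (R0 + real n)) x *\<^sub>R (norm (G x))\<^sup>2)) \<longlonglongrightarrow> integral\<^sup>L lebesgue (\<lambda>x::real^2. 0::real)"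
  proof (rule integral_dominated_convergence[OF _ _ i])
    show "(\<lambda>x. indicator (- ball 0 (R0 + real n)) x *\<^sub>R (norm (G x))\<^sup>2) \<in> borel_measurable lebesgue" for n
      unfolding eq by (rule borel_measurable_scaleR[OF borel_measurable_indicator[OF S] borel_measurable_integrable[OF i]])
    show "AE x in lebesgue. (\<lambda>n. indicator (- ball 0 (R0 + real n)) x *\<^sub>R (norm (G x))\<^sup>2) \<longlonglongrightarrow> 0"
    proof (rule AE_I2)
      fix x :: "real^2"
      obtain N where N: "norm x - R0 < real N" using reals_Archimedean2 by blast
      have "\<forall>\<^sub>F n in sequentially. indicator (- ball 0 (R0 + real n)) x *\<^sub>R (norm (G x))\<^sup>2 = 0"
        using eventually_ge_at_top[of N] by eventually_elim (use N in \<open>auto simp: indicator_def\<close>)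
      then show "(\<lambda>n. indicator (- ball 0 (R0 + real n)) x *\<^sub>R (norm (G x))\<^sup>2) \<longlonglongrightarrow> 0"
        by (rule tendsto_eventually)
    qed
    show "AE x in lebesgue. norm (indicator (- ball 0 (R0 + real n)) x *\<^sub>R (norm (G x))\<^sup>2) \<le> indicator \<Omega> x *\<^sub>R (norm (G x))\<^sup>2" for n
      using sub[of n] by (intro AE_I2) (auto simp: indicator_def)
  qed auto
  then have "(\<lambda>n. sqrt (integral\<^sup>L lebesgue (\<lambda>x. indicator (- ball 0 (R0 + real n)) x *\<^sub>R (norm (G x))\<^sup>2))) \<longlonglongrightarrow> sqrt 0"
    by (intro tendsto_real_sqrt) simp
  moreover have "L2_norm (- ball 0 (R0 + real n)) G = sqrt (integral\<^sup>L lebesgue (\<lambda>x. indicator (- ball 0 (R0 + real n)) x *\<^sub>R (norm (G x))\<^sup>2))" for n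
    unfolding L2_norm_def by (subst integral_restrict_space) (use S in auto)
  ultimately show ?thesis by simp
qed

text \<open>Approximants for the gradient norm converge in \<open>L2\<close> only locally. Cutting them off at a large radius
  \<open>R\<close> changes the gradient, apart from its tail, by at most \<open>A / R\<close> times the norm on a square of size \<open>R\<close>,
  which is bounded as \<open>w\<close> is in \<open>L2\<close>, but the cutoff itself costs the factor \<open>A\<close> in the \<open>L2\<close> norm.\<close>

lemma H1_dot_0_sigma_approx:
  assumes op: "open \<Omega>" and R0: "- \<Omega> \<subseteq> ball 0 R0" "R0 > 0"
  obtains A where "A > 0"
    "\<And>w \<epsilon>. w \<in> H1_dot_0_sigma \<Omega> \<Longrightarrow> w \<in> L2 \<Omega> \<Longrightarrow> \<epsilon> > 0 \<Longrightarrow>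
      \<exists>Y\<in>C0_sigma \<Omega>. L2_norm \<Omega> Y \<le> A * L2_norm \<Omega> w + \<epsilon> \<and> L2_norm \<Omega> (\<lambda>x. jacobian Y (at x) - wgrad \<Omega> w x) \<le> \<epsilon>"
proof -
  have \<Omega>: "\<Omega> \<in> sets lebesgue" using op by auto
  obtain A where A: "A > 0" and cut: "\<And>(\<phi> :: real^2 \<Rightarrow> real^2) K R. smooth \<phi> \<Longrightarrow> (\<And>x. divergence \<phi> x = 0) \<Longrightarrow> compact K \<Longrightarrow>
       (\<And>x. x \<notin> K \<Longrightarrow> \<phi> x = 0) \<Longrightarrow> R > 0 \<Longrightarrow>
     \<exists>Y. smooth Y \<and> (\<forall>x. divergence Y x = 0) \<and> (\<forall>x\<in>ball 0 R. Y x = \<phi> x) \<and> (\<forall>x. x \<notin> square (2 * R) \<longrightarrow> Y x = 0) \<and>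
        L2_norm UNIV Y \<le> A * L2_norm (square (2 * R)) \<phi> \<and>
        L2_norm UNIV (\<lambda>x. jacobian Y (at x) - jacobian \<phi> (at x))
          \<le> A / R * L2_norm (square (2 * R)) \<phi> + L2_norm (- ball 0 R) (\<lambda>x. jacobian \<phi> (at x))"
    by (rule solenoidal_cutoff) blast
  show ?thesis
  proof (rule that[OF A])
    fix w and \<epsilon> :: real assume w: "w \<in> H1_dot_0_sigma \<Omega>" "w \<in> L2 \<Omega>" and \<epsilon>: "\<epsilon> > 0"
    define G where "G = wgrad \<Omega> w"
    have wH: "w \<in> H1_dot \<Omega>" using w by (simp add: H1_dot_0_sigma_def)
    note G = H1_dot_wgrad[OF op wH, folded G_def]
    obtain \<phi> where \<phi>: "\<And>n. \<phi> n \<in> C0_sigma \<Omega>" "(\<lambda>n. H1_dot_norm \<Omega> (\<lambda>x. \<phi> n x - w x)) \<longlonglongrightarrow> 0"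
        "\<And>R. R > 0 \<Longrightarrow> (\<lambda>n. L2_norm (\<Omega> \<inter> ball 0 R) (\<lambda>x. \<phi> n x - w x)) \<longlonglongrightarrow> 0"
      using w(1) unfolding H1_dot_0_sigma_def by blast
    define n where "n = L2_norm \<Omega> w"
    have n0: "n \<ge> 0" by (simp add: n_def)
    have "\<forall>\<^sub>F k in sequentially. L2_norm (- ball 0 (R0 + real k)) G < \<epsilon> / 4"
      using L2_norm_tail[OF \<Omega> R0(1) G(2)] \<epsilon> by (intro order_tendstoD(2)) auto
    moreover have "\<forall>\<^sub>F k in sequentially. A / (R0 + real k) * (n + 1) < \<epsilon> / 4"
    proof (rule order_tendstoD(2))
      have "filterlim (\<lambda>k. R0 + real k) at_top sequentially"
        by (intro filterlim_tendsto_add_at_top[OF tendsto_const] filterlim_real_sequentially)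
      then have "(\<lambda>k. A / (R0 + real k)) \<longlonglongrightarrow> 0" by (intro real_tendsto_divide_at_top[OF tendsto_const])
      then show "(\<lambda>k. A / (R0 + real k) * (n + 1)) \<longlonglongrightarrow> 0" by (rule tendsto_mult_left_zero)
    qed (use \<epsilon> in auto)
    ultimately have "\<forall>\<^sub>F k in sequentially. L2_norm (- ball 0 (R0 + real k)) G < \<epsilon> / 4 \<and> A / (R0 + real k) * (n + 1) < \<epsilon> / 4"
      by (rule eventually_conj)
    then obtain k where k: "L2_norm (- ball 0 (R0 + real k)) G < \<epsilon> / 4" "A / (R0 + real k) * (n + 1) < \<epsilon> / 4"
      using eventually_happens by fastforce
    define R where "R = R0 + real k"
    have R: "R > 0" "R \<ge> R0" using R0(2) by (auto simp: R_def)
    have "\<forall>\<^sub>F m in sequentially. H1_dot_norm \<Omega> (\<lambda>x. \<phi> m x - w x) < \<epsilon> / 4"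
      using \<phi>(2) \<epsilon> by (intro order_tendstoD(2)) auto
    moreover have "\<forall>\<^sub>F m in sequentially. L2_norm (\<Omega> \<inter> ball 0 (5 * R)) (\<lambda>x. \<phi> m x - w x) < min 1 (\<epsilon> / A)"
      using \<phi>(3)[of "5 * R"] \<epsilon> A R by (intro order_tendstoD(2)) auto
    ultimately have "\<forall>\<^sub>F m in sequentially. H1_dot_norm \<Omega> (\<lambda>x. \<phi> m x - w x) < \<epsilon> / 4 \<and> L2_norm (\<Omega> \<inter> ball 0 (5 * R)) (\<lambda>x. \<phi> m x - w x) < min 1 (\<epsilon> / A)"
      by (rule eventually_conj)
    then obtain m where m: "H1_dot_norm \<Omega> (\<lambda>x. \<phi> m x - w x) < \<epsilon> / 4" "L2_norm (\<Omega> \<inter> ball 0 (5 * R)) (\<lambda>x. \<phi> m x - w x) < min 1 (\<epsilon> / A)"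
      using eventually_happens by fastforce
    define \<psi> where "\<psi> = \<phi> m"
    define J where "J = (\<lambda>x. jacobian \<psi> (at x))"
    have \<psi>: "\<psi> \<in> C0_sigma \<Omega>" using \<phi>(1) by (simp add: \<psi>_def)
    note \<psi>' = C0_sigmaD[OF \<psi>]
    have JL: "J \<in> L2 \<Omega>" unfolding J_def by (rule C0_sigma_L2(2)[OF \<psi> \<Omega>])
    have JG: "L2_norm \<Omega> (\<lambda>x. J x - G x) < \<epsilon> / 4"
      using m(1) H1_dot_norm_diff[OF op weak_gradient_jacobian[OF op \<psi>'(2)] G(1)] by (simp add: \<psi>_def J_def)
    obtain Y where Y: "smooth Y" "\<And>x. divergence Y x = 0" "\<And>x. x \<in> ball 0 R \<Longrightarrow> Y x = \<psi> x" "\<And>x. x \<notin> square (2 * R) \<Longrightarrow> Y x = 0"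
        "L2_norm UNIV Y \<le> A * L2_norm (square (2 * R)) \<psi>"
        "L2_norm UNIV (\<lambda>x. jacobian Y (at x) - J x) \<le> A / R * L2_norm (square (2 * R)) \<psi> + L2_norm (- ball 0 R) J"
      using cut[OF \<psi>'(2) \<psi>'(5) \<psi>'(3) \<psi>'(6) R(1)] unfolding J_def by blast
    have sq5: "square (2 * R) \<subseteq> ball 0 (5 * R)"
    proof
      fix x assume "x \<in> square (2 * R)"
      then have "norm x \<le> 4 * R" using norm_le_l1_cart[of x] by (simp add: square_iff sum_2)
      then show "x \<in> ball 0 (5 * R)" using R(1) by simp
    qed
    have outR: "- ball 0 R \<subseteq> \<Omega>" using R0(1) R(2) by (force simp: subset_eq)
    have C0: "Y \<in> C0_sigma \<Omega>"
    proof (rule C0_sigmaI[OF Y(1,2)])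
      show "compact (supp \<psi> \<union> (square (2 * R) - ball 0 R))" using \<psi>'(3) by (auto intro!: compact_Un compact_diff simp: square_def)
      show "supp \<psi> \<union> (square (2 * R) - ball 0 R) \<subseteq> \<Omega>" using \<psi>'(4) outR by auto
      show "Y x = 0" if "x \<notin> supp \<psi> \<union> (square (2 * R) - ball 0 R)" for x
        using that Y(3,4)[of x] \<psi>'(6)[of x] by (cases "x \<in> ball 0 R") auto
    qed
    have S5: "\<Omega> \<inter> ball 0 (5 * R) \<in> sets lebesgue" using op by auto
    have w5: "w \<in> L2 (\<Omega> \<inter> ball 0 (5 * R))" "L2_norm (\<Omega> \<inter> ball 0 (5 * R)) w \<le> n"
      using L2_subset_norm[OF w(2) _ S5 \<Omega>] by (auto simp: n_def)
    have nQ: "L2_norm (square (2 * R)) \<psi> \<le> n + L2_norm (\<Omega> \<inter> ball 0 (5 * R)) (\<lambda>x. \<psi> x - w x)"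
    proof -
      have "L2_norm (square (2 * R)) \<psi> = L2_norm (\<Omega> \<inter> square (2 * R)) \<psi>"
        by (rule L2_norm_subset_supported) (use \<Omega> \<psi>'(7) in \<open>auto simp: square_def\<close>)
      also have "\<dots> \<le> L2_norm (\<Omega> \<inter> ball 0 (5 * R)) \<psi>"
        by (rule L2_subset_norm(2)[OF C0_sigma_L2(1)[OF \<psi> S5] _ _ S5]) (use sq5 \<Omega> in \<open>auto simp: square_def\<close>)
      also have "\<dots> = L2_norm (\<Omega> \<inter> ball 0 (5 * R)) (\<lambda>x. w x + (\<psi> x - w x))" by simp
      also have "\<dots> \<le> L2_norm (\<Omega> \<inter> ball 0 (5 * R)) w + L2_norm (\<Omega> \<inter> ball 0 (5 * R)) (\<lambda>x. \<psi> x - w x)"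
        by (rule L2_norm_triangle[OF w5(1) L2_diff[OF C0_sigma_L2(1)[OF \<psi> S5] w5(1)]])
      finally show ?thesis using w5(2) by linarith
    qed
    have le1: "L2_norm (square (2 * R)) \<psi> \<le> n + 1" and le2: "A * L2_norm (square (2 * R)) \<psi> \<le> A * n + \<epsilon>"
    proof -
      have m': "L2_norm (\<Omega> \<inter> ball 0 (5 * R)) (\<lambda>x. \<psi> x - w x) < 1" "L2_norm (\<Omega> \<inter> ball 0 (5 * R)) (\<lambda>x. \<psi> x - w x) < \<epsilon> / A"
        using m(2) by (auto simp: \<psi>_def)
      show "L2_norm (square (2 * R)) \<psi> \<le> n + 1" using nQ m'(1) by linarith
      have "L2_norm (square (2 * R)) \<psi> \<le> n + \<epsilon> / A" using nQ m'(2) by linarith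
      from mult_left_mono[OF this, of A] show "A * L2_norm (square (2 * R)) \<psi> \<le> A * n + \<epsilon>" using A by (simp add: distrib_left)
    qed
    have YU: "Y \<in> L2 UNIV" "(\<lambda>x. jacobian Y (at x)) \<in> L2 UNIV" "J \<in> L2 UNIV"
      using C0_sigma_L2[OF C0] C0_sigma_L2(2)[OF \<psi>] by (auto simp: J_def)
    have 1: "L2_norm \<Omega> Y \<le> A * n + \<epsilon>"
      using L2_subset_norm(2)[OF YU(1) _ \<Omega>] Y(5) le2 by auto
    have "L2_norm \<Omega> (\<lambda>x. jacobian Y (at x) - G x) \<le> L2_norm \<Omega> (\<lambda>x. jacobian Y (at x) - J x) + L2_norm \<Omega> (\<lambda>x. J x - G x)"
      by (rule L2_norm_triangle3[OF C0_sigma_L2(2)[OF C0 \<Omega>] JL G(2)])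
    also have "L2_norm \<Omega> (\<lambda>x. jacobian Y (at x) - J x) \<le> L2_norm UNIV (\<lambda>x. jacobian Y (at x) - J x)"
      using L2_subset_norm(2)[OF L2_diff[OF YU(2,3)] _ \<Omega>] by auto
    also have "\<dots> \<le> A / R * (n + 1) + L2_norm (- ball 0 R) J"
      using Y(6) mult_left_mono[OF le1, of "A / R"] A R(1) by simp
    also have "L2_norm (- ball 0 R) J \<le> L2_norm (- ball 0 R) (\<lambda>x. J x - G x) + L2_norm (- ball 0 R) G"
    proof -
      have S: "- ball 0 R \<in> sets (lebesgue :: (real^2) measure)" by auto
      have "J \<in> L2 (- ball 0 R)" "G \<in> L2 (- ball 0 R)"
        using L2_subset_norm(1)[OF JL outR S \<Omega>] L2_subset_norm(1)[OF G(2) outR S \<Omega>] by auto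
      then show ?thesis using L2_norm_triangle[OF L2_diff, of J "- ball 0 R" G G] by simp
    qed
    also have "L2_norm (- ball 0 R) (\<lambda>x. J x - G x) \<le> L2_norm \<Omega> (\<lambda>x. J x - G x)"
      by (rule L2_subset_norm(2)[OF L2_diff[OF JL G(2)] outR _ \<Omega>]) auto
    finally have "L2_norm \<Omega> (\<lambda>x. jacobian Y (at x) - G x) \<le> \<epsilon>"
      using JG k unfolding R_def[symmetric] by linarith
    then show "\<exists>Y\<in>C0_sigma \<Omega>. L2_norm \<Omega> Y \<le> A * L2_norm \<Omega> w + \<epsilon> \<and> L2_norm \<Omega> (\<lambda>x. jacobian Y (at x) - wgrad \<Omega> w x) \<le> \<epsilon>"
      using C0 1 unfolding G_def n_def by blast
  qed
qed

text \<open>The closure of the test fields for the norm of \<open>L2\<close> of the field together with its gradient, as a relation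
  between a field and its gradient. Inequalities and identities for test fields pass to such pairs.\<close>

definition solenoidal_H1_0 :: "(real^2) set \<Rightarrow> (real^2 \<Rightarrow> real^2) \<Rightarrow> (real^2 \<Rightarrow> real^2^2) \<Rightarrow> bool" where
  "solenoidal_H1_0 \<Omega> w G \<longleftrightarrow> w \<in> L2 \<Omega> \<and> G \<in> L2 \<Omega> \<and> (\<exists>\<phi>. (\<forall>n. \<phi> n \<in> C0_sigma \<Omega>) \<and>
     (\<lambda>n. L2_norm \<Omega> (\<lambda>x. \<phi> n x - w x)) \<longlonglongrightarrow> 0 \<and>
     (\<lambda>n. L2_norm \<Omega> (\<lambda>x. jacobian (\<phi> n) (at x) - G x)) \<longlonglongrightarrow> 0)"

text \<open>Apply the approximation to \<open>w - \<psi>\<close> with a test field \<open>\<psi>\<close> close to \<open>w\<close> in \<open>L2\<close>: then \<open>A\<close> times the \<open>L2\<close> norm is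
  small as well.\<close>

lemma solenoidal_H1_0_wgrad:
  assumes op: "open \<Omega>" and bd: "bounded (- \<Omega>)"
    and w: "w \<in> L2_sigma \<Omega>" "w \<in> H1_dot_0_sigma \<Omega>"
  shows "solenoidal_H1_0 \<Omega> w (wgrad \<Omega> w)"
proof -
  have \<Omega>: "\<Omega> \<in> sets lebesgue" using op by auto
  obtain R0 where R0: "R0 > 0" "- \<Omega> \<subseteq> ball 0 R0" using bounded_subset_ballD[OF bd, of 0] by blast
  obtain A where A: "A > 0" and approx: "\<And>w \<epsilon>. w \<in> H1_dot_0_sigma \<Omega> \<Longrightarrow> w \<in> L2 \<Omega> \<Longrightarrow> \<epsilon> > 0 \<Longrightarrow>
      \<exists>Y\<in>C0_sigma \<Omega>. L2_norm \<Omega> Y \<le> A * L2_norm \<Omega> w + \<epsilon> \<and> L2_norm \<Omega> (\<lambda>x. jacobian Y (at x) - wgrad \<Omega> w x) \<le> \<epsilon>"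
    using H1_dot_0_sigma_approx[OF op R0(2,1)] by blast
  define G where "G = wgrad \<Omega> w"
  have wH: "w \<in> H1_dot \<Omega>" using w by (simp add: H1_dot_0_sigma_def)
  note G = H1_dot_wgrad[OF op wH, folded G_def]
  have wL: "w \<in> L2 \<Omega>" using w by (simp add: L2_sigma_def)
  obtain \<psi> where \<psi>: "\<And>n. \<psi> n \<in> C0_sigma \<Omega>" "(\<lambda>n. L2_norm \<Omega> (\<lambda>x. \<psi> n x - w x)) \<longlonglongrightarrow> 0"
    using w(1) unfolding L2_sigma_def by blast
  obtain \<phi> where \<phi>: "\<And>n. \<phi> n \<in> C0_sigma \<Omega>" "(\<lambda>n. H1_dot_norm \<Omega> (\<lambda>x. \<phi> n x - w x)) \<longlonglongrightarrow> 0"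
        "\<And>R. R > 0 \<Longrightarrow> (\<lambda>n. L2_norm (\<Omega> \<inter> ball 0 R) (\<lambda>x. \<phi> n x - w x)) \<longlonglongrightarrow> 0"
    using w(2) unfolding H1_dot_0_sigma_def by blast
  have "\<exists>Z\<in>C0_sigma \<Omega>. L2_norm \<Omega> (\<lambda>x. Z x - w x) \<le> (A + 1) * L2_norm \<Omega> (\<lambda>x. \<psi> k x - w x) + 1 / real (Suc k)
      \<and> L2_norm \<Omega> (\<lambda>x. jacobian Z (at x) - G x) \<le> 1 / real (Suc k)" for k
  proof -
    define u where "u = (\<lambda>x. w x - \<psi> k x)"
    define J where "J = (\<lambda>x. jacobian (\<psi> k) (at x))"
    note \<psi>k = C0_sigmaD[OF \<psi>(1)[of k]]
    have \<psi>L: "\<psi> k \<in> L2 \<Omega>" "J \<in> L2 \<Omega>" using C0_sigma_L2[OF \<psi>(1) \<Omega>] by (auto simp: J_def)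
    have uW: "has_weak_gradient \<Omega> u (\<lambda>x. G x - J x)"
      unfolding u_def J_def by (rule weak_gradient_diff[OF op G(1) weak_gradient_jacobian[OF op \<psi>k(2)]])
    have uL: "u \<in> L2 \<Omega>" unfolding u_def by (rule L2_diff[OF wL \<psi>L(1)])
    have uH: "u \<in> H1_dot \<Omega>" using uW L2_diff[OF G(2) \<psi>L(2)] by (auto simp: H1_dot_def)
    have "u \<in> H1_dot_0_sigma \<Omega>"
      unfolding H1_dot_0_sigma_def
    proof (intro CollectI conjI exI[of _ "\<lambda>n x. \<phi> n x + - \<psi> k x"] allI impI)
      show "u \<in> H1_dot \<Omega>" by fact
      show "u \<in> L2 (\<Omega> \<inter> ball 0 R)" for R using L2_subset_norm(1)[OF uL _ _ \<Omega>] op by auto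
      show "(\<lambda>x. \<phi> n x + - \<psi> k x) \<in> C0_sigma \<Omega>" for n by (intro C0_sigma_add C0_sigma_uminus \<phi> \<psi>)
      show "(\<lambda>n. H1_dot_norm \<Omega> (\<lambda>x. \<phi> n x + - \<psi> k x - u x)) \<longlonglongrightarrow> 0" using \<phi>(2) by (simp add: u_def)
      show "(\<lambda>n. L2_norm (\<Omega> \<inter> ball 0 R) (\<lambda>x. \<phi> n x + - \<psi> k x - u x)) \<longlonglongrightarrow> 0" if "R > 0" for R
        using \<phi>(3)[OF that] by (simp add: u_def)
    qed
    then obtain Y where Y: "Y \<in> C0_sigma \<Omega>" "L2_norm \<Omega> Y \<le> A * L2_norm \<Omega> u + 1 / real (Suc k)"
        "L2_norm \<Omega> (\<lambda>x. jacobian Y (at x) - wgrad \<Omega> u x) \<le> 1 / real (Suc k)"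
      using approx[of u "1 / real (Suc k)"] uL by auto
    have YL: "Y \<in> L2 \<Omega>" "(\<lambda>x. jacobian Y (at x)) \<in> L2 \<Omega>" using C0_sigma_L2[OF Y(1) \<Omega>] by auto
    have nu: "L2_norm \<Omega> u = L2_norm \<Omega> (\<lambda>x. \<psi> k x - w x)" unfolding u_def by (rule L2_norm_minus_commute)
    have "L2_norm \<Omega> (\<lambda>x. (Y x + \<psi> k x) - w x) = L2_norm \<Omega> (\<lambda>x. Y x - u x)" by (simp add: u_def algebra_simps)
    also have "\<dots> \<le> L2_norm \<Omega> Y + L2_norm \<Omega> u" by (rule L2_norm_triangle_diff[OF YL(1) uL])
    also have "\<dots> \<le> (A + 1) * L2_norm \<Omega> (\<lambda>x. \<psi> k x - w x) + 1 / real (Suc k)"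
      using Y(2) unfolding nu by (simp add: algebra_simps)
    finally have 1: "L2_norm \<Omega> (\<lambda>x. (Y x + \<psi> k x) - w x) \<le> (A + 1) * L2_norm \<Omega> (\<lambda>x. \<psi> k x - w x) + 1 / real (Suc k)" .
    have jac: "jacobian (\<lambda>x. Y x + \<psi> k x) (at x) = jacobian Y (at x) + J x" for x
      unfolding J_def by (rule jacobian_add[OF smooth_differentiable[OF C0_sigmaD(2)[OF Y(1)]] smooth_differentiable[OF \<psi>k(2)]])
    have "L2_norm \<Omega> (\<lambda>x. jacobian (\<lambda>x. Y x + \<psi> k x) (at x) - G x) = L2_norm \<Omega> (\<lambda>x. jacobian Y (at x) - wgrad \<Omega> u x)"
    proof (rule L2_norm_cong_AE)
      show "(\<lambda>x. jacobian (\<lambda>x. Y x + \<psi> k x) (at x) - G x) \<in> borel_measurable (lebesgue_on \<Omega>)"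
        unfolding jac by (intro L2_D(1) L2_diff L2_add YL \<psi>L G)
      show "(\<lambda>x. jacobian Y (at x) - wgrad \<Omega> u x) \<in> borel_measurable (lebesgue_on \<Omega>)"
        by (intro L2_D(1) L2_diff YL H1_dot_wgrad[OF op uH])
      show "AE x in lebesgue_on \<Omega>. jacobian (\<lambda>x. Y x + \<psi> k x) (at x) - G x = jacobian Y (at x) - wgrad \<Omega> u x"
        using weak_gradient_unique[OF op uW H1_dot_wgrad(1)[OF op uH]]
        by eventually_elim (simp add: jac algebra_simps)
    qed
    then show ?thesis using 1 Y C0_sigma_add[OF Y(1) \<psi>(1)[of k]] by (intro bexI[of _ "\<lambda>x. Y x + \<psi> k x"]) auto
  qed
  then have "\<forall>k. \<exists>Z. Z \<in> C0_sigma \<Omega> \<and> L2_norm \<Omega> (\<lambda>x. Z x - w x) \<le> (A + 1) * L2_norm \<Omega> (\<lambda>x. \<psi> k x - w x) + 1 / real (Suc k)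
      \<and> L2_norm \<Omega> (\<lambda>x. jacobian Z (at x) - G x) \<le> 1 / real (Suc k)"
    unfolding Bex_def by (rule allI)
  from choice[OF this] obtain Z where Z: "\<And>k. Z k \<in> C0_sigma \<Omega>"
      "\<And>k. L2_norm \<Omega> (\<lambda>x. Z k x - w x) \<le> (A + 1) * L2_norm \<Omega> (\<lambda>x. \<psi> k x - w x) + 1 / real (Suc k)"
      "\<And>k. L2_norm \<Omega> (\<lambda>x. jacobian (Z k) (at x) - G x) \<le> 1 / real (Suc k)"
    by blast
  have l1: "(\<lambda>k. 1 / real (Suc k)) \<longlonglongrightarrow> 0" by (rule LIMSEQ_Suc[OF lim_1_over_n])
  have "(\<lambda>k. L2_norm \<Omega> (\<lambda>x. Z k x - w x)) \<longlonglongrightarrow> 0"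
  proof (rule Lim_null_comparison)
    show "\<forall>\<^sub>F k in sequentially. norm (L2_norm \<Omega> (\<lambda>x. Z k x - w x)) \<le> (A + 1) * L2_norm \<Omega> (\<lambda>x. \<psi> k x - w x) + 1 / real (Suc k)"
      using Z(2) by (intro always_eventually) auto
    show "(\<lambda>k. (A + 1) * L2_norm \<Omega> (\<lambda>x. \<psi> k x - w x) + 1 / real (Suc k)) \<longlonglongrightarrow> 0"
      using tendsto_add[OF tendsto_mult[OF tendsto_const[of "A + 1"] \<psi>(2)] l1] by simp
  qed
  moreover have "(\<lambda>k. L2_norm \<Omega> (\<lambda>x. jacobian (Z k) (at x) - G x)) \<longlonglongrightarrow> 0"
    by (rule Lim_null_comparison[OF _ l1]) (use Z(3) in \<open>auto intro!: always_eventually\<close>)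
  ultimately show ?thesis unfolding solenoidal_H1_0_def using wL G(2) Z(1) unfolding G_def by blast
qed

text \<open>Carries the inequalities for smooth fields over to limits along almost everywhere convergent sequences.\<close>

lemma Fatou_bound:
  fixes f :: "nat \<Rightarrow> 'a \<Rightarrow> real"
  assumes "\<And>n. f n \<in> borel_measurable M" "g \<in> borel_measurable M" "\<And>x. 0 \<le> g x"
    and lim: "AE x in M. (\<lambda>n. f n x) \<longlonglongrightarrow> g x"
    and bd: "\<And>n. (\<integral>\<^sup>+x. ennreal (f n x) \<partial>M) \<le> ennreal (c n)" and c: "c \<longlonglongrightarrow> C" "0 \<le> C"
  shows "integrable M g" "integral\<^sup>L M g \<le> C"
proof -
  have "(\<integral>\<^sup>+x. ennreal (g x) \<partial>M) = (\<integral>\<^sup>+x. liminf (\<lambda>n. ennreal (f n x)) \<partial>M)"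
  proof (rule nn_integral_cong_AE)
    show "AE x in M. ennreal (g x) = liminf (\<lambda>n. ennreal (f n x))"
      using lim
    proof eventually_elim
      case (elim x)
      have "(\<lambda>n. ennreal (f n x)) \<longlonglongrightarrow> ennreal (g x)" by (rule tendsto_ennrealI[OF elim])
      then show ?case using lim_imp_Liminf[OF sequentially_bot] by metis
    qed
  qed
  also have "\<dots> \<le> liminf (\<lambda>n. \<integral>\<^sup>+x. ennreal (f n x) \<partial>M)"
    by (rule nn_integral_liminf) (use assms(1) in measurable)
  also have "\<dots> \<le> liminf (\<lambda>n. ennreal (c n))" by (rule Liminf_mono) (use bd in auto)
  also have "\<dots> = ennreal C" by (rule lim_imp_Liminf[OF sequentially_bot tendsto_ennrealI[OF c(1)]])
  finally have le: "(\<integral>\<^sup>+x. ennreal (g x) \<partial>M) \<le> ennreal C" .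
  then show i: "integrable M g"
    using assms(2,3) by (intro integrableI_nonneg) (auto simp: le_less_trans[OF le])
  show "integral\<^sup>L M g \<le> C"
    using le nn_integral_eq_integral[OF i] assms(3) c(2) by (simp add: ennreal_le_iff)
qed

lemma solenoidal_H1_0_sequence:
  assumes "solenoidal_H1_0 \<Omega> w G" "\<Omega> \<in> sets lebesgue"
  obtains \<phi> where "\<And>n. \<phi> n \<in> C0_sigma \<Omega>" "(\<lambda>n. L2_norm \<Omega> (\<lambda>x. \<phi> n x - w x)) \<longlonglongrightarrow> 0"
    "(\<lambda>n. L2_norm \<Omega> (\<lambda>x. jacobian (\<phi> n) (at x) - G x)) \<longlonglongrightarrow> 0"
    "(\<lambda>n. L2_norm UNIV (\<phi> n)) \<longlonglongrightarrow> L2_norm \<Omega> w"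
    "(\<lambda>n. L2_norm UNIV (\<lambda>x. jacobian (\<phi> n) (at x))) \<longlonglongrightarrow> L2_norm \<Omega> G"
    "AE x in lebesgue_on \<Omega>. (\<lambda>n. \<phi> n x) \<longlonglongrightarrow> w x"
proof -
  obtain \<phi> where \<phi>: "\<And>n. \<phi> n \<in> C0_sigma \<Omega>" "(\<lambda>n. L2_norm \<Omega> (\<lambda>x. \<phi> n x - w x)) \<longlonglongrightarrow> 0"
    "(\<lambda>n. L2_norm \<Omega> (\<lambda>x. jacobian (\<phi> n) (at x) - G x)) \<longlonglongrightarrow> 0" and wG: "w \<in> L2 \<Omega>" "G \<in> L2 \<Omega>"
    using assms(1) unfolding solenoidal_H1_0_def by blast
  note L = C0_sigma_L2[OF \<phi>(1) assms(2)]
  obtain r where r: "strict_mono r" "AE x in lebesgue_on \<Omega>. (\<lambda>n. \<phi> (r n) x) \<longlonglongrightarrow> w x"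
    using L2_AE_subsequence[OF L(1) wG(1) \<phi>(2)] by blast
  have sub: "(\<lambda>n. X (r n)) \<longlonglongrightarrow> l" if "X \<longlonglongrightarrow> l" for X :: "nat \<Rightarrow> real" and l
    using LIMSEQ_subseq_LIMSEQ[OF that r(1)] by (simp add: o_def)
  have eq: "L2_norm UNIV (\<phi> n) = L2_norm \<Omega> (\<phi> n)" for n
    by (rule L2_norm_subset_supported) (use assms(2) C0_sigmaD(7)[OF \<phi>(1)] in auto)
  have eq': "L2_norm UNIV (\<lambda>x. jacobian (\<phi> n) (at x)) = L2_norm \<Omega> (\<lambda>x. jacobian (\<phi> n) (at x))" for n
  proof (rule L2_norm_subset_supported)
    show "jacobian (\<phi> n) (at x) = 0" if "x \<in> UNIV - \<Omega>" for x
      by (rule jacobian_outside_supp) (use that C0_sigmaD(4)[OF \<phi>(1)] in auto)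
  qed (use assms(2) in auto)
  show ?thesis
    by (rule that[of "\<lambda>n. \<phi> (r n)"])
      (use \<phi>(1) r(2) sub[OF \<phi>(2)] sub[OF \<phi>(3)] sub[OF L2_tendsto_norm[OF L(1) wG(1) \<phi>(2)]] sub[OF L2_tendsto_norm[OF L(2) wG(2) \<phi>(3)]] in \<open>auto simp: eq eq'\<close>)
qed

lemma nn_integral_lebesgue_on_le_lborel:
  assumes "S \<in> sets lebesgue" "f \<in> borel_measurable borel"
  shows "(\<integral>\<^sup>+x. f x \<partial>lebesgue_on S) \<le> (\<integral>\<^sup>+x. f x \<partial>lborel)"
proof -
  have "(\<integral>\<^sup>+x. f x \<partial>lebesgue_on S) = (\<integral>\<^sup>+x. f x * indicator S x \<partial>lebesgue)"
    using assms(1) by (simp add: nn_integral_restrict_space)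
  also have "\<dots> \<le> (\<integral>\<^sup>+x. f x \<partial>lebesgue)" by (intro nn_integral_mono) (auto simp: indicator_def)
  also have "\<dots> = (\<integral>\<^sup>+x. f x \<partial>lborel)" by (rule nn_integral_completion)
  finally show ?thesis .
qed

lemma Ladyzhenskaya:
  assumes "solenoidal_H1_0 \<Omega> w G" "\<Omega> \<in> sets lebesgue"
  shows "integrable (lebesgue_on \<Omega>) (\<lambda>x. (norm (w x))^4)"
    "(LINT x|lebesgue_on \<Omega>. (norm (w x))^4) \<le> 4 * (L2_norm \<Omega> w)\<^sup>2 * (L2_norm \<Omega> G)\<^sup>2"
proof -
  obtain \<phi> where \<phi>: "\<And>n. \<phi> n \<in> C0_sigma \<Omega>" "(\<lambda>n. L2_norm UNIV (\<phi> n)) \<longlonglongrightarrow> L2_norm \<Omega> w"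
    "(\<lambda>n. L2_norm UNIV (\<lambda>x. jacobian (\<phi> n) (at x))) \<longlonglongrightarrow> L2_norm \<Omega> G"
    "AE x in lebesgue_on \<Omega>. (\<lambda>n. \<phi> n x) \<longlonglongrightarrow> w x"
    by (rule solenoidal_H1_0_sequence[OF assms]) blast
  have w: "w \<in> L2 \<Omega>" using assms(1) by (simp add: solenoidal_H1_0_def)
  have m: "\<phi> n \<in> borel_measurable borel" for n
    by (rule borel_measurable_continuous_onI[OF smooth_continuous_on[OF C0_sigmaD(2)[OF \<phi>(1)]]])
  have a: "(\<lambda>x. (norm (\<phi> n x))^4) \<in> borel_measurable (lebesgue_on \<Omega>)" for n
    using L2_D(1)[OF C0_sigma_L2(1)[OF \<phi>(1) assms(2)]] by measurable
  have b: "(\<lambda>x. (norm (w x))^4) \<in> borel_measurable (lebesgue_on \<Omega>)" using L2_D(1)[OF w] by measurable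
  have c: "AE x in lebesgue_on \<Omega>. (\<lambda>n. (norm (\<phi> n x))^4) \<longlonglongrightarrow> (norm (w x))^4"
    using \<phi>(4) by eventually_elim (intro tendsto_intros)
  have d: "(\<integral>\<^sup>+x. ennreal ((norm (\<phi> n x))^4) \<partial>lebesgue_on \<Omega>) \<le> ennreal (4 * (L2_norm UNIV (\<phi> n))\<^sup>2 * (L2_norm UNIV (\<lambda>x. jacobian (\<phi> n) (at x)))\<^sup>2)" for n
  proof -
    have "(\<integral>\<^sup>+x. ennreal ((norm (\<phi> n x))^4) \<partial>lebesgue_on \<Omega>) \<le> (\<integral>\<^sup>+x. ennreal ((norm (\<phi> n x))^4) \<partial>lborel)"
      by (rule nn_integral_lebesgue_on_le_lborel[OF assms(2)]) (use m in measurable)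
    also have "\<dots> \<le> ennreal (4 * (L2_norm UNIV (\<phi> n))\<^sup>2 * (L2_norm UNIV (\<lambda>x. jacobian (\<phi> n) (at x)))\<^sup>2)"
      by (rule Ladyzhenskaya_smooth[OF C0_sigmaD(2,3,6)[OF \<phi>(1)]])
    finally show ?thesis .
  qed
  have e: "(\<lambda>n. 4 * (L2_norm UNIV (\<phi> n))\<^sup>2 * (L2_norm UNIV (\<lambda>x. jacobian (\<phi> n) (at x)))\<^sup>2) \<longlonglongrightarrow> 4 * (L2_norm \<Omega> w)\<^sup>2 * (L2_norm \<Omega> G)\<^sup>2"
    by (intro tendsto_intros \<phi>)
  show "integrable (lebesgue_on \<Omega>) (\<lambda>x. (norm (w x))^4)"
    "(LINT x|lebesgue_on \<Omega>. (norm (w x))^4) \<le> 4 * (L2_norm \<Omega> w)\<^sup>2 * (L2_norm \<Omega> G)\<^sup>2"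
    by (rule Fatou_bound[OF a b _ c d e]; simp)+
qed

lemma Hardy_symmetric_difference:
  assumes "solenoidal_H1_0 \<Omega> w G" "\<Omega> \<in> sets lebesgue" "uminus ` \<Omega> = \<Omega>"
  shows "integrable (lebesgue_on \<Omega>) (\<lambda>x. (norm (w x - w (- x)) / norm x)\<^sup>2)"
    "(LINT x|lebesgue_on \<Omega>. (norm (w x - w (- x)) / norm x)\<^sup>2) \<le> pi\<^sup>2 * (L2_norm \<Omega> G)\<^sup>2"
proof -
  obtain \<phi> where \<phi>: "\<And>n. \<phi> n \<in> C0_sigma \<Omega>"
    "(\<lambda>n. L2_norm UNIV (\<lambda>x. jacobian (\<phi> n) (at x))) \<longlonglongrightarrow> L2_norm \<Omega> G"
    "AE x in lebesgue_on \<Omega>. (\<lambda>n. \<phi> n x) \<longlonglongrightarrow> w x"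
    by (rule solenoidal_H1_0_sequence[OF assms(1,2)]) blast
  have w: "w \<in> L2 \<Omega>" using assms(1) by (simp add: solenoidal_H1_0_def)
  have n[measurable]: "(\<lambda>x. norm x) \<in> borel_measurable (lebesgue_on \<Omega>)"
    by (rule measurable_restrict_space1[OF lebesgue_measurable_continuous]) (intro continuous_intros)
  have q: "(\<lambda>x. (norm (f x - f (- x)) / norm x)\<^sup>2) \<in> borel_measurable (lebesgue_on \<Omega>)" if "f \<in> L2 \<Omega>" for f :: "real^2 \<Rightarrow> real^2"
    using L2_D(1)[OF that] L2_D(1)[OF L2_reflect(1)[OF assms(2,3) that]] n by measurable
  have m: "\<phi> n \<in> borel_measurable borel" for n
    by (rule borel_measurable_continuous_onI[OF smooth_continuous_on[OF C0_sigmaD(2)[OF \<phi>(1)]]])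
  have m': "(\<lambda>x. \<phi> n (- x)) \<in> borel_measurable borel" for n
    by (rule measurable_compose[OF _ m]) simp
  have c: "AE x in lebesgue_on \<Omega>. (\<lambda>n. (norm (\<phi> n x - \<phi> n (- x)) / norm x)\<^sup>2) \<longlonglongrightarrow> (norm (w x - w (- x)) / norm x)\<^sup>2"
    using \<phi>(3) AE_reflect_lebesgue_on[OF assms(2,3) \<phi>(3)]
  proof eventually_elim
    case (elim x)
    then have "(\<lambda>n. (norm (\<phi> n x - \<phi> n (- x)) * inverse (norm x))\<^sup>2) \<longlonglongrightarrow> (norm (w x - w (- x)) * inverse (norm x))\<^sup>2"
      by (intro tendsto_intros)
    then show ?case by (simp add: divide_inverse)
  qed
  have d: "(\<integral>\<^sup>+x. ennreal ((norm (\<phi> n x - \<phi> n (- x)) / norm x)\<^sup>2) \<partial>lebesgue_on \<Omega>) \<le> ennreal (pi\<^sup>2 * (L2_norm UNIV (\<lambda>x. jacobian (\<phi> n) (at x)))\<^sup>2)" for n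
  proof -
    have "(\<integral>\<^sup>+x. ennreal ((norm (\<phi> n x - \<phi> n (- x)) / norm x)\<^sup>2) \<partial>lebesgue_on \<Omega>) \<le> (\<integral>\<^sup>+x. ennreal ((norm (\<phi> n x - \<phi> n (- x)) / norm x)\<^sup>2) \<partial>lborel)"
      by (rule nn_integral_lebesgue_on_le_lborel[OF assms(2)]) (use m m' in measurable)
    also have "\<dots> \<le> ennreal (pi\<^sup>2 * (L2_norm UNIV (\<lambda>x. jacobian (\<phi> n) (at x)))\<^sup>2)"
      by (rule Hardy_antipodal[OF C0_sigmaD(2,3,6)[OF \<phi>(1)]])
    finally show ?thesis .
  qed
  have e: "(\<lambda>n. pi\<^sup>2 * (L2_norm UNIV (\<lambda>x. jacobian (\<phi> n) (at x)))\<^sup>2) \<longlonglongrightarrow> pi\<^sup>2 * (L2_norm \<Omega> G)\<^sup>2"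
    by (intro tendsto_intros \<phi>)
  show "integrable (lebesgue_on \<Omega>) (\<lambda>x. (norm (w x - w (- x)) / norm x)\<^sup>2)"
    "(LINT x|lebesgue_on \<Omega>. (norm (w x - w (- x)) / norm x)\<^sup>2) \<le> pi\<^sup>2 * (L2_norm \<Omega> G)\<^sup>2"
    by (rule Fatou_bound[OF q[OF C0_sigma_L2(1)[OF \<phi>(1) assms(2)]] q[OF w] _ c d e]; simp)+
qed

section \<open>The convective terms in divergence form\<close>

definition outer :: "real^2 \<Rightarrow> real^2 \<Rightarrow> real^2^2" where
  "outer b a = (\<chi> i j. b $ i * a $ j)"

lemma outer_nth: "outer b a $ i $ j = b $ i * a $ j"
  by (simp add: outer_def)

lemma norm_outer: "norm (outer b a) = norm b * norm a"
proof -
  have "outer b a \<bullet> outer b a = (b \<bullet> b) * (a \<bullet> a)"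
    by (simp add: inner_vec_def outer_nth sum_2 algebra_simps)
  then show ?thesis by (simp add: norm_eq_sqrt_inner real_sqrt_mult)
qed

lemma bounded_bilinear_outer: "bounded_bilinear outer"
proof
  show "\<exists>K. \<forall>a b. norm (outer a b) \<le> norm a * norm b * K" by (intro exI[of _ 1]) (simp add: norm_outer)
qed (simp_all add: vec_eq_iff outer_nth algebra_simps)

lemma matrix_inner_outer: "(A *v a) \<bullet> b = A \<bullet> outer b a" for A :: "real^2^2"
  by (simp add: inner_vec_def matrix_vector_mult_def outer_nth sum_2 algebra_simps)

lemma matrix_inner_transpose: "(A *v a) \<bullet> b = a \<bullet> (transpose A *v b)" for A :: "real^2^2"
  by (simp add: inner_vec_def matrix_vector_mult_def transpose_def sum_2 algebra_simps)

lemma norm_transpose: "norm (transpose A) = norm A" for A :: "real^2^2"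
  by (simp add: norm_eq_sqrt_inner inner_vec_def transpose_def sum_2 algebra_simps)

lemma bounded_bilinear_matrix_mult: "bounded_bilinear (\<lambda>(A::real^2^2) w. A *v w)"
proof
  show "\<exists>K. \<forall>a b. norm ((a::real^2^2) *v b) \<le> norm a * norm b * K" by (intro exI[of _ 1]) (simp add: norm_matrix_mult_le)
qed (simp_all add: matrix_vector_mult_add_rdistrib matrix_vector_right_distrib scaleR_matrix_vector_assoc matrix_vector_mult_scaleR)

lemma borel_measurable_bilinear:
  fixes p :: "'a::euclidean_space \<Rightarrow> 'b::euclidean_space \<Rightarrow> 'c::euclidean_space"
  assumes "bounded_bilinear p" "f \<in> borel_measurable M" "g \<in> borel_measurable M"
  shows "(\<lambda>x. p (f x) (g x)) \<in> borel_measurable M"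
proof -
  have "continuous_on UNIV (\<lambda>z. p (fst z) (snd z))"
    by (intro bounded_bilinear.continuous_on[OF assms(1)] continuous_intros)
  then show ?thesis by (rule borel_measurable_continuous_Pair[OF assms(2,3)])
qed

lemmas borel_measurable_outer = borel_measurable_bilinear[OF bounded_bilinear_outer]
lemmas borel_measurable_matrix_mult = borel_measurable_bilinear[OF bounded_bilinear_matrix_mult]

lemma linear_transpose: "bounded_linear (transpose :: real^2^2 \<Rightarrow> real^2^2)"
proof -
  have "linear (transpose :: real^2^2 \<Rightarrow> real^2^2)"
    by (rule linearI) (simp_all add: transpose_def vec_eq_iff)
  then show ?thesis by (simp add: linear_conv_bounded_linear)
qed

lemma borel_measurable_transpose:
  "f \<in> borel_measurable M \<Longrightarrow> (\<lambda>x. transpose (f x :: real^2^2)) \<in> borel_measurable M"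
  by (rule borel_measurable_continuous_on[OF linear_continuous_on[OF linear_transpose]])

lemma L2_bounded_bilinear:
  fixes p :: "'a::euclidean_space \<Rightarrow> 'b::euclidean_space \<Rightarrow> 'c::euclidean_space"
  assumes "bounded_bilinear p" "\<And>a b. norm (p a b) \<le> norm a * norm b"
    and "f \<in> borel_measurable (lebesgue_on S)" "g \<in> borel_measurable (lebesgue_on S)"
    and "(\<lambda>x. norm (f x) * norm (g x)) \<in> L2 S"
  shows "(\<lambda>x. p (f x) (g x)) \<in> L2 S" "L2_norm S (\<lambda>x. p (f x) (g x)) \<le> L2_norm S (\<lambda>x. norm (f x) * norm (g x))"
proof -
  have "AE x in lebesgue_on S. norm (p (f x) (g x)) \<le> 1 * norm (norm (f x) * norm (g x))"
    using assms(2) by (intro AE_I2) simp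
  note b = L2_bound[OF borel_measurable_bilinear[OF assms(1,3,4)] assms(5) this]
  show "(\<lambda>x. p (f x) (g x)) \<in> L2 S" "L2_norm S (\<lambda>x. p (f x) (g x)) \<le> L2_norm S (\<lambda>x. norm (f x) * norm (g x))"
    using b by auto
qed

lemma L2_mult_bounded:
  assumes "f \<in> borel_measurable (lebesgue_on S)" "g \<in> L2 S" "AE x in lebesgue_on S. norm (f x) \<le> c" "c \<ge> 0"
  shows "(\<lambda>x. norm (f x) * norm (g x)) \<in> L2 S" "L2_norm S (\<lambda>x. norm (f x) * norm (g x)) \<le> c * L2_norm S g"
    "(\<lambda>x. norm (g x) * norm (f x)) \<in> L2 S"
proof -
  have "(\<lambda>x. norm (f x) * norm (g x)) \<in> borel_measurable (lebesgue_on S)"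
    using assms(1) L2_D(1)[OF assms(2)] by measurable
  moreover have "AE x in lebesgue_on S. norm (norm (f x) * norm (g x)) \<le> c * norm (g x)"
    using assms(3) by eventually_elim (auto simp: abs_mult intro!: mult_right_mono)
  ultimately show "(\<lambda>x. norm (f x) * norm (g x)) \<in> L2 S" "L2_norm S (\<lambda>x. norm (f x) * norm (g x)) \<le> c * L2_norm S g"
    using L2_bound[OF _ assms(2), of "\<lambda>x. norm (f x) * norm (g x)" c] assms(4) by auto
  then show "(\<lambda>x. norm (g x) * norm (f x)) \<in> L2 S" by (simp add: mult.commute)
qed

lemma L2_bounded_test:
  assumes "\<phi> \<in> C0_sigma \<Omega>"
  obtains c where "c > 0" "\<And>x. norm (\<phi> x) \<le> c" "\<And>x. norm (jacobian \<phi> (at x)) \<le> c"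
proof -
  note \<phi> = C0_sigmaD[OF assms]
  obtain a where a: "a > 0" "\<And>x. norm (\<phi> x) \<le> a"
    using bounded_range_compact_support[OF smooth_continuous_on[OF \<phi>(2)] \<phi>(3,6)] by blast
  obtain b where b: "b > 0" "\<And>x. norm (jacobian \<phi> (at x)) \<le> b"
    using bounded_range_compact_support[OF continuous_on_jacobian[OF \<phi>(2)] \<phi>(3) jacobian_outside_supp] by blast
  have "norm (\<phi> x) \<le> max a b" "norm (jacobian \<phi> (at x)) \<le> max a b" for x
    using a(2)[of x] b(2)[of x] by linarith+
  then show ?thesis using that[of "max a b"] a by auto
qed

lemma test_functions_mult_components:
  assumes "\<phi> \<in> C0_sigma \<Omega>" "\<psi> \<in> C0_sigma \<Omega>"
  shows "(\<lambda>x. \<psi> x $ j * \<phi> x $ i) \<in> test_functions \<Omega>"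
  by (rule test_functionsI[where K="supp \<phi>"])
    (use C0_sigmaD[OF assms(1)] C0_sigmaD[OF assms(2)] in \<open>auto intro!: smooth_mult smooth_vec_nth\<close>)

text \<open>For a test field in the place of \<open>a\<close>, the products \<open>a\<^sub>j \<phi>\<^sub>i\<close> are test functions and the terms with the
  divergence of \<open>a\<close> cancel. Both sides are continuous in \<open>a\<close> for the norm of \<open>L2\<close>.\<close>

lemma convect_by_parts:
  assumes op: "open \<Omega>" and a: "a \<in> L2_sigma \<Omega>" and W: "has_weak_gradient \<Omega> w G" and G: "G \<in> L2 \<Omega>"
    and \<phi>: "\<phi> \<in> C0_sigma \<Omega>"
    and wJ: "(\<lambda>x. norm (jacobian \<phi> (at x)) * norm (w x)) \<in> L2 \<Omega>"
  shows "L2_inner \<Omega> (\<lambda>x. G x *v a x) \<phi> = - L2_inner \<Omega> (\<lambda>x. outer (w x) (a x)) (\<lambda>x. jacobian \<phi> (at x))"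
proof -
  have \<Omega>: "\<Omega> \<in> sets lebesgue" using op by auto
  define J where "J = (\<lambda>x. jacobian \<phi> (at x))"
  have aL: "a \<in> L2 \<Omega>" using a by (simp add: L2_sigma_def)
  obtain \<psi> where \<psi>: "\<And>n. \<psi> n \<in> C0_sigma \<Omega>" "(\<lambda>n. L2_norm \<Omega> (\<lambda>x. \<psi> n x - a x)) \<longlonglongrightarrow> 0"
    using a unfolding L2_sigma_def by blast
  have wm: "w \<in> borel_measurable (lebesgue_on \<Omega>)" by (rule L1_loc_measurable[OF op]) (use W in \<open>simp add: has_weak_gradient_def\<close>)
  have Jm: "J \<in> borel_measurable (lebesgue_on \<Omega>)" unfolding J_def using C0_sigma_L2(2)[OF \<phi> \<Omega>] by (rule L2_D(1))
  have \<phi>m: "\<phi> \<in> borel_measurable (lebesgue_on \<Omega>)" using C0_sigma_L2(1)[OF \<phi> \<Omega>] by (rule L2_D(1))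
  obtain c where c: "c > 0" "\<And>x. norm (\<phi> x) \<le> c" by (rule L2_bounded_test[OF \<phi>]) blast
  have GL: "(\<lambda>x. transpose (G x) *v \<phi> x) \<in> L2 \<Omega>"
  proof (rule L2_bound(1))
    show "(\<lambda>x. transpose (G x) *v \<phi> x) \<in> borel_measurable (lebesgue_on \<Omega>)"
      by (intro borel_measurable_matrix_mult borel_measurable_transpose L2_D(1) G \<phi>m)
    show "AE x in lebesgue_on \<Omega>. norm (transpose (G x) *v \<phi> x) \<le> c * norm (G x)"
    proof (rule AE_I2)
      fix x
      have "norm (transpose (G x) *v \<phi> x) \<le> norm (G x) * norm (\<phi> x)"
        using norm_matrix_mult_le[of "transpose (G x)"] by (simp add: norm_transpose)
      also have "\<dots> \<le> norm (G x) * c" by (rule mult_left_mono[OF c(2)]) simp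
      finally show "norm (transpose (G x) *v \<phi> x) \<le> c * norm (G x)" by (simp add: mult.commute)
    qed
  qed (use G c in auto)
  have JL: "(\<lambda>x. transpose (J x) *v w x) \<in> L2 \<Omega>"
  proof (rule L2_bound(1)[OF _ wJ, where c=1])
    show "(\<lambda>x. transpose (J x) *v w x) \<in> borel_measurable (lebesgue_on \<Omega>)"
      by (intro borel_measurable_matrix_mult borel_measurable_transpose wm Jm)
    show "AE x in lebesgue_on \<Omega>. norm (transpose (J x) *v w x) \<le> 1 * norm (norm (jacobian \<phi> (at x)) * norm (w x))"
      using norm_matrix_mult_le[of "transpose (J _)"] by (intro AE_I2) (simp add: norm_transpose J_def)
  qed simp
  have *: "L2_inner \<Omega> (\<lambda>x. transpose (G x) *v \<phi> x) (\<psi> n) = - L2_inner \<Omega> (\<lambda>x. transpose (J x) *v w x) (\<psi> n)" for n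
  proof -
    define \<theta> where "\<theta> = (\<lambda>i j x. \<psi> n x $ j * \<phi> x $ i)"
    have \<theta>: "\<theta> i j \<in> test_functions \<Omega>" for i j unfolding \<theta>_def by (rule test_functions_mult_components[OF \<phi> \<psi>(1)])
    have L: "(\<lambda>x. w x $ i) \<in> L1_loc \<Omega>" "(\<lambda>x. G x $ i $ j) \<in> L1_loc \<Omega>" for i j
      using W by (auto simp: has_weak_gradient_def intro!: L1_loc_linear[OF bounded_linear_vec_nth])
    note iw = integrable_L1_loc_test_fn[OF bounded_bilinear_mult op test_functions_grad[OF \<theta>] L(1)]
    note iG = integrable_L1_loc_test_fn[OF bounded_bilinear_mult op \<theta> L(2)]
    have e: "(LINT x|lebesgue_on \<Omega>. w x $ i * grad (\<theta> i j) x $ j) = - (LINT x|lebesgue_on \<Omega>. G x $ i $ j * \<theta> i j x)" for i j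
      using W \<theta> by (simp add: has_weak_gradient_def)
    have 1: "(transpose (G x) *v \<phi> x) \<bullet> \<psi> n x = (\<Sum>i\<in>UNIV. \<Sum>j\<in>UNIV. G x $ i $ j * \<theta> i j x)" for x
      by (simp add: inner_vec_def matrix_vector_mult_def transpose_def sum_2 \<theta>_def algebra_simps)
    have g: "grad (\<theta> i j) x $ j = \<psi> n x $ j * J x $ i $ j + jacobian (\<psi> n) (at x) $ j $ j * \<phi> x $ i" for i j x
      unfolding \<theta>_def J_def
      using grad_mult[of "\<lambda>x. \<psi> n x $ j" x "\<lambda>x. \<phi> x $ i" j] C0_sigmaD(2)[OF \<phi>] C0_sigmaD(2)[OF \<psi>(1)]
      by (simp add: grad_component smooth_differentiable smooth_vec_nth)
    have 2: "(transpose (J x) *v w x) \<bullet> \<psi> n x = (\<Sum>i\<in>UNIV. \<Sum>j\<in>UNIV. w x $ i * grad (\<theta> i j) x $ j)" for x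
    proof -
      have "jacobian (\<psi> n) (at x) $ 2 $ 2 = - jacobian (\<psi> n) (at x) $ 1 $ 1"
        using C0_sigmaD(5)[OF \<psi>(1), of n x] unfolding jacobian_divergence2 by linarith
      then show ?thesis by (simp add: inner_vec_def matrix_vector_mult_def transpose_def sum_2 g algebra_simps)
    qed
    show ?thesis
      unfolding L2_inner_def 1 2 using iw iG e
      by (simp add: sum_negf)
  qed
  have "(\<lambda>n. L2_inner \<Omega> (\<lambda>x. transpose (G x) *v \<phi> x) (\<psi> n)) \<longlonglongrightarrow> L2_inner \<Omega> (\<lambda>x. transpose (G x) *v \<phi> x) a"
    by (rule L2_tendsto_inner[OF C0_sigma_L2(1)[OF \<psi>(1) \<Omega>] aL GL \<psi>(2)])
  moreover have "(\<lambda>n. L2_inner \<Omega> (\<lambda>x. transpose (G x) *v \<phi> x) (\<psi> n)) \<longlonglongrightarrow> - L2_inner \<Omega> (\<lambda>x. transpose (J x) *v w x) a"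
    unfolding * by (rule tendsto_minus[OF L2_tendsto_inner[OF C0_sigma_L2(1)[OF \<psi>(1) \<Omega>] aL JL \<psi>(2)]])
  ultimately have "L2_inner \<Omega> (\<lambda>x. transpose (G x) *v \<phi> x) a = - L2_inner \<Omega> (\<lambda>x. transpose (J x) *v w x) a"
    by (rule LIMSEQ_unique)
  moreover have "(transpose (G x) *v \<phi> x) \<bullet> a x = (G x *v a x) \<bullet> \<phi> x" for x
    by (metis matrix_inner_transpose inner_commute)
  moreover have "(transpose (J x) *v w x) \<bullet> a x = outer (w x) (a x) \<bullet> J x" for x
    by (metis matrix_inner_transpose matrix_inner_outer inner_commute)
  ultimately show ?thesis by (simp add: L2_inner_def J_def)
qed

text \<open>Here the convecting field \<open>u\<close> is merely bounded and weakly divergence free, and not a limit of test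
  fields in \<open>L2\<close>, so it is the convected field \<open>w\<close> that is approximated; then
  \<open>w \<bullet> \<phi>\<close> is an admissible test function for the divergence of \<open>u\<close>.\<close>

lemma convect_by_parts_bounded:
  assumes op: "open \<Omega>" and u: "weakly_div_free \<Omega> u" "\<And>x. x \<in> \<Omega> \<Longrightarrow> norm (u x) \<le> U" "U \<ge> 0"
    and w: "solenoidal_H1_0 \<Omega> w G" and \<phi>: "\<phi> \<in> C0_sigma \<Omega>"
  shows "L2_inner \<Omega> (\<lambda>x. G x *v u x) \<phi> = - L2_inner \<Omega> (\<lambda>x. outer (w x) (u x)) (\<lambda>x. jacobian \<phi> (at x))"
proof -
  have \<Omega>: "\<Omega> \<in> sets lebesgue" using op by auto
  define J where "J = (\<lambda>x. jacobian \<phi> (at x))"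
  obtain \<psi> where \<psi>: "\<And>n. \<psi> n \<in> C0_sigma \<Omega>" "(\<lambda>n. L2_norm \<Omega> (\<lambda>x. \<psi> n x - w x)) \<longlonglongrightarrow> 0"
     "(\<lambda>n. L2_norm \<Omega> (\<lambda>x. jacobian (\<psi> n) (at x) - G x)) \<longlonglongrightarrow> 0" and wL: "w \<in> L2 \<Omega>" "G \<in> L2 \<Omega>"
    using w unfolding solenoidal_H1_0_def by blast
  have uL: "u \<in> L1_loc \<Omega>" using u by (simp add: weakly_div_free_def)
  have um: "u \<in> borel_measurable (lebesgue_on \<Omega>)" by (rule L1_loc_measurable[OF op uL])
  have ub: "AE x in lebesgue_on \<Omega>. norm (u x) \<le> U" by (rule AE_I2) (use u(2) in auto)
  have \<phi>L: "\<phi> \<in> L2 \<Omega>" "J \<in> L2 \<Omega>" unfolding J_def using C0_sigma_L2[OF \<phi> \<Omega>] by auto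
  have A: "(\<lambda>x. outer (\<phi> x) (u x)) \<in> L2 \<Omega>"
    by (rule L2_bounded_bilinear(1)[OF bounded_bilinear_outer _ L2_D(1)[OF \<phi>L(1)] um L2_mult_bounded(3)[OF um \<phi>L(1) ub u(3)]])
      (simp add: norm_outer)
  have B: "(\<lambda>x. J x *v u x) \<in> L2 \<Omega>"
    by (rule L2_bounded_bilinear(1)[OF bounded_bilinear_matrix_mult norm_matrix_mult_le L2_D(1)[OF \<phi>L(2)] um L2_mult_bounded(3)[OF um \<phi>L(2) ub u(3)]])
  have *: "L2_inner \<Omega> (\<lambda>x. outer (\<phi> x) (u x)) (\<lambda>x. jacobian (\<psi> n) (at x)) = - L2_inner \<Omega> (\<lambda>x. J x *v u x) (\<psi> n)" for n
  proof -
    note \<psi>n = C0_sigmaD[OF \<psi>(1)[of n]]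
    define \<theta> where "\<theta> = (\<lambda>x. \<psi> n x $ 1 * \<phi> x $ 1 + \<psi> n x $ 2 * \<phi> x $ 2)"
    have \<theta>: "\<theta> \<in> test_functions \<Omega>"
      unfolding \<theta>_def by (rule test_functionsI[where K="supp \<phi>"])
         (use C0_sigmaD[OF \<phi>] \<psi>n in \<open>auto intro!: smooth_add smooth_mult smooth_vec_nth\<close>)
    have z: "(LINT x|lebesgue_on \<Omega>. u x \<bullet> grad \<theta> x) = 0" using u(1) \<theta> by (simp add: weakly_div_free_def)
    have ga: "grad (\<lambda>x. f x + g x) x $ j = grad f x $ j + grad g x $ j" if "f differentiable (at x)" "g differentiable (at x)"
      for f g :: "real^2 \<Rightarrow> real" and x j
    proof -
      have "((\<lambda>x. f x + g x) has_derivative (\<lambda>h. frechet_derivative f (at x) h + frechet_derivative g (at x) h)) (at x)"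
        by (intro has_derivative_add) (use that frechet_derivative_works in auto)
      from frechet_derivative_at[OF this, symmetric] show ?thesis by (simp add: grad_def)
    qed
    have sm: "smooth (\<lambda>x. \<psi> n x $ i)" "smooth (\<lambda>x. \<phi> x $ i)" for i
      using \<psi>n(2) C0_sigmaD(2)[OF \<phi>] by (auto intro: smooth_vec_nth)
    have g: "grad \<theta> x $ j = \<psi> n x $ 1 * J x $ 1 $ j + jacobian (\<psi> n) (at x) $ 1 $ j * \<phi> x $ 1
        + (\<psi> n x $ 2 * J x $ 2 $ j + jacobian (\<psi> n) (at x) $ 2 $ j * \<phi> x $ 2)" for x j
      unfolding \<theta>_def
      by (subst ga; (subst grad_mult)?)
        (simp_all add: smooth_differentiable sm smooth_mult grad_mult grad_component C0_sigmaD(2)[OF \<phi>] \<psi>n(2) J_def)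
    have pt: "u x \<bullet> grad \<theta> x = outer (\<phi> x) (u x) \<bullet> jacobian (\<psi> n) (at x) + (J x *v u x) \<bullet> \<psi> n x" for x
      by (simp add: inner_vec_def sum_2 g outer_nth matrix_vector_mult_def algebra_simps)
    show ?thesis
      using z L2_inner_integrable[OF A C0_sigma_L2(2)[OF \<psi>(1) \<Omega>, of n]] L2_inner_integrable[OF B C0_sigma_L2(1)[OF \<psi>(1) \<Omega>, of n]]
      unfolding pt by (simp add: L2_inner_def)
  qed
  have "(\<lambda>n. L2_inner \<Omega> (\<lambda>x. outer (\<phi> x) (u x)) (\<lambda>x. jacobian (\<psi> n) (at x))) \<longlonglongrightarrow> L2_inner \<Omega> (\<lambda>x. outer (\<phi> x) (u x)) G"
    by (rule L2_tendsto_inner[OF C0_sigma_L2(2)[OF \<psi>(1) \<Omega>] wL(2) A \<psi>(3)])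
  moreover have "(\<lambda>n. L2_inner \<Omega> (\<lambda>x. outer (\<phi> x) (u x)) (\<lambda>x. jacobian (\<psi> n) (at x))) \<longlonglongrightarrow> - L2_inner \<Omega> (\<lambda>x. J x *v u x) w"
    unfolding * by (rule tendsto_minus[OF L2_tendsto_inner[OF C0_sigma_L2(1)[OF \<psi>(1) \<Omega>] wL(1) B \<psi>(2)]])
  ultimately have "L2_inner \<Omega> (\<lambda>x. outer (\<phi> x) (u x)) G = - L2_inner \<Omega> (\<lambda>x. J x *v u x) w"
    by (rule LIMSEQ_unique)
  moreover have "outer (\<phi> x) (u x) \<bullet> G x = (G x *v u x) \<bullet> \<phi> x" for x by (metis matrix_inner_outer inner_commute)
  moreover have "(J x *v u x) \<bullet> w x = outer (w x) (u x) \<bullet> J x" for x by (metis matrix_inner_outer inner_commute)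
  ultimately show ?thesis by (simp add: L2_inner_def J_def)
qed

lemma L2_norm_mult_L4:
  fixes f g :: "real^2 \<Rightarrow> real^2"
  assumes "f \<in> borel_measurable (lebesgue_on S)" "g \<in> borel_measurable (lebesgue_on S)"
    and "integrable (lebesgue_on S) (\<lambda>x. (norm (f x))^4)" "integrable (lebesgue_on S) (\<lambda>x. (norm (g x))^4)"
    and "(LINT x|lebesgue_on S. (norm (f x))^4) \<le> a\<^sup>2" "(LINT x|lebesgue_on S. (norm (g x))^4) \<le> b\<^sup>2" "a \<ge> 0" "b \<ge> 0"
  shows "(\<lambda>x. norm (f x) * norm (g x)) \<in> L2 S" "(L2_norm S (\<lambda>x. norm (f x) * norm (g x)))\<^sup>2 \<le> a * b"
proof -
  define F where "F = (\<lambda>x. (norm (f x))\<^sup>2)"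
  define H where "H = (\<lambda>x. (norm (g x))\<^sup>2)"
  have p4: "(y\<^sup>2)\<^sup>2 = y^4" for y :: real by simp
  have FL: "F \<in> L2 S" "H \<in> L2 S" using assms unfolding L2_def F_def H_def by (auto simp: p4)
  have "L2_norm S F = sqrt (LINT x|lebesgue_on S. (norm (f x))^4)" "L2_norm S H = sqrt (LINT x|lebesgue_on S. (norm (g x))^4)"
    by (simp_all add: L2_norm_def F_def H_def p4)
  then have n: "L2_norm S F \<le> a" "L2_norm S H \<le> b" using assms real_le_lsqrt real_sqrt_le_iff
    by (metis real_sqrt_abs abs_of_nonneg)+
  have i: "integrable (lebesgue_on S) (\<lambda>x. F x \<bullet> H x)" by (rule L2_inner_integrable[OF FL])
  have sq: "(norm (norm (f x) * norm (g x)))\<^sup>2 = F x \<bullet> H x" for x by (simp add: F_def H_def power_mult_distrib)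
  show "(\<lambda>x. norm (f x) * norm (g x)) \<in> L2 S"
    unfolding L2_def mem_Collect_eq sq using i assms(1,2) by auto
  have "(L2_norm S (\<lambda>x. norm (f x) * norm (g x)))\<^sup>2 = L2_inner S F H"
    unfolding L2_norm_power2 sq L2_inner_def ..
  also have "\<dots> \<le> L2_norm S F * L2_norm S H" using L2_Cauchy_Schwarz[OF FL] by linarith
  also have "\<dots> \<le> a * b" using n assms by (intro mult_mono) auto
  finally show "(L2_norm S (\<lambda>x. norm (f x) * norm (g x)))\<^sup>2 \<le> a * b" .
qed

lemma L2_norm_mult_solenoidal:
  assumes "solenoidal_H1_0 \<Omega> f F" "solenoidal_H1_0 \<Omega> g G" "\<Omega> \<in> sets lebesgue"
  shows "(\<lambda>x. norm (f x) * norm (g x)) \<in> L2 \<Omega>"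
    "(L2_norm \<Omega> (\<lambda>x. norm (f x) * norm (g x)))\<^sup>2 \<le> 4 * (L2_norm \<Omega> f * L2_norm \<Omega> F) * (L2_norm \<Omega> g * L2_norm \<Omega> G)"
proof -
  have m: "f \<in> borel_measurable (lebesgue_on \<Omega>)" "g \<in> borel_measurable (lebesgue_on \<Omega>)"
    using assms L2_D(1) by (auto simp: solenoidal_H1_0_def)
  have b: "(LINT x|lebesgue_on \<Omega>. (norm (f x))^4) \<le> (2 * (L2_norm \<Omega> f * L2_norm \<Omega> F))\<^sup>2"
    "(LINT x|lebesgue_on \<Omega>. (norm (g x))^4) \<le> (2 * (L2_norm \<Omega> g * L2_norm \<Omega> G))\<^sup>2"
    using Ladyzhenskaya(2)[OF assms(1,3)] Ladyzhenskaya(2)[OF assms(2,3)] by (simp_all add: power_mult_distrib)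
  note r = L2_norm_mult_L4[OF m Ladyzhenskaya(1)[OF assms(1,3)] Ladyzhenskaya(1)[OF assms(2,3)] b]
  show "(\<lambda>x. norm (f x) * norm (g x)) \<in> L2 \<Omega>" using r(1) by simp
  show "(L2_norm \<Omega> (\<lambda>x. norm (f x) * norm (g x)))\<^sup>2 \<le> 4 * (L2_norm \<Omega> f * L2_norm \<Omega> F) * (L2_norm \<Omega> g * L2_norm \<Omega> G)"
    using r(2) by (simp add: mult.assoc mult.left_commute)
qed

text \<open>For solenoidal fields the divergence of this matrix is \<open>u \<bullet> \<nabla>w + w \<bullet> \<nabla>u + w \<bullet> \<nabla>w\<close>.\<close>

definition flux :: "(real^2 \<Rightarrow> real^2) \<Rightarrow> (real^2 \<Rightarrow> real^2) \<Rightarrow> real^2 \<Rightarrow> real^2^2" where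
  "flux u w x = outer (w x) (u x) + outer (u x) (w x) + outer (w x) (w x)"

lemma flux_L2:
  assumes op: "open \<Omega>" and u: "u \<in> borel_measurable (lebesgue_on \<Omega>)" "\<And>x. x \<in> \<Omega> \<Longrightarrow> norm (u x) \<le> U" "U \<ge> 0"
    and w: "solenoidal_H1_0 \<Omega> w G"
  shows "flux u w \<in> L2 \<Omega>" 
    "L2_norm \<Omega> (flux u w) \<le> 2 * L2_norm \<Omega> (\<lambda>x. norm (w x) * norm (u x)) + 2 * (L2_norm \<Omega> w * L2_norm \<Omega> G)"
    "(\<lambda>x. outer (w x) (u x)) \<in> L2 \<Omega>" "(\<lambda>x. outer (u x) (w x)) \<in> L2 \<Omega>" "(\<lambda>x. outer (w x) (w x)) \<in> L2 \<Omega>"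
    "L2_norm \<Omega> (\<lambda>x. norm (w x) * norm (u x)) \<le> U * L2_norm \<Omega> w"
proof -
  have \<Omega>: "\<Omega> \<in> sets lebesgue" using op by auto
  have wL: "w \<in> L2 \<Omega>" using w by (simp add: solenoidal_H1_0_def)
  have wm: "w \<in> borel_measurable (lebesgue_on \<Omega>)" by (rule L2_D(1)[OF wL])
  have ub: "AE x in lebesgue_on \<Omega>. norm (u x) \<le> U" by (rule AE_I2) (use u(2) in auto)
  note mb = L2_mult_bounded[OF u(1) wL ub u(3)]
  note bo = L2_bounded_bilinear[OF bounded_bilinear_outer eq_refl[OF norm_outer]]
  note 1 = bo[OF wm u(1) mb(3)] and 2 = bo[OF u(1) wm mb(1)] and 3 = bo[OF wm wm L2_norm_mult_solenoidal(1)[OF w w \<Omega>]]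
  show L: "(\<lambda>x. outer (w x) (u x)) \<in> L2 \<Omega>" "(\<lambda>x. outer (u x) (w x)) \<in> L2 \<Omega>" "(\<lambda>x. outer (w x) (w x)) \<in> L2 \<Omega>"
    by (rule 1(1) 2(1) 3(1))+
  show "flux u w \<in> L2 \<Omega>" unfolding flux_def[abs_def] by (intro L2_add L)
  show "L2_norm \<Omega> (\<lambda>x. norm (w x) * norm (u x)) \<le> U * L2_norm \<Omega> w" using mb(2) by (simp add: mult.commute)
  have "L2_norm \<Omega> (flux u w) \<le> L2_norm \<Omega> (\<lambda>x. outer (w x) (u x) + outer (u x) (w x)) + L2_norm \<Omega> (\<lambda>x. outer (w x) (w x))"
    unfolding flux_def[abs_def] by (rule L2_norm_triangle[OF L2_add[OF L(1,2)] L(3)])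
  also have "L2_norm \<Omega> (\<lambda>x. outer (w x) (u x) + outer (u x) (w x)) \<le> L2_norm \<Omega> (\<lambda>x. outer (w x) (u x)) + L2_norm \<Omega> (\<lambda>x. outer (u x) (w x))"
    by (rule L2_norm_triangle[OF L(1,2)])
  also have "L2_norm \<Omega> (\<lambda>x. outer (w x) (w x)) \<le> 2 * (L2_norm \<Omega> w * L2_norm \<Omega> G)"
  proof (rule order_trans[OF 3(2)])
    have "(L2_norm \<Omega> (\<lambda>x. norm (w x) * norm (w x)))\<^sup>2 \<le> (2 * (L2_norm \<Omega> w * L2_norm \<Omega> G))\<^sup>2"
      using L2_norm_mult_solenoidal(2)[OF w w \<Omega>] by (simp add: power2_eq_square mult_ac)
    then show "L2_norm \<Omega> (\<lambda>x. norm (w x) * norm (w x)) \<le> 2 * (L2_norm \<Omega> w * L2_norm \<Omega> G)"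
      by (rule power2_le_imp_le) simp
  qed
  finally show "L2_norm \<Omega> (flux u w) \<le> 2 * L2_norm \<Omega> (\<lambda>x. norm (w x) * norm (u x)) + 2 * (L2_norm \<Omega> w * L2_norm \<Omega> G)"
    using 1(2) 2(2) by (simp add: mult.commute)
qed

lemma weak_form_flux:
  assumes op: "open \<Omega>" and bd: "bounded (- \<Omega>)"
    and u: "u \<in> H1_dot \<Omega>" "weakly_div_free \<Omega> u" "\<And>x. x \<in> \<Omega> \<Longrightarrow> norm (u x) \<le> U" "U \<ge> 0"
    and w: "w \<in> L2_sigma \<Omega>" "w \<in> H1_dot_0_sigma \<Omega>" and \<phi>: "\<phi> \<in> C0_sigma \<Omega>"
  shows "L2_inner \<Omega> (wgrad \<Omega> w) (\<lambda>x. jacobian \<phi> (at x)) + L2_inner \<Omega> (convect \<Omega> u w) \<phi>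
     + L2_inner \<Omega> (convect \<Omega> w u) \<phi> + L2_inner \<Omega> (convect \<Omega> w w) \<phi>
     = L2_inner \<Omega> (\<lambda>x. wgrad \<Omega> w x - flux u w x) (\<lambda>x. jacobian \<phi> (at x))"
proof -
  have \<Omega>: "\<Omega> \<in> sets lebesgue" using op by auto
  have S: "solenoidal_H1_0 \<Omega> w (wgrad \<Omega> w)" by (rule solenoidal_H1_0_wgrad[OF op bd w])
  then have wL: "w \<in> L2 \<Omega>" "wgrad \<Omega> w \<in> L2 \<Omega>" by (auto simp: solenoidal_H1_0_def)
  have wH: "w \<in> H1_dot \<Omega>" using w by (simp add: H1_dot_0_sigma_def)
  have um: "u \<in> borel_measurable (lebesgue_on \<Omega>)" by (rule L1_loc_measurable[OF op]) (use u(2) in \<open>simp add: weakly_div_free_def\<close>)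
  have ub: "AE x in lebesgue_on \<Omega>. norm (u x) \<le> U" by (rule AE_I2) (use u(3) in auto)
  have J: "(\<lambda>x. jacobian \<phi> (at x)) \<in> L2 \<Omega>" by (rule C0_sigma_L2(2)[OF \<phi> \<Omega>])
  obtain c where c: "c > 0" "\<And>x. norm (jacobian \<phi> (at x)) \<le> c" by (rule L2_bounded_test[OF \<phi>]) blast
  have cb: "AE x in lebesgue_on \<Omega>. norm (jacobian \<phi> (at x)) \<le> c" by (rule AE_I2) (rule c(2))
  note F = flux_L2[OF op um u(3,4) S]
  have "L2_inner \<Omega> (convect \<Omega> u w) \<phi> = - L2_inner \<Omega> (\<lambda>x. outer (w x) (u x)) (\<lambda>x. jacobian \<phi> (at x))"
    unfolding convect_def[abs_def] by (rule convect_by_parts_bounded[OF op u(2,3,4) S \<phi>])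
  moreover have "L2_inner \<Omega> (convect \<Omega> w u) \<phi> = - L2_inner \<Omega> (\<lambda>x. outer (u x) (w x)) (\<lambda>x. jacobian \<phi> (at x))"
    unfolding convect_def[abs_def]
    by (rule convect_by_parts[OF op w(1) H1_dot_wgrad[OF op u(1)] \<phi> L2_mult_bounded(3)[OF um J ub u(4)]])
  moreover have "L2_inner \<Omega> (convect \<Omega> w w) \<phi> = - L2_inner \<Omega> (\<lambda>x. outer (w x) (w x)) (\<lambda>x. jacobian \<phi> (at x))"
    unfolding convect_def[abs_def]
    by (rule convect_by_parts[OF op w(1) H1_dot_wgrad[OF op wH] \<phi> L2_mult_bounded(1)[OF L2_D(1)[OF J] wL(1) cb less_imp_le[OF c(1)]]])
  moreover have "L2_inner \<Omega> (\<lambda>x. wgrad \<Omega> w x - flux u w x) (\<lambda>x. jacobian \<phi> (at x))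
    = L2_inner \<Omega> (wgrad \<Omega> w) (\<lambda>x. jacobian \<phi> (at x)) - L2_inner \<Omega> (flux u w) (\<lambda>x. jacobian \<phi> (at x))"
    by (rule L2_inner_diff_left[OF wL(2) F(1) J])
  moreover have "L2_inner \<Omega> (flux u w) (\<lambda>x. jacobian \<phi> (at x)) = L2_inner \<Omega> (\<lambda>x. outer (w x) (u x)) (\<lambda>x. jacobian \<phi> (at x))
       + L2_inner \<Omega> (\<lambda>x. outer (u x) (w x)) (\<lambda>x. jacobian \<phi> (at x)) + L2_inner \<Omega> (\<lambda>x. outer (w x) (w x)) (\<lambda>x. jacobian \<phi> (at x))"
    using L2_inner_add_left[OF L2_add[OF F(3,4)] F(5) J] L2_inner_add_left[OF F(3,4) J]
    unfolding flux_def[abs_def] by simp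
  ultimately show ?thesis by simp
qed

section \<open>Functions of time\<close>

text \<open>Sample at the next grid point to the right, on grids of vanishing width.\<close>

lemma right_continuous_borel_measurable:
  fixes \<rho> :: "real \<Rightarrow> real"
  assumes "\<And>t. (\<rho> \<longlongrightarrow> \<rho> t) (at_right t)"
  shows "\<rho> \<in> borel_measurable borel"
proof (rule borel_measurable_LIMSEQ_real)
  define s where "s = (\<lambda>(n::nat) t. (real_of_int \<lfloor>real (Suc n) * t\<rfloor> + 1) / real (Suc n))"
  show "(\<lambda>t. \<rho> (s n t)) \<in> borel_measurable borel" for n
  proof -
    have "(\<lambda>t. \<lfloor>real (Suc n) * t\<rfloor>) \<in> measurable borel (count_space UNIV)"
      by (rule measurable_compose[OF _ measurable_real_floor]) measurable
    from measurable_compose[OF this, of "\<lambda>k. \<rho> ((real_of_int k + 1) / real (Suc n))" borel]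
    show ?thesis by (simp add: s_def)
  qed
  fix t :: real
  have gt: "s n t > t" for n
  proof -
    have "real (Suc n) * t < real_of_int \<lfloor>real (Suc n) * t\<rfloor> + 1" by linarith
    then show ?thesis by (simp add: s_def field_simps)
  qed
  have le: "s n t \<le> t + 1 / real (Suc n)" for n
  proof -
    have "real_of_int \<lfloor>real (Suc n) * t\<rfloor> + 1 \<le> real (Suc n) * t + 1" by linarith
    then have "s n t \<le> (real (Suc n) * t + 1) / real (Suc n)" unfolding s_def by (rule divide_right_mono) simp
    also have "\<dots> = t + 1 / real (Suc n)" by (simp add: add_divide_distrib del: of_nat_Suc)
    finally show ?thesis .
  qed
  have "(\<lambda>n. t + 1 / real (Suc n)) \<longlonglongrightarrow> t + 0" by (intro tendsto_intros LIMSEQ_Suc[OF lim_1_over_n])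
  then have "(\<lambda>n. s n t) \<longlonglongrightarrow> t"
    by (intro tendsto_sandwich[OF _ _ tendsto_const[of t], of "\<lambda>n. s n t" sequentially "\<lambda>n. t + 1 / real (Suc n)"])
      (use gt le in \<open>auto intro!: always_eventually less_imp_le\<close>)
  then have "filterlim (\<lambda>n. s n t) (at_right t) sequentially"
    using gt less_imp_neq[OF gt, symmetric] by (simp add: filterlim_at)
  then show "(\<lambda>n. \<rho> (s n t)) \<longlonglongrightarrow> \<rho> t" by (rule filterlim_compose[OF assms])
qed

lemma lmeasurable_Ioc: "{a<..b::real} \<in> lmeasurable"
  by (rule bounded_set_imp_lmeasurable[OF bounded_subset[of "{a..b}"]]) auto

lemma integrable_bounded_Icc:
  fixes f :: "real \<Rightarrow> real"
  assumes "f \<in> borel_measurable (lebesgue_on {a..b})" "\<And>t. t \<in> {a..b} \<Longrightarrow> \<bar>f t\<bar> \<le> B"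
  shows "integrable (lebesgue_on {a..b}) f"
proof -
  interpret finite_measure "lebesgue_on {a..b}" by (rule finite_measure_lebesgue_on) simp
  show ?thesis by (rule integrable_const_bound[where B=B, OF _ assms(1)]) (use assms(2) in \<open>auto intro!: AE_I2\<close>)
qed

lemma average_tendsto:
  fixes \<rho> :: "real \<Rightarrow> real"
  assumes "\<rho> integrable_on {t..t + h0}" "h0 > 0" "(\<rho> \<longlongrightarrow> \<rho> t) (at_right t)"
  shows "(\<lambda>n. integral {t..t + h0 / real (Suc n)} \<rho> / (h0 / real (Suc n))) \<longlonglongrightarrow> \<rho> t"
proof -
  have "continuous (at t within {t..t + h0} - {}) \<rho>"
    using assms(2,3) by (simp add: continuous_within at_within_Icc_at_right)
  from integral_has_vector_derivative_continuous_at[OF assms(1) _ _ this] assms(2)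
  have "((\<lambda>u. integral {t..u} \<rho>) has_vector_derivative \<rho> t) (at t within {t..t + h0})" by simp
  then have "((\<lambda>u. integral {t..u} \<rho>) has_real_derivative \<rho> t) (at t within {t..t + h0})"
    by (simp add: has_real_derivative_iff_has_vector_derivative)
  then have L: "((\<lambda>u. (integral {t..u} \<rho> - integral {t..t} \<rho>) / (u - t)) \<longlongrightarrow> \<rho> t) (at t within {t..t + h0})"
    by (simp add: has_field_derivative_iff)
  have lim: "(\<lambda>n. t + h0 * (1 / real (Suc n))) \<longlonglongrightarrow> t + h0 * 0"
    by (intro tendsto_intros LIMSEQ_Suc[OF lim_1_over_n])
  have "filterlim (\<lambda>n. t + h0 / real (Suc n)) (at t within {t..t + h0}) sequentially"
    unfolding filterlim_at
  proof
    show "(\<lambda>n. t + h0 / real (Suc n)) \<longlonglongrightarrow> t" using lim by simp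
    have "h0 / real (Suc n) \<le> h0" for n using assms(2) by (simp add: divide_le_eq mult_le_cancel_left1)
    then show "\<forall>\<^sub>F n in sequentially. t + h0 / real (Suc n) \<in> {t..t + h0} \<and> t + h0 / real (Suc n) \<noteq> t"
      using assms(2) by (intro always_eventually) auto
  qed
  from filterlim_compose[OF L this] show ?thesis by simp
qed

text \<open>Averaging a pointwise bound on the increments over one time step, with the step tending to
  zero. The error terms \<open>q\<close> enter twice, once from each end point of a step.\<close>

lemma increment_bound_from_steps:
  fixes \<rho> p q :: "real \<Rightarrow> real"
  assumes ab: "a < b" and h0: "h0 > 0"
    and rc: "\<And>t. (\<rho> \<longlongrightarrow> \<rho> t) (at_right t)" and B: "\<And>t. \<bar>\<rho> t\<bar> \<le> B"
    and p: "p integrable_on {a..b + h0}" and q: "q integrable_on {a..b + h0}"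
    and step: "\<And>h. 0 < h \<Longrightarrow> h \<le> h0 \<Longrightarrow> \<exists>Z. negligible Z \<and> (\<forall>t\<in>{a..b} - Z.
       \<rho> (t + h) - \<rho> t \<le> integral {t..t + h} p + h * (q t + q (t + h)))"
  shows "\<rho> b - \<rho> a \<le> integral {a..b} p + 2 * integral {a..b} q"
proof -
  define P where "P = (\<lambda>t. integral {a..t} p)"
  define \<sigma> where "\<sigma> = (\<lambda>t. \<rho> t - P t)"
  have c: "b + h0 > b" "b + h0 \<ge> a" using ab h0 by auto
  have "\<rho> \<in> borel_measurable (lebesgue_on {a..b + h0})"
    by (rule measurable_restrict_space1[OF measurable_completion]) (use right_continuous_borel_measurable[OF rc] in simp)
  then have \<rho>i: "\<rho> integrable_on {a..b + h0}"
    using integrable_on_lebesgue_on[OF integrable_bounded_Icc[of \<rho> a "b + h0" B]] B by auto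
  have Pc: "continuous_on {a..b + h0} P" unfolding P_def by (rule indefinite_integral_continuous_1[OF p])
  have \<sigma>i: "\<sigma> integrable_on {a..b + h0}"
    unfolding \<sigma>_def by (intro integrable_diff \<rho>i integrable_continuous_interval Pc)
  have sub: "f integrable_on {s..t}" if "f integrable_on {a..b + h0}" "a \<le> s" "t \<le> b + h0" for f :: "real \<Rightarrow> real" and s t
    using integrable_on_subinterval[OF that(1)] that(2,3) by auto
  have comb: "integral {s..r} f + integral {r..t} f = integral {s..t} f" if "f integrable_on {a..b + h0}" "a \<le> s" "s \<le> r" "r \<le> t" "t \<le> b + h0" for f :: "real \<Rightarrow> real" and s r t
    using Henstock_Kurzweil_Integration.integral_combine[OF that(3,4) sub[OF that(1)]] that by auto
  define Q where "Q = (\<lambda>t. integral {a..t} q)"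
  have Qc: "continuous_on {a..b + h0} Q" unfolding Q_def by (rule indefinite_integral_continuous_1[OF q])
  have main: "integral {b..b + h} \<sigma> / h - integral {a..a + h} \<sigma> / h \<le> Q b + (Q (b + h) - Q (a + h))" if h: "0 < h" "h \<le> h0" for h
  proof -
    obtain Z where Z: "negligible Z" "\<And>t. t \<in> {a..b} - Z \<Longrightarrow> \<rho> (t + h) - \<rho> t \<le> integral {t..t + h} p + h * (q t + q (t + h))"
      using step[OF h] by blast
    have s\<sigma>: "\<sigma> (t + h) - \<sigma> t \<le> h * (q t + q (t + h))" if "t \<in> {a..b} - Z" for t
      using Z(2)[OF that] comb[OF p, of a t "t + h"] that h by (simp add: \<sigma>_def P_def)
    have sh: "((\<lambda>t. f (t + h)) has_integral integral {a + h..b + h} f) {a..b}" if "f integrable_on {a..b + h0}" for f :: "real \<Rightarrow> real"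
    proof -
      have "(f has_integral integral {a + h..b + h} f) {a + h..b + h}"
        by (rule integrable_integral[OF sub[OF that]]) (use h in auto)
      then show ?thesis using has_integral_shift_Icc_real[of f h _ a b] by (simp add: o_def add.commute)
    qed
    have I1: "((\<lambda>t. \<sigma> (t + h) - \<sigma> t) has_integral (integral {a + h..b + h} \<sigma> - integral {a..b} \<sigma>)) {a..b}"
      by (intro has_integral_diff sh \<sigma>i integrable_integral sub) (use h in auto)
    have I2: "((\<lambda>t. h * (q t + q (t + h))) has_integral h * (integral {a..b} q + integral {a + h..b + h} q)) {a..b}"
      by (intro has_integral_mult_right has_integral_add sh q integrable_integral sub) (use h in auto)
    have I3: "((\<lambda>t. if t \<in> Z then h * (q t + q (t + h)) else \<sigma> (t + h) - \<sigma> t) has_integral (integral {a + h..b + h} \<sigma> - integral {a..b} \<sigma>)) {a..b}"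
      by (rule has_integral_spike[OF Z(1) _ I1]) auto
    have "integral {a + h..b + h} \<sigma> - integral {a..b} \<sigma> \<le> h * (integral {a..b} q + integral {a + h..b + h} q)"
      by (rule has_integral_le[OF I3 I2]) (use s\<sigma> in auto)
    moreover have "integral {a + h..b + h} \<sigma> - integral {a..b} \<sigma> = integral {b..b + h} \<sigma> - integral {a..a + h} \<sigma>"
      using comb[OF \<sigma>i, of a b "b + h"] comb[OF \<sigma>i, of a "a + h" "b + h"] h ab by simp
    moreover have "integral {a + h..b + h} q = Q (b + h) - Q (a + h)"
      using comb[OF q, of a "a + h" "b + h"] h ab by (simp add: Q_def)
    ultimately have "integral {b..b + h} \<sigma> - integral {a..a + h} \<sigma> \<le> h * (Q b + (Q (b + h) - Q (a + h)))"
      by (simp add: Q_def)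
    then have "(integral {b..b + h} \<sigma> - integral {a..a + h} \<sigma>) / h \<le> Q b + (Q (b + h) - Q (a + h))"
      using h by (simp add: divide_le_eq mult.commute)
    then show ?thesis by (simp add: diff_divide_distrib)
  qed
  have \<sigma>rc: "(\<sigma> \<longlongrightarrow> \<sigma> t) (at_right t)" if "a \<le> t" "t \<le> b" for t
  proof -
    have "(P \<longlongrightarrow> P t) (at t within {a..b + h0})" using Pc that c by (simp add: continuous_on)
    then have "(P \<longlongrightarrow> P t) (at t within {t..b + h0})" by (rule tendsto_within_subset) (use that in auto)
    then have "(P \<longlongrightarrow> P t) (at_right t)" using that c by (simp add: at_within_Icc_at_right)
    then show ?thesis unfolding \<sigma>_def by (intro tendsto_diff rc)
  qed
  define h where "h = (\<lambda>n. h0 / real (Suc n))"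
  have h: "0 < h n" "h n \<le> h0" for n using h0 by (auto simp: h_def divide_le_eq mult_le_cancel_left1)
  have "(\<lambda>n. h0 * (1 / real (Suc n))) \<longlonglongrightarrow> h0 * 0" by (intro tendsto_intros LIMSEQ_Suc[OF lim_1_over_n])
  then have hl: "h \<longlonglongrightarrow> 0" by (simp add: h_def)
  have avg: "(\<lambda>n. integral {t..t + h n} \<sigma> / h n) \<longlonglongrightarrow> \<sigma> t" if "a \<le> t" "t \<le> b" for t
    unfolding h_def by (rule average_tendsto[OF sub[OF \<sigma>i] h0 \<sigma>rc]) (use that in auto)
  have Ql: "(\<lambda>n. Q (t + h n)) \<longlonglongrightarrow> Q t" if "a \<le> t" "t \<le> b" for t
  proof -
    have "(\<lambda>n. t + h n) \<longlonglongrightarrow> t + 0" by (intro tendsto_intros hl)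
    then show ?thesis
      by (intro continuous_on_tendsto_compose[OF Qc]) 
        (use that h c in \<open>auto intro!: always_eventually add_mono\<close>, use h that in \<open>smt (verit)\<close>)
  qed
  have "\<sigma> b - \<sigma> a \<le> Q b + (Q b - Q a)"
  proof (rule LIMSEQ_le)
    show "(\<lambda>n. integral {b..b + h n} \<sigma> / h n - integral {a..a + h n} \<sigma> / h n) \<longlonglongrightarrow> \<sigma> b - \<sigma> a"
      by (intro tendsto_diff avg) (use ab in auto)
    show "(\<lambda>n. Q b + (Q (b + h n) - Q (a + h n))) \<longlonglongrightarrow> Q b + (Q b - Q a)"
      by (intro tendsto_intros Ql) (use ab in auto)
    show "\<exists>N. \<forall>n\<ge>N. integral {b..b + h n} \<sigma> / h n - integral {a..a + h n} \<sigma> / h n \<le> Q b + (Q (b + h n) - Q (a + h n))"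
      using main[OF h] by blast
  qed
  then show ?thesis by (simp add: \<sigma>_def P_def Q_def)
qed

text \<open>On a compact set \<open>K\<close> of almost full measure a simple approximant is locally constant, because its
  finitely many level sets are approximated from inside by disjoint compact sets, which have positive distance.\<close>

lemma Lusin_simple_approximation:
  fixes d :: "'a \<Rightarrow> 'a \<Rightarrow> real" and v :: "real \<Rightarrow> 'a" and s :: "nat \<Rightarrow> real \<Rightarrow> 'a"
  assumes d: "\<And>x y. x \<in> X \<Longrightarrow> y \<in> X \<Longrightarrow> d x y = d y x" "\<And>x y z. x \<in> X \<Longrightarrow> y \<in> X \<Longrightarrow> z \<in> X \<Longrightarrow> d x z \<le> d x y + d y z"
    "\<And>x y. x \<in> X \<Longrightarrow> y \<in> X \<Longrightarrow> 0 \<le> d x y"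
    and s: "\<And>n. simple_function (lebesgue_on {0<..}) (s n)" "\<And>n t. t > 0 \<Longrightarrow> s n t \<in> X"
    and N: "negligible N" "\<And>t. t > 0 \<Longrightarrow> t \<notin> N \<Longrightarrow> v t \<in> X" "\<And>t. t > 0 \<Longrightarrow> t \<notin> N \<Longrightarrow> (\<lambda>n. d (s n t) (v t)) \<longlonglongrightarrow> 0"
    and \<kappa>: "\<kappa> > 0" and \<eta>: "\<eta> > 0"
  obtains K h0 where "K \<subseteq> {0<..b} - N" "compact K" "measure lebesgue ({0<..b} - K) \<le> \<kappa>" "h0 > 0"
    "\<And>\<sigma> \<tau>. \<sigma> \<in> K \<Longrightarrow> \<tau> \<in> K \<Longrightarrow> \<bar>\<sigma> - \<tau>\<bar> < h0 \<Longrightarrow> d (v \<sigma>) (v \<tau>) \<le> \<eta>"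
proof -
  define T where "T = {0<..b} - N"
  have Tm: "T \<in> lmeasurable" unfolding T_def
    by (intro fmeasurable_Diff negligible_imp_sets[OF N(1)] lmeasurable_Ioc)
  have Ts: "T \<in> sets lebesgue" using Tm by (rule fmeasurableD)
  have T0: "t > 0" "t \<notin> N" if "t \<in> T" for t using that by (auto simp: T_def)
  define f where "f = (\<lambda>n t. if t \<in> T then d (s n t) (v t) else 0)"
  have mset: "{t \<in> T. P (s n t) (s m t)} \<in> sets lebesgue" for P n m
  proof -
    have "simple_function (lebesgue_on {0<..}) (\<lambda>t. P (s n t) (s m t))"
      by (rule simple_function_compose2[OF s(1) s(1)])
    then have "(\<lambda>t. P (s n t) (s m t)) -` {True} \<inter> space (lebesgue_on {0<..}) \<in> sets (lebesgue_on {0<..})"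
      by (rule simple_functionD(2))
    then have "{t \<in> {0<..}. P (s n t) (s m t)} \<in> sets lebesgue"
      by (auto simp: space_restrict_space sets_restrict_space_iff vimage_def Int_def conj_commute)
    then have "T \<inter> {t \<in> {0<..}. P (s n t) (s m t)} \<in> sets lebesgue" using Ts by (rule sets.Int[rotated])
    moreover have "T \<inter> {t \<in> {0<..}. P (s n t) (s m t)} = {t \<in> T. P (s n t) (s m t)}" using T0 by auto
    ultimately show ?thesis by simp
  qed
  have fm: "f n \<in> borel_measurable lebesgue" for n
  proof (rule borel_measurable_LIMSEQ_real)
    show "(\<lambda>t. if t \<in> T then d (s n t) (s m t) else 0) \<in> borel_measurable lebesgue" for m
    proof (rule borel_measurable_lebesgue_preimage_borel[THEN iffD2, rule_format])
      fix A :: "real set" assume "A \<in> sets borel"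
      have "{t. (if t \<in> T then d (s n t) (s m t) else 0) \<in> A} = {t \<in> T. d (s n t) (s m t) \<in> A} \<union> (if 0 \<in> A then - T else {})"
        by auto
      also have "\<dots> \<in> sets lebesgue" using mset[of "\<lambda>x y. d x y \<in> A" n m] Ts
        by (cases "0 \<in> A") (simp_all add: sets.Un Compl_in_sets_lebesgue)
      finally show "{x. (if x \<in> T then d (s n x) (s m x) else 0) \<in> A} \<in> sets lebesgue" .
    qed
    fix t
    show "(\<lambda>m. if t \<in> T then d (s n t) (s m t) else 0) \<longlonglongrightarrow> f n t"
    proof (cases "t \<in> T")
      case True
      note t = T0[OF True]
      have "\<bar>d (s n t) (s m t) - d (s n t) (v t)\<bar> \<le> d (s m t) (v t)" for m
        using d(2)[of "s n t" "s m t" "v t"] d(2)[of "s n t" "v t" "s m t"] d(1)[of "s m t" "v t"] s(2)[OF t(1)] N(2)[OF t]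
        by (auto simp: abs_le_iff)
      then have "(\<lambda>m. d (s n t) (s m t) - d (s n t) (v t)) \<longlonglongrightarrow> 0"
        by (intro Lim_null_comparison[OF _ N(3)[OF t]] always_eventually) auto
      then show ?thesis using True by (simp add: f_def LIM_zero_iff)
    qed (simp add: f_def)
  qed
  define A where "A = (\<lambda>n. {t \<in> T. f n t > \<eta> / 2})"
  have A_eq: "A n = T \<inter> (f n -` {\<eta> / 2<..} \<inter> space lebesgue)" for n by (auto simp: A_def)
  have Am: "A n \<in> lmeasurable" for n
    unfolding A_eq by (intro fmeasurable_Int_fmeasurable Tm measurable_sets[OF fm]) auto
  have "(\<lambda>n. measure lebesgue (A n)) \<longlonglongrightarrow> 0"
  proof -
    have iT: "integrable lebesgue (indicator T :: real \<Rightarrow> real)" 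
      by (rule integrable_real_indicator[OF fmeasurableD[OF Tm]]) (metis fmeasurableD2[OF Tm] infinity_ennreal_def less_top)
    have "(\<lambda>n. integral\<^sup>L lebesgue (indicator (A n) :: real \<Rightarrow> real)) \<longlonglongrightarrow> integral\<^sup>L lebesgue (\<lambda>x::real. 0::real)"
    proof (rule integral_dominated_convergence[OF _ _ iT])
      show "indicator (A n) \<in> borel_measurable lebesgue" for n
        using Am[of n] by (auto dest: fmeasurableD)
      show "AE x in lebesgue. (\<lambda>n. indicator (A n) x :: real) \<longlonglongrightarrow> 0"
      proof (rule AE_I2)
        fix t :: real
        show "(\<lambda>n. indicator (A n) t :: real) \<longlonglongrightarrow> 0"
        proof (cases "t \<in> T")
          case True
          have "\<forall>\<^sub>F n in sequentially. d (s n t) (v t) < \<eta> / 2"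
            using N(3)[OF T0[OF True]] \<eta> by (intro order_tendstoD(2)) auto
          then have "\<forall>\<^sub>F n in sequentially. (indicator (A n) t :: real) = 0"
            by eventually_elim (auto simp: A_def f_def)
          then show ?thesis by (rule tendsto_eventually)
        qed (simp add: A_def)
      qed
      show "AE x in lebesgue. norm (indicator (A n) x :: real) \<le> indicator T x" for n
        by (intro AE_I2) (auto simp: A_def indicator_def)
    qed auto
    moreover have "integral\<^sup>L lebesgue (indicator (A n) :: real \<Rightarrow> real) = measure lebesgue (A n)" for n by simp
    ultimately show ?thesis by simp
  qed
  then have "\<forall>\<^sub>F n in sequentially. measure lebesgue (A n) < \<kappa> / 2"
    using \<kappa> by (intro order_tendstoD(2)) auto
  then obtain n where n: "measure lebesgue (A n) < \<kappa> / 2" using eventually_happens by fastforce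
  define W where "W = s n ` T"
  have finW: "finite W"
    by (rule finite_subset[OF _ simple_functionD(1)[OF s(1)[of n]]]) (use T0 in \<open>auto simp: W_def\<close>)
  define L where "L = (\<lambda>w. {t \<in> T - A n. s n t = w})"
  have Lm: "L w \<in> lmeasurable" for w
  proof -
    have "L w = {t \<in> T. s n t = w} - A n" by (auto simp: L_def)
    moreover have "{t \<in> T. s n t = w} = T \<inter> {t \<in> T. s n t = w}" by auto
    moreover have "T \<inter> {t \<in> T. s n t = w} \<in> lmeasurable"
      by (rule fmeasurable_Int_fmeasurable[OF Tm mset[of "\<lambda>x y. x = w" n n]])
    ultimately show ?thesis using Am[of n] by (auto intro: fmeasurable_Diff dest: fmeasurableD)
  qed
  define k where "k = \<kappa> / (2 * (real (card W) + 1))"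
  have k: "k > 0" "real (card W) * k \<le> \<kappa> / 2" using \<kappa> by (auto simp: k_def field_simps)
  have "\<exists>C. compact C \<and> C \<subseteq> L w \<and> measure lebesgue (L w - C) < k" for w
  proof -
    obtain C where C: "closed C" "C \<subseteq> L w" "L w - C \<in> lmeasurable" "emeasure lebesgue (L w - C) < ennreal k"
      using sets_lebesgue_inner_closed[OF fmeasurableD[OF Lm[of w]] k(1)] by metis
    have "bounded C" by (rule bounded_subset[of "{0..b}"]) (use C(2) in \<open>auto simp: L_def T_def\<close>)
    then have "compact C" using C(1) by (simp add: compact_eq_bounded_closed)
    moreover have "measure lebesgue (L w - C) < k"
      using C(3,4) by (simp add: emeasure_eq_measure2 ennreal_less_iff)
    ultimately show ?thesis using C(2) by blast
  qed
  then obtain C where C: "\<And>w. compact (C w)" "\<And>w. C w \<subseteq> L w" "\<And>w. measure lebesgue (L w - C w) < k" by metis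
  define K where "K = (\<Union>w\<in>W. C w)"
  have KT: "K \<subseteq> T - A n" using C(2) by (auto simp: K_def L_def)
  have Kc: "compact K" unfolding K_def by (intro compact_UN finW C(1))
  have Kl: "K \<in> lmeasurable" using Kc by (rule lmeasurable_compact)
  obtain g :: "'a \<Rightarrow> nat" where g: "inj_on g W" using finite_imp_inj_to_nat_seg[OF finW] by blast
  have gc: "continuous_on K (\<lambda>t. real (g (s n t)))"
    unfolding K_def
  proof (rule continuous_on_closed_Union[OF finW])
    show "closed (C w)" for w using C(1) by (rule compact_imp_closed)
    show "continuous_on (C w) (\<lambda>t. real (g (s n t)))" for w
    proof -
      have "continuous_on (C w) (\<lambda>t. real (g w))" by simp
      then show ?thesis by (rule continuous_on_eq) (use C(2)[of w] in \<open>auto simp: L_def\<close>)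
    qed
  qed
  obtain h0 where h0: "h0 > 0" "\<And>\<sigma> \<tau>. \<sigma> \<in> K \<Longrightarrow> \<tau> \<in> K \<Longrightarrow> dist \<tau> \<sigma> < h0 \<Longrightarrow> dist (real (g (s n \<tau>))) (real (g (s n \<sigma>))) < 1"
    using compact_uniformly_continuous[OF gc Kc] unfolding uniformly_continuous_on_def by (metis zero_less_one)
  show ?thesis
  proof (rule that[of K h0])
    show "K \<subseteq> {0<..b} - N" using KT by (auto simp: T_def)
    show "d (v \<sigma>) (v \<tau>) \<le> \<eta>" if "\<sigma> \<in> K" "\<tau> \<in> K" "\<bar>\<sigma> - \<tau>\<bar> < h0" for \<sigma> \<tau>
    proof -
      have T: "\<sigma> \<in> T - A n" "\<tau> \<in> T - A n" using KT that by auto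
      have "dist (real (g (s n \<tau>))) (real (g (s n \<sigma>))) < 1"
        using h0(2)[OF that(1,2)] that(3) by (simp add: dist_real_def abs_minus_commute)
      then have "g (s n \<tau>) = g (s n \<sigma>)" by (simp add: dist_real_def)
      then have eq: "s n \<tau> = s n \<sigma>" using g T by (auto simp: inj_on_def W_def)
      have a: "d (s n \<sigma>) (v \<sigma>) \<le> \<eta> / 2" "d (s n \<tau>) (v \<tau>) \<le> \<eta> / 2"
        using T by (auto simp: A_def f_def)
      have X: "v \<sigma> \<in> X" "v \<tau> \<in> X" "s n \<sigma> \<in> X" using T0 T N(2) s(2) by blast+
      show ?thesis using d(2)[of "v \<sigma>" "s n \<sigma>" "v \<tau>"] d(1)[of "v \<sigma>" "s n \<sigma>"] X a eq by auto
    qed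
    have Leq: "T - A n = (\<Union>w\<in>W. L w)" by (auto simp: L_def W_def)
    have d1: "{0<..b} - K \<subseteq> (N \<inter> {0<..b}) \<union> (A n \<union> (\<Union>w\<in>W. L w - C w))"
    proof
      fix t assume t: "t \<in> {0<..b} - K"
      show "t \<in> (N \<inter> {0<..b}) \<union> (A n \<union> (\<Union>w\<in>W. L w - C w))"
      proof (cases "t \<in> T - A n")
        case True
        then obtain w where "w \<in> W" "t \<in> L w" using Leq by auto
        then show ?thesis using t by (auto simp: K_def)
      qed (use t in \<open>auto simp: T_def\<close>)
    qed
    have LC: "L w - C w \<in> lmeasurable" for w
      using Lm[of w] lmeasurable_compact[OF C(1)[of w]] by (intro fmeasurable_Diff) (auto dest: fmeasurableD)
    have NN: "N \<inter> {0<..b} \<in> null_sets lebesgue"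
      using negligible_subset[OF N(1), of "N \<inter> {0<..b}"] by (auto simp: negligible_iff_null_sets)
    have NNl: "N \<inter> {0<..b} \<in> lmeasurable" using NN by (auto simp: null_sets_def fmeasurable_def)
    have U: "(\<Union>w\<in>W. L w - C w) \<in> lmeasurable" by (intro fmeasurable.finite_UN finW LC)
    have "measure lebesgue ({0<..b} - K) \<le> measure lebesgue ((N \<inter> {0<..b}) \<union> (A n \<union> (\<Union>w\<in>W. L w - C w)))"
    proof (rule measure_mono_fmeasurable[OF d1])
      show "{0<..b} - K \<in> sets lebesgue" using Kl by (auto dest: fmeasurableD)
      show "(N \<inter> {0<..b}) \<union> (A n \<union> (\<Union>w\<in>W. L w - C w)) \<in> lmeasurable" using NNl Am U by (intro fmeasurable.Un)
    qed
    also have "\<dots> \<le> measure lebesgue (N \<inter> {0<..b}) + measure lebesgue (A n \<union> (\<Union>w\<in>W. L w - C w))"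
      using NNl Am U by (intro measure_Un_le) (auto dest: fmeasurableD)
    also have "measure lebesgue (N \<inter> {0<..b}) = 0" using NN by (rule measure_eq_0_null_sets)
    also have "measure lebesgue (A n \<union> (\<Union>w\<in>W. L w - C w)) \<le> measure lebesgue (A n) + measure lebesgue (\<Union>w\<in>W. L w - C w)"
      using Am U by (intro measure_Un_le) (auto dest: fmeasurableD)
    also have "measure lebesgue (\<Union>w\<in>W. L w - C w) \<le> (\<Sum>w\<in>W. measure lebesgue (L w - C w))"
      using LC finW by (intro measure_UNION_le) (auto dest: fmeasurableD)
    also have "\<dots> \<le> (\<Sum>w\<in>W. k)" by (rule sum_mono) (use C(3) in \<open>auto intro: less_imp_le\<close>)
    finally show "measure lebesgue ({0<..b} - K) \<le> \<kappa>" using n k(2) by simp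
  qed (use Kc h0 in auto)
qed

text \<open>Continuity of translations in \<open>L2\<close> of time, with a bound that splits as \<open>e \<sigma> + e \<tau>\<close>. On a large compact set
  where \<open>\<theta> \<le> \<Lambda>\<close> the constant \<open>\<eta>\<close> serves for \<open>e\<close>; elsewhere \<open>e\<close> is about \<open>\<theta> + \<Lambda>\<close>, which has
  small norm as the exceptional set is small compared with \<open>\<Lambda>\<close>.\<close>

lemma translation_modulus:
  fixes d :: "'a \<Rightarrow> 'a \<Rightarrow> real" and v :: "real \<Rightarrow> 'a" and s :: "nat \<Rightarrow> real \<Rightarrow> 'a" and \<theta> :: "real \<Rightarrow> real"
  assumes d: "\<And>x y. x \<in> X \<Longrightarrow> y \<in> X \<Longrightarrow> d x y = d y x" "\<And>x y z. x \<in> X \<Longrightarrow> y \<in> X \<Longrightarrow> z \<in> X \<Longrightarrow> d x z \<le> d x y + d y z"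
    "\<And>x y. x \<in> X \<Longrightarrow> y \<in> X \<Longrightarrow> 0 \<le> d x y"
    and s: "\<And>n. simple_function (lebesgue_on {0<..}) (s n)" "\<And>n t. t > 0 \<Longrightarrow> s n t \<in> X"
    and N: "negligible N" "\<And>t. t > 0 \<Longrightarrow> t \<notin> N \<Longrightarrow> v t \<in> X" "\<And>t. t > 0 \<Longrightarrow> t \<notin> N \<Longrightarrow> (\<lambda>n. d (s n t) (v t)) \<longlonglongrightarrow> 0"
    and \<theta>: "\<And>t. 0 \<le> \<theta> t" "\<And>\<sigma> \<tau>. \<sigma> > 0 \<Longrightarrow> \<tau> > 0 \<Longrightarrow> \<sigma> \<notin> N \<Longrightarrow> \<tau> \<notin> N \<Longrightarrow> d (v \<sigma>) (v \<tau>) \<le> \<theta> \<sigma> + \<theta> \<tau>"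
    and i\<theta>: "integrable (lebesgue_on {0<..b}) (\<lambda>t. (\<theta> t)\<^sup>2)"
    and \<epsilon>: "\<epsilon> > 0"
  obtains e h0 where "h0 > 0" "\<And>t. 0 \<le> e t" "integrable (lebesgue_on {0<..b}) (\<lambda>t. (e t)\<^sup>2)"
    "(LINT t|lebesgue_on {0<..b}. (e t)\<^sup>2) \<le> \<epsilon>"
    "\<And>\<sigma> \<tau>. \<sigma> \<in> {0<..b} - N \<Longrightarrow> \<tau> \<in> {0<..b} - N \<Longrightarrow> \<bar>\<sigma> - \<tau>\<bar> < h0 \<Longrightarrow> d (v \<sigma>) (v \<tau>) \<le> e \<sigma> + e \<tau>"
proof -
  define M where "M = lebesgue_on {0<..b}"
  have sM: "space M = {0<..b}" by (simp add: M_def space_restrict_space)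
  interpret finite_measure M unfolding M_def by (rule finite_measure_lebesgue_on[OF lmeasurable_Ioc])
  have i: "integrable M (\<lambda>t. (\<theta> t)\<^sup>2)" using i\<theta> by (simp add: M_def)
  have m: "\<theta> \<in> borel_measurable M"
  proof -
    have "(\<lambda>t. sqrt ((\<theta> t)\<^sup>2)) \<in> borel_measurable M" using i by measurable
    then show ?thesis using \<theta>(1) by (simp add: real_sqrt_abs abs_of_nonneg)
  qed
  have "(\<lambda>n. LINT t|M. indicator {t. \<theta> t > real n} t * (\<theta> t)\<^sup>2) \<longlonglongrightarrow> (LINT t|M. 0)"
  proof (rule integral_dominated_convergence[OF _ _ i])
    show "(\<lambda>t. indicator {t. \<theta> t > real n} t * (\<theta> t)\<^sup>2) \<in> borel_measurable M" for n
    proof -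
      have "(\<lambda>t. if \<theta> t > real n then (\<theta> t)\<^sup>2 else 0) \<in> borel_measurable M" using m by measurable
      moreover have "(\<lambda>t. indicator {t. \<theta> t > real n} t * (\<theta> t)\<^sup>2) = (\<lambda>t. if \<theta> t > real n then (\<theta> t)\<^sup>2 else 0)"
        by (auto simp: indicator_def)
      ultimately show ?thesis by simp
    qed
    show "AE t in M. (\<lambda>n. indicator {t. \<theta> t > real n} t * (\<theta> t)\<^sup>2) \<longlonglongrightarrow> 0"
    proof (rule AE_I2)
      fix t
      obtain k where k: "\<theta> t < real k" using reals_Archimedean2 by blast
      have "\<forall>\<^sub>F n in sequentially. indicator {t. \<theta> t > real n} t * (\<theta> t)\<^sup>2 = 0"
        using eventually_ge_at_top[of k] by eventually_elim (use k in \<open>auto simp: indicator_def\<close>)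
      then show "(\<lambda>n. indicator {t. \<theta> t > real n} t * (\<theta> t)\<^sup>2) \<longlonglongrightarrow> 0" by (rule tendsto_eventually)
    qed
    show "AE t in M. norm (indicator {t. \<theta> t > real n} t * (\<theta> t)\<^sup>2) \<le> (\<theta> t)\<^sup>2" for n
      by (intro AE_I2) (auto simp: indicator_def)
  qed auto
  then have "\<forall>\<^sub>F n in sequentially. (LINT t|M. indicator {t. \<theta> t > real n} t * (\<theta> t)\<^sup>2) < \<epsilon> / 24"
    using \<epsilon> by (intro order_tendstoD(2)) auto
  then obtain n where n: "(LINT t|M. indicator {t. \<theta> t > real n} t * (\<theta> t)\<^sup>2) < \<epsilon> / 24"
    using eventually_happens by fastforce
  define \<Lambda> where "\<Lambda> = real n"
  have \<Lambda>: "\<Lambda> \<ge> 0" by (simp add: \<Lambda>_def)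
  define \<mu> where "\<mu> = measure M {0<..b}"
  define \<eta> where "\<eta> = sqrt (\<epsilon> / (6 * (\<mu> + 1)))"
  have \<mu>: "\<mu> \<ge> 0" by (simp add: \<mu>_def)
  have \<eta>: "\<eta> > 0" "\<eta>\<^sup>2 * \<mu> \<le> \<epsilon> / 6"
  proof -
    show "\<eta> > 0" using \<epsilon> \<mu> by (simp add: \<eta>_def)
    have "\<eta>\<^sup>2 * \<mu> = \<epsilon> / 6 * (\<mu> / (\<mu> + 1))" using \<epsilon> \<mu> by (simp add: \<eta>_def field_simps)
    also have "\<dots> \<le> \<epsilon> / 6 * 1" using \<epsilon> \<mu> by (intro mult_left_mono) auto
    finally show "\<eta>\<^sup>2 * \<mu> \<le> \<epsilon> / 6" by simp
  qed
  define \<kappa> where "\<kappa> = \<epsilon> / (24 * (\<Lambda>\<^sup>2 + 1))"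
  have \<kappa>: "\<kappa> > 0" "\<Lambda>\<^sup>2 * \<kappa> \<le> \<epsilon> / 24"
  proof -
    show "\<kappa> > 0" using \<epsilon> by (simp add: \<kappa>_def add_nonneg_pos)
    have "\<Lambda>\<^sup>2 * \<kappa> = \<epsilon> / 24 * (\<Lambda>\<^sup>2 / (\<Lambda>\<^sup>2 + 1))" by (simp add: \<kappa>_def)
    also have "\<dots> \<le> \<epsilon> / 24 * 1" using \<epsilon> by (intro mult_left_mono) (auto simp: divide_le_eq add_nonneg_pos)
    finally show "\<Lambda>\<^sup>2 * \<kappa> \<le> \<epsilon> / 24" by simp
  qed
  obtain K h0 where K: "K \<subseteq> {0<..b} - N" "compact K" "measure lebesgue ({0<..b} - K) \<le> \<kappa>" "h0 > 0"
    "\<And>\<sigma> \<tau>. \<sigma> \<in> K \<Longrightarrow> \<tau> \<in> K \<Longrightarrow> \<bar>\<sigma> - \<tau>\<bar> < h0 \<Longrightarrow> d (v \<sigma>) (v \<tau>) \<le> \<eta>"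
    using Lusin_simple_approximation[OF d s N \<kappa>(1) \<eta>(1), of b] by blast
  define G where "G = {t \<in> K. \<theta> t \<le> \<Lambda>}"
  define e where "e = (\<lambda>t. if t \<in> G then \<eta> else \<eta> + (\<theta> t + \<Lambda>))"
  have Kb: "K \<in> sets lebesgue" using lmeasurable_compact[OF K(2)] by (rule fmeasurableD)
  have KM: "K \<in> sets M" using Kb K(1) by (auto simp: M_def sets_restrict_space_iff)
  have em: "e \<in> borel_measurable M"
  proof -
    have "(\<lambda>t. if t \<in> K \<and> \<theta> t \<le> \<Lambda> then \<eta> else \<eta> + (\<theta> t + \<Lambda>)) \<in> borel_measurable M"
      using m KM by measurable
    then show ?thesis by (simp add: e_def G_def)
  qed
  define R where "R = (\<lambda>t. 2 * \<eta>\<^sup>2 + 8 * (indicator {t. \<theta> t > real n} t * (\<theta> t)\<^sup>2) + 8 * \<Lambda>\<^sup>2 * indicator ({0<..b} - K) t)"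
  have ind: "{0<..b} - K \<in> sets M" using KM sM by (metis sets.compl_sets)
  have i1: "integrable M (\<lambda>t. indicator {t. \<theta> t > real n} t * (\<theta> t)\<^sup>2)"
  proof (rule Bochner_Integration.integrable_bound[OF i])
    have "(\<lambda>t. if \<theta> t > real n then (\<theta> t)\<^sup>2 else 0) \<in> borel_measurable M" using m by measurable
    moreover have "(\<lambda>t. indicator {t. \<theta> t > real n} t * (\<theta> t)\<^sup>2) = (\<lambda>t. if \<theta> t > real n then (\<theta> t)\<^sup>2 else 0)"
      by (auto simp: indicator_def)
    ultimately show "(\<lambda>t. indicator {t. \<theta> t > real n} t * (\<theta> t)\<^sup>2) \<in> borel_measurable M" by simp
  qed (auto simp: indicator_def)
  have i2: "integrable M (indicator ({0<..b} - K) :: real \<Rightarrow> real)"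
    by (rule integrable_real_indicator[OF ind]) (simp add: less_top[symmetric])
  have Ri: "integrable M R" unfolding R_def using i1 i2 by auto
  have eR: "(e t)\<^sup>2 \<le> R t" if t: "t \<in> {0<..b}" for t
  proof (cases "t \<in> G")
    case True then show ?thesis by (simp add: e_def R_def indicator_def)
  next
    case False
    have q: "(x + y)\<^sup>2 \<le> 2 * x\<^sup>2 + 2 * y\<^sup>2" for x y :: real
      using zero_le_power2[of "x - y"] by (simp add: power2_sum power2_diff)
    have e: "(e t)\<^sup>2 \<le> 2 * \<eta>\<^sup>2 + 4 * ((\<theta> t)\<^sup>2 + \<Lambda>\<^sup>2)"
      using False q[of \<eta> "\<theta> t + \<Lambda>"] q[of "\<theta> t" \<Lambda>] by (simp add: e_def)
    show ?thesis
    proof (cases "\<theta> t > \<Lambda>")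
      case True
      then have "\<Lambda>\<^sup>2 \<le> (\<theta> t)\<^sup>2" using \<Lambda> by (simp add: power_mono)
      moreover have "0 \<le> 8 * \<Lambda>\<^sup>2 * (indicator ({0<..b} - K) t :: real)" by simp
      moreover have "R t = 2 * \<eta>\<^sup>2 + 8 * (\<theta> t)\<^sup>2 + 8 * \<Lambda>\<^sup>2 * indicator ({0<..b} - K) t"
        using True by (simp add: R_def \<Lambda>_def)
      ultimately have "2 * \<eta>\<^sup>2 + 8 * (\<theta> t)\<^sup>2 \<le> R t" "(\<Lambda>)\<^sup>2 \<le> (\<theta> t)\<^sup>2" by simp_all
      then show ?thesis using e by (simp add: distrib_left)
    next
      case le: False
      then have "(\<theta> t)\<^sup>2 \<le> \<Lambda>\<^sup>2" using \<theta>(1)[of t] by (simp add: power_mono)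
      moreover have "t \<in> {0<..b} - K" using False le t by (auto simp: G_def)
      ultimately show ?thesis using e le by (simp add: R_def \<Lambda>_def)
    qed
  qed
  have ei: "integrable M (\<lambda>t. (e t)\<^sup>2)"
    by (rule Bochner_Integration.integrable_bound[OF Ri]) (use em eR sM in \<open>auto intro!: AE_I2 order_trans[OF eR abs_ge_self]\<close>)
  have "(LINT t|M. (e t)\<^sup>2) \<le> (LINT t|M. R t)"
    by (rule integral_mono[OF ei Ri]) (use eR sM in auto)
  also have "\<dots> = 2 * \<eta>\<^sup>2 * \<mu> + 8 * (LINT t|M. indicator {t. \<theta> t > real n} t * (\<theta> t)\<^sup>2) + 8 * \<Lambda>\<^sup>2 * measure M ({0<..b} - K)"
    unfolding R_def using i1 i2 ind Int_absorb2[of "{0<..b} - K" "{0<..b}"] by (simp add: \<mu>_def sM)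
  also have "measure M ({0<..b} - K) = measure lebesgue ({0<..b} - K)"
    unfolding M_def by (rule measure_restrict_space) auto
  also have "2 * \<eta>\<^sup>2 * \<mu> + 8 * (LINT t|M. indicator {t. \<theta> t > real n} t * (\<theta> t)\<^sup>2) + 8 * \<Lambda>\<^sup>2 * measure lebesgue ({0<..b} - K) \<le> \<epsilon>"
  proof -
    have "\<Lambda>\<^sup>2 * measure lebesgue ({0<..b} - K) \<le> \<epsilon> / 24"
      using mult_left_mono[OF K(3), of "\<Lambda>\<^sup>2"] \<kappa>(2) by simp
    then show ?thesis using \<eta>(2) n by linarith
  qed
  finally have eb: "(LINT t|M. (e t)\<^sup>2) \<le> \<epsilon>" .
  show ?thesis
  proof (rule that[OF K(4)])
    show "0 \<le> e t" for t using \<eta> \<theta>(1)[of t] \<Lambda> by (simp add: e_def)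
    show "integrable (lebesgue_on {0<..b}) (\<lambda>t. (e t)\<^sup>2)" "(LINT t|lebesgue_on {0<..b}. (e t)\<^sup>2) \<le> \<epsilon>"
      using ei eb by (simp_all add: M_def)
    fix \<sigma> \<tau> assume \<sigma>\<tau>: "\<sigma> \<in> {0<..b} - N" "\<tau> \<in> {0<..b} - N" "\<bar>\<sigma> - \<tau>\<bar> < h0"
    have b: "d (v \<sigma>) (v \<tau>) \<le> \<theta> \<sigma> + \<theta> \<tau>" using \<theta>(2) \<sigma>\<tau> by auto
    show "d (v \<sigma>) (v \<tau>) \<le> e \<sigma> + e \<tau>"
      using K(5)[of \<sigma> \<tau>] \<sigma>\<tau>(3) b \<eta>(1) \<Lambda> \<theta>(1)[of \<sigma>] \<theta>(1)[of \<tau>] by (auto simp: e_def G_def)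
  qed
qed

text \<open>On an interval on which \<open>k\<close> has integral less than one half, the supremum of \<open>y\<close> is at most half of itself;
  finitely many such intervals reach \<open>b\<close>.\<close>

lemma Gronwall_zero:
  fixes y k :: "real \<Rightarrow> real"
  assumes y: "\<And>t. 0 \<le> y t" "\<And>t. y t \<le> B" and k: "\<And>t. 0 \<le> k t" "\<And>b. k integrable_on {0..b}"
    and ky: "\<And>b. (\<lambda>t. k t * y t) integrable_on {0..b}"
    and le: "\<And>b. b \<ge> 0 \<Longrightarrow> y b \<le> integral {0..b} (\<lambda>t. k t * y t)"
    and b: "b \<ge> 0"
  shows "y b = 0"
proof -
  have ys: "\<exists>S\<ge>0. (\<forall>t\<in>I. y t \<le> S) \<and> (\<forall>S'. (\<forall>t\<in>I. y t \<le> S') \<longrightarrow> S \<le> S')" if ne: "I \<noteq> {}" for I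
  proof -
    have bdd: "bdd_above (y ` I)" using y(2) by (auto intro!: bdd_aboveI[of _ B])
    obtain t where t: "t \<in> I" using ne by blast
    show ?thesis
      by (rule exI[of _ "Sup (y ` I)"])
        (use cSup_upper[OF _ bdd] cSup_least[of "y ` I"] ne order_trans[OF y(1)[of t] cSup_upper[OF imageI[OF t] bdd]] in auto)
  qed
  have Kc: "continuous_on {0..b} (\<lambda>t. integral {0..t} k)" by (rule indefinite_integral_continuous_1[OF k(2)])
  obtain \<delta> where \<delta>: "\<delta> > 0" "\<And>s t. s \<in> {0..b} \<Longrightarrow> t \<in> {0..b} \<Longrightarrow> dist t s < \<delta> \<Longrightarrow> dist (integral {0..t} k) (integral {0..s} k) < 1 / 2"
    using compact_uniformly_continuous[OF Kc compact_Icc] unfolding uniformly_continuous_on_def 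
    by (meson half_gt_zero zero_less_one)
  have "\<forall>t\<in>{0..min b (real n * (\<delta> / 2))}. y t = 0" for n
  proof (induction n)
    case 0
    have "y 0 = 0" using le[of 0] y(1)[of 0] by simp
    then show ?case using b by simp
  next
    case (Suc n)
    define a where "a = min b (real n * (\<delta> / 2))"
    define c where "c = min b (real (Suc n) * (\<delta> / 2))"
    have ac: "0 \<le> a" "a \<le> c" "c \<le> b" using b \<delta> by (auto simp: a_def c_def algebra_simps min_le_iff_disj)
    have ca: "c - a < \<delta>" using \<delta> by (auto simp: a_def c_def algebra_simps min_def)
    have z: "y t = 0" if "t \<in> {0..a}" for t using Suc that by (simp add: a_def)
    obtain S where S: "S \<ge> 0" "\<And>t. t \<in> {a..c} \<Longrightarrow> y t \<le> S" "\<And>S'. (\<And>t. t \<in> {a..c} \<Longrightarrow> y t \<le> S') \<Longrightarrow> S \<le> S'"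
      using ys[of "{a..c}"] ac by auto
    have "y t \<le> S / 2" if t: "t \<in> {a..c}" for t
    proof -
      have sub: "f integrable_on {p..q}" if "f integrable_on {0..b}" "0 \<le> p" "q \<le> b" for f :: "real \<Rightarrow> real" and p q
        using integrable_on_subinterval[OF that(1)] that(2,3) by auto
      have "integral {0..t} (\<lambda>t. k t * y t) = integral {0..a} (\<lambda>t. k t * y t) + integral {a..t} (\<lambda>t. k t * y t)"
        using Henstock_Kurzweil_Integration.integral_combine[of 0 a t "\<lambda>t. k t * y t"] ky ac t by auto
      also have "integral {0..a} (\<lambda>t. k t * y t) = integral {0..a} (\<lambda>t. 0)" by (rule integral_cong) (use z in auto)
      also have "integral {a..t} (\<lambda>t. k t * y t) \<le> integral {a..t} (\<lambda>t. k t * S)"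
      proof (rule integral_le)
        show "(\<lambda>t. k t * y t) integrable_on {a..t}" by (rule sub[OF ky]) (use ac t in auto)
        show "(\<lambda>t. k t * S) integrable_on {a..t}" by (intro integrable_on_mult_left sub[OF k(2)]) (use ac t in auto)
        show "k x * y x \<le> k x * S" if "x \<in> {a..t}" for x using S(2)[of x] that t k(1) by (intro mult_left_mono) auto
      qed
      also have "integral {a..t} (\<lambda>t. k t * S) = integral {a..t} k * S" by simp
      also have "integral {a..t} k \<le> 1 / 2"
      proof -
        have "integral {0..a} k + integral {a..t} k = integral {0..t} k"
          using Henstock_Kurzweil_Integration.integral_combine[of 0 a t k] k(2) ac t by auto
        moreover have "dist (integral {0..t} k) (integral {0..a} k) < 1 / 2"
          using \<delta>(2)[of a t] ac t ca by (auto simp: dist_real_def)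
        ultimately show ?thesis unfolding dist_real_def by linarith
      qed
      finally have "integral {0..t} (\<lambda>t. k t * y t) \<le> 1 / 2 * S" using S(1) by (simp add: mult_right_mono)
      then show ?thesis using le[of t] ac t by auto
    qed
    then have "S \<le> S / 2" by (rule S(3))
    then have "S = 0" using S(1) by simp
    then have z': "y t = 0" if "t \<in> {a..c}" for t using S(2)[OF that] y(1)[of t] by simp
    show ?case unfolding c_def[symmetric]
    proof
      fix t assume "t \<in> {0..c}"
      then show "y t = 0" using z[of t] z'[of t] by (cases "t \<le> a") auto
    qed
  qed
  note zero = this
  obtain n where "b / (\<delta> / 2) < real n" using reals_Archimedean2 by blast
  then have "b \<le> real n * (\<delta> / 2)" using \<delta>(1) by (simp add: field_simps)
  then have "min b (real n * (\<delta> / 2)) = b" by simp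
  then show ?thesis using zero[of n] b by simp
qed

section \<open>The perturbation as a curve\<close>

lemma AE_lebesgue_on_negligible:
  assumes "AE x in lebesgue_on S. P x" "S \<in> sets lebesgue"
  obtains Z where "negligible Z" "\<And>x. x \<in> S \<Longrightarrow> x \<notin> Z \<Longrightarrow> P x"
proof -
  have "AE x in lebesgue. x \<in> S \<longrightarrow> P x" using assms by (simp add: AE_lebesgue_on_iff)
  then obtain Z where "Z \<in> null_sets lebesgue" "{x \<in> space lebesgue. \<not> (x \<in> S \<longrightarrow> P x)} \<subseteq> Z"
    unfolding eventually_ae_filter by blast
  then show ?thesis by (intro that[of Z]) (auto simp: negligible_iff_null_sets)
qed

text \<open>The case distinction is on the integrability of \<open>g\<close>: if \<open>g\<close> is not integrable, its integral is zero, and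
  \<open>f \<ge> 0\<close> gives the bound.\<close>

lemma LINT_le_bound:
  fixes f g :: "real \<Rightarrow> real"
  assumes f: "integrable (lebesgue_on {s..t}) f" "\<And>\<tau>. \<tau> \<in> {s..t} \<Longrightarrow> 0 \<le> f \<tau>"
    and Z: "negligible Z" "\<And>\<tau>. \<tau> \<in> {s..t} - Z \<Longrightarrow> g \<tau> \<le> f \<tau>"
  shows "(LINT \<tau>|lebesgue_on {s..t}. g \<tau>) \<le> integral {s..t} f"
proof -
  have eq: "(LINT \<tau>|lebesgue_on {s..t}. f \<tau>) = integral {s..t} f"
    by (rule lebesgue_integral_eq_integral[OF f(1)]) simp
  have f0: "0 \<le> (LINT \<tau>|lebesgue_on {s..t}. f \<tau>)"
    by (rule integral_nonneg_AE) (use f(2) in \<open>auto intro!: AE_I2\<close>)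
  show ?thesis
  proof (cases "integrable (lebesgue_on {s..t}) g")
    case True
    have "AE \<tau> in lebesgue. \<tau> \<notin> Z" by (rule AE_notin_negligible[OF Z(1)])
    then have "AE \<tau> in lebesgue_on {s..t}. g \<tau> \<le> f \<tau>"
      by (subst AE_lebesgue_on_iff) (auto elim!: eventually_mono intro: Z(2))
    then show ?thesis using integral_mono_AE[OF True f(1)] eq by simp
  next
    case False then show ?thesis using f0 eq by (simp add: not_integrable_integral_eq)
  qed
qed

lemma integral_reflect_about:
  fixes f :: "real \<Rightarrow> real"
  assumes "f integrable_on {c - b..c - a}"
  shows "(\<lambda>x. f (c - x)) integrable_on {a..b}" "integral {a..b} (\<lambda>x. f (c - x)) = integral {c - b..c - a} f"
proof -
  have "(f has_integral integral {c - b..c - a} f) {-b + c..-a + c}"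
    using integrable_integral[OF assms] by (simp add: add.commute)
  then have "((f \<circ> (+) c) has_integral integral {c - b..c - a} f) {-b..-a}"
    by (simp only: has_integral_shift_Icc_real)
  then have "((\<lambda>x. (f \<circ> (+) c) (- x)) has_integral integral {c - b..c - a} f) {a..b}"
    using has_integral_reflect_real[where f="f \<circ> (+) c" and a="-b" and b="-a"] by simp
  then have "((\<lambda>x. f (c - x)) has_integral integral {c - b..c - a} f) {a..b}" by (simp add: o_def)
  then show "(\<lambda>x. f (c - x)) integrable_on {a..b}" "integral {a..b} (\<lambda>x. f (c - x)) = integral {c - b..c - a} f"
    by (auto simp: has_integral_integrable_integral)
qed

lemma constant_C1_test_curve:
  assumes "\<phi> \<in> C0_sigma \<Omega>" shows "C1_test_curve \<Omega> (\<lambda>_. \<phi>) (\<lambda>_ _. 0)"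
proof -
  have it: "iter_deriv vs (\<lambda>x. 0) = (\<lambda>x. 0)" for vs :: "(real^2) list"
    by (induction vs) (auto simp: frechet_derivative_const)
  have sm: "smooth (\<lambda>x::real^2. 0::real^2)" by (rule smooth_const)
  have "(\<lambda>x. 0) \<in> C0_sigma \<Omega>"
    by (rule C0_sigmaI[OF sm, where K="{}"]) (auto simp: jacobian_divergence2 jacobian_nth frechet_derivative_const)
  moreover have "test_tendsto \<Omega> (\<lambda>s x. 0) (\<lambda>x. 0) F" for F :: "real filter"
    unfolding test_tendsto_def it by (intro conjI exI[of _ "{}"]) (auto simp: supp_def intro: uniform_limit_const)
  ultimately show ?thesis using assms by (simp add: C1_test_curve_def)
qed

text \<open>The bound \<open>U\<close> of \<open>u\<close> comes from the decay condition, as \<open>\<Omega>\<close> stays away from the origin. It governs short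
  times; for the decay at infinity only the scale invariant condition \<open>u_decay\<close> is used.\<close>

locale perturbed_flow =
  fixes \<Omega> :: "(real^2) set" and u :: "real^2 \<Rightarrow> real^2" and v :: "real \<Rightarrow> real^2 \<Rightarrow> real^2" and U :: real
  assumes op: "open \<Omega>" and bd: "bounded (- \<Omega>)" and sym: "uminus ` \<Omega> = \<Omega>"
    and u_H1: "u \<in> H1_dot \<Omega>" and u_div: "weakly_div_free \<Omega> u"
    and u_bound: "\<And>x. x \<in> \<Omega> \<Longrightarrow> norm (u x) \<le> U" and U_nonneg: "U \<ge> 0"
    and u_decay: "\<And>x. x \<in> \<Omega> \<Longrightarrow> norm x * norm (u x) \<le> 1"
    and u_sym: "centrally_symmetric \<Omega> u"
    and v_sigma: "\<And>t. t \<ge> 0 \<Longrightarrow> v t \<in> L2_sigma \<Omega>"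
    and v_Bochner: "v \<in> Bochner_L2 (H1_dot_0_sigma \<Omega>) (H1_dot_norm \<Omega>)"
    and v_weak: "\<And>\<phi> \<phi>' s t. C1_test_curve \<Omega> \<phi> \<phi>' \<Longrightarrow> 0 \<le> s \<Longrightarrow> s \<le> t \<Longrightarrow>
        L2_inner \<Omega> (v t) (\<phi> t) +
        (LINT \<tau>|lebesgue_on {s..t}.
            L2_inner \<Omega> (wgrad \<Omega> (v \<tau>)) (\<lambda>x. jacobian (\<phi> \<tau>) (at x)) +
            L2_inner \<Omega> (convect \<Omega> u (v \<tau>)) (\<phi> \<tau>) +
            L2_inner \<Omega> (convect \<Omega> (v \<tau>) u) (\<phi> \<tau>) +
            L2_inner \<Omega> (convect \<Omega> (v \<tau>) (v \<tau>)) (\<phi> \<tau>))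
        = L2_inner \<Omega> (v s) (\<phi> s) +
          (LINT \<tau>|lebesgue_on {s..t}. L2_inner \<Omega> (v \<tau>) (\<phi>' \<tau>))"
    and v_decreasing: "\<And>s t. 0 \<le> s \<Longrightarrow> s \<le> t \<Longrightarrow> L2_norm \<Omega> (v t) \<le> L2_norm \<Omega> (v s)"
    and v0_sym: "centrally_symmetric \<Omega> (v 0)"
begin

definition N :: "real \<Rightarrow> real" where "N t = L2_norm \<Omega> (wgrad \<Omega> (v t))"
definition M :: real where "M = L2_norm \<Omega> (v 0)"
definition good :: "real \<Rightarrow> bool" where "good t \<longleftrightarrow> t > 0 \<and> v t \<in> H1_dot_0_sigma \<Omega>"

text \<open>The extension by the initial value to negative times makes one-sided continuity meaningful on the
  whole line.\<close>

definition V :: "real \<Rightarrow> real^2 \<Rightarrow> real^2" where "V t = v (max 0 t)"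

lemma \<Omega>: "\<Omega> \<in> sets lebesgue" using op by auto

lemma N_nonneg: "0 \<le> N t" and M_nonneg: "0 \<le> M" by (simp_all add: N_def M_def)

lemma V_sigma: "V t \<in> L2_sigma \<Omega>" by (simp add: V_def v_sigma)

lemma L2_sigma_L2: "w \<in> L2_sigma \<Omega> \<Longrightarrow> w \<in> L2 \<Omega>" by (simp add: L2_sigma_def)

lemma V_L2: "V t \<in> L2 \<Omega>" by (rule L2_sigma_L2[OF V_sigma])

lemma v_L2: "t \<ge> 0 \<Longrightarrow> v t \<in> L2 \<Omega>" by (rule L2_sigma_L2[OF v_sigma])

lemma v_le_M: "t \<ge> 0 \<Longrightarrow> L2_norm \<Omega> (v t) \<le> M" using v_decreasing[of 0 t] by (simp add: M_def)

lemma V_le_M: "L2_norm \<Omega> (V t) \<le> M" by (simp add: V_def v_le_M)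

lemma u_meas: "u \<in> borel_measurable (lebesgue_on \<Omega>)"
  by (rule L1_loc_measurable[OF op]) (use u_div in \<open>simp add: weakly_div_free_def\<close>)

lemma good_solenoidal: "good t \<Longrightarrow> solenoidal_H1_0 \<Omega> (v t) (wgrad \<Omega> (v t))"
  by (rule solenoidal_H1_0_wgrad[OF op bd]) (auto simp: good_def v_sigma)

lemma wgrad_L2: "good t \<Longrightarrow> wgrad \<Omega> (v t) \<in> L2 \<Omega>"
  using good_solenoidal by (simp add: solenoidal_H1_0_def)

lemma bad_negligible: "negligible {t. t > 0 \<and> \<not> good t}"
proof -
  have "AE t in lebesgue_on {0<..}. v t \<in> H1_dot_0_sigma \<Omega>"
    using v_Bochner by (simp add: Bochner_L2_def strongly_measurable_def)
  then obtain Z where Z: "negligible Z" "\<And>t. t \<in> {0<..} \<Longrightarrow> t \<notin> Z \<Longrightarrow> v t \<in> H1_dot_0_sigma \<Omega>"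
    by (rule AE_lebesgue_on_negligible) auto
  show ?thesis by (rule negligible_subset[OF Z(1)]) (use Z(2) in \<open>auto simp: good_def\<close>)
qed

lemma N2_integrable: 
  assumes "S \<subseteq> {0..}" "S \<in> sets lebesgue"
  shows "integrable (lebesgue_on S) (\<lambda>t. (N t)\<^sup>2)"
proof -
  have "integrable (lebesgue_on {0<..}) (\<lambda>t. (N t)\<^sup>2)"
    using v_Bochner by (simp add: Bochner_L2_def N_def H1_dot_norm_def)
  then have "(\<lambda>t. (N t)\<^sup>2) absolutely_integrable_on {0<..}"
    by (simp add: integrable_restrict_space set_integrable_def)
  then have "(\<lambda>t. (N t)\<^sup>2) absolutely_integrable_on {0..}"
  proof (rule absolutely_integrable_spike_set)
    show "negligible {x \<in> {0<..} - {0..}. (N x)\<^sup>2 \<noteq> 0}" "negligible {x \<in> {0..} - {0<..}. (N x)\<^sup>2 \<noteq> 0}"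
      by (rule negligible_subset[of "{0}"]; auto)+
  qed
  then have "(\<lambda>t. (N t)\<^sup>2) absolutely_integrable_on S"
    by (rule set_integrable_subset) (use assms in auto)
  then show ?thesis using assms by (simp add: integrable_restrict_space set_integrable_def)
qed

lemma N_integrable:
  assumes "0 \<le> a" shows "integrable (lebesgue_on {a..b}) N"
proof -
  have i: "integrable (lebesgue_on {a..b}) (\<lambda>t. (N t)\<^sup>2)" by (rule N2_integrable) (use assms in auto)
  have "(\<lambda>t. sqrt ((N t)\<^sup>2)) \<in> borel_measurable (lebesgue_on {a..b})" using i by measurable
  then have m: "N \<in> borel_measurable (lebesgue_on {a..b})" using N_nonneg by (simp add: abs_of_nonneg)
  interpret finite_measure "lebesgue_on {a..b}" by (rule finite_measure_lebesgue_on) simp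
  have nb: "norm (N t) \<le> norm (1 + (N t)\<^sup>2)" for t
    using zero_le_power2[of "N t - 1"] N_nonneg[of t] by (simp add: power2_diff)
  have "integrable (lebesgue_on {a..b}) (\<lambda>t. 1 + (N t)\<^sup>2)" using i by auto
  then show ?thesis by (rule Bochner_Integration.integrable_bound[OF _ m AE_I2[OF nb]])
qed

lemma N_integrable_on: "0 \<le> a \<Longrightarrow> N integrable_on {a..b}"
  and N2_integrable_on: "0 \<le> a \<Longrightarrow> (\<lambda>t. (N t)\<^sup>2) integrable_on {a..b}"
  using integrable_on_lebesgue_on[OF N_integrable] integrable_on_lebesgue_on[OF N2_integrable, of "{a..b}"] by auto

definition I :: "real \<Rightarrow> (real^2 \<Rightarrow> real^2) \<Rightarrow> real" where
  "I \<tau> \<phi> = L2_inner \<Omega> (wgrad \<Omega> (v \<tau>)) (\<lambda>x. jacobian \<phi> (at x)) + L2_inner \<Omega> (convect \<Omega> u (v \<tau>)) \<phi>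
     + L2_inner \<Omega> (convect \<Omega> (v \<tau>) u) \<phi> + L2_inner \<Omega> (convect \<Omega> (v \<tau>) (v \<tau>)) \<phi>"

lemma increment_weak:
  assumes "\<phi> \<in> C0_sigma \<Omega>" "0 \<le> s" "s \<le> t"
  shows "L2_inner \<Omega> (v t) \<phi> - L2_inner \<Omega> (v s) \<phi> = (LINT \<tau>|lebesgue_on {s..t}. - I \<tau> \<phi>)"
proof -
  have "L2_inner \<Omega> (v t) \<phi> + (LINT \<tau>|lebesgue_on {s..t}. I \<tau> \<phi>)
      = L2_inner \<Omega> (v s) \<phi> + (LINT \<tau>|lebesgue_on {s..t}. L2_inner \<Omega> (v \<tau>) (\<lambda>_. 0))"
    using v_weak[OF constant_C1_test_curve[OF assms(1)] assms(2,3)] unfolding I_def .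
  moreover have "L2_inner \<Omega> w (\<lambda>_. 0) = 0" for w :: "real^2 \<Rightarrow> real^2" by (simp add: L2_inner_def)
  ultimately show ?thesis by simp
qed

lemma I_flux:
  assumes "good \<tau>" "\<phi> \<in> C0_sigma \<Omega>"
  shows "I \<tau> \<phi> = L2_inner \<Omega> (\<lambda>x. wgrad \<Omega> (v \<tau>) x - flux u (v \<tau>) x) (\<lambda>x. jacobian \<phi> (at x))"
  unfolding I_def
  by (rule weak_form_flux[OF op bd u_H1 u_div u_bound U_nonneg]) (use assms v_sigma in \<open>auto simp: good_def\<close>)

lemma good_flux:
  assumes "good \<tau>"
  shows "flux u (v \<tau>) \<in> L2 \<Omega>" "L2_norm \<Omega> (flux u (v \<tau>)) \<le> 2 * L2_norm \<Omega> (\<lambda>x. norm (v \<tau> x) * norm (u x)) + 2 * M * N \<tau>"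
    "L2_norm \<Omega> (\<lambda>x. norm (v \<tau> x) * norm (u x)) \<le> U * M"
proof -
  note F = flux_L2[OF op u_meas u_bound U_nonneg good_solenoidal[OF assms]]
  have m: "L2_norm \<Omega> (v \<tau>) \<le> M" using assms by (simp add: good_def v_le_M)
  show "flux u (v \<tau>) \<in> L2 \<Omega>" by (rule F(1))
  show "L2_norm \<Omega> (flux u (v \<tau>)) \<le> 2 * L2_norm \<Omega> (\<lambda>x. norm (v \<tau> x) * norm (u x)) + 2 * M * N \<tau>"
    using F(2) mult_right_mono[OF m N_nonneg[of \<tau>]] unfolding N_def by linarith
  show "L2_norm \<Omega> (\<lambda>x. norm (v \<tau> x) * norm (u x)) \<le> U * M"
    using F(6) mult_left_mono[OF m U_nonneg] by linarith
qed

text \<open>The shape in which the weak formulation is used: any bound on the dual norm of the right-hand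
  side bounds the increments of \<open>v\<close> tested with fields of the energy space.\<close>

lemma increment_bound:
  assumes f: "integrable (lebesgue_on {s..t}) f" "\<And>\<tau>. \<tau> \<in> {s..t} \<Longrightarrow> 0 \<le> f \<tau>"
    and b: "\<And>\<tau>. \<tau> \<in> {s..t} \<Longrightarrow> good \<tau> \<Longrightarrow> N \<tau> + L2_norm \<Omega> (flux u (v \<tau>)) \<le> f \<tau>"
    and st: "0 \<le> s" "s \<le> t" and \<phi>: "\<phi> \<in> C0_sigma \<Omega>"
  shows "\<bar>L2_inner \<Omega> (v t) \<phi> - L2_inner \<Omega> (v s) \<phi>\<bar> \<le> L2_norm \<Omega> (\<lambda>x. jacobian \<phi> (at x)) * integral {s..t} f"
proof -
  define c where "c = L2_norm \<Omega> (\<lambda>x. jacobian \<phi> (at x))"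
  have c0: "c \<ge> 0" by (simp add: c_def)
  have Jb: "\<bar>I \<tau> \<phi>\<bar> \<le> c * f \<tau>" if "\<tau> \<in> {s..t} - ({t. t > 0 \<and> \<not> good t} \<union> {0})" for \<tau>
  proof -
    have g: "good \<tau>" "\<tau> \<in> {s..t}" using that st by auto
    have 1: "\<bar>I \<tau> \<phi>\<bar> \<le> L2_norm \<Omega> (\<lambda>x. wgrad \<Omega> (v \<tau>) x - flux u (v \<tau>) x) * c"
      unfolding I_flux[OF g(1) \<phi>] c_def
      by (rule L2_Cauchy_Schwarz[OF L2_diff[OF wgrad_L2[OF g(1)] good_flux(1)[OF g(1)]] C0_sigma_L2(2)[OF \<phi> \<Omega>]])
    have "L2_norm \<Omega> (\<lambda>x. wgrad \<Omega> (v \<tau>) x - flux u (v \<tau>) x) \<le> N \<tau> + L2_norm \<Omega> (flux u (v \<tau>))"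
      unfolding N_def by (rule L2_norm_triangle_diff[OF wgrad_L2[OF g(1)] good_flux(1)[OF g(1)]])
    also have "\<dots> \<le> f \<tau>" by (rule b[OF g(2,1)])
    finally have 2: "L2_norm \<Omega> (\<lambda>x. wgrad \<Omega> (v \<tau>) x - flux u (v \<tau>) x) \<le> f \<tau>" .
    show ?thesis using order_trans[OF 1 mult_right_mono[OF 2 c0]] by (simp add: mult.commute)
  qed
  have Z: "negligible ({t. t > 0 \<and> \<not> good t} \<union> {0})" using bad_negligible by (intro negligible_Un) auto
  have i: "integrable (lebesgue_on {s..t}) (\<lambda>\<tau>. c * f \<tau>)" using f(1) by simp
  have n: "0 \<le> c * f \<tau>" if "\<tau> \<in> {s..t}" for \<tau> using f(2)[OF that] c0 by simp
  have "(LINT \<tau>|lebesgue_on {s..t}. - I \<tau> \<phi>) \<le> integral {s..t} (\<lambda>\<tau>. c * f \<tau>)"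
    by (rule LINT_le_bound[OF i n Z]) (use Jb in \<open>fastforce simp: abs_le_iff\<close>)+
  moreover have "(LINT \<tau>|lebesgue_on {s..t}. I \<tau> \<phi>) \<le> integral {s..t} (\<lambda>\<tau>. c * f \<tau>)"
    by (rule LINT_le_bound[OF i n Z]) (use Jb in \<open>fastforce simp: abs_le_iff\<close>)+
  moreover have "(LINT \<tau>|lebesgue_on {s..t}. - I \<tau> \<phi>) = - (LINT \<tau>|lebesgue_on {s..t}. I \<tau> \<phi>)" by simp
  ultimately show ?thesis unfolding increment_weak[OF \<phi> st] c_def[symmetric] by (simp add: abs_le_iff)
qed

lemma increment_bound_solenoidal:
  assumes f: "integrable (lebesgue_on {s..t}) f" "\<And>\<tau>. \<tau> \<in> {s..t} \<Longrightarrow> 0 \<le> f \<tau>"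
    and b: "\<And>\<tau>. \<tau> \<in> {s..t} \<Longrightarrow> good \<tau> \<Longrightarrow> N \<tau> + L2_norm \<Omega> (flux u (v \<tau>)) \<le> f \<tau>"
    and st: "0 \<le> s" "s \<le> t" and w: "solenoidal_H1_0 \<Omega> w G"
  shows "\<bar>L2_inner \<Omega> (v t) w - L2_inner \<Omega> (v s) w\<bar> \<le> L2_norm \<Omega> G * integral {s..t} f"
proof -
  obtain \<phi> where \<phi>: "\<And>n. \<phi> n \<in> C0_sigma \<Omega>" "(\<lambda>n. L2_norm \<Omega> (\<lambda>x. \<phi> n x - w x)) \<longlonglongrightarrow> 0"
    "(\<lambda>n. L2_norm \<Omega> (\<lambda>x. jacobian (\<phi> n) (at x) - G x)) \<longlonglongrightarrow> 0" and wG: "w \<in> L2 \<Omega>" "G \<in> L2 \<Omega>"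
    using w unfolding solenoidal_H1_0_def by blast
  note L = C0_sigma_L2[OF \<phi>(1) \<Omega>]
  show ?thesis
  proof (rule LIMSEQ_le)
    show "(\<lambda>n. \<bar>L2_inner \<Omega> (v t) (\<phi> n) - L2_inner \<Omega> (v s) (\<phi> n)\<bar>) \<longlonglongrightarrow> \<bar>L2_inner \<Omega> (v t) w - L2_inner \<Omega> (v s) w\<bar>"
      by (intro tendsto_rabs tendsto_diff L2_tendsto_inner[OF L(1) wG(1) v_L2 \<phi>(2)]) (use st in auto)
    show "(\<lambda>n. L2_norm \<Omega> (\<lambda>x. jacobian (\<phi> n) (at x)) * integral {s..t} f) \<longlonglongrightarrow> L2_norm \<Omega> G * integral {s..t} f"
      by (intro tendsto_mult tendsto_const L2_tendsto_norm[OF L(2) wG(2) \<phi>(3)])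
    show "\<exists>N. \<forall>n\<ge>N. \<bar>L2_inner \<Omega> (v t) (\<phi> n) - L2_inner \<Omega> (v s) (\<phi> n)\<bar> \<le> L2_norm \<Omega> (\<lambda>x. jacobian (\<phi> n) (at x)) * integral {s..t} f"
      using increment_bound[OF f b st \<phi>(1)] by blast
  qed
qed

lemma weakly_continuous:
  assumes y: "y \<in> L2_sigma \<Omega>"
  shows "continuous_on UNIV (\<lambda>t. L2_inner \<Omega> (V t) y)"
proof -
  define f where "f = (\<lambda>\<tau>. 2 * U * M + (2 * M + 1) * N \<tau>)"
  have fi: "integrable (lebesgue_on {s..t}) f" if "0 \<le> s" for s t
  proof -
    interpret finite_measure "lebesgue_on {s..t}" by (rule finite_measure_lebesgue_on) simp
    show ?thesis unfolding f_def using N_integrable[OF that] by auto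
  qed
  have f0: "0 \<le> f \<tau>" for \<tau> using U_nonneg M_nonneg N_nonneg by (simp add: f_def)
  have fb: "N \<tau> + L2_norm \<Omega> (flux u (v \<tau>)) \<le> f \<tau>" if "good \<tau>" for \<tau>
    using good_flux(2,3)[OF that] by (simp add: f_def algebra_simps)
  obtain \<phi> where \<phi>: "\<And>n. \<phi> n \<in> C0_sigma \<Omega>" "(\<lambda>n. L2_norm \<Omega> (\<lambda>x. \<phi> n x - y x)) \<longlonglongrightarrow> 0"
    using y unfolding L2_sigma_def by blast
  have c: "continuous_on {0..b} (\<lambda>t. L2_inner \<Omega> (v t) \<psi>)" if \<psi>: "\<psi> \<in> C0_sigma \<Omega>" for \<psi> b
  proof -
    define c where "c = L2_norm \<Omega> (\<lambda>x. jacobian \<psi> (at x))"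
    define F where "F = (\<lambda>t. integral {0..t} f)"
    have fio: "f integrable_on {0..b}" for b using integrable_on_lebesgue_on[OF fi] by auto
    have Fc: "continuous_on {0..b} (\<lambda>t. c * F t)"
      unfolding F_def by (intro continuous_intros indefinite_integral_continuous_1 fio)
    have st: "\<bar>L2_inner \<Omega> (v t) \<psi> - L2_inner \<Omega> (v s) \<psi>\<bar> \<le> \<bar>c * F t - c * F s\<bar>" if "0 \<le> s" "s \<le> t" for s t
    proof -
      have "F t - F s = integral {s..t} f"
        using Henstock_Kurzweil_Integration.integral_combine[OF that fio] by (simp add: F_def)
      then show ?thesis using increment_bound[OF fi f0 fb that \<psi>] that
        by (simp add: c_def right_diff_distrib[symmetric])
    qed
    have st': "dist (L2_inner \<Omega> (v t) \<psi>) (L2_inner \<Omega> (v s) \<psi>) \<le> dist (c * F t) (c * F s)" if "0 \<le> s" "0 \<le> t" for s t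
      using st[of s t] st[of t s] that by (cases "s \<le> t") (auto simp: dist_real_def abs_minus_commute)
    show ?thesis unfolding continuous_on_iff
    proof (intro ballI allI impI)
      fix t e :: real assume t: "t \<in> {0..b}" and e: "e > 0"
      obtain d where d: "d > 0" "\<forall>s\<in>{0..b}. dist s t < d \<longrightarrow> dist (c * F s) (c * F t) < e"
        using Fc t e unfolding continuous_on_iff by blast
      have "dist (L2_inner \<Omega> (v s) \<psi>) (L2_inner \<Omega> (v t) \<psi>) < e" if "s \<in> {0..b}" "dist s t < d" for s
        using st'[of t s] d(2) that t by (auto intro: le_less_trans)
      then show "\<exists>d>0. \<forall>s\<in>{0..b}. dist s t < d \<longrightarrow> dist (L2_inner \<Omega> (v s) \<psi>) (L2_inner \<Omega> (v t) \<psi>) < e"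
        using d(1) by blast
    qed
  qed
  have cV: "continuous_on UNIV (\<lambda>t. L2_inner \<Omega> (V t) \<psi>)" if \<psi>: "\<psi> \<in> C0_sigma \<Omega>" for \<psi>
  proof -
    have "isCont (\<lambda>t. L2_inner \<Omega> (V t) \<psi>) t" for t
    proof -
      have "continuous_on {..\<bar>t\<bar> + 1} (\<lambda>s. L2_inner \<Omega> (v (max 0 s)) \<psi>)"
        by (rule continuous_on_compose2[OF c[OF \<psi>, of "\<bar>t\<bar> + 1"]]) (auto intro!: continuous_intros)
      then have "continuous_on {..<\<bar>t\<bar> + 1} (\<lambda>s. L2_inner \<Omega> (V s) \<psi>)"
        unfolding V_def by (rule continuous_on_subset) auto
      then show ?thesis by (simp add: continuous_on_eq_continuous_at)
    qed
    then show ?thesis by (simp add: continuous_at_imp_continuous_on)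
  qed
  show ?thesis
  proof (rule uniform_limit_theorem)
    show "\<forall>\<^sub>F n in sequentially. continuous_on UNIV (\<lambda>t. L2_inner \<Omega> (V t) (\<phi> n))"
      using cV[OF \<phi>(1)] by (intro always_eventually) auto
    have lim: "(\<lambda>n. M * L2_norm \<Omega> (\<lambda>x. \<phi> n x - y x)) \<longlonglongrightarrow> 0" using tendsto_mult_left[OF \<phi>(2), of M] by simp
    have b: "dist (L2_inner \<Omega> (V t) (\<phi> n)) (L2_inner \<Omega> (V t) y) \<le> M * L2_norm \<Omega> (\<lambda>x. \<phi> n x - y x)" for n t
    proof -
      have "\<bar>L2_inner \<Omega> (V t) (\<lambda>x. \<phi> n x - y x)\<bar> \<le> L2_norm \<Omega> (V t) * L2_norm \<Omega> (\<lambda>x. \<phi> n x - y x)"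
        by (rule L2_Cauchy_Schwarz[OF V_L2 L2_diff[OF C0_sigma_L2(1)[OF \<phi>(1) \<Omega>] L2_sigma_L2[OF y]]])
      also have "\<dots> \<le> M * L2_norm \<Omega> (\<lambda>x. \<phi> n x - y x)" by (rule mult_right_mono[OF V_le_M]) simp
      finally show ?thesis
        by (simp add: dist_real_def L2_inner_diff_right[OF C0_sigma_L2(1)[OF \<phi>(1) \<Omega>] L2_sigma_L2[OF y] V_L2])
    qed
    show "uniform_limit UNIV (\<lambda>n t. L2_inner \<Omega> (V t) (\<phi> n)) (\<lambda>t. L2_inner \<Omega> (V t) y) sequentially"
    proof (rule uniform_limitI)
      fix e :: real assume "e > 0"
      then have "\<forall>\<^sub>F n in sequentially. M * L2_norm \<Omega> (\<lambda>x. \<phi> n x - y x) < e" by (intro order_tendstoD(2)[OF lim])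
      then show "\<forall>\<^sub>F n in sequentially. \<forall>t\<in>UNIV. dist (L2_inner \<Omega> (V t) (\<phi> n)) (L2_inner \<Omega> (V t) y) < e"
        by eventually_elim (use b in \<open>auto intro: le_less_trans\<close>)
    qed
  qed auto
qed

text \<open>Weak continuity together with monotonicity of the norm gives strong continuity from the right.\<close>

lemma right_continuous: "((\<lambda>\<tau>. L2_norm \<Omega> (\<lambda>x. V \<tau> x - V t x)) \<longlongrightarrow> 0) (at_right t)"
proof -
  have "isCont (\<lambda>\<tau>. L2_inner \<Omega> (V \<tau>) (V t)) t"
    using weakly_continuous[OF V_sigma[of t]] by (simp add: continuous_on_eq_continuous_at)
  then have "((\<lambda>\<tau>. L2_inner \<Omega> (V \<tau>) (V t)) \<longlongrightarrow> L2_inner \<Omega> (V t) (V t)) (at_right t)"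
    unfolding isCont_def by (rule tendsto_mono[OF at_le, rotated]) simp
  then have "((\<lambda>\<tau>. 2 * (L2_norm \<Omega> (V t))\<^sup>2 - 2 * L2_inner \<Omega> (V \<tau>) (V t)) \<longlongrightarrow> 2 * (L2_norm \<Omega> (V t))\<^sup>2 - 2 * L2_inner \<Omega> (V t) (V t)) (at_right t)"
    by (intro tendsto_intros)
  then have lim: "((\<lambda>\<tau>. 2 * (L2_norm \<Omega> (V t))\<^sup>2 - 2 * L2_inner \<Omega> (V \<tau>) (V t)) \<longlongrightarrow> 0) (at_right t)"
    by (simp add: L2_norm_power2_inner)
  have "((\<lambda>\<tau>. (L2_norm \<Omega> (\<lambda>x. V \<tau> x - V t x))\<^sup>2) \<longlongrightarrow> 0) (at_right t)"
  proof (rule Lim_null_comparison[OF _ lim])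
    show "\<forall>\<^sub>F \<tau> in at_right t. norm ((L2_norm \<Omega> (\<lambda>x. V \<tau> x - V t x))\<^sup>2) \<le> 2 * (L2_norm \<Omega> (V t))\<^sup>2 - 2 * L2_inner \<Omega> (V \<tau>) (V t)"
      unfolding eventually_at_filter
    proof (intro always_eventually allI impI)
      fix \<tau> assume "\<tau> \<in> {t<..}"
      then have "L2_norm \<Omega> (V \<tau>) \<le> L2_norm \<Omega> (V t)" unfolding V_def by (intro v_decreasing) auto
      then have le: "(L2_norm \<Omega> (V \<tau>))\<^sup>2 \<le> (L2_norm \<Omega> (V t))\<^sup>2" by (simp add: power_mono)
      show "norm ((L2_norm \<Omega> (\<lambda>x. V \<tau> x - V t x))\<^sup>2) \<le> 2 * (L2_norm \<Omega> (V t))\<^sup>2 - 2 * L2_inner \<Omega> (V \<tau>) (V t)"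
        using L2_norm_diff_power2[OF V_L2[of \<tau>] V_L2[of t]] le unfolding real_norm_def abs_power2 by linarith
    qed
  qed
  then have "((\<lambda>\<tau>. sqrt ((L2_norm \<Omega> (\<lambda>x. V \<tau> x - V t x))\<^sup>2)) \<longlongrightarrow> sqrt 0) (at_right t)" by (rule tendsto_real_sqrt)
  then show ?thesis by simp
qed

end

section \<open>Central symmetry is preserved\<close>

lemma solenoidal_even_part:
  assumes S: "\<Omega> \<in> sets lebesgue" "uminus ` \<Omega> = \<Omega>" and w: "w \<in> L2 \<Omega>" "G \<in> L2 \<Omega>"
    and \<phi>: "\<And>n. \<phi> n \<in> C0_sigma \<Omega>" "(\<lambda>n. L2_norm \<Omega> (\<lambda>x. \<phi> n x - w x)) \<longlonglongrightarrow> 0"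
    "(\<lambda>n. L2_norm \<Omega> (\<lambda>x. jacobian (\<phi> n) (at x) - G x)) \<longlonglongrightarrow> 0"
  defines "\<psi> \<equiv> \<lambda>n x. \<phi> n x + \<phi> n (- x)"
  shows "\<psi> n \<in> C0_sigma \<Omega>" "jacobian (\<psi> n) (at x) = jacobian (\<phi> n) (at x) - jacobian (\<phi> n) (at (- x))"
    "(\<lambda>n. L2_norm \<Omega> (\<lambda>x. \<psi> n x - (w x + w (- x)))) \<longlonglongrightarrow> 0"
    "(\<lambda>n. L2_norm \<Omega> (\<lambda>x. jacobian (\<psi> n) (at x) - (G x - G (- x)))) \<longlonglongrightarrow> 0"
    "solenoidal_H1_0 \<Omega> (\<lambda>x. w x + w (- x)) (\<lambda>x. G x - G (- x))"
proof -
  show C: "\<psi> n \<in> C0_sigma \<Omega>" for n unfolding \<psi>_def by (intro C0_sigma_add C0_sigma_reflect \<phi>(1) S(2))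
  have sm: "smooth (\<phi> n)" "smooth (\<lambda>x. \<phi> n (- x))" for n
    using C0_sigmaD(2)[OF \<phi>(1)] C0_sigmaD(2)[OF C0_sigma_reflect[OF \<phi>(1) S(2)]] by auto
  show jac: "jacobian (\<psi> n) (at x) = jacobian (\<phi> n) (at x) - jacobian (\<phi> n) (at (- x))" for n x
    unfolding \<psi>_def
    using jacobian_add[OF smooth_differentiable[OF sm(1)] smooth_differentiable[OF sm(2)]] jacobian_reflect[OF smooth_differentiable[OF sm(1)]]
    by simp
  note L = C0_sigma_L2[OF \<phi>(1) S(1)]
  have D: "(\<lambda>x. \<phi> n x - w x) \<in> L2 \<Omega>" "(\<lambda>x. jacobian (\<phi> n) (at x) - G x) \<in> L2 \<Omega>" for n
    by (intro L2_diff L w)+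
  have b1: "L2_norm \<Omega> (\<lambda>x. \<psi> n x - (w x + w (- x))) \<le> 2 * L2_norm \<Omega> (\<lambda>x. \<phi> n x - w x)" for n
    using L2_norm_triangle[OF D(1) L2_reflect(1)[OF S D(1)], of n n] L2_reflect(2)[OF S D(1)[of n]]
    by (simp add: \<psi>_def algebra_simps)
  have b2: "L2_norm \<Omega> (\<lambda>x. jacobian (\<psi> n) (at x) - (G x - G (- x))) \<le> 2 * L2_norm \<Omega> (\<lambda>x. jacobian (\<phi> n) (at x) - G x)" for n
    using L2_norm_triangle_diff[OF D(2) L2_reflect(1)[OF S D(2)], of n n] L2_reflect(2)[OF S D(2)[of n]]
    by (simp add: jac algebra_simps)
  show l1: "(\<lambda>n. L2_norm \<Omega> (\<lambda>x. \<psi> n x - (w x + w (- x)))) \<longlonglongrightarrow> 0"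
    by (rule Lim_null_comparison[of _ "\<lambda>n. 2 * L2_norm \<Omega> (\<lambda>x. \<phi> n x - w x)"])
      (use b1 tendsto_mult_left[OF \<phi>(2), of 2] in auto)
  show l2: "(\<lambda>n. L2_norm \<Omega> (\<lambda>x. jacobian (\<psi> n) (at x) - (G x - G (- x)))) \<longlonglongrightarrow> 0"
    by (rule Lim_null_comparison[of _ "\<lambda>n. 2 * L2_norm \<Omega> (\<lambda>x. jacobian (\<phi> n) (at x) - G x)"])
      (use b2 tendsto_mult_left[OF \<phi>(3), of 2] in auto)
  have "(\<lambda>x. w x + w (- x)) \<in> L2 \<Omega>" "(\<lambda>x. G x - G (- x)) \<in> L2 \<Omega>"
    by (intro L2_add L2_diff w L2_reflect(1)[OF S])+
  then show "solenoidal_H1_0 \<Omega> (\<lambda>x. w x + w (- x)) (\<lambda>x. G x - G (- x))"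
    unfolding solenoidal_H1_0_def using C l1 l2 by blast
qed

lemma integrable_Ioc_imp_Icc:
  fixes f :: "real \<Rightarrow> real"
  assumes "integrable (lebesgue_on {0<..c}) f"
  shows "integrable (lebesgue_on {0..c}) f" "(LINT t|lebesgue_on {0..c}. f t) = (LINT t|lebesgue_on {0<..c}. f t)"
    "0 \<le> s \<Longrightarrow> t \<le> c \<Longrightarrow> integrable (lebesgue_on {s..t}) f"
proof -
  have a: "f absolutely_integrable_on {0<..c}" using assms by (simp add: integrable_restrict_space set_integrable_def)
  have b: "f absolutely_integrable_on {0..c}"
    by (rule absolutely_integrable_spike_set[OF a]; rule negligible_subset[of "{0}"]; auto)
  then show i: "integrable (lebesgue_on {0..c}) f" by (simp add: integrable_restrict_space set_integrable_def)
  have "integral {0..c} f = integral {0<..c} f"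
    by (rule integral_spike_set; rule negligible_subset[of "{0}"]; auto)
  then show "(LINT t|lebesgue_on {0..c}. f t) = (LINT t|lebesgue_on {0<..c}. f t)"
    using lebesgue_integral_eq_integral[OF i] lebesgue_integral_eq_integral[OF assms] by simp
  show "0 \<le> s \<Longrightarrow> t \<le> c \<Longrightarrow> integrable (lebesgue_on {s..t}) f"
    using set_integrable_subset[OF b, of "{s..t}"] by (simp add: integrable_restrict_space set_integrable_def)
qed

context perturbed_flow
begin

text \<open>Testing an increment of \<open>v\<close> with a value of \<open>v\<close> pairs gradients at different times. Bochner
  measurability makes their distance small in the mean.\<close>

lemma gradient_time_modulus:
  assumes \<epsilon>: "\<epsilon> > 0"
  obtains e h0 Z where "h0 > 0" "negligible Z" "\<And>t. 0 \<le> e t" "integrable (lebesgue_on {0<..b}) (\<lambda>t. (e t)\<^sup>2)"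
    "(LINT t|lebesgue_on {0<..b}. (e t)\<^sup>2) \<le> \<epsilon>" "\<And>t. t > 0 \<Longrightarrow> t \<notin> Z \<Longrightarrow> good t"
    "\<And>\<sigma> \<tau>. \<sigma> \<in> {0<..b} - Z \<Longrightarrow> \<tau> \<in> {0<..b} - Z \<Longrightarrow> \<bar>\<sigma> - \<tau>\<bar> < h0 \<Longrightarrow>
        L2_norm \<Omega> (\<lambda>x. wgrad \<Omega> (v \<sigma>) x - wgrad \<Omega> (v \<tau>) x) \<le> e \<sigma> + e \<tau>"
proof -
  define X where "X = H1_dot_0_sigma \<Omega>"
  define d where "d = (\<lambda>a b. L2_norm \<Omega> (\<lambda>x. wgrad \<Omega> a x - wgrad \<Omega> b x))"
  have XH: "w \<in> H1_dot \<Omega>" if "w \<in> X" for w using that by (simp add: X_def H1_dot_0_sigma_def)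
  note W = H1_dot_wgrad[OF op XH]
  obtain s where s: "\<And>n. simple_function (lebesgue_on {0<..}) (s n)" "\<And>n t. t > 0 \<Longrightarrow> s n t \<in> X"
    and ae: "AE t in lebesgue_on {0<..}. (\<lambda>n. H1_dot_norm \<Omega> (\<lambda>x. s n t x - v t x)) \<longlonglongrightarrow> 0"
    using v_Bochner unfolding Bochner_L2_def strongly_measurable_def X_def by blast
  obtain Z1 where Z1: "negligible Z1" "\<And>t. t \<in> {0<..} \<Longrightarrow> t \<notin> Z1 \<Longrightarrow> (\<lambda>n. H1_dot_norm \<Omega> (\<lambda>x. s n t x - v t x)) \<longlonglongrightarrow> 0"
    by (rule AE_lebesgue_on_negligible[OF ae]) auto
  define Z where "Z = Z1 \<union> {t. t > 0 \<and> \<not> good t}"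
  have Z: "negligible Z" unfolding Z_def using Z1(1) bad_negligible by (rule negligible_Un)
  have Zg: "good t" if "t > 0" "t \<notin> Z" for t using that by (auto simp: Z_def)
  have ZX: "v t \<in> X" if "t > 0" "t \<notin> Z" for t using Zg[OF that] by (simp add: good_def X_def)
  have conv: "(\<lambda>n. d (s n t) (v t)) \<longlonglongrightarrow> 0" if t: "t > 0" "t \<notin> Z" for t
  proof -
    have "H1_dot_norm \<Omega> (\<lambda>x. s n t x - v t x) = d (s n t) (v t)" for n
      unfolding d_def by (rule H1_dot_norm_diff[OF op W(1)[OF s(2)[OF t(1)]] W(1)[OF ZX[OF t]]])
    then show ?thesis using Z1(2)[of t] t by (simp add: Z_def)
  qed
  have d1: "d x y = d y x" if "x \<in> X" "y \<in> X" for x y unfolding d_def by (rule L2_norm_minus_commute)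
  have d2: "d x z \<le> d x y + d y z" if "x \<in> X" "y \<in> X" "z \<in> X" for x y z
    unfolding d_def by (rule L2_norm_triangle3[OF W(2)[OF that(1)] W(2)[OF that(2)] W(2)[OF that(3)]])
  have d3: "0 \<le> d x y" if "x \<in> X" "y \<in> X" for x y by (simp add: d_def)
  have t2: "d (v \<sigma>) (v \<tau>) \<le> N \<sigma> + N \<tau>" if "\<sigma> > 0" "\<tau> > 0" "\<sigma> \<notin> Z" "\<tau> \<notin> Z" for \<sigma> \<tau>
    unfolding d_def N_def by (rule L2_norm_triangle_diff[OF W(2)[OF ZX] W(2)[OF ZX]]) (use that in auto)
  have iN: "integrable (lebesgue_on {0<..b}) (\<lambda>t. (N t)\<^sup>2)" by (rule N2_integrable) auto
  show ?thesis
  proof (rule translation_modulus[of X d s Z v N b \<epsilon>, OF d1 d2 d3 s Z ZX conv N_nonneg t2 iN \<epsilon>])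
    fix e :: "real \<Rightarrow> real" and h0 :: real
    assume e: "h0 > 0" "\<And>t. 0 \<le> e t" "integrable (lebesgue_on {0<..b}) (\<lambda>t. (e t)\<^sup>2)"
      "(LINT t|lebesgue_on {0<..b}. (e t)\<^sup>2) \<le> \<epsilon>"
      "\<And>\<sigma> \<tau>. \<sigma> \<in> {0<..b} - Z \<Longrightarrow> \<tau> \<in> {0<..b} - Z \<Longrightarrow> \<bar>\<sigma> - \<tau>\<bar> < h0 \<Longrightarrow> d (v \<sigma>) (v \<tau>) \<le> e \<sigma> + e \<tau>"
    show ?thesis by (rule that[OF e(1) Z e(2,3,4) Zg e(5)[unfolded d_def]])
  qed
qed

definition even_part :: "real \<Rightarrow> real^2 \<Rightarrow> real^2" where
  "even_part t x = V t x + V t (- x)"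

definition y :: "real \<Rightarrow> real" where "y t = (L2_norm \<Omega> (even_part t))\<^sup>2"

text \<open>The rate in Gronwall's inequality for \<open>y\<close>; the constants are those of \<open>flux_difference\<close> below.\<close>

definition k :: "real \<Rightarrow> real" where "k t = 8 * U\<^sup>2 + 512 * (M * N t)\<^sup>2"

lemma even_part_L2: "even_part t \<in> L2 \<Omega>"
  unfolding even_part_def[abs_def] by (intro L2_add V_L2 L2_reflect(1)[OF \<Omega> sym])

lemma V_v: "t \<ge> 0 \<Longrightarrow> V t = v t" by (simp add: V_def)

lemma even_part_solenoidal:
  assumes "good t"
  shows "solenoidal_H1_0 \<Omega> (even_part t) (\<lambda>x. wgrad \<Omega> (v t) x - wgrad \<Omega> (v t) (- x))"
proof -
  obtain \<phi> where \<phi>: "\<And>n. \<phi> n \<in> C0_sigma \<Omega>" "(\<lambda>n. L2_norm \<Omega> (\<lambda>x. \<phi> n x - v t x)) \<longlonglongrightarrow> 0"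
    "(\<lambda>n. L2_norm \<Omega> (\<lambda>x. jacobian (\<phi> n) (at x) - wgrad \<Omega> (v t) x)) \<longlonglongrightarrow> 0" and L: "v t \<in> L2 \<Omega>" "wgrad \<Omega> (v t) \<in> L2 \<Omega>"
    using good_solenoidal[OF assms] unfolding solenoidal_H1_0_def by blast
  from solenoidal_even_part(5)[OF \<Omega> sym L \<phi>] show ?thesis
    using assms by (simp add: even_part_def[abs_def] V_v good_def)
qed

text \<open>Every term of the difference contains the even part \<open>z\<close>: the terms with \<open>u\<close> are at most \<open>2 U \<bar>z\<bar>\<close>, the
  others at most \<open>\<bar>z\<bar> (\<bar>v x\<bar> + \<bar>v (- x)\<bar>)\<close>. Ladyzhenskaya's inequality for these products and Young's
  inequality leave half of the square of the gradient of \<open>z\<close>, which the dissipation absorbs.\<close>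

lemma flux_difference:
  assumes g: "good t"
  shows "(\<lambda>x. flux u (v t) x - flux u (v t) (- x)) \<in> L2 \<Omega>"
    "(L2_norm \<Omega> (\<lambda>x. flux u (v t) x - flux u (v t) (- x)))\<^sup>2
      \<le> 1 / 2 * (L2_norm \<Omega> (\<lambda>x. wgrad \<Omega> (v t) x - wgrad \<Omega> (v t) (- x)))\<^sup>2 + k t * y t"
proof -
  define z where "z = even_part t"
  define D where "D = (\<lambda>x. flux u (v t) x - flux u (v t) (- x))"
  define Z where "Z = (\<lambda>x. wgrad \<Omega> (v t) x - wgrad \<Omega> (v t) (- x))"
  have t: "t > 0" using g by (simp add: good_def)
  have z: "z x = v t x + v t (- x)" for x using t by (simp add: z_def even_part_def V_v)
  have zL: "z \<in> L2 \<Omega>" unfolding z_def by (rule even_part_L2)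
  show DL: "(\<lambda>x. flux u (v t) x - flux u (v t) (- x)) \<in> L2 \<Omega>"
    by (intro L2_diff L2_reflect(1)[OF \<Omega> sym] good_flux(1)[OF g])
  have zS: "solenoidal_H1_0 \<Omega> z Z" unfolding z_def Z_def by (rule even_part_solenoidal[OF g])
  define a where "a = (\<lambda>x. norm (z x) * norm (v t x))"
  note A = L2_norm_mult_solenoidal[OF zS good_solenoidal[OF g] \<Omega>, folded a_def]
  have aL: "(\<lambda>x. a (- x)) \<in> L2 \<Omega>" "L2_norm \<Omega> (\<lambda>x. a (- x)) = L2_norm \<Omega> a"
    using L2_reflect[OF \<Omega> sym A(1)] by auto
  define E where "E = (\<lambda>x. (2 * U) *\<^sub>R norm (z x) + (a x + a (- x)))"
  have nz: "(\<lambda>x. norm (z x)) \<in> L2 \<Omega>" "L2_norm \<Omega> (\<lambda>x. norm (z x)) = L2_norm \<Omega> z"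
    using zL by (auto simp: L2_def L2_norm_def)
  have EL: "E \<in> L2 \<Omega>" unfolding E_def by (intro L2_add L2_scaleR nz A(1) aL)
  have "AE x in lebesgue_on \<Omega>. norm (D x) \<le> 1 * norm (E x)"
    using u_sym[unfolded centrally_symmetric_def] AE_space
  proof eventually_elim
    case (elim x)
    define p where "p = v t x"
    define q where "q = v t (- x)"
    have u: "u (- x) = - u x" using elim(1) by simp
    have x: "x \<in> \<Omega>" using elim(2) by (simp add: space_restrict_space)
    have zx: "z x = p + q" "z (- x) = p + q" by (simp_all add: z p_def q_def add.commute)
    have Dx: "D x = outer (p + q) (u x) + outer (u x) (p + q) + (outer p (p + q) - outer (p + q) q)"
      unfolding D_def flux_def u p_def[symmetric] q_def[symmetric]
      by (simp add: vec_eq_iff outer_nth algebra_simps)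
    have "norm (D x) \<le> norm (outer (p + q) (u x)) + norm (outer (u x) (p + q)) + (norm (outer p (p + q)) + norm (outer (p + q) q))"
      unfolding Dx
      using norm_triangle_ineq[of "outer (p + q) (u x) + outer (u x) (p + q)" "outer p (p + q) - outer (p + q) q"]
        norm_triangle_ineq[of "outer (p + q) (u x)" "outer (u x) (p + q)"] norm_triangle_ineq4[of "outer p (p + q)" "outer (p + q) q"]
      by linarith
    also have "\<dots> = 2 * (norm (p + q) * norm (u x)) + (norm (p + q) * norm p + norm (p + q) * norm q)"
      by (simp add: norm_outer mult.commute)
    also have "\<dots> \<le> 2 * (norm (p + q) * U) + (norm (p + q) * norm p + norm (p + q) * norm q)"
      using u_bound[OF x] by (intro add_right_mono mult_left_mono) auto
    also have "\<dots> = E x" using zx by (simp add: E_def a_def p_def q_def mult_ac)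
    finally show ?case by simp
  qed
  then have "L2_norm \<Omega> D \<le> 1 * L2_norm \<Omega> E"
    by (intro L2_bound(2)[OF _ EL]) (use DL L2_D(1) in \<open>auto simp: D_def\<close>)
  also have "L2_norm \<Omega> E \<le> L2_norm \<Omega> (\<lambda>x. (2 * U) *\<^sub>R norm (z x)) + L2_norm \<Omega> (\<lambda>x. a x + a (- x))"
    unfolding E_def by (rule L2_norm_triangle[OF L2_scaleR[OF nz(1)] L2_add[OF A(1) aL(1)]])
  also have "L2_norm \<Omega> (\<lambda>x. a x + a (- x)) \<le> 2 * L2_norm \<Omega> a"
    using L2_norm_triangle[OF A(1) aL(1)] aL(2) by simp
  also have "L2_norm \<Omega> (\<lambda>x. (2 * U) *\<^sub>R norm (z x)) = 2 * U * L2_norm \<Omega> z"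
    using L2_norm_scaleR[of \<Omega> "2 * U" "\<lambda>x. norm (z x)"] U_nonneg by (simp add: nz(2))
  finally have "L2_norm \<Omega> D \<le> 2 * U * L2_norm \<Omega> z + 2 * L2_norm \<Omega> a" by simp
  then have "(L2_norm \<Omega> D)\<^sup>2 \<le> (2 * U * L2_norm \<Omega> z + 2 * L2_norm \<Omega> a)\<^sup>2" by (simp add: power_mono)
  also have "\<dots> \<le> 2 * (2 * U * L2_norm \<Omega> z)\<^sup>2 + 2 * (2 * L2_norm \<Omega> a)\<^sup>2"
    using zero_le_power2[of "2 * U * L2_norm \<Omega> z - 2 * L2_norm \<Omega> a"] by (simp add: power2_sum power2_diff)
  also have "\<dots> = 8 * U\<^sup>2 * (L2_norm \<Omega> z)\<^sup>2 + 8 * (L2_norm \<Omega> a)\<^sup>2" by (simp add: power_mult_distrib)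
  also have "(L2_norm \<Omega> a)\<^sup>2 \<le> 4 * (L2_norm \<Omega> Z * (L2_norm \<Omega> z * (M * N t)))"
  proof -
    have "L2_norm \<Omega> (v t) * N t \<le> M * N t" using v_le_M[of t] t N_nonneg by (intro mult_right_mono) auto
    then have "(L2_norm \<Omega> z * L2_norm \<Omega> Z) * (L2_norm \<Omega> (v t) * N t) \<le> (L2_norm \<Omega> z * L2_norm \<Omega> Z) * (M * N t)"
      by (rule mult_left_mono) simp
    then show ?thesis using A(2) by (simp add: N_def mult_ac)
  qed
  also have "8 * (4 * (L2_norm \<Omega> Z * (L2_norm \<Omega> z * (M * N t)))) \<le> 1 / 2 * (L2_norm \<Omega> Z)\<^sup>2 + 512 * (L2_norm \<Omega> z * (M * N t))\<^sup>2"
    using zero_le_power2[of "L2_norm \<Omega> Z - 32 * (L2_norm \<Omega> z * (M * N t))"] by (simp add: power2_diff power_mult_distrib)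
  finally have "(L2_norm \<Omega> D)\<^sup>2 \<le> 8 * U\<^sup>2 * (L2_norm \<Omega> z)\<^sup>2 + (1 / 2 * (L2_norm \<Omega> Z)\<^sup>2 + 512 * (L2_norm \<Omega> z * (M * N t))\<^sup>2)"
    by simp
  then show "(L2_norm \<Omega> (\<lambda>x. flux u (v t) x - flux u (v t) (- x)))\<^sup>2
      \<le> 1 / 2 * (L2_norm \<Omega> (\<lambda>x. wgrad \<Omega> (v t) x - wgrad \<Omega> (v t) (- x)))\<^sup>2 + k t * y t"
    unfolding D_def Z_def by (simp add: k_def y_def z_def power_mult_distrib algebra_simps)
qed

lemma k_nonneg: "0 \<le> k t" and y_nonneg: "0 \<le> y t" by (simp_all add: k_def y_def)

lemma y_bounded: "y t \<le> (2 * M)\<^sup>2"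
proof -
  have "L2_norm \<Omega> (even_part t) \<le> 2 * L2_norm \<Omega> (V t)"
    using L2_norm_triangle[OF V_L2 L2_reflect(1)[OF \<Omega> sym V_L2], of t t] L2_reflect(2)[OF \<Omega> sym V_L2[of t]]
    by (simp add: even_part_def[abs_def])
  then have "L2_norm \<Omega> (even_part t) \<le> 2 * M" using V_le_M[of t] by simp
  from power_mono[OF this L2_norm_nonneg, of 2] show ?thesis unfolding y_def .
qed

lemma y_right_continuous: "(y \<longlongrightarrow> y t) (at_right t)"
proof -
  have b: "\<bar>L2_norm \<Omega> (even_part \<tau>) - L2_norm \<Omega> (even_part t)\<bar> \<le> 2 * L2_norm \<Omega> (\<lambda>x. V \<tau> x - V t x)" for \<tau>
  proof -
    have D: "(\<lambda>x. V \<tau> x - V t x) \<in> L2 \<Omega>" by (intro L2_diff V_L2)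
    have "\<bar>L2_norm \<Omega> (even_part \<tau>) - L2_norm \<Omega> (even_part t)\<bar> \<le> L2_norm \<Omega> (\<lambda>x. even_part \<tau> x - even_part t x)"
      by (rule L2_norm_sub_le[OF even_part_L2 even_part_L2])
    also have "(\<lambda>x. even_part \<tau> x - even_part t x) = (\<lambda>x. (V \<tau> x - V t x) + (V \<tau> (- x) - V t (- x)))"
      by (simp add: even_part_def algebra_simps)
    also have "L2_norm \<Omega> \<dots> \<le> 2 * L2_norm \<Omega> (\<lambda>x. V \<tau> x - V t x)"
      using L2_norm_triangle[OF D L2_reflect(1)[OF \<Omega> sym D]] L2_reflect(2)[OF \<Omega> sym D] by simp
    finally show ?thesis .
  qed
  have "((\<lambda>\<tau>. L2_norm \<Omega> (even_part \<tau>) - L2_norm \<Omega> (even_part t)) \<longlongrightarrow> 0) (at_right t)"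
    by (rule Lim_null_comparison[of _ "\<lambda>\<tau>. 2 * L2_norm \<Omega> (\<lambda>x. V \<tau> x - V t x)"])
      (use b tendsto_mult_left[OF right_continuous[of t], of 2] in auto)
  then have "((\<lambda>\<tau>. L2_norm \<Omega> (even_part \<tau>)) \<longlongrightarrow> L2_norm \<Omega> (even_part t)) (at_right t)" by (simp add: LIM_zero_iff)
  then show ?thesis unfolding y_def by (rule tendsto_power)
qed

lemma ky_integrable:
  assumes "0 \<le> a" shows "integrable (lebesgue_on {a..b}) k" "integrable (lebesgue_on {a..b}) (\<lambda>t. k t * y t)"
proof -
  interpret finite_measure "lebesgue_on {a..b}" by (rule finite_measure_lebesgue_on) simp
  show ki: "integrable (lebesgue_on {a..b}) k"
    unfolding k_def[abs_def] power_mult_distrib using N2_integrable[of "{a..b}"] assms by auto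
  have m: "y \<in> borel_measurable (lebesgue_on {a..b})"
    by (rule measurable_restrict_space1[OF measurable_completion]) (use right_continuous_borel_measurable[OF y_right_continuous] in simp)
  have b: "norm (k t * y t) \<le> norm ((2 * M)\<^sup>2 * k t)" for t
    using mult_left_mono[OF y_bounded[of t] k_nonneg[of t]] k_nonneg[of t] y_nonneg[of t]
    by (simp add: abs_mult mult.commute)
  show "integrable (lebesgue_on {a..b}) (\<lambda>t. k t * y t)"
    by (rule Bochner_Integration.integrable_bound[of _ "\<lambda>t. (2 * M)\<^sup>2 * k t"])
      (use ki m b in \<open>auto intro!: borel_measurable_times\<close>)
qed

text \<open>Testing the increment of the even part with its value at an end point. The product of the
  gradients at two nearby times is, up to the modulus \<open>e\<close>, at least half the sum of their squares.\<close>

lemma even_part_increment: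
  assumes e: "\<And>t. 0 \<le> e t" "integrable (lebesgue_on {s..t}) (\<lambda>\<tau>. (e \<tau>)\<^sup>2)"
    and Z: "negligible Z" "\<And>\<tau>. \<tau> \<in> {s..t} - Z \<Longrightarrow> good \<tau> \<and> L2_norm \<Omega> (\<lambda>x. wgrad \<Omega> (v \<tau>) x - wgrad \<Omega> (v r) x) \<le> e \<tau> + e r"
    and st: "0 \<le> s" "s \<le> t" and r: "good r"
  shows "L2_inner \<Omega> (even_part t) (even_part r) - L2_inner \<Omega> (even_part s) (even_part r)
     \<le> integral {s..t} (\<lambda>\<tau>. 6 * (e \<tau>)\<^sup>2 + 1 / 2 * (k \<tau> * y \<tau>)) + 6 * (t - s) * (e r)\<^sup>2"
proof -
  define G where "G = wgrad \<Omega> (v r)"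
  obtain \<phi> where \<phi>: "\<And>n. \<phi> n \<in> C0_sigma \<Omega>" "(\<lambda>n. L2_norm \<Omega> (\<lambda>x. \<phi> n x - v r x)) \<longlonglongrightarrow> 0"
    "(\<lambda>n. L2_norm \<Omega> (\<lambda>x. jacobian (\<phi> n) (at x) - G x)) \<longlonglongrightarrow> 0" and L: "v r \<in> L2 \<Omega>" "G \<in> L2 \<Omega>"
    using good_solenoidal[OF r] unfolding solenoidal_H1_0_def G_def by blast
  define \<psi> where "\<psi> = (\<lambda>n x. \<phi> n x + \<phi> n (- x))"
  have \<psi>: "\<psi> n \<in> C0_sigma \<Omega>" "jacobian (\<psi> n) (at x) = jacobian (\<phi> n) (at x) - jacobian (\<phi> n) (at (- x))"
    "(\<lambda>n. L2_norm \<Omega> (\<lambda>x. \<psi> n x - (v r x + v r (- x)))) \<longlonglongrightarrow> 0" for n x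
    unfolding \<psi>_def by (rule solenoidal_even_part(1-3)[OF \<Omega> sym L \<phi>])+
  have er: "even_part r = (\<lambda>x. v r x + v r (- x))" using r by (simp add: even_part_def[abs_def] V_v good_def)
  define \<eta> where "\<eta> = (\<lambda>n. L2_norm \<Omega> (\<lambda>x. jacobian (\<phi> n) (at x) - G x))"
  note \<psi>L = C0_sigma_L2[OF \<psi>(1) \<Omega>]
  have \<psi>e: "(\<lambda>x. \<psi> n (- x)) = \<psi> n" for n by (auto simp: \<psi>_def add.commute)
  have E2: "L2_inner \<Omega> (even_part \<tau>) (\<psi> n) = 2 * L2_inner \<Omega> (v \<tau>) (\<psi> n)" if "0 \<le> \<tau>" for \<tau> n
  proof -
    have "L2_inner \<Omega> (even_part \<tau>) (\<psi> n) = L2_inner \<Omega> (V \<tau>) (\<psi> n) + L2_inner \<Omega> (\<lambda>x. V \<tau> (- x)) (\<psi> n)"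
      using L2_inner_add_left[OF V_L2[of \<tau>] L2_reflect(1)[OF \<Omega> sym V_L2[of \<tau>]] \<psi>L(1)[of n]]
      by (simp add: even_part_def[abs_def])
    also have "L2_inner \<Omega> (\<lambda>x. V \<tau> (- x)) (\<psi> n) = L2_inner \<Omega> (V \<tau>) (\<psi> n)"
      using L2_inner_reflect[OF \<Omega> sym V_L2 \<psi>L(1)] by (simp add: \<psi>e)
    finally show ?thesis using that by (simp add: V_v)
  qed
  have key: "- (2 * I \<tau> (\<psi> n)) \<le> 6 * (e \<tau>)\<^sup>2 + 1 / 2 * (k \<tau> * y \<tau>) + 6 * ((e r)\<^sup>2 + (\<eta> n)\<^sup>2)" if \<tau>: "\<tau> \<in> {s..t} - Z" for \<tau> n
  proof -
    have g: "good \<tau>" and er: "L2_norm \<Omega> (\<lambda>x. wgrad \<Omega> (v \<tau>) x - G x) \<le> e \<tau> + e r" using Z(2)[OF \<tau>] by (auto simp: G_def)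
    define J where "J = (\<lambda>x. jacobian (\<phi> n) (at x))"
    define P where "P = (\<lambda>x. jacobian (\<psi> n) (at x))"
    define W where "W = wgrad \<Omega> (v \<tau>)"
    define A where "A = (\<lambda>x. W x - flux u (v \<tau>) x)"
    define Y where "Y = (\<lambda>x. W x - W (- x))"
    define D where "D = (\<lambda>x. flux u (v \<tau>) x - flux u (v \<tau>) (- x))"
    have JL: "J \<in> L2 \<Omega>" unfolding J_def by (rule C0_sigma_L2(2)[OF \<phi>(1) \<Omega>])
    have PL: "P \<in> L2 \<Omega>" unfolding P_def by (rule \<psi>L(2))
    have WL: "W \<in> L2 \<Omega>" unfolding W_def by (rule wgrad_L2[OF g])
    have AL: "A \<in> L2 \<Omega>" unfolding A_def by (intro L2_diff WL good_flux(1)[OF g])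
    have YL: "Y \<in> L2 \<Omega>" unfolding Y_def by (intro L2_diff WL L2_reflect(1)[OF \<Omega> sym])
    have DL: "D \<in> L2 \<Omega>" unfolding D_def by (rule flux_difference(1)[OF g])
    have P: "P x = J x - J (- x)" for x unfolding P_def J_def by (rule \<psi>(2))
    have "L2_inner \<Omega> (\<lambda>x. A (- x)) P = L2_inner \<Omega> A (\<lambda>x. P (- x))" by (rule L2_inner_reflect[OF \<Omega> sym AL PL])
    also have "(\<lambda>x. P (- x)) = (\<lambda>x. - P x)" by (simp add: P)
    also have "L2_inner \<Omega> A (\<lambda>x. - P x) = - L2_inner \<Omega> A P" by (simp add: L2_inner_def)
    finally have odd: "L2_inner \<Omega> (\<lambda>x. A (- x)) P = - L2_inner \<Omega> A P" .
    have "I \<tau> (\<psi> n) = L2_inner \<Omega> A P" unfolding I_flux[OF g \<psi>(1)] A_def W_def P_def ..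
    with odd have "2 * I \<tau> (\<psi> n) = L2_inner \<Omega> A P - L2_inner \<Omega> (\<lambda>x. A (- x)) P" by simp
    also have "\<dots> = L2_inner \<Omega> (\<lambda>x. A x - A (- x)) P"
      by (rule L2_inner_diff_left[OF AL L2_reflect(1)[OF \<Omega> sym AL] PL, symmetric])
    also have "(\<lambda>x. A x - A (- x)) = (\<lambda>x. Y x - D x)" by (auto simp: A_def Y_def D_def algebra_simps)
    also have "L2_inner \<Omega> (\<lambda>x. Y x - D x) P = L2_inner \<Omega> Y P - L2_inner \<Omega> D P" by (rule L2_inner_diff_left[OF YL DL PL])
    finally have I: "- (2 * I \<tau> (\<psi> n)) = L2_inner \<Omega> D P - L2_inner \<Omega> Y P" by simp
    have "L2_inner \<Omega> D P \<le> L2_norm \<Omega> D * L2_norm \<Omega> P" using L2_Cauchy_Schwarz[OF DL PL] by linarith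
    also have "\<dots> \<le> 1 / 2 * (L2_norm \<Omega> D)\<^sup>2 + 1 / 2 * (L2_norm \<Omega> P)\<^sup>2"
      using sum_squares_bound[of "L2_norm \<Omega> D" "L2_norm \<Omega> P"] by simp
    finally have 1: "L2_inner \<Omega> D P \<le> 1 / 2 * (L2_norm \<Omega> D)\<^sup>2 + 1 / 2 * (L2_norm \<Omega> P)\<^sup>2" .
    \<comment> \<open>polarisation: the dissipation is kept up to the distance of the two gradients\<close>
    have 2: "L2_inner \<Omega> Y P = 1 / 2 * (L2_norm \<Omega> Y)\<^sup>2 + 1 / 2 * (L2_norm \<Omega> P)\<^sup>2 - 1 / 2 * (L2_norm \<Omega> (\<lambda>x. Y x - P x))\<^sup>2"
      using L2_norm_diff_power2[OF YL PL] by linarith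
    have 3: "(L2_norm \<Omega> D)\<^sup>2 \<le> 1 / 2 * (L2_norm \<Omega> Y)\<^sup>2 + k \<tau> * y \<tau>"
      unfolding D_def Y_def W_def by (rule flux_difference(2)[OF g])
    have B: "(\<lambda>x. W x - J x) \<in> L2 \<Omega>" by (intro L2_diff WL JL)
    have "L2_norm \<Omega> (\<lambda>x. Y x - P x) = L2_norm \<Omega> (\<lambda>x. (W x - J x) - (W (- x) - J (- x)))"
      by (simp add: Y_def P algebra_simps)
    also have "\<dots> \<le> 2 * L2_norm \<Omega> (\<lambda>x. W x - J x)"
      using L2_norm_triangle_diff[OF B L2_reflect(1)[OF \<Omega> sym B]] L2_reflect(2)[OF \<Omega> sym B] by simp
    also have "L2_norm \<Omega> (\<lambda>x. W x - J x) \<le> L2_norm \<Omega> (\<lambda>x. W x - G x) + L2_norm \<Omega> (\<lambda>x. G x - J x)"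
      by (rule L2_norm_triangle3[OF WL L(2) JL])
    also have "L2_norm \<Omega> (\<lambda>x. G x - J x) = \<eta> n" unfolding \<eta>_def J_def by (rule L2_norm_minus_commute)
    finally have "L2_norm \<Omega> (\<lambda>x. Y x - P x) \<le> 2 * (e \<tau> + e r + \<eta> n)" using er by (simp add: W_def)
    then have "(L2_norm \<Omega> (\<lambda>x. Y x - P x))\<^sup>2 \<le> (2 * (e \<tau> + e r + \<eta> n))\<^sup>2" by (simp add: power_mono)
    also have "\<dots> \<le> 12 * ((e \<tau>)\<^sup>2 + (e r)\<^sup>2 + (\<eta> n)\<^sup>2)"
    proof -
      have "(a + b + c)\<^sup>2 \<le> 3 * (a\<^sup>2 + b\<^sup>2 + c\<^sup>2)" for a b c :: real
      proof -
        have "3 * (a\<^sup>2 + b\<^sup>2 + c\<^sup>2) - (a + b + c)\<^sup>2 = (a - b)\<^sup>2 + (b - c)\<^sup>2 + (a - c)\<^sup>2"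
          by (simp add: power2_eq_square algebra_simps)
        then show ?thesis using zero_le_power2[of "a - b"] zero_le_power2[of "b - c"] zero_le_power2[of "a - c"] by linarith
      qed
      from this[of "e \<tau>" "e r" "\<eta> n"] show ?thesis unfolding power_mult_distrib by simp
    qed
    finally have 4: "(L2_norm \<Omega> (\<lambda>x. Y x - P x))\<^sup>2 \<le> 12 * ((e \<tau>)\<^sup>2 + (e r)\<^sup>2 + (\<eta> n)\<^sup>2)" .
    show ?thesis unfolding I 2 using 1 3 4 zero_le_power2[of "L2_norm \<Omega> Y"] unfolding distrib_left by linarith
  qed
  define f where "f = (\<lambda>\<tau>. 6 * (e \<tau>)\<^sup>2 + 1 / 2 * (k \<tau> * y \<tau>))"
  have fi: "integrable (lebesgue_on {s..t}) f" unfolding f_def using e(2) ky_integrable(2)[OF st(1)] by auto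
  have bound: "L2_inner \<Omega> (even_part t) (\<psi> n) - L2_inner \<Omega> (even_part s) (\<psi> n)
      \<le> integral {s..t} f + 6 * ((e r)\<^sup>2 + (\<eta> n)\<^sup>2) * (t - s)" for n
  proof -
    interpret finite_measure "lebesgue_on {s..t}" by (rule finite_measure_lebesgue_on) simp
    have i: "integrable (lebesgue_on {s..t}) (\<lambda>\<tau>. f \<tau> + 6 * ((e r)\<^sup>2 + (\<eta> n)\<^sup>2))" using fi by auto
    have "L2_inner \<Omega> (even_part t) (\<psi> n) - L2_inner \<Omega> (even_part s) (\<psi> n) = 2 * (L2_inner \<Omega> (v t) (\<psi> n) - L2_inner \<Omega> (v s) (\<psi> n))"
      using E2[of t n] E2[of s n] st by simp
    also have "\<dots> = (LINT \<tau>|lebesgue_on {s..t}. - (2 * I \<tau> (\<psi> n)))"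
      unfolding increment_weak[OF \<psi>(1) st] by simp
    also have "\<dots> \<le> integral {s..t} (\<lambda>\<tau>. f \<tau> + 6 * ((e r)\<^sup>2 + (\<eta> n)\<^sup>2))"
      by (rule LINT_le_bound[OF i _ Z(1)]) (use key k_nonneg y_nonneg in \<open>auto simp: f_def\<close>)
    also have "\<dots> = integral {s..t} f + 6 * ((e r)\<^sup>2 + (\<eta> n)\<^sup>2) * (t - s)"
      using integrable_on_lebesgue_on[OF fi] st by (subst integral_add) auto
    finally show ?thesis .
  qed
  have "L2_inner \<Omega> (even_part t) (even_part r) - L2_inner \<Omega> (even_part s) (even_part r)
      \<le> integral {s..t} f + 6 * ((e r)\<^sup>2 + 0\<^sup>2) * (t - s)"
  proof (rule LIMSEQ_le)
    show "(\<lambda>n. L2_inner \<Omega> (even_part t) (\<psi> n) - L2_inner \<Omega> (even_part s) (\<psi> n)) \<longlonglongrightarrow>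
        L2_inner \<Omega> (even_part t) (even_part r) - L2_inner \<Omega> (even_part s) (even_part r)"
      by (intro tendsto_diff L2_tendsto_inner[OF \<psi>L(1) even_part_L2 even_part_L2]) (use \<psi>(3) in \<open>simp_all add: er\<close>)
    show "(\<lambda>n. integral {s..t} f + 6 * ((e r)\<^sup>2 + (\<eta> n)\<^sup>2) * (t - s)) \<longlonglongrightarrow> integral {s..t} f + 6 * ((e r)\<^sup>2 + 0\<^sup>2) * (t - s)"
      using \<phi>(3) unfolding \<eta>_def by (intro tendsto_intros)
    show "\<exists>N. \<forall>n\<ge>N. L2_inner \<Omega> (even_part t) (\<psi> n) - L2_inner \<Omega> (even_part s) (\<psi> n) \<le> integral {s..t} f + 6 * ((e r)\<^sup>2 + (\<eta> n)\<^sup>2) * (t - s)"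
      using bound by blast
  qed
  moreover have "6 * ((e r)\<^sup>2 + 0\<^sup>2) * (t - s) = 6 * (t - s) * (e r)\<^sup>2" by simp
  ultimately show ?thesis unfolding f_def by argo
qed

lemma y_0: "y 0 = 0"
proof -
  have "AE x in lebesgue_on \<Omega>. even_part 0 x = 0"
    using v0_sym[unfolded centrally_symmetric_def] by eventually_elim (simp add: even_part_def V_def)
  then have "L2_norm \<Omega> (even_part 0) = L2_norm \<Omega> (\<lambda>x. 0 :: real^2)"
    by (intro L2_norm_cong_AE L2_D(1)[OF even_part_L2]) auto
  then show ?thesis by (simp add: y_def L2_norm_def)
qed

text \<open>The square of the norm of the even part grows over a step by two increments, tested at the two end points.
  The contributions of the modulus \<open>e\<close> are arbitrarily small.\<close>

lemma y_le:
  assumes b: "b \<ge> 0" shows "y b \<le> integral {0..b} (\<lambda>t. k t * y t)"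
proof (cases "b = 0")
  case True then show ?thesis by (simp add: y_0)
next
  case False
  then have b0: "0 < b" using b by simp
  have "y b \<le> integral {0..b} (\<lambda>t. k t * y t) + 24 * \<epsilon>" if \<epsilon>: "\<epsilon> > 0" for \<epsilon>
  proof -
    obtain e h0 Z where e: "h0 > 0" "negligible Z" "\<And>t. 0 \<le> e t" "integrable (lebesgue_on {0<..b + 1}) (\<lambda>t. (e t)\<^sup>2)"
      "(LINT t|lebesgue_on {0<..b + 1}. (e t)\<^sup>2) \<le> \<epsilon>" "\<And>t. t > 0 \<Longrightarrow> t \<notin> Z \<Longrightarrow> good t"
      "\<And>\<sigma> \<tau>. \<sigma> \<in> {0<..b + 1} - Z \<Longrightarrow> \<tau> \<in> {0<..b + 1} - Z \<Longrightarrow> \<bar>\<sigma> - \<tau>\<bar> < h0 \<Longrightarrow>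
        L2_norm \<Omega> (\<lambda>x. wgrad \<Omega> (v \<sigma>) x - wgrad \<Omega> (v \<tau>) x) \<le> e \<sigma> + e \<tau>"
      by (rule gradient_time_modulus[OF \<epsilon>, of "b + 1"]) blast
    note ei = integrable_Ioc_imp_Icc[OF e(4)]
    define h1 where "h1 = min (h0 / 2) 1"
    have h1: "h1 > 0" "h1 \<le> 1" "h1 < h0" using e(1) by (auto simp: h1_def)
    define p where "p = (\<lambda>\<tau>. 12 * (e \<tau>)\<^sup>2 + k \<tau> * y \<tau>)"
    define q where "q = (\<lambda>\<tau>. 6 * (e \<tau>)\<^sup>2)"
    have on: "(\<lambda>t. (e t)\<^sup>2) integrable_on {s..t}" "(\<lambda>t. k t * y t) integrable_on {s..t}" if "0 \<le> s" "t \<le> b + 1" for s t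
      using integrable_on_lebesgue_on[OF ei(3)[OF that]] integrable_on_lebesgue_on[OF ky_integrable(2)[OF that(1)]] by auto
    have pq: "p integrable_on {s..t}" "q integrable_on {s..t}" if "0 \<le> s" "t \<le> b + 1" for s t
      unfolding p_def q_def by (intro integrable_add integrable_on_mult_right on that)+
    have "y b - y 0 \<le> integral {0..b} p + 2 * integral {0..b} q"
    proof (rule increment_bound_from_steps[OF b0 h1(1) y_right_continuous])
      show "\<bar>y t\<bar> \<le> (2 * M)\<^sup>2" for t using y_bounded y_nonneg by simp
      show "p integrable_on {0..b + h1}" "q integrable_on {0..b + h1}" by (rule pq; use h1 in simp)+
      fix h assume h: "0 < h" "h \<le> h1"
      \<comment> \<open>both end points of a step have to be times at which \<open>v\<close> lies in the energy space\<close>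
      define Z' where "Z' = {0} \<union> Z \<union> (\<lambda>t. - h + t) ` Z"
      have Z': "negligible Z'" unfolding Z'_def
        by (intro negligible_Un negligible_translation e(2)) auto
      have "y (\<tau> + h) - y \<tau> \<le> integral {\<tau>..\<tau> + h} p + h * (q \<tau> + q (\<tau> + h))" if \<tau>: "\<tau> \<in> {0..b} - Z'" for \<tau>
      proof -
        have \<tau>0: "\<tau> > 0" "\<tau> \<notin> Z" "\<tau> \<le> b" using \<tau> by (auto simp: Z'_def)
        have \<tau>h: "\<tau> + h \<notin> Z"
        proof
          assume "\<tau> + h \<in> Z"
          then have "- h + (\<tau> + h) \<in> (\<lambda>t. - h + t) ` Z" by (rule imageI)
          then show False using \<tau> by (simp add: Z'_def)
        qed
        have in1: "\<sigma> \<in> {0<..b + 1}" if "\<sigma> \<in> {\<tau>..\<tau> + h}" for \<sigma> using that \<tau>0 h h1 by auto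
        have mod: "good \<sigma> \<and> L2_norm \<Omega> (\<lambda>x. wgrad \<Omega> (v \<sigma>) x - wgrad \<Omega> (v r) x) \<le> e \<sigma> + e r"
          if "\<sigma> \<in> {\<tau>..\<tau> + h} - Z" "r \<in> {\<tau>, \<tau> + h}" for \<sigma> r
        proof -
          have r: "r \<in> {0<..b + 1} - Z" using that(2) in1[of r] \<tau>0 \<tau>h h by auto
          have \<sigma>: "\<sigma> \<in> {0<..b + 1} - Z" using that(1) in1 by auto
          have "\<bar>\<sigma> - r\<bar> < h0" using that h h1 by auto
          then show ?thesis using e(7)[OF \<sigma> r] e(6)[of \<sigma>] \<sigma> by auto
        qed
        have ie: "integrable (lebesgue_on {\<tau>..\<tau> + h}) (\<lambda>t. (e t)\<^sup>2)" by (rule ei(3)) (use \<tau>0 h h1 in auto)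
        define F where "F = integral {\<tau>..\<tau> + h} (\<lambda>\<tau>. 6 * (e \<tau>)\<^sup>2 + 1 / 2 * (k \<tau> * y \<tau>))"
        have gr: "good r" if "r \<in> {\<tau>, \<tau> + h}" for r using e(6)[of r] that \<tau>0 \<tau>h h by auto
        have inc: "L2_inner \<Omega> (even_part (\<tau> + h)) (even_part r) - L2_inner \<Omega> (even_part \<tau>) (even_part r) \<le> F + 6 * h * (e r)\<^sup>2"
          if "r \<in> {\<tau>, \<tau> + h}" for r
          using even_part_increment[OF e(3) ie e(2) mod[OF _ that] _ _ gr[OF that]] \<tau>0 h by (simp add: F_def)
        have "y (\<tau> + h) - y \<tau> = (L2_inner \<Omega> (even_part (\<tau> + h)) (even_part (\<tau> + h)) - L2_inner \<Omega> (even_part \<tau>) (even_part (\<tau> + h)))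
           + (L2_inner \<Omega> (even_part (\<tau> + h)) (even_part \<tau>) - L2_inner \<Omega> (even_part \<tau>) (even_part \<tau>))"
          by (simp add: y_def L2_norm_power2_inner L2_inner_commute[of \<Omega> "even_part \<tau>" "even_part (\<tau> + h)"])
        also have "\<dots> \<le> (F + 6 * h * (e (\<tau> + h))\<^sup>2) + (F + 6 * h * (e \<tau>)\<^sup>2)"
          by (intro add_mono inc) auto
        also have "\<dots> = 2 * F + h * (q \<tau> + q (\<tau> + h))" by (simp add: q_def algebra_simps)
        also have "2 * F = integral {\<tau>..\<tau> + h} p"
        proof -
          have "2 * F = integral {\<tau>..\<tau> + h} (\<lambda>\<tau>. 2 * (6 * (e \<tau>)\<^sup>2 + 1 / 2 * (k \<tau> * y \<tau>)))"
            unfolding F_def by (rule Henstock_Kurzweil_Integration.integral_mult_right[symmetric])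
          also have "(\<lambda>\<tau>. 2 * (6 * (e \<tau>)\<^sup>2 + 1 / 2 * (k \<tau> * y \<tau>))) = p" by (auto simp: p_def)
          finally show ?thesis .
        qed
        finally show ?thesis .
      qed
      then show "\<exists>Z. negligible Z \<and> (\<forall>t\<in>{0..b} - Z. y (t + h) - y t \<le> integral {t..t + h} p + h * (q t + q (t + h)))"
        using Z' by blast
    qed
    also have "integral {0..b} p = 12 * integral {0..b} (\<lambda>t. (e t)\<^sup>2) + integral {0..b} (\<lambda>t. k t * y t)"
      unfolding p_def using on[of 0 b] by (subst integral_add) (auto intro: integrable_on_mult_right)
    also have "integral {0..b} q = 6 * integral {0..b} (\<lambda>t. (e t)\<^sup>2)" by (simp add: q_def)
    finally have le: "y b \<le> integral {0..b} (\<lambda>t. k t * y t) + 24 * integral {0..b} (\<lambda>t. (e t)\<^sup>2)" by (simp add: y_0)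
    have "integral {0..b} (\<lambda>t. (e t)\<^sup>2) \<le> integral {0..b + 1} (\<lambda>t. (e t)\<^sup>2)"
      by (rule integral_subset_le) (use on b in auto)
    also have "\<dots> = (LINT t|lebesgue_on {0..b + 1}. (e t)\<^sup>2)"
      by (rule lebesgue_integral_eq_integral[OF ei(1), symmetric]) simp
    also have "\<dots> \<le> \<epsilon>" using ei(2) e(5) by simp
    finally show ?thesis using le by simp
  qed
  note main = this
  have le: "y b \<le> integral {0..b} (\<lambda>t. k t * y t) + e" if "e > 0" for e
    using main[of "e / 24"] that by simp
  show ?thesis by (rule field_le_epsilon) (rule le)
qed

text \<open>Gronwall's inequality for the squared norm of the even part, which vanishes initially.\<close>

lemma v_symmetric:
  assumes "t \<ge> 0" shows "AE x in lebesgue_on \<Omega>. v t x = - v t (- x)"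
proof -
  have "y t = 0"
    by (rule Gronwall_zero[OF y_nonneg y_bounded k_nonneg _ _ y_le assms])
      (use integrable_on_lebesgue_on[OF ky_integrable(1)] integrable_on_lebesgue_on[OF ky_integrable(2)] in auto)
  then have "(LINT x|lebesgue_on \<Omega>. (norm (even_part t x))\<^sup>2) = 0" by (simp add: y_def L2_norm_power2)
  then have "AE x in lebesgue_on \<Omega>. (norm (even_part t x))\<^sup>2 = 0"
    using integral_nonneg_eq_0_iff_AE[OF L2_D(2)[OF even_part_L2]] by simp
  then show ?thesis
    by eventually_elim (use assms in \<open>simp add: even_part_def V_v eq_neg_iff_add_eq_0\<close>)
qed

end

section \<open>Decay of symmetric perturbations\<close>

context perturbed_flow
begin

definition K :: real where "K = 1 + pi + 2 * M"

lemma K_pos: "K > 0" using pi_gt_zero M_nonneg unfolding K_def by linarith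

text \<open>For a symmetric field, \<open>v x\<close> is half of \<open>v x - v (- x)\<close>.\<close>

lemma Hardy_good:
  assumes "good t"
  shows "(\<lambda>x. norm (v t x) / norm x) \<in> L2 \<Omega>" "L2_norm \<Omega> (\<lambda>x. norm (v t x) / norm x) \<le> pi / 2 * N t"
proof -
  have t: "t > 0" using assms by (simp add: good_def)
  define h where "h = (\<lambda>x. norm (v t x - v t (- x)) / norm x)"
  note H = Hardy_symmetric_difference[OF good_solenoidal[OF assms] \<Omega> sym]
  have n[measurable]: "(\<lambda>x. norm x) \<in> borel_measurable (lebesgue_on \<Omega>)"
    by (rule measurable_restrict_space1[OF lebesgue_measurable_continuous]) (intro continuous_intros)
  have vL: "v t \<in> L2 \<Omega>" using t by (simp add: v_L2)
  have [measurable]: "v t \<in> borel_measurable (lebesgue_on \<Omega>)" "(\<lambda>x. v t (- x)) \<in> borel_measurable (lebesgue_on \<Omega>)"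
    by (rule L2_D(1)[OF vL], rule L2_D(1)[OF L2_reflect(1)[OF \<Omega> sym vL]])
  have hm: "h \<in> borel_measurable (lebesgue_on \<Omega>)" unfolding h_def by measurable
  have hL: "h \<in> L2 \<Omega>" using hm H(1) by (simp add: L2_def h_def)
  have "(L2_norm \<Omega> h)\<^sup>2 \<le> (pi * N t)\<^sup>2" using H(2) by (simp add: L2_norm_power2 h_def N_def power_mult_distrib)
  then have hn: "L2_norm \<Omega> h \<le> pi * N t" by (rule power2_le_imp_le) (use N_nonneg pi_gt_zero in simp)
  have "AE x in lebesgue_on \<Omega>. v t x = - v t (- x)" using t by (intro v_symmetric) simp
  then have ae: "AE x in lebesgue_on \<Omega>. norm (norm (v t x) / norm x) \<le> 1 / 2 * norm (h x)"
  proof eventually_elim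
    case (elim x)
    have "v t x - v t (- x) = 2 *\<^sub>R v t x" using elim by (simp add: scaleR_2)
    then show ?case by (simp add: h_def)
  qed
  have m: "(\<lambda>x. norm (v t x) / norm x) \<in> borel_measurable (lebesgue_on \<Omega>)" by measurable
  show "(\<lambda>x. norm (v t x) / norm x) \<in> L2 \<Omega>" by (rule L2_bound(1)[OF m hL ae]) simp
  have "L2_norm \<Omega> (\<lambda>x. norm (v t x) / norm x) \<le> 1 / 2 * L2_norm \<Omega> h" by (rule L2_bound(2)[OF m hL ae]) simp
  then show "L2_norm \<Omega> (\<lambda>x. norm (v t x) / norm x) \<le> pi / 2 * N t" using hn by simp
qed

lemma AE_nonzero: "AE x in lebesgue_on \<Omega>. x \<noteq> 0"
  using AE_notin_negligible[of "{0 :: real^2}"] by (auto simp: AE_lebesgue_on_iff[OF \<Omega>] elim: eventually_mono)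

text \<open>Here the decay condition enters: \<open>\<bar>v\<bar> \<bar>u\<bar> \<le> \<bar>v\<bar> / \<bar>x\<bar>\<close>, so the linear terms, too, are controlled by the
  gradient alone.\<close>

lemma flux_le_gradient:
  assumes "good t" shows "N t + L2_norm \<Omega> (flux u (v t)) \<le> K * N t"
proof -
  have "v t \<in> L2 \<Omega>" using assms by (intro v_L2) (simp add: good_def)
  note [measurable] = L2_D(1)[OF this] u_meas
  have m: "(\<lambda>x. norm (v t x) * norm (u x)) \<in> borel_measurable (lebesgue_on \<Omega>)" by measurable
  have "AE x in lebesgue_on \<Omega>. norm (norm (v t x) * norm (u x)) \<le> 1 * norm (norm (v t x) / norm x)"
    using AE_nonzero AE_space
  proof eventually_elim
    case (elim x)
    have "norm (u x) \<le> 1 / norm x" using u_decay[of x] elim by (simp add: space_restrict_space field_simps)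
    from mult_left_mono[OF this, of "norm (v t x)"] show ?case by simp
  qed
  from L2_bound(2)[OF m Hardy_good(1)[OF assms] this]
  have "L2_norm \<Omega> (\<lambda>x. norm (v t x) * norm (u x)) \<le> pi / 2 * N t" using Hardy_good(2)[OF assms] by simp
  then show ?thesis using good_flux(2)[OF assms] by (simp add: K_def algebra_simps)
qed

lemma increment_le_gradient:
  assumes "0 \<le> s" "s \<le> t" "solenoidal_H1_0 \<Omega> w G"
  shows "\<bar>L2_inner \<Omega> (v t) w - L2_inner \<Omega> (v s) w\<bar> \<le> L2_norm \<Omega> G * (K * integral {s..t} N)"
proof -
  have "\<bar>L2_inner \<Omega> (v t) w - L2_inner \<Omega> (v s) w\<bar> \<le> L2_norm \<Omega> G * integral {s..t} (\<lambda>\<tau>. K * N \<tau>)"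
    by (rule increment_bound_solenoidal[OF _ _ _ assms])
      (use N_integrable[OF assms(1)] flux_le_gradient K_pos N_nonneg in auto)
  then show ?thesis by simp
qed

text \<open>The integral of \<open>N\<^sup>2\<close> over the half line is finite.\<close>

lemma dissipation_tail:
  assumes "\<epsilon> > 0"
  obtains T where "T \<ge> 0" "\<And>a b. T \<le> a \<Longrightarrow> a \<le> b \<Longrightarrow> integral {a..b} (\<lambda>t. (N t)\<^sup>2) < \<epsilon>"
proof -
  define E where "E = (\<lambda>t. integral {0..t} (\<lambda>t. (N t)\<^sup>2))"
  have i: "(\<lambda>t. (N t)\<^sup>2) integrable_on {0..}"
    using integrable_on_lebesgue_on[OF N2_integrable[of "{0..}"]] by auto
  have E: "E t \<le> integral {0..} (\<lambda>t. (N t)\<^sup>2)" for t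
    unfolding E_def by (rule integral_subset_le[OF _ N2_integrable_on i]) auto
  have bdd: "bdd_above (E ` {0..})" using E by (intro bdd_aboveI2)
  have "\<exists>x\<in>E ` {0..}. Sup (E ` {0..}) - \<epsilon> < x" using assms by (intro less_cSupD) auto
  then obtain T where T: "T \<ge> 0" "Sup (E ` {0..}) - \<epsilon> < E T" by auto
  show ?thesis
  proof (rule that[OF T(1)])
    fix a b assume ab: "T \<le> a" "a \<le> b"
    have "E T + integral {T..a} (\<lambda>t. (N t)\<^sup>2) = E a" "E a + integral {a..b} (\<lambda>t. (N t)\<^sup>2) = E b"
      unfolding E_def
      by (rule Henstock_Kurzweil_Integration.integral_combine; use ab T(1) N2_integrable_on in simp)+
    moreover have "0 \<le> integral {T..a} (\<lambda>t. (N t)\<^sup>2)" by (rule integral_nonneg) (use N2_integrable_on T(1) in auto)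
    moreover have "E b \<le> Sup (E ` {0..})" by (rule cSup_upper[OF _ bdd]) (use ab T(1) in auto)
    ultimately show "integral {a..b} (\<lambda>t. (N t)\<^sup>2) < \<epsilon>" using T(2) by linarith
  qed
qed

text \<open>The pairing with \<open>\<phi>\<close> is at most \<open>c N\<close> by Hardy's inequality, and its increments over a unit of time are at most
  a multiple of the integral of \<open>N\<close>. Averaging, \<open>\<bar>(v T, \<phi>)\<bar>\<close> is bounded by the integral of \<open>N\<close> over
  \<open>{T..T + 1}\<close>, which tends to zero because that of \<open>N\<^sup>2\<close> does.\<close>

lemma test_decay:
  assumes \<phi>: "\<phi> \<in> C0_sigma \<Omega>" shows "((\<lambda>t. L2_inner \<Omega> (v t) \<phi>) \<longlongrightarrow> 0) at_top"
proof -
  define \<phi>' where "\<phi>' = (\<lambda>x. norm x *\<^sub>R \<phi> x)"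
  have \<phi>L: "\<phi>' \<in> L2 \<Omega>"
    by (rule L2_continuous_compact_support[OF _ C0_sigmaD(3)[OF \<phi>] _ \<Omega>])
      (auto simp: \<phi>'_def C0_sigmaD(6)[OF \<phi>] intro!: continuous_intros smooth_continuous_on[OF C0_sigmaD(2)[OF \<phi>]])
  define G where "G = (\<lambda>x. jacobian \<phi> (at x))"
  have S: "solenoidal_H1_0 \<Omega> \<phi> G"
    unfolding solenoidal_H1_0_def G_def using C0_sigma_L2[OF \<phi> \<Omega>] \<phi> by (auto intro!: exI[of _ "\<lambda>n. \<phi>"] simp: L2_norm_def)
  define c where "c = pi / 2 * L2_norm \<Omega> \<phi>' + L2_norm \<Omega> G * K + 1"
  have c: "c > 0" using K_pos by (simp add: c_def add_nonneg_pos)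
  have pt: "\<bar>L2_inner \<Omega> (v t) \<phi>\<bar> \<le> pi / 2 * L2_norm \<Omega> \<phi>' * N t" if g: "good t" for t
  proof -
    define a where "a = (\<lambda>x. inverse (norm x) *\<^sub>R v t x)"
    have "v t \<in> L2 \<Omega>" using g by (intro v_L2) (simp add: good_def)
    note vm[measurable] = L2_D(1)[OF this]
    have n[measurable]: "(\<lambda>x. norm x) \<in> borel_measurable (lebesgue_on \<Omega>)"
      by (rule measurable_restrict_space1[OF lebesgue_measurable_continuous]) (intro continuous_intros)
    have am: "a \<in> borel_measurable (lebesgue_on \<Omega>)" unfolding a_def by measurable
    have na: "norm (a x) = norm (v t x) / norm x" for x by (simp add: a_def divide_inverse mult.commute)
    have ab: "AE x in lebesgue_on \<Omega>. norm (a x) \<le> 1 * norm (norm (v t x) / norm x)" by (simp add: na)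
    note A = L2_bound[OF am Hardy_good(1)[OF g] ab]
    have aL: "a \<in> L2 \<Omega>" "L2_norm \<Omega> a \<le> pi / 2 * N t" using A Hardy_good(2)[OF g] by auto
    have "L2_inner \<Omega> (v t) \<phi> = L2_inner \<Omega> a \<phi>'"
      unfolding L2_inner_def
    proof (rule integral_cong_AE)
      show "AE x in lebesgue_on \<Omega>. v t x \<bullet> \<phi> x = a x \<bullet> \<phi>' x"
        using AE_nonzero by eventually_elim (simp add: a_def \<phi>'_def)
    qed (use vm am L2_D(1)[OF \<phi>L] L2_D(1)[OF C0_sigma_L2(1)[OF \<phi> \<Omega>]] in auto)
    then have "\<bar>L2_inner \<Omega> (v t) \<phi>\<bar> \<le> L2_norm \<Omega> a * L2_norm \<Omega> \<phi>'" using L2_Cauchy_Schwarz[OF aL(1) \<phi>L] by simp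
    also have "\<dots> \<le> pi / 2 * N t * L2_norm \<Omega> \<phi>'" by (rule mult_right_mono[OF aL(2)]) simp
    finally show ?thesis by (simp add: mult_ac)
  qed
  have le: "\<bar>L2_inner \<Omega> (v T) \<phi>\<bar> \<le> c * integral {T..T + 1} N" if T: "T > 0" for T
  proof -
    define F where "F = integral {T..T + 1} N"
    have iN: "N integrable_on {T..T + 1}" by (rule N_integrable_on) (use T in simp)
    have F0: "0 \<le> F" unfolding F_def by (rule integral_nonneg[OF iN]) (simp add: N_nonneg)
    define f where "f = (\<lambda>\<tau>. pi / 2 * L2_norm \<Omega> \<phi>' * N \<tau> + L2_norm \<Omega> G * (K * F))"
    interpret finite_measure "lebesgue_on {T..T + 1}" by (rule finite_measure_lebesgue_on) simp
    have fi: "integrable (lebesgue_on {T..T + 1}) f" unfolding f_def using N_integrable[of T] T by auto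
    have b: "\<bar>L2_inner \<Omega> (v T) \<phi>\<bar> \<le> f \<tau>" if "\<tau> \<in> {T..T + 1} - {t. t > 0 \<and> \<not> good t}" for \<tau>
    proof -
      have g: "good \<tau>" using that T by auto
      have le: "integral {T..\<tau>} N \<le> F"
        unfolding F_def by (rule integral_subset_le[OF _ _ iN]) (use that T N_nonneg N_integrable_on in auto)
      have "\<bar>L2_inner \<Omega> (v \<tau>) \<phi> - L2_inner \<Omega> (v T) \<phi>\<bar> \<le> L2_norm \<Omega> G * (K * integral {T..\<tau>} N)"
        by (rule increment_le_gradient[OF _ _ S]) (use that T in auto)
      also have "\<dots> \<le> L2_norm \<Omega> G * (K * F)" using K_pos le by (intro mult_left_mono) auto
      finally show ?thesis using pt[OF g] by (simp add: f_def)
    qed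
    have f0: "0 \<le> f \<tau>" for \<tau> using N_nonneg K_pos F0 by (simp add: f_def)
    have "\<bar>L2_inner \<Omega> (v T) \<phi>\<bar> = (LINT \<tau>|lebesgue_on {T..T + 1}. \<bar>L2_inner \<Omega> (v T) \<phi>\<bar>)"
      by (simp add: measure_restrict_space)
    also have "\<dots> \<le> integral {T..T + 1} f" by (rule LINT_le_bound[OF fi f0 bad_negligible b])
    also have "\<dots> = pi / 2 * L2_norm \<Omega> \<phi>' * F + L2_norm \<Omega> G * (K * F)"
      unfolding f_def F_def using iN by (subst integral_add) (auto intro: integrable_on_mult_right)
    also have "\<dots> \<le> c * F" using F0 by (simp add: c_def algebra_simps)
    finally show ?thesis unfolding F_def .
  qed
  show ?thesis
  proof (rule tendstoI)
    fix e :: real assume e: "e > 0"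
    define d where "d = e / (2 * c)"
    have d: "d > 0" using e c by (simp add: d_def)
    obtain T where T: "T \<ge> 0" "\<And>a b. T \<le> a \<Longrightarrow> a \<le> b \<Longrightarrow> integral {a..b} (\<lambda>t. (N t)\<^sup>2) < d * d"
      by (rule dissipation_tail[of "d * d"]) (use d in auto)
    have "dist (L2_inner \<Omega> (v t) \<phi>) 0 < e" if t: "t \<ge> T + 1" for t
    proof -
      \<comment> \<open>trading the integral of \<open>N\<close> over a unit interval for that of \<open>N\<^sup>2\<close>\<close>
      have N: "N \<tau> \<le> d + (N \<tau>)\<^sup>2 / d" for \<tau>
      proof -
        have "N \<tau> * d \<le> d * d + (N \<tau>)\<^sup>2"
          using zero_le_power2[of "N \<tau> - d"] mult_nonneg_nonneg[OF N_nonneg[of \<tau>] less_imp_le[OF d]]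
          by (simp add: power2_diff power2_eq_square algebra_simps)
        then show ?thesis using d by (simp add: field_simps)
      qed
      have i2: "(\<lambda>t. (N t)\<^sup>2) integrable_on {t..t + 1}" by (rule N2_integrable_on) (use t T(1) in simp)
      have "integral {t..t + 1} N \<le> integral {t..t + 1} (\<lambda>\<tau>. d + (N \<tau>)\<^sup>2 / d)"
        by (rule integral_le) (use N t T(1) i2 N_integrable_on in \<open>auto intro!: integrable_add integrable_on_divide\<close>)
      also have "\<dots> = d + integral {t..t + 1} (\<lambda>\<tau>. (N \<tau>)\<^sup>2) / d"
        using i2 by (subst integral_add) (auto intro!: integrable_on_divide)
      also have "\<dots> < d + d" using T(2)[of t "t + 1"] t d by (simp add: field_simps)
      finally have "c * integral {t..t + 1} N < c * (d + d)" using c by simp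
      also have "c * (d + d) = e" using c by (simp add: d_def)
      finally show ?thesis using le[of t] t T(1) by simp
    qed
    then show "\<forall>\<^sub>F t in at_top. dist (L2_inner \<Omega> (v t) \<phi>) 0 < e" unfolding eventually_at_top_linorder by blast
  qed
qed

lemma weak_decay:
  assumes w: "w \<in> L2_sigma \<Omega>" shows "((\<lambda>t. L2_inner \<Omega> (v t) w) \<longlongrightarrow> 0) at_top"
proof (rule tendstoI)
  fix e :: real assume e: "e > 0"
  obtain \<phi> where \<phi>: "\<And>n. \<phi> n \<in> C0_sigma \<Omega>" "(\<lambda>n. L2_norm \<Omega> (\<lambda>x. \<phi> n x - w x)) \<longlonglongrightarrow> 0"
    using w unfolding L2_sigma_def by blast
  have "(\<lambda>n. M * L2_norm \<Omega> (\<lambda>x. \<phi> n x - w x)) \<longlonglongrightarrow> 0" using tendsto_mult_left[OF \<phi>(2), of M] by simp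
  from order_tendstoD(2)[OF this, of "e / 2"] e
  obtain n where n: "M * L2_norm \<Omega> (\<lambda>x. \<phi> n x - w x) < e / 2" by (auto simp: eventually_sequentially)
  have "\<forall>\<^sub>F t in at_top. dist (L2_inner \<Omega> (v t) (\<phi> n)) 0 < e / 2"
    using tendstoD[OF test_decay[OF \<phi>(1)], of "e / 2"] e by simp
  with eventually_ge_at_top[of 0] show "\<forall>\<^sub>F t in at_top. dist (L2_inner \<Omega> (v t) w) 0 < e"
  proof eventually_elim
    case (elim t)
    note L = C0_sigma_L2(1)[OF \<phi>(1) \<Omega>, of n] L2_sigma_L2[OF w]
    have "\<bar>L2_inner \<Omega> (v t) (\<lambda>x. \<phi> n x - w x)\<bar> \<le> L2_norm \<Omega> (v t) * L2_norm \<Omega> (\<lambda>x. \<phi> n x - w x)"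
      by (rule L2_Cauchy_Schwarz[OF v_L2[OF elim(1)] L2_diff[OF L]])
    also have "\<dots> \<le> M * L2_norm \<Omega> (\<lambda>x. \<phi> n x - w x)" by (rule mult_right_mono[OF v_le_M[OF elim(1)]]) simp
    finally show ?case using n elim(2) L2_inner_diff_right[OF L v_L2[OF elim(1)]] by simp
  qed
qed

text \<open>An increment of the correlation \<open>\<tau> \<mapsto> (v \<tau>, v (2 t - \<tau>))\<close> is a sum of products of the gradient norms at two
  times, and those are split by Young's inequality. The reflection makes the right-hand side useful: at the
  far end \<open>\<tau> = S\<close> the correlation pairs \<open>v S\<close> with a much later value, to which weak decay applies.\<close>

lemma reflected_correlation:
  assumes S: "0 \<le> S" "S < t" and t: "1 \<le> t"
  shows "(L2_norm \<Omega> (v t))\<^sup>2 \<le> L2_inner \<Omega> (v (2 * t - S)) (v S) + 3 / 2 * K * integral {S..2 * t - S} (\<lambda>\<tau>. (N \<tau>)\<^sup>2)"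
proof -
  define \<rho> where "\<rho> = (\<lambda>\<tau>. L2_inner \<Omega> (V \<tau>) (V (2 * t - \<tau>)))"
  define p where "p = (\<lambda>\<tau>. K / 2 * ((N \<tau>)\<^sup>2 + (N (2 * t - \<tau>))\<^sup>2))"
  have on: "(\<lambda>\<tau>. (N \<tau>)\<^sup>2) integrable_on {a..b}" if "0 \<le> a" for a b using N2_integrable_on[OF that] .
  have refl: "(\<lambda>\<tau>. (N (2 * t - \<tau>))\<^sup>2) integrable_on {a..b}"
    "integral {a..b} (\<lambda>\<tau>. (N (2 * t - \<tau>))\<^sup>2) = integral {2 * t - b..2 * t - a} (\<lambda>\<tau>. (N \<tau>)\<^sup>2)" if "b \<le> 2 * t" for a b
    using integral_reflect_about[OF on, of "2 * t" b a] that by auto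
  have pon: "p integrable_on {a..b}" if "0 \<le> a" "b \<le> 2 * t" for a b
    unfolding p_def by (intro integrable_on_mult_right integrable_add on refl that)
  have pint: "integral {a..b} p = K / 2 * (integral {a..b} (\<lambda>\<tau>. (N \<tau>)\<^sup>2) + integral {2 * t - b..2 * t - a} (\<lambda>\<tau>. (N \<tau>)\<^sup>2))"
    if "0 \<le> a" "b \<le> 2 * t" for a b
    unfolding p_def Henstock_Kurzweil_Integration.integral_mult_right
    by (subst integral_add[OF on[OF that(1)] refl(1)[OF that(2)]]) (simp add: refl(2)[OF that(2)])
  have "\<rho> t - \<rho> S \<le> integral {S..t} p + 2 * integral {S..t} p"
  proof (rule increment_bound_from_steps[OF S(2), of 1])
    show "(\<rho> \<longlongrightarrow> \<rho> \<tau>) (at_right \<tau>)" for \<tau>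
    proof -
      have "continuous_on UNIV (\<lambda>r. L2_inner \<Omega> (V (2 * t - r)) (V \<tau>))"
        by (rule continuous_on_compose2[OF weakly_continuous[OF V_sigma[of \<tau>]]]) (auto intro!: continuous_intros)
      then have "isCont (\<lambda>r. L2_inner \<Omega> (V (2 * t - r)) (V \<tau>)) \<tau>" by (simp add: continuous_on_eq_continuous_at)
      then have 1: "((\<lambda>r. L2_inner \<Omega> (V (2 * t - r)) (V \<tau>)) \<longlongrightarrow> \<rho> \<tau>) (at_right \<tau>)"
        unfolding isCont_def \<rho>_def L2_inner_commute[of \<Omega> "V \<tau>"] by (rule tendsto_mono[OF at_le, rotated]) simp
      have 2: "((\<lambda>r. L2_inner \<Omega> (\<lambda>x. V r x - V \<tau> x) (V (2 * t - r))) \<longlongrightarrow> 0) (at_right \<tau>)"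
      proof (rule Lim_null_comparison)
        show "((\<lambda>r. L2_norm \<Omega> (\<lambda>x. V r x - V \<tau> x) * M) \<longlongrightarrow> 0) (at_right \<tau>)"
          using tendsto_mult_right[OF right_continuous[of \<tau>], of M] by simp
        have "\<bar>L2_inner \<Omega> (\<lambda>x. V r x - V \<tau> x) (V (2 * t - r))\<bar> \<le> L2_norm \<Omega> (\<lambda>x. V r x - V \<tau> x) * M" for r
          using L2_Cauchy_Schwarz[OF L2_diff[OF V_L2[of r] V_L2[of \<tau>]] V_L2[of "2 * t - r"]]
            mult_left_mono[OF V_le_M[of "2 * t - r"] L2_norm_nonneg[of \<Omega> "\<lambda>x. V r x - V \<tau> x"]] by linarith
        then show "\<forall>\<^sub>F r in at_right \<tau>. norm (L2_inner \<Omega> (\<lambda>x. V r x - V \<tau> x) (V (2 * t - r))) \<le> L2_norm \<Omega> (\<lambda>x. V r x - V \<tau> x) * M"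
          by simp
      qed
      have "L2_inner \<Omega> (\<lambda>x. V r x - V \<tau> x) (V (2 * t - r)) + L2_inner \<Omega> (V (2 * t - r)) (V \<tau>) = \<rho> r" for r
        using L2_inner_diff_left[OF V_L2[of r] V_L2[of \<tau>] V_L2[of "2 * t - r"]] L2_inner_commute[of \<Omega> "V \<tau>" "V (2 * t - r)"]
        by (simp add: \<rho>_def)
      with tendsto_add[OF 2 1] show ?thesis by (simp only: add_0)
    qed
    show "\<bar>\<rho> \<tau>\<bar> \<le> M * M" for \<tau>
    proof -
      have "\<bar>\<rho> \<tau>\<bar> \<le> L2_norm \<Omega> (V \<tau>) * L2_norm \<Omega> (V (2 * t - \<tau>))" unfolding \<rho>_def by (rule L2_Cauchy_Schwarz[OF V_L2 V_L2])
      also have "\<dots> \<le> M * M" by (rule mult_mono[OF V_le_M V_le_M M_nonneg L2_norm_nonneg])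
      finally show ?thesis .
    qed
    show "p integrable_on {S..t + 1}" "p integrable_on {S..t + 1}" by (rule pon; use S t in simp)+
    fix h :: real assume h: "0 < h" "h \<le> 1"
    define Z where "Z = {t. t > 0 \<and> \<not> good t}"
    \<comment> \<open>exclude the \<open>\<tau>\<close> for which \<open>\<tau>\<close> or the reflected time \<open>r = 2 t - \<tau> - h\<close> is zero or bad\<close>
    define Z' where "Z' = {0, 2 * t - h} \<union> Z \<union> (\<lambda>r. (2 * t - h) + r) ` uminus ` Z"
    have "negligible (uminus ` Z)" using bad_negligible 
      by (intro negligible_differentiable_image_negligible) (auto simp: Z_def intro!: differentiable_on_minus differentiable_on_id[unfolded id_def])
    then have Z': "negligible Z'" unfolding Z'_def using bad_negligible
      by (intro negligible_Un negligible_translation) (auto simp: Z_def)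
    have "\<rho> (\<tau> + h) - \<rho> \<tau> \<le> integral {\<tau>..\<tau> + h} p + h * (p \<tau> + p (\<tau> + h))" if \<tau>: "\<tau> \<in> {S..t} - Z'" for \<tau>
    proof -
      define r where "r = 2 * t - \<tau> - h"
      have \<tau>0: "\<tau> > 0" "\<tau> \<le> t" using \<tau> S by (auto simp: Z'_def)
      have r0: "r > 0"
      proof -
        have "r \<ge> 0" using \<tau>0 h t by (simp add: r_def)
        moreover have "r \<noteq> 0" using \<tau> by (auto simp: Z'_def r_def)
        ultimately show ?thesis by simp
      qed
      have g: "good \<tau>" using \<tau> \<tau>0 by (auto simp: Z'_def Z_def)
      have g': "good r"
      proof (rule ccontr)
        assume "\<not> good r"
        then have "r \<in> Z" using r0 by (simp add: Z_def)
        then have "(2 * t - h) + - r \<in> (\<lambda>r. (2 * t - h) + r) ` uminus ` Z" by (intro imageI)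
        then show False using \<tau> by (simp add: Z'_def r_def)
      qed
      have young: "N s * (K * integral {a..b} N) \<le> K / 2 * ((b - a) * (N s)\<^sup>2 + integral {a..b} (\<lambda>\<tau>. (N \<tau>)\<^sup>2))"
        if "0 \<le> a" "a \<le> b" for s a b
      proof -
        have "N s * integral {a..b} N = integral {a..b} (\<lambda>\<tau>. N s * N \<tau>)" by simp
        also have "\<dots> \<le> integral {a..b} (\<lambda>\<tau>. 1 / 2 * (N s)\<^sup>2 + 1 / 2 * (N \<tau>)\<^sup>2)"
        proof (rule integral_le)
          show "N s * N \<tau> \<le> 1 / 2 * (N s)\<^sup>2 + 1 / 2 * (N \<tau>)\<^sup>2" for \<tau> using sum_squares_bound[of "N s" "N \<tau>"] by simp
        qed (use N_integrable_on[OF that(1)] on[OF that(1)] in \<open>auto intro!: integrable_add integrable_on_mult_right\<close>)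
        also have "\<dots> = (b - a) * (1 / 2 * (N s)\<^sup>2) + 1 / 2 * integral {a..b} (\<lambda>\<tau>. (N \<tau>)\<^sup>2)"
          using on[OF that(1), of b] that(2) by (subst integral_add) (auto intro!: integrable_on_mult_right)
        finally have le: "N s * integral {a..b} N \<le> (b - a) * (1 / 2 * (N s)\<^sup>2) + 1 / 2 * integral {a..b} (\<lambda>\<tau>. (N \<tau>)\<^sup>2)" .
        show ?thesis using mult_left_mono[OF le less_imp_le[OF K_pos]] by (simp add: field_simps)
      qed
      have Vv: "V \<tau> = v \<tau>" "V (\<tau> + h) = v (\<tau> + h)" "V (2 * t - \<tau>) = v (r + h)" "V (2 * t - (\<tau> + h)) = v r"
        using \<tau>0 h t by (simp_all add: V_def r_def max_def algebra_simps)
      have "\<rho> (\<tau> + h) - \<rho> \<tau> = (L2_inner \<Omega> (v (\<tau> + h)) (v r) - L2_inner \<Omega> (v \<tau>) (v r))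
          - (L2_inner \<Omega> (v (r + h)) (v \<tau>) - L2_inner \<Omega> (v r) (v \<tau>))"
        using L2_inner_commute[of \<Omega> "v \<tau>" "v r"] L2_inner_commute[of \<Omega> "v \<tau>" "v (r + h)"] by (simp add: \<rho>_def Vv)
      also have "\<dots> \<le> N r * (K * integral {\<tau>..\<tau> + h} N) + N \<tau> * (K * integral {r..r + h} N)"
        using increment_le_gradient[of \<tau> "\<tau> + h", OF _ _ good_solenoidal[OF g']]
          increment_le_gradient[of r "r + h", OF _ _ good_solenoidal[OF g]] \<tau>0 r0 h by (simp add: N_def)
      also have "\<dots> \<le> K / 2 * (h * (N r)\<^sup>2 + integral {\<tau>..\<tau> + h} (\<lambda>\<tau>. (N \<tau>)\<^sup>2)) + K / 2 * (h * (N \<tau>)\<^sup>2 + integral {r..r + h} (\<lambda>\<tau>. (N \<tau>)\<^sup>2))"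
        using young[of \<tau> "\<tau> + h" r] young[of r "r + h" \<tau>] \<tau>0 r0 h by (intro add_mono) auto
      also have "\<dots> = integral {\<tau>..\<tau> + h} p + h * (K / 2 * (N \<tau>)\<^sup>2 + K / 2 * (N r)\<^sup>2)"
        using pint[of \<tau> "\<tau> + h"] \<tau>0 h t by (simp add: r_def algebra_simps)
      also have "\<dots> \<le> integral {\<tau>..\<tau> + h} p + h * (p \<tau> + p (\<tau> + h))"
      proof -
        have "2 * t - (\<tau> + h) = r" by (simp add: r_def)
        then have "K / 2 * (N \<tau>)\<^sup>2 + K / 2 * (N r)\<^sup>2 \<le> p \<tau> + p (\<tau> + h)" using K_pos by (simp add: p_def distrib_left)
        then show ?thesis using h by simp
      qed
      finally show ?thesis .
    qed
    then show "\<exists>Z. negligible Z \<and> (\<forall>\<tau>\<in>{S..t} - Z. \<rho> (\<tau> + h) - \<rho> \<tau> \<le> integral {\<tau>..\<tau> + h} p + h * (p \<tau> + p (\<tau> + h)))"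
      using Z' by blast
  qed simp
  also have "integral {S..t} p = K / 2 * integral {S..2 * t - S} (\<lambda>\<tau>. (N \<tau>)\<^sup>2)"
    using pint[of S t] S Henstock_Kurzweil_Integration.integral_combine[of S t "2 * t - S" "\<lambda>\<tau>. (N \<tau>)\<^sup>2", OF _ _ on] by simp
  finally have "\<rho> t \<le> \<rho> S + 3 / 2 * K * integral {S..2 * t - S} (\<lambda>\<tau>. (N \<tau>)\<^sup>2)" by simp
  moreover have "\<rho> t = (L2_norm \<Omega> (v t))\<^sup>2" using t by (simp add: \<rho>_def V_def L2_norm_power2_inner)
  moreover have "\<rho> S = L2_inner \<Omega> (v (2 * t - S)) (v S)"
    using S L2_inner_commute[of \<Omega> "v S" "v (2 * t - S)"] by (simp add: \<rho>_def V_def)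
  ultimately show ?thesis by simp
qed

lemma norm_tends_to_zero: "((\<lambda>t. L2_norm \<Omega> (v t)) \<longlongrightarrow> 0) at_top"
proof -
  have "((\<lambda>t. (L2_norm \<Omega> (v t))\<^sup>2) \<longlongrightarrow> 0) at_top"
  proof (rule tendstoI)
    fix e :: real assume e: "e > 0"
    define d where "d = e / (3 * K)"
    have d: "d > 0" using e K_pos by (simp add: d_def)
    obtain S where S: "S \<ge> 0" "\<And>a b. S \<le> a \<Longrightarrow> a \<le> b \<Longrightarrow> integral {a..b} (\<lambda>t. (N t)\<^sup>2) < d"
      by (rule dissipation_tail[OF d]) blast
    have lin: "filterlim (\<lambda>t. 2 * t - S) at_top at_top"
      by (rule filterlim_at_top_mono[OF filterlim_ident]) (use eventually_ge_at_top[of S] in eventually_elim, simp)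
    have "((\<lambda>t. L2_inner \<Omega> (v (2 * t - S)) (v S)) \<longlongrightarrow> 0) at_top"
      by (rule filterlim_compose[OF weak_decay[OF v_sigma[OF S(1)]] lin])
    then have "\<forall>\<^sub>F t in at_top. dist (L2_inner \<Omega> (v (2 * t - S)) (v S)) 0 < e / 2" by (rule tendstoD) (use e in simp)
    with eventually_gt_at_top[of "max 1 S"]
    show "\<forall>\<^sub>F t in at_top. dist ((L2_norm \<Omega> (v t))\<^sup>2) 0 < e"
    proof eventually_elim
      case (elim t)
      have "3 / 2 * K * integral {S..2 * t - S} (\<lambda>\<tau>. (N \<tau>)\<^sup>2) < 3 / 2 * K * d"
        by (rule mult_strict_left_mono) (use S(2)[of S "2 * t - S"] elim K_pos in auto)
      also have "3 / 2 * K * d = e / 2" using K_pos by (simp add: d_def)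
      finally show ?case using reflected_correlation[OF S(1), of t] elim by (simp add: abs_less_iff)
    qed
  qed
  then have "((\<lambda>t. sqrt ((L2_norm \<Omega> (v t))\<^sup>2)) \<longlongrightarrow> sqrt 0) at_top" by (rule tendsto_real_sqrt)
  then show ?thesis by simp
qed

end

theorem corollary11:
  fixes B \<Omega> :: "(real^2) set"
  assumes "bounded B" and "simply_connected B" and "lipschitz_domain B" and "0 \<in> B"
    and "\<Omega> = - closure B"
    and "uminus ` \<Omega> = \<Omega>"
  shows "\<exists>C>0. \<forall>(u :: real^2 \<Rightarrow> real^2) p ustar \<delta>.
           u \<in> H1_dot_sigma \<Omega> \<and> centrally_symmetric \<Omega> u \<and> steady_solution \<Omega> u p ustar \<and>
           \<delta> > 0 \<and> (SUP x\<in>\<Omega>. ereal (norm x * norm (u x))) \<le> ereal (\<delta> / C) \<and>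
           \<delta> < 1 \<longrightarrow>
           (\<forall>v0 v. v0 \<in> L2_sigma \<Omega> \<and> centrally_symmetric \<Omega> v0 \<and> weak_solution \<Omega> u v0 v \<and>
              (\<forall>s t. 0 \<le> s \<and> s \<le> t \<longrightarrow>
                 (L2_norm \<Omega> (v t))\<^sup>2 +
                 (1 - \<delta>) * (LINT \<tau>|lebesgue_on {s..t}. (L2_norm \<Omega> (wgrad \<Omega> (v \<tau>)))\<^sup>2)
                 \<le> (L2_norm \<Omega> (v s))\<^sup>2) \<longrightarrow>
              ((\<lambda>t. L2_norm \<Omega> (v t)) \<longlongrightarrow> 0) at_top)"
proof (intro exI[of _ "1 :: real"] conjI allI impI)
  fix u :: "real^2 \<Rightarrow> real^2" and p ustar \<delta> v0 v
  assume *: "u \<in> H1_dot_sigma \<Omega> \<and> centrally_symmetric \<Omega> u \<and> steady_solution \<Omega> u p ustar \<and>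
           \<delta> > 0 \<and> (SUP x\<in>\<Omega>. ereal (norm x * norm (u x))) \<le> ereal (\<delta> / 1) \<and> \<delta> < 1"
    and **: "v0 \<in> L2_sigma \<Omega> \<and> centrally_symmetric \<Omega> v0 \<and> weak_solution \<Omega> u v0 v \<and>
              (\<forall>s t. 0 \<le> s \<and> s \<le> t \<longrightarrow>
                 (L2_norm \<Omega> (v t))\<^sup>2 +
                 (1 - \<delta>) * (LINT \<tau>|lebesgue_on {s..t}. (L2_norm \<Omega> (wgrad \<Omega> (v \<tau>)))\<^sup>2)
                 \<le> (L2_norm \<Omega> (v s))\<^sup>2)"
  have op: "open \<Omega>" using assms(5) by auto
  then have \<Omega>: "\<Omega> \<in> sets lebesgue" by auto
  have bd: "bounded (- \<Omega>)" using assms(1,5) by auto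
  have decay: "norm x * norm (u x) \<le> 1" if "x \<in> \<Omega>" for x
  proof -
    have "ereal (norm x * norm (u x)) \<le> (SUP x\<in>\<Omega>. ereal (norm x * norm (u x)))" using that by (rule SUP_upper)
    also have "\<dots> \<le> ereal \<delta>" using * by simp
    finally show ?thesis using * by simp
  qed
  have "open B" using assms(3) by (simp add: lipschitz_domain_def)
  then obtain r where r: "r > 0" "ball 0 r \<subseteq> B" using assms(4) by (auto simp: open_contains_ball)
  have far: "r \<le> norm x" if "x \<in> \<Omega>" for x
    using that r(2) closure_subset[of B] by (fastforce simp: assms(5) not_less[symmetric])
  have bound: "norm (u x) \<le> 1 / r" if "x \<in> \<Omega>" for x
  proof -
    have "r * norm (u x) \<le> norm x * norm (u x)" using far[OF that] by (rule mult_right_mono) simp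
    with decay[OF that] show ?thesis using r(1) by (simp add: field_simps)
  qed
  have mono: "L2_norm \<Omega> (v t) \<le> L2_norm \<Omega> (v s)" if "0 \<le> s" "s \<le> t" for s t
  proof -
    have "0 \<le> (1 - \<delta>) * (LINT \<tau>|lebesgue_on {s..t}. (L2_norm \<Omega> (wgrad \<Omega> (v \<tau>)))\<^sup>2)" using * by simp
    moreover have "(L2_norm \<Omega> (v t))\<^sup>2 + (1 - \<delta>) * (LINT \<tau>|lebesgue_on {s..t}. (L2_norm \<Omega> (wgrad \<Omega> (v \<tau>)))\<^sup>2)
        \<le> (L2_norm \<Omega> (v s))\<^sup>2" using ** that by blast
    ultimately have "(L2_norm \<Omega> (v t))\<^sup>2 \<le> (L2_norm \<Omega> (v s))\<^sup>2" by linarith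
    then show ?thesis by (rule power2_le_imp_le) simp
  qed
  have v0: "AE x in lebesgue_on \<Omega>. v 0 x = v0 x" using ** by (simp add: weak_solution_def)
  have "AE x in lebesgue_on \<Omega>. v0 x = - v0 (- x)" using ** by (simp add: centrally_symmetric_def)
  with v0 AE_reflect_lebesgue_on[OF \<Omega> assms(6) v0] have v0s: "centrally_symmetric \<Omega> (v 0)"
    unfolding centrally_symmetric_def by eventually_elim simp
  interpret perturbed_flow \<Omega> u v "1 / r"
  proof
    show "open \<Omega>" "bounded (- \<Omega>)" "uminus ` \<Omega> = \<Omega>" by (fact op bd assms(6))+
    show "u \<in> H1_dot \<Omega>" "weakly_div_free \<Omega> u" using * by (auto simp: H1_dot_sigma_def)
    show "norm (u x) \<le> 1 / r" if "x \<in> \<Omega>" for x by (rule bound[OF that])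
    show "0 \<le> 1 / r" using r(1) by simp
    show "norm x * norm (u x) \<le> 1" if "x \<in> \<Omega>" for x by (rule decay[OF that])
    show "centrally_symmetric \<Omega> u" using * by blast
    show "v t \<in> L2_sigma \<Omega>" if "t \<ge> 0" for t using ** that by (simp add: weak_solution_def)
    show "v \<in> Bochner_L2 (H1_dot_0_sigma \<Omega>) (H1_dot_norm \<Omega>)" using ** by (simp add: weak_solution_def)
    show "L2_inner \<Omega> (v t) (\<phi> t) +
        (LINT \<tau>|lebesgue_on {s..t}.
            L2_inner \<Omega> (wgrad \<Omega> (v \<tau>)) (\<lambda>x. jacobian (\<phi> \<tau>) (at x)) +
            L2_inner \<Omega> (convect \<Omega> u (v \<tau>)) (\<phi> \<tau>) +
            L2_inner \<Omega> (convect \<Omega> (v \<tau>) u) (\<phi> \<tau>) +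
            L2_inner \<Omega> (convect \<Omega> (v \<tau>) (v \<tau>)) (\<phi> \<tau>))
        = L2_inner \<Omega> (v s) (\<phi> s) +
          (LINT \<tau>|lebesgue_on {s..t}. L2_inner \<Omega> (v \<tau>) (\<phi>' \<tau>))"
      if "C1_test_curve \<Omega> \<phi> \<phi>'" "0 \<le> s" "s \<le> t" for \<phi> \<phi>' s t
      using ** that unfolding weak_solution_def by blast
    show "L2_norm \<Omega> (v t) \<le> L2_norm \<Omega> (v s)" if "0 \<le> s" "s \<le> t" for s t by (rule mono[OF that])
    show "centrally_symmetric \<Omega> (v 0)" by (rule v0s)
  qed
  show "((\<lambda>t. L2_norm \<Omega> (v t)) \<longlongrightarrow> 0) at_top" by (rule norm_tends_to_zero)
qed simp

end
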